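(* The bundles $E^{(\eta,[Y])}$, with $\eta\in\mathbb R$ and $[Y]$ a conjugacy class of block subdiagonal matrices $Y$ under block diagonal unitaries, form a parametrization of the elementary homogeneous holomorphic Hermitian vector bundles over $\mathbb D$: every elementary homogeneous holomorphic Hermitian vector bundle is isomorphic to $(E^{(\eta,Y)},I)$ for some $\eta,Y$, and $(E^{(\eta,Y)},I)$ and $(E^{(\eta',Y')},I)$ are isomorphic if and only if $\eta=\eta'$ and $[Y]=[Y']$. The Hermitian vector bundle $E^{(\eta,[Y])}$ is irreducible if and only if $Y$ cannot be split into an orthogonal direct sum $Y'\oplus Y''$ with $Y',Y''$ having the same block form as $Y$ (that is, one cannot write $\mathbb C^{d_j}=W_j'\oplus W_j''$ orthogonally for $0\le j\le m$ with $\bigoplus_jW_j'$ and $\bigoplus_jW_j''$ both nonzero and both invariant under $Y$).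
   Context: $G=\mathrm{SU}(1,1)$ acts on the unit disc $\mathbb D$ by $g\cdot z=(az+b)(cz+d)^{-1}$ for $g=\begin{pmatrix}a&b\\ c&d\end{pmatrix}\in G$ (so $c=\bar b$, $d=\bar a$). $\tilde G$ is the universal covering group of $G$, acting on $\mathbb D$ through $G$; $\tilde{\mathbb K}$ is the stabilizer of $0$. For $g\in\tilde G$, $c_g$ is the lower left entry of the image of $g$ in $G$, $g'(z)$ is the complex derivative of $z\mapsto g\cdot z$, and for real $\lambda$, $g'(z)^\lambda$ is the real analytic function on $\tilde G\times\mathbb D$, holomorphic in $z$, which is given by the principal branch for $g$ near the identity. A homogeneous holomorphic (Hermitian) vector bundle over $\mathbb D$ is a finite rank holomorphic (Hermitian) vector bundle with an action of $\tilde G$ by holomorphic (isometric) bundle automorphisms covering the action on $\mathbb D$; isomorphisms are $\tilde G$-equivariant (and isometric in the Hermitian case). It is irreducible if it is not an orthogonal direct sum of two nonzero homogeneous holomorphic Hermitian sub-bundles. Let $h=\frac12\begin{pmatrix}1&0\\0&-1\end{pmatrix}$, $y=\begin{pmatrix}0&0\\1&0\end{pmatrix}$, $\mathfrak b=\mathbb C h+\mathbb C y\subset\mathfrak{sl}(2,\mathbb C)$. Homogeneous holomorphic vector bundles over $\mathbb D$ are exactly those obtained by holomorphic induction from finite dimensional representations $(\varrho,V)$ of $\mathfrak b$, i.e. pairs with $[\varrho(h),\varrho(y)]=-\varrho(y)$ (lifts of sections are the smooth $F:\tilde G\to V$ with $F(gk)=\varrho(k)^{-1}F(g)$, $k\in\tilde{\mathbb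 K}$, and $XF=-\varrho(X)F$, $X\in\mathfrak b$). A homogeneous holomorphic Hermitian vector bundle is elementary if the set of eigenvalues of $\varrho(h)$ is an uninterrupted string $-\eta,-(\eta+1),\dots,-(\eta+m)$. Data: $\eta\in\mathbb R$, $m\ge 0$, $d_0,\dots,d_m\ge1$, $d=d_0+\cdots+d_m$, $\mathbb C^d=\bigoplus_{j=0}^m\mathbb C^{d_j}$; "block" refers to this decomposition. $Y$ denotes the block matrix whose only nonzero blocks are $Y_j:\mathbb C^{d_{j-1}}\to\mathbb C^{d_j}$ in position $(j,j-1)$, $1\le j\le m$ (arbitrary matrices). $E^{(\eta,Y)}$ is the bundle induced by $\varrho(h)=\mathrm{diag}(-\eta I_{d_0},\dots,-(\eta+m)I_{d_m})$, $\varrho(y)=Y$. In its canonical trivialization it is $\mathbb D\times\mathbb C^d$ with action $g\cdot(z,\xi)=(g\cdot z,J_g(z)^{-1}\xi)$, where $J_g(z)=J_g^{(\eta,Y)}(z)$ has $(p,\ell)$ block $$\frac{1}{(p-\ell)!}(-c_g)^{p-\ell}\,g'(z)^{\eta+\frac{p+\ell}{2}}\,Y_p\cdots Y_{\ell+1}\quad(p\ge\ell),\qquad 0\quad(p<\ell).$$ A $\tilde G$-invariant Hermitian structure is given by $\|\xi\|_z^2=\langle H(z)\xi,\xi\rangle$ with $H(g\cdot z)=J_g(z)^*H(z)J_g(z)$ and is determined by the positive definite block diagonal matrix $H=H(0)$; the resulting Hermitian bundle is $(E^{(\eta,Y)},H)$. $[Y]$ is the equivalence class of $Y$ under $Y\mapsto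 AYA^{-1}$ with $A$ block diagonal unitary, and $E^{(\eta,[Y])}$ is the equivalence class of $(E^{(\eta,Y)},I)$. *)

theory Defs
  imports
    "HOL-Analysis.Analysis"
    "Jordan_Normal_Form.Spectral_Radius"
    "Jordan_Normal_Form.Schur_Decomposition"
begin

no_notation vec_nth (infixl "$" 90)
hide_const (open) Finite_Cartesian_Product.vec

abbreviation disc :: "complex set" where
  "disc \<equiv> ball 0 1"


section \<open>The universal covering group of SU(1,1)\<close>

definition SU11 :: "(complex^2^2) set" where
  "SU11 = {g. Determinants.det g = 1 \<and> vec_nth (vec_nth g 2) 1 = cnj (vec_nth (vec_nth g 1) 2)
              \<and> vec_nth (vec_nth g 2) 2 = cnj (vec_nth (vec_nth g 1) 1)}"

text \<open>An element of the universal covering group is given by the global coordinates \<open>(b, \<theta>)\<close>,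
  where \<open>b\<close> is the upper right entry of its image in SU(1,1), and \<open>\<theta>\<close> is a choice of argument of
  the lower right entry \<open>d\<close>, whose modulus is determined by \<open>\<bar>d\<bar>\<^sup>2 - \<bar>b\<bar>\<^sup>2 = 1\<close>.  These coordinates
  identify the group, as a manifold, with the vector space \<open>complex \<times> real\<close>.\<close>

type_synonym gtilde = "complex \<times> real"

definition gt_b :: "gtilde \<Rightarrow> complex" where "gt_b g = fst g"
definition gt_d :: "gtilde \<Rightarrow> complex" where
  "gt_d g = of_real (sqrt (1 + (cmod (fst g))\<^sup>2)) * cis (snd g)"
definition gt_a :: "gtilde \<Rightarrow> complex" where "gt_a g = cnj (gt_d g)"
definition gt_c :: "gtilde \<Rightarrow> complex" where "gt_c g = cnj (gt_b g)"

definition gt_proj :: "gtilde \<Rightarrow> complex^2^2" where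
  "gt_proj g = vector [vector [gt_a g, gt_b g], vector [gt_c g, gt_d g]]"

text \<open>The argument of \<open>d\<^sub>g\<^sub>h = d\<^sub>g d\<^sub>h (1 + c\<^sub>g b\<^sub>h / (d\<^sub>g d\<^sub>h))\<close> is lifted using that the last factor has
  positive real part.\<close>

definition gt_mult :: "gtilde \<Rightarrow> gtilde \<Rightarrow> gtilde" where
  "gt_mult g h = (gt_a g * gt_b h + gt_b g * gt_d h,
                  snd g + snd h + Arg (1 + gt_c g * gt_b h / (gt_d g * gt_d h)))"

definition gt_one :: gtilde where "gt_one = (0, 0)"
definition gt_inv :: "gtilde \<Rightarrow> gtilde" where "gt_inv g = (- fst g, - snd g)"

definition gt_act :: "gtilde \<Rightarrow> complex \<Rightarrow> complex" where
  "gt_act g z = (gt_a g * z + gt_b g) / (gt_c g * z + gt_d g)"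

text \<open>The continuous logarithm of \<open>g'(z) = (c z + d)\<^sup>-\<^sup>2\<close> that vanishes at the identity, and the
  corresponding real powers of \<open>g'(z)\<close>.\<close>

definition gt_log_deriv :: "gtilde \<Rightarrow> complex \<Rightarrow> complex" where
  "gt_log_deriv g z =
     - 2 * (of_real (ln (cmod (gt_d g))) + \<i> * of_real (snd g) + Ln (1 + gt_c g * z / gt_d g))"

definition gt_deriv_pow :: "real \<Rightarrow> gtilde \<Rightarrow> complex \<Rightarrow> complex" where
  "gt_deriv_pow s g z = exp (of_real s * gt_log_deriv g z)"

text \<open>The one-parameter subgroups generated by \<open>\<i>h = diag(\<i>/2, -\<i>/2)\<close> and by
  \<open>X\<^sub>1 = (0 1; 1 0)\<close>, \<open>X\<^sub>2 = (0 \<i>; -\<i> 0)\<close>, so that \<open>y = (X\<^sub>1 + \<i> X\<^sub>2) / 2\<close> in the complexified Lie algebra.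
  The first one is the stabilizer of \<open>0\<close>.\<close>

definition gt_exp_ih :: "real \<Rightarrow> gtilde" where "gt_exp_ih t = (0, - t / 2)"
definition gt_exp_x1 :: "real \<Rightarrow> gtilde" where "gt_exp_x1 t = (of_real (sinh t), 0)"
definition gt_exp_x2 :: "real \<Rightarrow> gtilde" where "gt_exp_x2 t = (\<i> * of_real (sinh t), 0)"

text \<open>Left invariant vector fields acting on functions, and their complex linear extension to
  \<open>h\<close> and \<open>y\<close>.\<close>

definition lie_deriv :: "(real \<Rightarrow> gtilde) \<Rightarrow> (gtilde \<Rightarrow> complex) \<Rightarrow> gtilde \<Rightarrow> complex" where
  "lie_deriv e f g = vector_derivative (\<lambda>t. f (gt_mult g (e t))) (at 0)"

definition lie_h :: "(gtilde \<Rightarrow> complex) \<Rightarrow> gtilde \<Rightarrow> complex" where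
  "lie_h f g = - \<i> * lie_deriv gt_exp_ih f g"

definition lie_y :: "(gtilde \<Rightarrow> complex) \<Rightarrow> gtilde \<Rightarrow> complex" where
  "lie_y f g = (lie_deriv gt_exp_x1 f g + \<i> * lie_deriv gt_exp_x2 f g) / 2"


subsection \<open>Justification of the model\<close>

lemma norm_gt_d: "cmod (gt_d g) = sqrt (1 + (cmod (gt_b g))\<^sup>2)"
  by (simp add: gt_d_def gt_b_def norm_mult abs_of_nonneg)

lemma gt_d_nonzero [simp]: "gt_d g \<noteq> 0"
proof -
  have "1 + (cmod (gt_b g))\<^sup>2 > 0" by (simp add: add_pos_nonneg)
  then show ?thesis using norm_gt_d[of g] by (metis norm_zero real_sqrt_gt_0_iff less_irrefl)
qed

lemma gt_d_polar: "gt_d g = of_real (cmod (gt_d g)) * cis (snd g)"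
  unfolding norm_gt_d by (simp add: gt_d_def gt_b_def)

lemma gt_det: "gt_a g * gt_d g - gt_b g * gt_c g = 1"
proof -
  have "gt_a g * gt_d g = of_real ((cmod (gt_d g))\<^sup>2)"
    by (simp add: gt_a_def complex_norm_square mult.commute del: of_real_power)
  moreover have "gt_b g * gt_c g = of_real ((cmod (gt_b g))\<^sup>2)"
    by (simp add: gt_c_def complex_norm_square del: of_real_power)
  moreover have "(cmod (gt_d g))\<^sup>2 = 1 + (cmod (gt_b g))\<^sup>2"
    unfolding norm_gt_d by (simp add: add_nonneg_nonneg)
  ultimately show ?thesis by simp
qed

lemma norm_gt_b_less: "cmod (gt_b g) < cmod (gt_d g)"
  unfolding norm_gt_d by (simp add: real_less_rsqrt)

lemma cmod_sq: "(cmod z)\<^sup>2 = Re (z * cnj z)"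
  by (metis Re_complex_of_real complex_norm_square)

lemma gt_factor_norm: "cmod (gt_c g * gt_b h / (gt_d g * gt_d h)) < 1"
proof -
  have "cmod (gt_b g) * cmod (gt_b h) < cmod (gt_d g) * cmod (gt_d h)"
    using norm_gt_b_less[of g] norm_gt_b_less[of h] by (intro mult_strict_mono') auto
  then show ?thesis by (simp add: norm_divide norm_mult gt_c_def)
qed

lemma Re_one_plus_pos: "cmod u < 1 \<Longrightarrow> 0 < Re (1 + u)"
  using abs_Re_le_cmod[of u] by simp

lemma gt_b_mult: "gt_b (gt_mult g h) = gt_a g * gt_b h + gt_b g * gt_d h"
  by (simp add: gt_mult_def gt_b_def)

lemma gt_d_mult: "gt_d (gt_mult g h) = gt_c g * gt_b h + gt_d g * gt_d h"
proof -
  let ?w = "1 + gt_c g * gt_b h / (gt_d g * gt_d h)"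
  let ?e = "gt_c g * gt_b h + gt_d g * gt_d h"
  have e: "?e = gt_d g * gt_d h * ?w" by (simp add: field_simps)
  have "?w \<noteq> 0" using Re_one_plus_pos[OF gt_factor_norm[of g h]] by force
  have "cnj ?e * ?e - gt_b (gt_mult g h) * cnj (gt_b (gt_mult g h))
     = (gt_a g * gt_d g - gt_b g * gt_c g) * (gt_a h * gt_d h - gt_b h * gt_c h)"
    by (simp add: gt_b_mult gt_a_def gt_c_def algebra_simps)
  then have "cnj ?e * ?e - gt_b (gt_mult g h) * cnj (gt_b (gt_mult g h)) = 1"
    by (simp add: gt_det)
  then have "of_real ((cmod ?e)\<^sup>2) = (of_real (1 + (cmod (gt_b (gt_mult g h)))\<^sup>2) :: complex)"
    by (simp add: complex_norm_square mult.commute algebra_simps del: of_real_power complex_cnj_add complex_cnj_mult)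
  then have sq: "(cmod ?e)\<^sup>2 = 1 + (cmod (gt_b (gt_mult g h)))\<^sup>2"
    using of_real_eq_iff by blast
  then have n: "cmod (gt_d (gt_mult g h)) = cmod ?e"
    unfolding norm_gt_d by (simp flip: sq)
  have "gt_d (gt_mult g h) = of_real (cmod ?e) * cis (snd g + snd h + Arg ?w)"
    by (subst gt_d_polar) (simp add: n, simp add: gt_mult_def)
  also have "\<dots> = (of_real (cmod (gt_d g)) * cis (snd g)) * (of_real (cmod (gt_d h)) * cis (snd h)) * (of_real (cmod ?w) * cis (Arg ?w))"
    by (simp add: e norm_mult cis_mult[symmetric] del: add_divide_eq_iff)
  also have "\<dots> = gt_d g * gt_d h * ?w"
    using rcis_cmod_Arg[of ?w] by (simp add: gt_d_polar[symmetric] rcis_def)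
  finally show ?thesis using e by simp
qed

lemma gt_a_mult: "gt_a (gt_mult g h) = gt_a g * gt_a h + gt_b g * gt_c h"
  unfolding gt_a_def gt_d_mult by (simp add: gt_a_def gt_c_def)

lemma gt_c_mult: "gt_c (gt_mult g h) = gt_c g * gt_a h + gt_d g * gt_c h"
  unfolding gt_c_def gt_b_mult by (simp add: gt_a_def gt_c_def)

lemma gt_eqI:
  assumes "gt_b g = gt_b h" "gt_d g = gt_d h" "\<bar>snd g - snd h\<bar> < 2 * pi"
  shows "g = h"
proof -
  have "cis (snd g) = cis (snd h)"
    using assms(1,2) gt_d_polar[of g] gt_d_polar[of h] gt_d_nonzero[of h]
    by (metis mult_cancel_left norm_eq_zero of_real_eq_0_iff)
  then have "cis (snd g - snd h) = 1" by (simp flip: cis_divide)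
  then have "cos (snd g - snd h) = 1" by (metis cis.sel(1) one_complex.sel(1))
  then obtain k :: int where k: "snd g - snd h = of_int k * 2 * pi"
    by (auto simp: cos_one_2pi_int)
  then have "\<bar>of_int k :: real\<bar> < 1" using assms(3) by (simp add: abs_mult)
  then have "k = 0" by linarith
  then show ?thesis using k assms(1) by (simp add: prod_eq_iff gt_b_def)
qed

lemma Arg_factor: "\<bar>Arg (1 + gt_c g * gt_b h / (gt_d g * gt_d h))\<bar> < pi / 2"
  using Re_one_plus_pos[OF gt_factor_norm[of g h]] Arg_Re_pos by blast

lemma gt_mult_assoc: "gt_mult (gt_mult g h) k = gt_mult g (gt_mult h k)"
proof (rule gt_eqI)
  show "gt_b (gt_mult (gt_mult g h) k) = gt_b (gt_mult g (gt_mult h k))"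
    by (simp add: gt_b_mult gt_d_mult gt_a_mult algebra_simps)
  show "gt_d (gt_mult (gt_mult g h) k) = gt_d (gt_mult g (gt_mult h k))"
    by (simp add: gt_b_mult gt_d_mult gt_c_mult algebra_simps)
  have s: "snd (gt_mult g h) = snd g + snd h + Arg (1 + gt_c g * gt_b h / (gt_d g * gt_d h))" for g h
    by (simp add: gt_mult_def)
  show "\<bar>snd (gt_mult (gt_mult g h) k) - snd (gt_mult g (gt_mult h k))\<bar> < 2 * pi"
    unfolding s using Arg_factor[of g h] Arg_factor[of h k] Arg_factor[of "gt_mult g h" k]
      Arg_factor[of g "gt_mult h k"] by linarith
qed

lemma gt_b_inv [simp]: "gt_b (gt_inv g) = - gt_b g"
  and gt_d_inv [simp]: "gt_d (gt_inv g) = gt_a g"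
  by (simp_all add: gt_inv_def gt_b_def gt_d_def gt_a_def cis_cnj)

lemma gt_one_simps [simp]: "gt_b gt_one = 0" "gt_d gt_one = 1" "gt_a gt_one = 1" "gt_c gt_one = 0" "snd gt_one = 0"
  by (simp_all add: gt_one_def gt_b_def gt_d_def gt_a_def gt_c_def)

lemma gt_mult_one [simp]: "gt_mult gt_one g = g" "gt_mult g gt_one = g"
  by (simp_all add: gt_mult_def prod_eq_iff gt_b_def Arg_eq_0) (simp_all add: gt_one_def)

lemma gt_mult_inv: "gt_mult (gt_inv g) g = gt_one"
proof (rule gt_eqI)
  show "gt_b (gt_mult (gt_inv g) g) = gt_b gt_one"
    by (simp add: gt_b_mult) (simp add: gt_a_def)
  show "gt_d (gt_mult (gt_inv g) g) = gt_d gt_one"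
    using gt_det[of g] by (simp add: gt_d_mult) (simp add: gt_c_def mult.commute)
  have "\<bar>snd (gt_mult (gt_inv g) g)\<bar> < pi / 2"
    using Arg_factor[of "gt_inv g" g] by (simp add: gt_mult_def gt_inv_def)
  then show "\<bar>snd (gt_mult (gt_inv g) g) - snd gt_one\<bar> < 2 * pi" by simp
qed

lemma gt_group: "group \<lparr>carrier = UNIV, monoid.mult = gt_mult, one = gt_one\<rparr>"
proof (rule groupI)
  show "\<exists>y\<in>carrier \<lparr>carrier = UNIV, monoid.mult = gt_mult, one = gt_one\<rparr>.
          y \<otimes>\<^bsub>\<lparr>carrier = UNIV, monoid.mult = gt_mult, one = gt_one\<rparr>\<^esub> x
        = \<one>\<^bsub>\<lparr>carrier = UNIV, monoid.mult = gt_mult, one = gt_one\<rparr>\<^esub>" for x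
    by (intro bexI[of _ "gt_inv x"]) (simp_all add: gt_mult_inv)
qed (auto simp: gt_mult_assoc)

lemma gt_proj_in_SU11: "gt_proj g \<in> SU11"
  using gt_det[of g] by (simp add: SU11_def gt_proj_def det_2 gt_a_def gt_c_def)

lemma gt_proj_one: "gt_proj gt_one = Finite_Cartesian_Product.mat 1"
  by (simp add: gt_proj_def Finite_Cartesian_Product.vec_eq_iff forall_2 Finite_Cartesian_Product.mat_def)

lemma gt_proj_mult: "gt_proj (gt_mult g h) = gt_proj g ** gt_proj h"
  by (simp add: gt_proj_def Finite_Cartesian_Product.vec_eq_iff forall_2 matrix_matrix_mult_def sum_2
      gt_a_mult gt_b_mult gt_c_mult gt_d_mult)

lemma continuous_on_gt_mult: "continuous_on UNIV (\<lambda>(g, h). gt_mult g h)"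
proof -
  have [continuous_intros]: "continuous_on UNIV (\<lambda>x. gt_d (f x))" "continuous_on UNIV (\<lambda>x. gt_b (f x))"
    if "continuous_on UNIV f" for f :: "gtilde \<times> gtilde \<Rightarrow> gtilde"
    unfolding gt_d_def gt_b_def by (intro continuous_intros that)+
  have "1 + gt_c g * gt_b h / (gt_d g * gt_d h) \<notin> \<real>\<^sub>\<le>\<^sub>0" for g h
    using Re_one_plus_pos[OF gt_factor_norm[of g h]] by (auto simp: complex_nonpos_Reals_iff)
  then show ?thesis
    unfolding gt_mult_def gt_a_def gt_c_def split_beta by (intro continuous_intros) (auto simp: gt_c_def)
qed


lemma gt_proj_nth [simp]:
  "vec_nth (vec_nth (gt_proj g) 1) 1 = gt_a g" "vec_nth (vec_nth (gt_proj g) 1) 2 = gt_b g"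
  "vec_nth (vec_nth (gt_proj g) 2) 1 = gt_c g" "vec_nth (vec_nth (gt_proj g) 2) 2 = gt_d g"
  by (simp_all add: gt_proj_def)

lemma SU11_eqI:
  assumes "M \<in> SU11" "N \<in> SU11" "vec_nth (vec_nth M 1) 2 = vec_nth (vec_nth N 1) 2"
    "vec_nth (vec_nth M 2) 2 = vec_nth (vec_nth N 2) 2"
  shows "M = N"
proof -
  have "vec_nth (vec_nth M 1) 1 = vec_nth (vec_nth N 1) 1"
    using assms by (metis (mono_tags, lifting) SU11_def complex_cnj_cnj mem_Collect_eq)
  then show ?thesis using assms
    by (simp add: SU11_def Finite_Cartesian_Product.vec_eq_iff forall_2)
qed

lemma SU11_norm:
  assumes "M \<in> SU11"
  shows "cmod (vec_nth (vec_nth M 2) 2) = sqrt (1 + (cmod (vec_nth (vec_nth M 1) 2))\<^sup>2)"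
proof -
  let ?d = "vec_nth (vec_nth M 2) 2" and ?b = "vec_nth (vec_nth M 1) 2"
  have "cnj ?d * ?d - ?b * cnj ?b = 1" using assms by (auto simp: SU11_def det_2)
  then have "of_real ((cmod ?d)\<^sup>2) = (of_real (1 + (cmod ?b)\<^sup>2) :: complex)"
    by (simp add: complex_norm_square algebra_simps del: of_real_power)
  then have "(cmod ?d)\<^sup>2 = 1 + (cmod ?b)\<^sup>2" using of_real_eq_iff by blast
  then show ?thesis by (metis norm_ge_zero real_sqrt_unique)
qed

lemma gt_proj_lift:
  assumes M: "M \<in> SU11" and c: "of_real (cmod (vec_nth (vec_nth M 2) 2)) * cis t = vec_nth (vec_nth M 2) 2"
  shows "gt_proj (vec_nth (vec_nth M 1) 2, t) = M"
proof (rule SU11_eqI[OF gt_proj_in_SU11 M])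
  show "vec_nth (vec_nth (gt_proj (vec_nth (vec_nth M 1) 2, t)) 1) 2 = vec_nth (vec_nth M 1) 2"
    by (simp add: gt_b_def)
  show "vec_nth (vec_nth (gt_proj (vec_nth (vec_nth M 1) 2, t)) 2) 2 = vec_nth (vec_nth M 2) 2"
    using c by (simp add: gt_d_def SU11_norm[OF M])
qed

lemma continuous_on_gt_proj: "continuous_on UNIV gt_proj"
proof -
  have d: "continuous_on UNIV gt_d" "continuous_on UNIV gt_b"
    unfolding gt_d_def gt_b_def by (intro continuous_intros)+
  have "continuous_on UNIV gt_a" "continuous_on UNIV gt_c"
    unfolding gt_a_def[abs_def] gt_c_def[abs_def] by (rule continuous_on_cnj, rule d)+
  with d have c: "continuous_on UNIV (\<lambda>g. vec_nth (vec_nth (gt_proj g) i) j)" for i j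
    by (cases i rule: exhaust_2[THEN disjE]; cases j rule: exhaust_2[THEN disjE]) (auto simp: gt_proj_nth)
  have "continuous_on UNIV (\<lambda>g. \<chi> i j. vec_nth (vec_nth (gt_proj g) i) j)"
    by (rule continuous_on_vec_lambda, rule continuous_on_vec_lambda, rule c)
  then show ?thesis by simp
qed

lemma gt_proj_covering: "covering_space UNIV gt_proj SU11"
proof
  show "continuous_on UNIV gt_proj" by (rule continuous_on_gt_proj)
  show "gt_proj ` UNIV = SU11"
  proof
    show "SU11 \<subseteq> range gt_proj"
    proof
      fix M :: "complex^2^2" assume M: "M \<in> SU11"
      show "M \<in> range gt_proj"
        using gt_proj_lift[OF M, of "Arg (vec_nth (vec_nth M 2) 2)"] rcis_cmod_Arg
        by (metis rangeI rcis_def)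
    qed
  qed (auto simp: gt_proj_in_SU11)
  fix M0 :: "complex^2^2" assume M0: "M0 \<in> SU11"
  define d0 where "d0 = vec_nth (vec_nth M0 2) 2"
  define t0 where "t0 = Arg d0"
  have "0 < sqrt (1 + (cmod (vec_nth (vec_nth M0 1) 2))\<^sup>2)"
    by (simp add: add_pos_nonneg)
  then have "d0 \<noteq> 0" using SU11_norm[OF M0] unfolding d0_def by auto
  have d0: "d0 * cis (- t0) = of_real (cmod d0)"
    using rcis_cmod_Arg[of d0] unfolding rcis_def t0_def
    by (metis (no_types, lifting) cis_mult cis_zero mult.assoc mult.right_neutral add.right_inverse)
  define F where "F M = vec_nth (vec_nth M 2) 2 * cis (- t0)" for M :: "complex^2^2"
  define T where "T = {M \<in> SU11. 0 < Re (F M)}"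
  define u where "u k = {g::gtilde. \<bar>snd g - t0 - of_int k * (2 * pi)\<bar> < pi / 2}" for k :: int
  define q where "q k M = (vec_nth (vec_nth M 1) 2, t0 + of_int k * (2 * pi) + Arg (F M))"
    for k :: int and M :: "complex^2^2"
  have contF: "continuous_on A F" for A
    unfolding F_def by (intro continuous_intros)
  have Fg: "F (gt_proj g) = of_real (cmod (gt_d g)) * cis (snd g - t0)" for g
    unfolding F_def by (subst gt_proj_nth, subst gt_d_polar) (simp add: cis_mult)
  have dpos: "0 < cmod (gt_d g)" for g by simp
  have cis2: "cis (s + of_int k * (2 * pi)) = cis s" for s and k :: int
    using cis_multiple_2pi[of "of_int k"] by (simp flip: cis_mult add: mult.commute mult.left_commute)
  have Tg: "gt_proj g \<in> T \<longleftrightarrow> 0 < cos (snd g - t0)" for g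
    unfolding T_def using dpos[of g] by (simp add: gt_proj_in_SU11 Fg zero_less_mult_iff del: zero_less_norm_iff)
  have uT: "gt_proj g \<in> T" and qu: "q k (gt_proj g) = g" if "g \<in> u k" for g k
  proof -
    define s where "s = snd g - t0 - of_int k * (2 * pi)"
    have s: "\<bar>s\<bar> < pi / 2" using that by (simp add: u_def s_def)
    have "snd g - t0 = s + of_int k * (2 * pi)" by (simp add: s_def)
    then have c: "cis (snd g - t0) = cis s" by (simp add: cis2)
    have "0 < cos s" using s by (simp add: cos_gt_zero_pi abs_less_iff)
    then show "gt_proj g \<in> T" using c Tg by (metis cis.sel(1))
    have "Arg (F (gt_proj g)) = s"
      using s dpos[of g] unfolding Fg c by (subst Arg_times_of_real) (auto intro!: Arg_cis)
    then show "q k (gt_proj g) = g" by (simp add: q_def s_def prod_eq_iff gt_b_def)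
  qed
  have qT: "q k M \<in> u k" and pq: "gt_proj (q k M) = M" if "M \<in> T" for k M
  proof -
    have M: "M \<in> SU11" and r: "0 < Re (F M)" using that by (auto simp: T_def)
    show "q k M \<in> u k" using r Arg_Re_pos[of "F M"] by (simp add: q_def u_def)
    have "cis (t0 + of_int k * (2 * pi) + Arg (F M)) = cis t0 * cis (Arg (F M))"
      using cis2[of "t0 + Arg (F M)" k] by (simp add: cis_mult algebra_simps)
    moreover have "of_real (cmod (vec_nth (vec_nth M 2) 2)) * cis (Arg (F M)) = F M"
      using rcis_cmod_Arg[of "F M"] by (simp add: rcis_def F_def norm_mult)
    moreover have "F M * cis t0 = vec_nth (vec_nth M 2) 2" by (simp add: F_def cis_mult)
    ultimately show "gt_proj (q k M) = M"
      unfolding q_def by (intro gt_proj_lift[OF M]) (metis mult.assoc mult.commute)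
  qed
  show "\<exists>T. M0 \<in> T \<and> openin (top_of_set SU11) T \<and>
      (\<exists>v. \<Union>v = UNIV \<inter> gt_proj -` T \<and> (\<forall>u\<in>v. openin (top_of_set UNIV) u) \<and>
           pairwise disjnt v \<and> (\<forall>u\<in>v. \<exists>q. homeomorphism u T gt_proj q))"
  proof (intro exI conjI)
    have "F M0 = of_real (cmod d0)" unfolding F_def using d0 by (simp only: d0_def)
    then show "M0 \<in> T" using M0 \<open>d0 \<noteq> 0\<close> by (simp add: T_def)
    have "open {M. 0 < Re (F M)}"
      by (intro open_Collect_less continuous_intros contF)
    moreover have "T = SU11 \<inter> {M. 0 < Re (F M)}" by (auto simp: T_def)
    ultimately show "openin (top_of_set SU11) T" by auto
    show "\<Union> (range u) = UNIV \<inter> gt_proj -` T"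
    proof (intro equalityI subsetI)
      fix g assume "g \<in> UNIV \<inter> gt_proj -` T"
      then have c: "gt_proj g \<in> T" by simp
      define k where "k = \<lfloor>(snd g - t0) / (2 * pi) + 1 / 2\<rfloor>"
      define s where "s = snd g - t0 - of_int k * (2 * pi)"
      have "of_int k \<le> (snd g - t0) / (2 * pi) + 1 / 2" "(snd g - t0) / (2 * pi) + 1 / 2 < of_int k + 1"
        by (simp_all add: k_def)
      then have s: "- pi \<le> s" "s < pi" by (simp_all add: s_def field_simps)
      have "cis (snd g - t0) = cis s" using cis2[of s k] by (simp add: s_def)
      then have "0 < cos s" using c Tg by (metis cis.sel(1))
      have "\<bar>s\<bar> < pi / 2"
      proof (rule ccontr)
        assume "\<not> \<bar>s\<bar> < pi / 2"
        then have "cos \<bar>s\<bar> \<le> cos (pi / 2)" using s by (intro cos_monotone_0_pi_le) auto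
        then show False using \<open>0 < cos s\<close> by simp
      qed
      then show "g \<in> \<Union> (range u)" by (auto simp: u_def s_def)
    qed (use uT in auto)
    have "open (u k)" for k
      unfolding u_def by (intro open_Collect_less continuous_intros)
    then show "\<forall>w\<in>range u. openin (top_of_set UNIV) w" by auto
    have "k = l" if "g \<in> u k" "g \<in> u l" for g k l
    proof -
      have "\<bar>of_int (k - l) * (2 * pi)\<bar> < pi"
        using that unfolding u_def mem_Collect_eq of_int_diff left_diff_distrib by linarith
      then have "\<bar>of_int (k - l) :: real\<bar> < 1" by (simp add: abs_mult)
      then show ?thesis by linarith
    qed
    then show "pairwise disjnt (range u)" by (auto simp: pairwise_def disjnt_def)
    show "\<forall>w\<in>range u. \<exists>q. homeomorphism w T gt_proj q"
    proof clarify
      fix k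
      have "F M \<notin> \<real>\<^sub>\<le>\<^sub>0" if "M \<in> T" for M
        using that by (auto simp: T_def complex_nonpos_Reals_iff)
      then have "continuous_on T (q k)"
        unfolding q_def by (intro continuous_intros contF) auto
      then have "homeomorphism (u k) T gt_proj (q k)"
        unfolding homeomorphism_def
        using uT qu qT pq continuous_on_subset[OF continuous_on_gt_proj]
        by (auto simp: image_iff) metis+
      then show "\<exists>q. homeomorphism (u k) T gt_proj q" by blast
    qed
  qed
qed

lemma gt_simply_connected: "simply_connected (UNIV :: gtilde set)"
  by (simp add: convex_imp_simply_connected)

lemma gt_denom_nonzero:
  assumes "z \<in> disc" shows "gt_c g * z + gt_d g \<noteq> 0"
proof
  assume "gt_c g * z + gt_d g = 0"
  then have "cmod (gt_d g) = cmod (gt_b g) * cmod z"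
    by (metis add_eq_0_iff complex_mod_cnj gt_c_def norm_minus_cancel norm_mult)
  also have "\<dots> \<le> cmod (gt_b g)" using assms by (simp add: mult_left_le)
  finally show False using norm_gt_b_less[of g] by simp
qed

lemma gt_act_one: "gt_act gt_one z = z"
  by (simp add: gt_act_def)

lemma gt_act_disc:
  assumes "z \<in> disc" shows "gt_act g z \<in> disc"
proof -
  let ?n = "gt_a g * z + gt_b g" and ?e = "gt_c g * z + gt_d g"
  have "?e * cnj ?e - ?n * cnj ?n = (gt_a g * gt_d g - gt_b g * gt_c g) * (1 - z * cnj z)"
    by (simp add: gt_a_def gt_c_def algebra_simps)
  then have "of_real ((cmod ?e)\<^sup>2 - (cmod ?n)\<^sup>2) = (of_real (1 - (cmod z)\<^sup>2) :: complex)"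
    by (simp add: gt_det complex_norm_square del: of_real_power complex_cnj_add complex_cnj_mult)
  then have "(cmod ?e)\<^sup>2 - (cmod ?n)\<^sup>2 = 1 - (cmod z)\<^sup>2" using of_real_eq_iff by blast
  moreover have "(cmod z)\<^sup>2 < 1" using assms by (simp add: power_less_one_iff)
  ultimately have "(cmod ?n)\<^sup>2 < (cmod ?e)\<^sup>2" by linarith
  then have "cmod ?n < cmod ?e" by (simp add: power_less_imp_less_base)
  then have "cmod ?n / cmod ?e < 1" by (intro divide_less_eq_1_pos[THEN iffD2]) (auto intro: le_less_trans)
  then show ?thesis by (simp add: gt_act_def norm_divide)
qed

lemma gt_act_mult:
  assumes "z \<in> disc" shows "gt_act (gt_mult g h) z = gt_act g (gt_act h z)"
proof -
  let ?e = "gt_c h * z + gt_d h"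
  have e: "?e \<noteq> 0" by (rule gt_denom_nonzero[OF assms])
  have "gt_a g * gt_act h z + gt_b g = (gt_a (gt_mult g h) * z + gt_b (gt_mult g h)) / ?e"
       "gt_c g * gt_act h z + gt_d g = (gt_c (gt_mult g h) * z + gt_d (gt_mult g h)) / ?e"
    using e by (simp_all add: gt_act_def gt_a_mult gt_b_mult gt_c_mult gt_d_mult field_simps)
  then show ?thesis unfolding gt_act_def[of g "gt_act h z"] using e by (simp add: gt_act_def)
qed

lemma gt_log_deriv:
  assumes z: "z \<in> disc"
  shows "(gt_act g has_field_derivative exp (gt_log_deriv g z)) (at z)"
proof -
  let ?e = "gt_c g * z + gt_d g"
  have e: "?e \<noteq> 0" by (rule gt_denom_nonzero[OF z])
  have "1 + gt_c g * z / gt_d g = ?e / gt_d g" by (simp add: field_simps)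
  then have L: "exp (Ln (1 + gt_c g * z / gt_d g)) = ?e / gt_d g" using e by simp
  have "exp (of_real (ln (cmod (gt_d g))) + \<i> * of_real (snd g)) = gt_d g"
    by (subst (2) gt_d_polar) (simp add: exp_add cis_conv_exp exp_of_real)
  then have "exp (of_real (ln (cmod (gt_d g))) + \<i> * of_real (snd g) + Ln (1 + gt_c g * z / gt_d g)) = ?e"
    by (subst exp_add) (simp add: L)
  moreover have "exp (- 2 * w) = 1 / (exp w)\<^sup>2" for w :: complex
    by (simp add: exp_minus exp_double inverse_eq_divide)
  ultimately have "exp (gt_log_deriv g z) = 1 / ?e\<^sup>2"
    unfolding gt_log_deriv_def by metis
  moreover have "(gt_act g has_field_derivative 1 / ?e\<^sup>2) (at z)"
    unfolding gt_act_def using e gt_det[of g]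
    by (auto intro!: derivative_eq_intros simp: power2_eq_square algebra_simps)
  ultimately show ?thesis by simp
qed

lemma sqrt_one_plus_sinh: "sqrt (1 + (sinh t)\<^sup>2) = cosh (t::real)"
  using cosh_square_eq[of t] cosh_real_pos[of t] by (simp add: real_sqrt_unique add.commute)

lemma gt_exp_simps [simp]:
  "gt_b (gt_exp_ih t) = 0" "gt_d (gt_exp_ih t) = cis (- t / 2)"
  "gt_b (gt_exp_x1 t) = of_real (sinh t)" "gt_d (gt_exp_x1 t) = of_real (cosh t)"
  "gt_b (gt_exp_x2 t) = \<i> * of_real (sinh t)" "gt_d (gt_exp_x2 t) = of_real (cosh t)"
  by (simp_all add: gt_exp_ih_def gt_exp_x1_def gt_exp_x2_def gt_b_def gt_d_def norm_mult
      sqrt_one_plus_sinh)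

lemma gt_exp_add:
  "gt_mult (gt_exp_ih s) (gt_exp_ih t) = gt_exp_ih (s + t)"
  "gt_mult (gt_exp_x1 s) (gt_exp_x1 t) = gt_exp_x1 (s + t)"
  "gt_mult (gt_exp_x2 s) (gt_exp_x2 t) = gt_exp_x2 (s + t)"
proof -
  show "gt_mult (gt_exp_ih s) (gt_exp_ih t) = gt_exp_ih (s + t)"
    by (simp add: gt_mult_def) (simp add: gt_exp_ih_def field_simps Arg_eq_0)
  have "\<bar>snd (gt_mult g h)\<bar> < 2 * pi" if "snd g = 0" "snd h = 0" for g h
    using Arg_factor[of g h] that by (simp add: gt_mult_def)
  from this[of "gt_exp_x1 s" "gt_exp_x1 t"] show "gt_mult (gt_exp_x1 s) (gt_exp_x1 t) = gt_exp_x1 (s + t)"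
    by (intro gt_eqI) (simp_all add: gt_b_mult gt_d_mult gt_a_def gt_c_def sinh_add cosh_add
        algebra_simps, simp_all add: gt_exp_x1_def)
  have "\<bar>snd (gt_mult g h)\<bar> < 2 * pi" if "snd g = 0" "snd h = 0" for g h
    using Arg_factor[of g h] that by (simp add: gt_mult_def)
  from this[of "gt_exp_x2 s" "gt_exp_x2 t"] show "gt_mult (gt_exp_x2 s) (gt_exp_x2 t) = gt_exp_x2 (s + t)"
    by (intro gt_eqI) (simp_all add: gt_b_mult gt_d_mult gt_a_def gt_c_def sinh_add cosh_add
        algebra_simps, simp_all add: gt_exp_x2_def)
qed

lemma gt_exp_proj:
  "gt_proj (gt_exp_ih t) = vector [vector [cis (t / 2), 0], vector [0, cis (- t / 2)]]"
  "gt_proj (gt_exp_x1 t) = vector [vector [of_real (cosh t), of_real (sinh t)],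
                                   vector [of_real (sinh t), of_real (cosh t)]]"
  "gt_proj (gt_exp_x2 t) = vector [vector [of_real (cosh t), \<i> * of_real (sinh t)],
                                   vector [- \<i> * of_real (sinh t), of_real (cosh t)]]"
  by (simp_all add: gt_proj_def gt_a_def gt_c_def cis_cnj)


section \<open>Smooth functions on open subsets of finite dimensional spaces\<close>

primrec Ck_on :: "nat \<Rightarrow> 'a::real_normed_vector set \<Rightarrow> ('a \<Rightarrow> 'b::real_normed_vector) \<Rightarrow> bool" where
  "Ck_on 0 S f = continuous_on S f"
| "Ck_on (Suc k) S f =
     ((\<forall>x\<in>S. f differentiable (at x)) \<and> (\<forall>v. Ck_on k S (\<lambda>x. frechet_derivative f (at x) v)))"

definition smooth_on :: "'a::real_normed_vector set \<Rightarrow> ('a \<Rightarrow> 'b::real_normed_vector) \<Rightarrow> bool" where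
  "smooth_on S f \<longleftrightarrow> (\<forall>k. Ck_on k S f)"


section \<open>Homogeneous holomorphic Hermitian vector bundles over the disc\<close>

text \<open>The total space carries fibrewise addition and scalar multiplication and a set of local
  trivializations \<open>(U, \<phi>)\<close>; here \<open>\<phi>\<close> is the vector component of the trivialization
  over \<open>U\<close>.  Only the values of the operations on vectors in a common fibre are relevant.\<close>

record 'e vbundle =
  total :: "'e set"
  bproj :: "'e \<Rightarrow> complex"
  vadd :: "'e \<Rightarrow> 'e \<Rightarrow> 'e"
  vscale :: "complex \<Rightarrow> 'e \<Rightarrow> 'e"
  charts :: "(complex set \<times> ('e \<Rightarrow> complex vec)) set"

record 'e hom_vbundle = "'e vbundle" +
  bact :: "gtilde \<Rightarrow> 'e \<Rightarrow> 'e"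

record 'e hom_herm_vbundle = "'e hom_vbundle" +
  herm :: "'e \<Rightarrow> 'e \<Rightarrow> complex"

definition fibre :: "('e, 'm) vbundle_scheme \<Rightarrow> complex \<Rightarrow> 'e set" where
  "fibre E z = {e \<in> total E. bproj E e = z}"

definition fibre_coords :: "('e, 'm) vbundle_scheme \<Rightarrow> nat \<Rightarrow> complex \<Rightarrow> ('e \<Rightarrow> complex vec) \<Rightarrow> bool" where
  "fibre_coords E n z \<phi> \<longleftrightarrow> bij_betw \<phi> (fibre E z) (carrier_vec n)
     \<and> (\<forall>u\<in>fibre E z. \<forall>v\<in>fibre E z. vadd E u v \<in> fibre E z \<and> \<phi> (vadd E u v) = \<phi> u + \<phi> v)
     \<and> (\<forall>c. \<forall>u\<in>fibre E z. vscale E c u \<in> fibre E z \<and> \<phi> (vscale E c u) = c \<cdot>\<^sub>v \<phi> u)"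

definition frame :: "('e, 'm) vbundle_scheme \<Rightarrow> nat \<Rightarrow> ('e \<Rightarrow> complex vec) \<Rightarrow> complex \<Rightarrow> nat \<Rightarrow> 'e" where
  "frame E n \<phi> z j = the_inv_into (fibre E z) \<phi> (unit_vec n j)"

definition local_triv :: "('e, 'm) vbundle_scheme \<Rightarrow> nat \<Rightarrow> complex set \<times> ('e \<Rightarrow> complex vec) \<Rightarrow> bool" where
  "local_triv E n = (\<lambda>(U, \<phi>). open U \<and> U \<subseteq> disc \<and> (\<forall>z\<in>U. fibre_coords E n z \<phi>))"

definition hol_transition :: "('e, 'm) vbundle_scheme \<Rightarrow> nat \<Rightarrow>
    complex set \<times> ('e \<Rightarrow> complex vec) \<Rightarrow> complex set \<times> ('e \<Rightarrow> complex vec) \<Rightarrow> bool" where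
  "hol_transition E n = (\<lambda>(U, \<phi>) (V, \<psi>).
     \<forall>i<n. \<forall>j<n. (\<lambda>z. \<psi> (frame E n \<phi> z j) $ i) holomorphic_on U \<inter> V)"

definition hol_vbundle :: "('e, 'm) vbundle_scheme \<Rightarrow> nat \<Rightarrow> bool" where
  "hol_vbundle E n \<longleftrightarrow>
     (\<forall>e\<in>total E. bproj E e \<in> disc)
   \<and> \<Union> (fst ` charts E) = disc
   \<and> (\<forall>A\<in>charts E. local_triv E n A)
   \<and> (\<forall>A\<in>charts E. \<forall>B\<in>charts E. hol_transition E n A B)"

text \<open>\<open>hol_bundle_map E n E' n' f \<Phi>\<close>: \<open>\<Phi>\<close> is a holomorphic bundle map covering the map
  \<open>f\<close> of the disc.\<close>

definition hol_bundle_map :: "('e, 'm) vbundle_scheme \<Rightarrow> nat \<Rightarrow> ('f, 'k) vbundle_scheme \<Rightarrow> nat \<Rightarrow>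
    (complex \<Rightarrow> complex) \<Rightarrow> ('e \<Rightarrow> 'f) \<Rightarrow> bool" where
  "hol_bundle_map E n E' n' f \<Phi> \<longleftrightarrow>
     (\<forall>z\<in>disc. \<forall>u\<in>fibre E z. \<Phi> u \<in> fibre E' (f z)
        \<and> (\<forall>v\<in>fibre E z. \<Phi> (vadd E u v) = vadd E' (\<Phi> u) (\<Phi> v))
        \<and> (\<forall>c. \<Phi> (vscale E c u) = vscale E' c (\<Phi> u)))
   \<and> (\<forall>(U, \<phi>)\<in>charts E. \<forall>(V, \<psi>)\<in>charts E'. \<forall>i<n'. \<forall>j<n.
        (\<lambda>z. \<psi> (\<Phi> (frame E n \<phi> z j)) $ i) holomorphic_on {z\<in>U. f z \<in> V})"

text \<open>The action is required to be smooth as a map of the product of the group and the total space.\<close>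

definition hom_hol_vbundle :: "('e, 'm) hom_vbundle_scheme \<Rightarrow> nat \<Rightarrow> bool" where
  "hom_hol_vbundle E n \<longleftrightarrow> hol_vbundle E n
   \<and> (\<forall>e\<in>total E. bact E gt_one e = e)
   \<and> (\<forall>g h. \<forall>e\<in>total E. bact E (gt_mult g h) e = bact E g (bact E h e))
   \<and> (\<forall>g. hol_bundle_map E n E n (gt_act g) (bact E g))
   \<and> (\<forall>(U, \<phi>)\<in>charts E. \<forall>(V, \<psi>)\<in>charts E. \<forall>i<n. \<forall>j<n.
        smooth_on {(g, z). z \<in> U \<and> gt_act g z \<in> V} (\<lambda>(g, z). \<psi> (bact E g (frame E n \<phi> z j)) $ i))"

text \<open>The Hermitian inner products are linear in the first argument.\<close>

definition herm_structure :: "('e, 'm) hom_herm_vbundle_scheme \<Rightarrow> nat \<Rightarrow> bool" where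
  "herm_structure E n \<longleftrightarrow>
     (\<forall>z\<in>disc. \<forall>u\<in>fibre E z. \<forall>v\<in>fibre E z.
        (\<forall>w\<in>fibre E z. herm E (vadd E u v) w = herm E u w + herm E v w)
      \<and> (\<forall>c. herm E (vscale E c u) v = c * herm E u v)
      \<and> herm E v u = cnj (herm E u v))
   \<and> (\<forall>u\<in>total E. u \<noteq> vscale E 0 u \<longrightarrow> 0 < Re (herm E u u))
   \<and> (\<forall>(U, \<phi>)\<in>charts E. \<forall>i<n. \<forall>j<n.
        smooth_on U (\<lambda>z. herm E (frame E n \<phi> z i) (frame E n \<phi> z j)))"

definition hom_hol_herm_vbundle :: "('e, 'm) hom_herm_vbundle_scheme \<Rightarrow> nat \<Rightarrow> bool" where
  "hom_hol_herm_vbundle E n \<longleftrightarrow> hom_hol_vbundle E n \<and> herm_structure E n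
   \<and> (\<forall>g. \<forall>z\<in>disc. \<forall>u\<in>fibre E z. \<forall>v\<in>fibre E z. herm E (bact E g u) (bact E g v) = herm E u v)"

definition hom_herm_isomorphic ::
    "('e, 'm) hom_herm_vbundle_scheme \<Rightarrow> ('f, 'k) hom_herm_vbundle_scheme \<Rightarrow> bool" where
  "hom_herm_isomorphic E E' \<longleftrightarrow> (\<exists>n n' \<Phi>.
     hom_hol_herm_vbundle E n \<and> hom_hol_herm_vbundle E' n'
   \<and> bij_betw \<Phi> (total E) (total E')
   \<and> hol_bundle_map E n E' n' id \<Phi>
   \<and> hol_bundle_map E' n' E n id (the_inv_into (total E) \<Phi>)
   \<and> (\<forall>g. \<forall>e\<in>total E. \<Phi> (bact E g e) = bact E' g (\<Phi> e))
   \<and> (\<forall>z\<in>disc. \<forall>u\<in>fibre E z. \<forall>v\<in>fibre E z. herm E' (\<Phi> u) (\<Phi> v) = herm E u v))"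

text \<open>A sub-bundle of rank \<open>k\<close> is locally the span of the first \<open>k\<close> members of a holomorphic
  frame.\<close>

definition hol_subbundle :: "('e, 'm) vbundle_scheme \<Rightarrow> nat \<Rightarrow> nat \<Rightarrow> 'e set \<Rightarrow> bool" where
  "hol_subbundle E n k S \<longleftrightarrow> S \<subseteq> total E \<and> k \<le> n
   \<and> (\<forall>z0\<in>disc. \<exists>U \<phi>. z0 \<in> U \<and> local_triv E n (U, \<phi>)
        \<and> (\<forall>A\<in>charts E. hol_transition E n A (U, \<phi>) \<and> hol_transition E n (U, \<phi>) A)
        \<and> (\<forall>z\<in>U. \<phi> ` (S \<inter> fibre E z) = {v \<in> carrier_vec n. \<forall>i<n. k \<le> i \<longrightarrow> v $ i = 0}))"

definition hom_subbundle :: "('e, 'm) hom_vbundle_scheme \<Rightarrow> nat \<Rightarrow> nat \<Rightarrow> 'e set \<Rightarrow> bool" where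
  "hom_subbundle E n k S \<longleftrightarrow> hol_subbundle E n k S \<and> (\<forall>g. bact E g ` S \<subseteq> S)"

definition irreducible_bundle :: "('e, 'm) hom_herm_vbundle_scheme \<Rightarrow> nat \<Rightarrow> bool" where
  "irreducible_bundle E n \<longleftrightarrow> hom_hol_herm_vbundle E n \<and>
     \<not> (\<exists>S' S'' k' k''. 0 < k' \<and> 0 < k'' \<and> hom_subbundle E n k' S' \<and> hom_subbundle E n k'' S''
        \<and> (\<forall>z\<in>disc. (\<forall>u\<in>S' \<inter> fibre E z. \<forall>v\<in>S'' \<inter> fibre E z. herm E u v = 0)
             \<and> (\<forall>e\<in>fibre E z. \<exists>u\<in>S' \<inter> fibre E z. \<exists>v\<in>S'' \<inter> fibre E z. e = vadd E u v)))"


section \<open>Holomorphic induction and elementary bundles\<close>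

definition b_rep :: "nat \<Rightarrow> complex mat \<Rightarrow> complex mat \<Rightarrow> bool" where
  "b_rep n \<rho>h \<rho>y \<longleftrightarrow> \<rho>h \<in> carrier_mat n n \<and> \<rho>y \<in> carrier_mat n n \<and> \<rho>h * \<rho>y - \<rho>y * \<rho>h = - \<rho>y"

definition mat_exp :: "complex mat \<Rightarrow> complex mat" where
  "mat_exp A = mat (dim_row A) (dim_row A) (\<lambda>(i, j). \<Sum>k. (A ^\<^sub>m k) $$ (i, j) / fact k)"

text \<open>The functions \<open>F\<close> on a right invariant open subset of the group that lift holomorphic sections
  of the induced bundle; note that \<open>\<rho>(exp (t \<i>h)) = exp (\<i> t \<rho>(h))\<close>.\<close>

definition induced_lift :: "nat \<Rightarrow> complex mat \<Rightarrow> complex mat \<Rightarrow> gtilde set \<Rightarrow>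
    (gtilde \<Rightarrow> complex vec) \<Rightarrow> bool" where
  "induced_lift n \<rho>h \<rho>y \<Omega> F \<longleftrightarrow>
     (\<forall>g\<in>\<Omega>. F g \<in> carrier_vec n)
   \<and> (\<forall>i<n. smooth_on \<Omega> (\<lambda>g. F g $ i))
   \<and> (\<forall>g\<in>\<Omega>. \<forall>t. F (gt_mult g (gt_exp_ih t)) = mat_exp ((- \<i> * of_real t) \<cdot>\<^sub>m \<rho>h) *\<^sub>v F g)
   \<and> (\<forall>g\<in>\<Omega>. \<forall>i<n. lie_h (\<lambda>g. F g $ i) g = - (\<rho>h *\<^sub>v F g) $ i)
   \<and> (\<forall>g\<in>\<Omega>. \<forall>i<n. lie_y (\<lambda>g. F g $ i) g = - (\<rho>y *\<^sub>v F g) $ i)"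

text \<open>With \<open>\<iota>\<close> identifying the fibre over \<open>0\<close> with the representation space, the lift of a section
  \<open>s\<close> is \<open>F(g) = g\<^sup>-\<^sup>1 s(g \<cdot> 0)\<close>.\<close>

definition section_lift :: "('e, 'm) hom_vbundle_scheme \<Rightarrow> ('e \<Rightarrow> complex vec) \<Rightarrow>
    (complex \<Rightarrow> 'e) \<Rightarrow> gtilde \<Rightarrow> complex vec" where
  "section_lift E \<iota> s g = \<iota> (bact E (gt_inv g) (s (gt_act g 0)))"

definition hol_induced_from :: "('e, 'm) hom_vbundle_scheme \<Rightarrow> nat \<Rightarrow>
    complex mat \<Rightarrow> complex mat \<Rightarrow> bool" where
  "hol_induced_from E n \<rho>h \<rho>y \<longleftrightarrow> b_rep n \<rho>h \<rho>y \<and>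
     (\<exists>\<iota>. fibre_coords E n 0 \<iota> \<and>
       (\<forall>U s. open U \<and> U \<subseteq> disc \<and> (\<forall>z\<in>U. s z \<in> fibre E z) \<longrightarrow>
          ((\<forall>(V, \<phi>)\<in>charts E. \<forall>i<n. (\<lambda>z. \<phi> (s z) $ i) holomorphic_on U \<inter> V) \<longleftrightarrow>
           induced_lift n \<rho>h \<rho>y {g. gt_act g 0 \<in> U} (section_lift E \<iota> s))))"

definition elementary :: "('e, 'm) hom_herm_vbundle_scheme \<Rightarrow> bool" where
  "elementary E \<longleftrightarrow> (\<exists>n \<rho>h \<rho>y (\<eta>::real) (m::nat).
     hom_hol_herm_vbundle E n \<and> hol_induced_from E n \<rho>h \<rho>y
   \<and> spectrum \<rho>h = (\<lambda>j. - of_real (\<eta> + real j)) ` {0..m})"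


section \<open>Block matrices\<close>

text \<open>The block sizes are \<open>ds = [d\<^sub>0, \<dots>, d\<^sub>m]\<close>.\<close>

definition block_sizes :: "nat list \<Rightarrow> bool" where
  "block_sizes ds \<longleftrightarrow> ds \<noteq> [] \<and> (\<forall>k\<in>set ds. 1 \<le> k)"

definition blk_start :: "nat list \<Rightarrow> nat \<Rightarrow> nat" where
  "blk_start ds p = sum_list (take p ds)"

definition blk_of :: "nat list \<Rightarrow> nat \<Rightarrow> nat" where
  "blk_of ds i = (LEAST p. i < blk_start ds (Suc p))"

definition blk_off :: "nat list \<Rightarrow> nat \<Rightarrow> nat" where
  "blk_off ds i = i - blk_start ds (blk_of ds i)"

definition block :: "nat list \<Rightarrow> complex mat \<Rightarrow> nat \<Rightarrow> nat \<Rightarrow> complex mat" where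
  "block ds M p l = mat (ds ! p) (ds ! l) (\<lambda>(r, s). M $$ (blk_start ds p + r, blk_start ds l + s))"

definition vec_block :: "nat list \<Rightarrow> complex vec \<Rightarrow> nat \<Rightarrow> complex vec" where
  "vec_block ds v p = vec (ds ! p) (\<lambda>r. v $ (blk_start ds p + r))"

definition of_blocks :: "nat list \<Rightarrow> (nat \<Rightarrow> nat \<Rightarrow> complex mat) \<Rightarrow> complex mat" where
  "of_blocks ds B = mat (sum_list ds) (sum_list ds)
     (\<lambda>(i, j). B (blk_of ds i) (blk_of ds j) $$ (blk_off ds i, blk_off ds j))"

definition block_diagonal :: "nat list \<Rightarrow> complex mat \<Rightarrow> bool" where
  "block_diagonal ds A \<longleftrightarrow> A \<in> carrier_mat (sum_list ds) (sum_list ds)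
   \<and> (\<forall>p<length ds. \<forall>l<length ds. p \<noteq> l \<longrightarrow> block ds A p l = 0\<^sub>m (ds ! p) (ds ! l))"

definition block_subdiagonal :: "nat list \<Rightarrow> complex mat \<Rightarrow> bool" where
  "block_subdiagonal ds Y \<longleftrightarrow> Y \<in> carrier_mat (sum_list ds) (sum_list ds)
   \<and> (\<forall>p<length ds. \<forall>l<length ds. p \<noteq> Suc l \<longrightarrow> block ds Y p l = 0\<^sub>m (ds ! p) (ds ! l))"

definition unitary_mat :: "nat \<Rightarrow> complex mat \<Rightarrow> bool" where
  "unitary_mat n A \<longleftrightarrow> A \<in> carrier_mat n n \<and> A * mat_adjoint A = 1\<^sub>m n \<and> mat_adjoint A * A = 1\<^sub>m n"

text \<open>The class \<open>[Y]\<close>; for unitary \<open>A\<close> the inverse is the adjoint.\<close>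

definition unitary_class :: "nat list \<Rightarrow> complex mat \<Rightarrow> complex mat set" where
  "unitary_class ds Y =
     {A * Y * mat_adjoint A | A. block_diagonal ds A \<and> unitary_mat (sum_list ds) A}"

definition vec_subspace :: "nat \<Rightarrow> complex vec set \<Rightarrow> bool" where
  "vec_subspace n W \<longleftrightarrow> W \<subseteq> carrier_vec n \<and> 0\<^sub>v n \<in> W
   \<and> (\<forall>u\<in>W. \<forall>v\<in>W. u + v \<in> W) \<and> (\<forall>c. \<forall>u\<in>W. c \<cdot>\<^sub>v u \<in> W)"

definition block_direct_sum :: "nat list \<Rightarrow> (nat \<Rightarrow> complex vec set) \<Rightarrow> complex vec set" where
  "block_direct_sum ds W = {v \<in> carrier_vec (sum_list ds). \<forall>j<length ds. vec_block ds v j \<in> W j}"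

definition splits :: "nat list \<Rightarrow> complex mat \<Rightarrow> bool" where
  "splits ds Y \<longleftrightarrow> (\<exists>W' W''.
     (\<forall>j<length ds. vec_subspace (ds ! j) (W' j) \<and> vec_subspace (ds ! j) (W'' j)
        \<and> (\<forall>u\<in>W' j. \<forall>v\<in>W'' j. u \<bullet>c v = 0)
        \<and> (\<forall>x\<in>carrier_vec (ds ! j). \<exists>u\<in>W' j. \<exists>v\<in>W'' j. x = u + v))
   \<and> block_direct_sum ds W' \<noteq> {0\<^sub>v (sum_list ds)}
   \<and> block_direct_sum ds W'' \<noteq> {0\<^sub>v (sum_list ds)}
   \<and> (\<forall>v\<in>block_direct_sum ds W'. Y *\<^sub>v v \<in> block_direct_sum ds W')
   \<and> (\<forall>v\<in>block_direct_sum ds W''. Y *\<^sub>v v \<in> block_direct_sum ds W''))"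


section \<open>The bundles induced by block subdiagonal matrices, in their canonical trivialization\<close>

text \<open>\<open>chain ds Y l k\<close> is the product \<open>Y\<^sub>l\<^sub>+\<^sub>k \<cdots> Y\<^sub>l\<^sub>+\<^sub>1\<close>.\<close>

primrec chain :: "nat list \<Rightarrow> complex mat \<Rightarrow> nat \<Rightarrow> nat \<Rightarrow> complex mat" where
  "chain ds Y l 0 = 1\<^sub>m (ds ! l)"
| "chain ds Y l (Suc k) = block ds Y (Suc (l + k)) (l + k) * chain ds Y l k"

definition J_mat :: "real \<Rightarrow> nat list \<Rightarrow> complex mat \<Rightarrow> gtilde \<Rightarrow> complex \<Rightarrow> complex mat" where
  "J_mat \<eta> ds Y g z = of_blocks ds (\<lambda>p l.
     if l \<le> p
     then (1 / fact (p - l) * (- gt_c g) ^ (p - l) * gt_deriv_pow (\<eta> + (real p + real l) / 2) g z)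
            \<cdot>\<^sub>m chain ds Y l (p - l)
     else 0\<^sub>m (ds ! p) (ds ! l))"

text \<open>The element with \<open>\<theta> = 0\<close> that maps \<open>0\<close> to \<open>z\<close>.\<close>

definition gt_transvection :: "complex \<Rightarrow> gtilde" where
  "gt_transvection z = (z / of_real (sqrt (1 - (cmod z)\<^sup>2)), 0)"

text \<open>The invariant Hermitian structure with value \<open>H\<close> over \<open>0\<close>, obtained from
  \<open>H(g \<cdot> 0) = J\<^sub>g(0)\<^sup>* H J\<^sub>g(0)\<close>.\<close>

definition H_mat :: "real \<Rightarrow> nat list \<Rightarrow> complex mat \<Rightarrow> complex mat \<Rightarrow> complex \<Rightarrow> complex mat" where
  "H_mat \<eta> ds Y H z = (let J = J_mat \<eta> ds Y (gt_transvection z) 0 in mat_adjoint J * H * J)"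

definition E_bundle :: "real \<Rightarrow> nat list \<Rightarrow> complex mat \<Rightarrow> complex mat \<Rightarrow>
    (complex \<times> complex vec) hom_herm_vbundle" where
  "E_bundle \<eta> ds Y H = \<lparr>
     total = disc \<times> carrier_vec (sum_list ds),
     bproj = fst,
     vadd = (\<lambda>(z, \<xi>) (w, \<zeta>). (z, \<xi> + \<zeta>)),
     vscale = (\<lambda>c (z, \<xi>). (z, c \<cdot>\<^sub>v \<xi>)),
     charts = {(disc, snd)},
     bact = (\<lambda>g (z, \<xi>). (gt_act g z, the (mat_inverse (J_mat \<eta> ds Y g z)) *\<^sub>v \<xi>)),
     herm = (\<lambda>(z, \<xi>) (w, \<zeta>). (H_mat \<eta> ds Y H z *\<^sub>v \<xi>) \<bullet>c \<zeta>)\<rparr>"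

end

theory Submission
  imports Defs "HOL-Complex_Analysis.Cauchy_Integral_Formula"
begin

no_notation vec_nth (infixl "$" 90)
hide_const (open) Finite_Cartesian_Product.vec

text \<open>A homogeneous bundle is determined by the representation \<open>\<rho>\<close> of \<open>\<bb>\<close> on its fibre over \<open>0\<close>, and a
  homogeneous Hermitian bundle by \<open>\<rho>\<close> together with the inner product of that fibre, because the group acts
  transitively. The translation between the two sides goes through the lifts \<open>F(g) = g\<^sup>-\<^sup>1 s(g \<cdot> 0)\<close> of holomorphic
  sections \<open>s\<close>: every vector over \<open>0\<close> is the value of a local one, and the derivatives of the lift at the
  identity are \<open>- \<rho>(h) F\<close> and \<open>- \<rho>(y) F\<close>. If two bundles are induced from the same \<open>\<rho>\<close> and have the same inner
  product over \<open>0\<close>, then transport of the identity map of this fibre by the two actions is an isomorphism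
  (\<open>isomorphic_if_same_representation\<close>). Conversely, equivariant bundle maps intertwine the representations
  (\<open>bundle_map_intertwines\<close>).

  The bundle \<open>E\<^sup>(\<^sup>\<eta>\<^sup>,\<^sup>Y\<^sup>)\<close> is induced from \<open>\<rho>(y) = Y\<close> and the block scalar matrix \<open>\<rho>(h)\<close> (\<open>E_bundle_induced\<close>). In its
  trivialization a section is a vector valued function \<open>f\<close>, its lift is \<open>F(g) = J\<^sub>g(0) f(g \<cdot> 0)\<close>, and by the cocycle
  identity for \<open>J\<close> the equation \<open>y F = - Y F\<close> becomes the Cauchy-Riemann equation for \<open>f\<close>
  (\<open>induced_lift_canonical\<close>). The cocycle identity itself is the statement that the matrices
  \<open>exp(L \<rho>(h)) exp(- c Y) exp(L \<rho>(h))\<close> multiply like lower triangular two by two matrices (\<open>aut_mat_mult\<close>).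

  For an elementary bundle the stabilizer of \<open>0\<close> acts on the fibre by isometries, so \<open>\<rho>(h)\<close> is self-adjoint
  (\<open>induced_h_self_adjoint\<close>) and is diagonal in a suitable orthonormal basis, with the eigenvalues in the order of
  the string. The relation \<open>[\<rho>(h), \<rho>(y)] = - \<rho>(y)\<close> then says that \<open>\<rho>(y)\<close> is block subdiagonal. An isomorphism of
  two of these bundles is over \<open>0\<close> a unitary map that conjugates \<open>\<rho>(h)\<close> to \<open>\<rho>'(h)\<close> and \<open>Y\<close> to \<open>Y'\<close>. The
  multiplicities of the eigenvalues determine \<open>\<eta>\<close> and the block sizes, and commuting with \<open>\<rho>(h)\<close> means being
  block diagonal, so the remaining invariant is the class of \<open>Y\<close>.

  The fibre over \<open>0\<close> of a homogeneous sub-bundle is an invariant subspace of \<open>\<rho>\<close>. Invariance under \<open>\<rho>(h)\<close> makes it the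
  direct sum of its components in the blocks, so an orthogonal decomposition of the bundle gives a splitting of
  \<open>Y\<close> (\<open>reducible_imp_splits\<close>). Conversely, the projection that belongs to a splitting commutes with every
  factor of automorphy, so the two summands are constant sub-bundles in the canonical trivialization
  (\<open>splits_imp_reducible\<close>).\<close>

section \<open>Calculus of smooth functions\<close>

lemma Ck_on_cong:
  assumes "open S" "\<And>x. x \<in> S \<Longrightarrow> f x = g x"
  shows "Ck_on k S f = Ck_on k S g"
  using assms(2)
proof (induction k arbitrary: f g)
  case 0
  then show ?case by (simp cong: continuous_on_cong)
next
  case (Suc k)
  have d: "(f has_derivative D) (at x) = (g has_derivative D) (at x)" if "x \<in> S" for x D
    using has_derivative_transform_within_open[OF _ \<open>open S\<close> that, of f D UNIV g]
      has_derivative_transform_within_open[OF _ \<open>open S\<close> that, of g D UNIV f] Suc.prems by auto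
  have "(\<forall>x\<in>S. f differentiable (at x)) = (\<forall>x\<in>S. g differentiable (at x))"
    using d by (simp add: differentiable_def)
  moreover have "Ck_on k S (\<lambda>x. frechet_derivative f (at x) v) = Ck_on k S (\<lambda>x. frechet_derivative g (at x) v)" for v
    by (rule Suc.IH) (use d in \<open>simp add: frechet_derivative_def\<close>)
  ultimately show ?case by simp
qed

lemma smooth_on_cong:
  assumes "open S" "\<And>x. x \<in> S \<Longrightarrow> f x = g x"
  shows "smooth_on S f = smooth_on S g"
  using Ck_on_cong[OF assms] by (simp add: smooth_on_def)

lemma Ck_on_SucI:
  assumes "open S" "\<And>x. x \<in> S \<Longrightarrow> (f has_derivative f' x) (at x)" "\<And>v. Ck_on k S (\<lambda>x. f' x v)"
  shows "Ck_on (Suc k) S f"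
proof -
  have "frechet_derivative f (at x) v = f' x v" if "x \<in> S" for x v
    using frechet_derivative_at[OF assms(2)[OF that]] by simp
  then have "Ck_on k S (\<lambda>x. frechet_derivative f (at x) v) = Ck_on k S (\<lambda>x. f' x v)" for v
    by (intro Ck_on_cong assms(1))
  then show ?thesis using assms(2,3) by (auto simp: differentiable_def)
qed

lemma Ck_on_SucD: "Ck_on (Suc k) S f \<Longrightarrow> Ck_on k S f"
proof (induction k arbitrary: f)
  case 0
  then show ?case
    by (auto intro!: differentiable_imp_continuous_on simp: differentiable_on_def differentiable_at_withinI)
next
  case (Suc k)
  then show ?case by simp
qed

lemma Ck_on_derivative:
  assumes "Ck_on (Suc k) S f" "x \<in> S"
  shows "(f has_derivative frechet_derivative f (at x)) (at x)"
  using assms frechet_derivative_works by auto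

lemma smooth_on_differentiable: "smooth_on S f \<Longrightarrow> x \<in> S \<Longrightarrow> f differentiable (at x)"
  by (metis Ck_on.simps(2) smooth_on_def)

lemma Ck_on_const: "open S \<Longrightarrow> Ck_on k S (\<lambda>x. c)"
proof (induction k arbitrary: c)
  case (Suc k)
  then show ?case by (intro Ck_on_SucI[where f' = "\<lambda>_ _. 0"]) auto
qed simp

lemma Ck_on_add:
  "open S \<Longrightarrow> Ck_on k S f \<Longrightarrow> Ck_on k S g \<Longrightarrow> Ck_on k S (\<lambda>x. f x + g x)"
proof (induction k arbitrary: f g)
  case (Suc k)
  show ?case
  proof (rule Ck_on_SucI)
    show "((\<lambda>x. f x + g x) has_derivative
        (\<lambda>v. frechet_derivative f (at x) v + frechet_derivative g (at x) v)) (at x)" if "x \<in> S" for x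
      by (intro has_derivative_add Ck_on_derivative[OF Suc.prems(2) that] Ck_on_derivative[OF Suc.prems(3) that])
    show "Ck_on k S (\<lambda>x. frechet_derivative f (at x) v + frechet_derivative g (at x) v)" for v
      using Suc.prems by (intro Suc.IH) simp_all
  qed (fact Suc.prems(1))
qed (auto intro: continuous_on_add)

lemma Ck_on_mult:
  fixes f g :: "'a::real_normed_vector \<Rightarrow> complex"
  shows "open S \<Longrightarrow> Ck_on k S f \<Longrightarrow> Ck_on k S g \<Longrightarrow> Ck_on k S (\<lambda>x. f x * g x)"
proof (induction k arbitrary: f g)
  case (Suc k)
  show ?case
  proof (rule Ck_on_SucI)
    show "((\<lambda>x. f x * g x) has_derivative
        (\<lambda>v. f x * frechet_derivative g (at x) v + frechet_derivative f (at x) v * g x)) (at x)" if "x \<in> S" for x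
      by (intro has_derivative_mult Ck_on_derivative[OF Suc.prems(2) that] Ck_on_derivative[OF Suc.prems(3) that])
    show "Ck_on k S (\<lambda>x. f x * frechet_derivative g (at x) v + frechet_derivative f (at x) v * g x)" for v
      using Suc.prems Ck_on_SucD[OF Suc.prems(2)] Ck_on_SucD[OF Suc.prems(3)]
      by (intro Ck_on_add Suc.IH) simp_all
  qed (fact Suc.prems(1))
qed (auto intro: continuous_on_mult)

lemma Ck_on_bounded_linear_comp:
  assumes L: "bounded_linear L"
  shows "open S \<Longrightarrow> Ck_on k S f \<Longrightarrow> Ck_on k S (\<lambda>x. L (f x))"
proof (induction k arbitrary: f)
  case 0
  then show ?case by (simp add: bounded_linear.continuous_on[OF L])
next
  case (Suc k)
  show ?case
  proof (rule Ck_on_SucI)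
    show "((\<lambda>x. L (f x)) has_derivative (\<lambda>v. L (frechet_derivative f (at x) v))) (at x)" if "x \<in> S" for x
      by (intro bounded_linear.has_derivative[OF L] Ck_on_derivative[OF Suc.prems(2) that])
    show "Ck_on k S (\<lambda>x. L (frechet_derivative f (at x) v))" for v
      using Suc.prems by (intro Suc.IH) simp_all
  qed (fact Suc.prems(1))
qed

text \<open>Holomorphic functions are closed under differentiation, which carries the induction on the
  order of differentiability.\<close>

lemma Ck_on_holomorphic_comp:
  assumes "open S" "open T" "f ` S \<subseteq> T"
  shows "h holomorphic_on T \<Longrightarrow> Ck_on k S f \<Longrightarrow> Ck_on k S (\<lambda>x. h (f x))"
proof (induction k arbitrary: h)
  case 0
  then show ?case
    using continuous_on_compose2[OF holomorphic_on_imp_continuous_on[OF 0(1)] _ assms(3)] by auto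
next
  case (Suc k)
  show ?case
  proof (rule Ck_on_SucI)
    fix x assume x: "x \<in> S"
    have h: "(h has_field_derivative deriv h (f x)) (at (f x))"
      using Suc.prems(1) assms x by (intro holomorphic_derivI[of _ T]) auto
    show "((\<lambda>x. h (f x)) has_derivative (\<lambda>v. deriv h (f x) * frechet_derivative f (at x) v)) (at x)"
      using has_derivative_compose[OF Ck_on_derivative[OF Suc.prems(2) x] h[unfolded has_field_derivative_def]] .
  next
    fix v
    have "deriv h holomorphic_on T" using Suc.prems(1) assms(2) by (rule holomorphic_deriv)
    then have "Ck_on k S (\<lambda>x. deriv h (f x))"
      using Ck_on_SucD[OF Suc.prems(2)] by (rule Suc.IH)
    moreover have "Ck_on k S (\<lambda>x. frechet_derivative f (at x) v)" using Suc.prems(2) by simp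
    ultimately show "Ck_on k S (\<lambda>x. deriv h (f x) * frechet_derivative f (at x) v)"
      by (rule Ck_on_mult[OF assms(1)])
  qed (fact assms(1))
qed

named_theorems smooth_intros

lemma smooth_on_const [smooth_intros]: "open S \<Longrightarrow> smooth_on S (\<lambda>x. c)"
  by (simp add: smooth_on_def Ck_on_const)

lemma smooth_on_add [smooth_intros]:
  "open S \<Longrightarrow> smooth_on S f \<Longrightarrow> smooth_on S g \<Longrightarrow> smooth_on S (\<lambda>x. f x + g x)"
  by (simp add: smooth_on_def Ck_on_add)

lemma smooth_on_mult [smooth_intros]:
  fixes f g :: "'a::real_normed_vector \<Rightarrow> complex"
  shows "open S \<Longrightarrow> smooth_on S f \<Longrightarrow> smooth_on S g \<Longrightarrow> smooth_on S (\<lambda>x. f x * g x)"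
  by (simp add: smooth_on_def Ck_on_mult)

lemma smooth_on_bounded_linear_comp:
  "bounded_linear L \<Longrightarrow> open S \<Longrightarrow> smooth_on S f \<Longrightarrow> smooth_on S (\<lambda>x. L (f x))"
  by (simp add: smooth_on_def Ck_on_bounded_linear_comp)

lemma smooth_on_ident: "open S \<Longrightarrow> smooth_on S (\<lambda>x. x)"
  unfolding smooth_on_def
proof
  fix k assume S: "open S"
  show "Ck_on k S (\<lambda>x. x)"
  proof (cases k)
    case (Suc l)
    show ?thesis unfolding Suc using S by (rule Ck_on_SucI) (rule has_derivative_ident, rule Ck_on_const[OF S])
  qed (simp add: continuous_on_id)
qed

lemma smooth_on_bounded_linear: "bounded_linear L \<Longrightarrow> open S \<Longrightarrow> smooth_on S L"
  using smooth_on_bounded_linear_comp[OF _ _ smooth_on_ident] by blast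

lemma smooth_on_holomorphic_comp:
  assumes "open S" "open T" "f ` S \<subseteq> T" "h holomorphic_on T" "smooth_on S f"
  shows "smooth_on S (\<lambda>x. h (f x))"
  using assms by (simp add: smooth_on_def Ck_on_holomorphic_comp)

lemma smooth_on_uminus [smooth_intros]:
  "open S \<Longrightarrow> smooth_on S f \<Longrightarrow> smooth_on S (\<lambda>x. - f x)"
  by (rule smooth_on_bounded_linear_comp) (auto intro: bounded_linear_minus bounded_linear_ident)

lemma smooth_on_cnj [smooth_intros]:
  "open S \<Longrightarrow> smooth_on S f \<Longrightarrow> smooth_on S (\<lambda>x. cnj (f x))"
  by (rule smooth_on_bounded_linear_comp) (auto intro: bounded_linear_cnj)

lemma smooth_on_exp [smooth_intros]:
  fixes f :: "'a::real_normed_vector \<Rightarrow> complex"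
  shows "open S \<Longrightarrow> smooth_on S f \<Longrightarrow> smooth_on S (\<lambda>x. exp (f x))"
  by (rule smooth_on_holomorphic_comp[of S UNIV]) (auto intro: holomorphic_intros)

lemma smooth_on_power [smooth_intros]:
  fixes f :: "'a::real_normed_vector \<Rightarrow> complex"
  shows "open S \<Longrightarrow> smooth_on S f \<Longrightarrow> smooth_on S (\<lambda>x. f x ^ k)"
  by (rule smooth_on_holomorphic_comp[of S UNIV]) (auto intro: holomorphic_intros)

lemma smooth_on_inverse [smooth_intros]:
  fixes f :: "'a::real_normed_vector \<Rightarrow> complex"
  shows "open S \<Longrightarrow> smooth_on S f \<Longrightarrow> (\<And>x. x \<in> S \<Longrightarrow> f x \<noteq> 0) \<Longrightarrow> smooth_on S (\<lambda>x. inverse (f x))"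
  by (rule smooth_on_holomorphic_comp[of S "- {0}"]) (auto intro: holomorphic_intros)

lemma smooth_on_divide [smooth_intros]:
  fixes f :: "'a::real_normed_vector \<Rightarrow> complex"
  shows "open S \<Longrightarrow> smooth_on S f \<Longrightarrow> smooth_on S g \<Longrightarrow> (\<And>x. x \<in> S \<Longrightarrow> g x \<noteq> 0) \<Longrightarrow> smooth_on S (\<lambda>x. f x / g x)"
  unfolding divide_inverse by (intro smooth_intros)

lemma smooth_on_Ln [smooth_intros]:
  assumes "open S" "smooth_on S f" "\<And>x. x \<in> S \<Longrightarrow> 0 < Re (f x)"
  shows "smooth_on S (\<lambda>x. Ln (f x))"
proof (rule smooth_on_holomorphic_comp[where T = "{z. 0 < Re z}" and f = f and h = Ln])
  show "open {z. 0 < Re z}" by (intro open_Collect_less continuous_intros)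
  show "Ln holomorphic_on {z. 0 < Re z}"
    by (intro holomorphic_on_Ln) (auto simp: complex_nonpos_Reals_iff)
qed (use assms in auto)

lemma smooth_on_sum [smooth_intros]:
  assumes "open S" "\<And>i. i \<in> I \<Longrightarrow> smooth_on S (f i)"
  shows "smooth_on S (\<lambda>x. \<Sum>i\<in>I. f i x)"
  using assms(2)
proof (induction I rule: infinite_finite_induct)
  case (insert i I)
  then show ?case by (simp add: smooth_on_add assms(1))
qed (simp_all add: smooth_on_const assms(1))

section \<open>The universal covering group and its action on the disc\<close>

lemma gt_mult_inv_right: "gt_mult g (gt_inv g) = gt_one"
proof -
  have "gt_inv (gt_inv g) = g" by (simp add: gt_inv_def)
  then show ?thesis using gt_mult_inv[of "gt_inv g"] by simp
qed

lemma gt_act_inv: "z \<in> disc \<Longrightarrow> gt_act (gt_inv g) (gt_act g z) = z"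
  "z \<in> disc \<Longrightarrow> gt_act g (gt_act (gt_inv g) z) = z"
  using gt_act_mult[of z "gt_inv g" g] gt_act_mult[of z g "gt_inv g"]
  by (simp_all add: gt_mult_inv gt_mult_inv_right gt_act_one)

lemma gt_act_0: "gt_act g 0 = gt_b g / gt_d g"
  by (simp add: gt_act_def)

text \<open>A logarithm of the automorphy factor \<open>c z + d\<close>. The argument of \<open>d\<close> is a coordinate of the covering
  group, and the quotient of \<open>c z + d\<close> by \<open>d\<close> has positive real part, so that the principal branch applies to it.
  Since \<open>g'(z) = (c z + d)\<^sup>-\<^sup>2\<close>, the real powers of \<open>g'(z)\<close> are exponentials of multiples of it.\<close>

definition gt_log_aut :: "gtilde \<Rightarrow> complex \<Rightarrow> complex" where
  "gt_log_aut g z = of_real (ln (cmod (gt_d g))) + \<i> * of_real (snd g) + Ln (1 + gt_c g * z / gt_d g)"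

lemma gt_log_deriv_aut: "gt_log_deriv g z = - 2 * gt_log_aut g z"
  by (simp add: gt_log_deriv_def gt_log_aut_def)

lemma gt_aut_factor_norm: "z \<in> disc \<Longrightarrow> cmod (gt_c g * z / gt_d g) < 1"
proof -
  assume "z \<in> disc"
  then have "cmod (gt_b g) * cmod z \<le> cmod (gt_b g)" by (simp add: mult_left_le)
  then have "cmod (gt_b g) * cmod z < cmod (gt_d g)" using norm_gt_b_less[of g] by linarith
  then show ?thesis by (simp add: gt_c_def norm_mult norm_divide)
qed

lemma exp_ln_gt_d: "exp (of_real (ln (cmod (gt_d g))) + \<i> * of_real (snd g)) = gt_d g"
  by (subst (2) gt_d_polar) (simp add: exp_add cis_conv_exp exp_of_real)

lemma exp_gt_log_aut: "z \<in> disc \<Longrightarrow> exp (gt_log_aut g z) = gt_c g * z + gt_d g"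
proof -
  assume z: "z \<in> disc"
  have "1 + gt_c g * z / gt_d g \<noteq> 0"
    using Re_one_plus_pos[OF gt_aut_factor_norm[OF z, of g]] by force
  then show ?thesis
    unfolding gt_log_aut_def exp_add[of "of_real (ln (cmod (gt_d g))) + \<i> * of_real (snd g)"] exp_ln_gt_d
    by (simp add: distrib_left)
qed

lemma Im_gt_log_aut:
  assumes "z \<in> disc"
  shows "\<bar>Im (gt_log_aut g z) - snd g\<bar> < pi / 2"
proof -
  have r: "0 < Re (1 + gt_c g * z / gt_d g)" by (rule Re_one_plus_pos[OF gt_aut_factor_norm[OF assms]])
  then have "1 + gt_c g * z / gt_d g \<noteq> 0" by force
  then show ?thesis using r Arg_Re_pos[of "1 + gt_c g * z / gt_d g"]
    by (simp add: gt_log_aut_def Arg_eq_Im_Ln)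
qed

text \<open>Both sides are logarithms of the same automorphy factor, and the bounds on the arguments leave
  no room for a multiple of \<open>2 \<pi>\<close>.\<close>

lemma gt_log_aut_mult:
  assumes z: "z \<in> disc"
  shows "gt_log_aut (gt_mult g h) z = gt_log_aut g (gt_act h z) + gt_log_aut h z"
proof -
  have hz: "gt_act h z \<in> disc" by (rule gt_act_disc[OF z])
  let ?e = "gt_c h * z + gt_d h"
  have e: "?e \<noteq> 0" by (rule gt_denom_nonzero[OF z])
  have "(gt_c g * gt_act h z + gt_d g) * ?e = gt_c (gt_mult g h) * z + gt_d (gt_mult g h)"
    using e by (simp add: gt_act_def gt_c_mult gt_d_mult field_simps)
  then have ex: "exp (gt_log_aut (gt_mult g h) z) = exp (gt_log_aut g (gt_act h z) + gt_log_aut h z)"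
    unfolding exp_add exp_gt_log_aut[OF z] exp_gt_log_aut[OF hz] by simp
  have s: "snd (gt_mult g h) = snd g + snd h + Arg (1 + gt_c g * gt_b h / (gt_d g * gt_d h))"
    by (simp add: gt_mult_def)
  have "\<bar>Im (gt_log_aut (gt_mult g h) z) - Im (gt_log_aut g (gt_act h z) + gt_log_aut h z)\<bar> < 2 * pi"
    using Im_gt_log_aut[OF z, of "gt_mult g h"] Im_gt_log_aut[OF z, of h] Im_gt_log_aut[OF hz, of g]
      Arg_factor[of g h] s unfolding plus_complex.sel by linarith
  then show ?thesis using exp_complex_eqI ex by blast
qed

lemma gt_log_aut_one: "gt_log_aut gt_one z = 0"
  by (simp add: gt_log_aut_def)

text \<open>With \<open>L = gt_log_aut g z\<close>, the lower triangular matrices with diagonal entries \<open>exp(- L)\<close>, \<open>exp L\<close> and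
  lower left entry \<open>c\<close> form a cocycle. The additivity of \<open>L\<close> is the diagonal part of this, and here is the lower
  left entry.\<close>

lemma gt_c_mult_aut:
  assumes z: "z \<in> disc"
  shows "gt_c (gt_mult g h) = gt_c h * exp (gt_log_aut g (gt_act h z)) + gt_c g * exp (- gt_log_aut h z)"
proof -
  have hz: "gt_act h z \<in> disc" by (rule gt_act_disc[OF z])
  let ?e = "gt_c h * z + gt_d h"
  have e: "?e \<noteq> 0" by (rule gt_denom_nonzero[OF z])
  have "gt_act h z * ?e = gt_a h * z + gt_b h" using e by (simp add: gt_act_def)
  moreover have "gt_c h * (gt_c g * w + gt_d g) * e = gt_c h * (gt_c g * (w * e) + gt_d g * e)" for w e
    by (simp add: algebra_simps)
  ultimately have "gt_c h * (gt_c g * gt_act h z + gt_d g) * ?e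
      = gt_c h * (gt_c g * (gt_a h * z + gt_b h) + gt_d g * ?e)" by metis
  then have "(gt_c h * (gt_c g * gt_act h z + gt_d g) + gt_c g / ?e) * ?e
      = gt_c h * (gt_c g * (gt_a h * z + gt_b h) + gt_d g * ?e) + gt_c g"
    using e by (simp add: distrib_right)
  also have "\<dots> = gt_c h * gt_c g * gt_a h * z + gt_c g * (gt_b h * gt_c h + 1) + gt_c h * gt_d g * ?e"
    by (simp add: algebra_simps)
  also have "gt_b h * gt_c h + 1 = gt_a h * gt_d h" using gt_det[of h] by (simp add: algebra_simps)
  also have "gt_c h * gt_c g * gt_a h * z + gt_c g * (gt_a h * gt_d h) + gt_c h * gt_d g * ?e
      = gt_c (gt_mult g h) * ?e"
    by (simp add: gt_c_mult algebra_simps)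
  finally have "gt_c h * (gt_c g * gt_act h z + gt_d g) + gt_c g / ?e = gt_c (gt_mult g h)"
    using e mult_right_cancel by blast
  then show ?thesis unfolding exp_minus exp_gt_log_aut[OF z] exp_gt_log_aut[OF hz] by (simp add: divide_inverse)
qed

lemma gt_act_transvection:
  assumes "z \<in> disc" shows "gt_act (gt_transvection z) 0 = z"
proof -
  have 1: "0 < 1 - (cmod z)\<^sup>2" using assms by (simp add: power_less_one_iff abs_square_less_1)
  have "(cmod (gt_b (gt_transvection z)))\<^sup>2 = (cmod z)\<^sup>2 / (1 - (cmod z)\<^sup>2)"
    using 1 by (simp add: gt_transvection_def gt_b_def norm_divide power_divide)
  then have "1 + (cmod (gt_b (gt_transvection z)))\<^sup>2 = 1 / (1 - (cmod z)\<^sup>2)"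
    using 1 by (simp add: field_simps)
  then have "gt_d (gt_transvection z) = of_real (1 / sqrt (1 - (cmod z)\<^sup>2))"
    by (simp add: gt_d_def gt_b_def gt_transvection_def real_sqrt_divide)
  then show ?thesis using 1 by (simp add: gt_act_0 gt_transvection_def gt_b_def)
qed

lemma gt_transvection_0: "gt_transvection 0 = gt_one"
  by (simp add: gt_transvection_def gt_one_def)

lemma gt_stabilizer:
  assumes "gt_act k 0 = 0" obtains t where "k = gt_exp_ih t"
proof
  have "fst k = 0" using assms by (simp add: gt_act_0 gt_b_def)
  then show "k = gt_exp_ih (- 2 * snd k)" by (simp add: gt_exp_ih_def prod_eq_iff)
qed

lemma gt_act_exp_ih [simp]: "gt_act (gt_exp_ih t) 0 = 0"
  by (simp add: gt_act_0)

text \<open>Constructions over a point \<open>z\<close> use the transvection that carries \<open>0\<close> to \<open>z\<close>; any other choice differs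
  from it by an element of the stabilizer on the right.\<close>

lemma gt_orbit_eq:
  assumes "gt_act g 0 = gt_act h 0" obtains t where "h = gt_mult g (gt_exp_ih t)"
proof -
  have "gt_act (gt_mult (gt_inv g) h) 0 = 0"
    by (simp add: gt_act_mult flip: assms) (simp add: gt_act_inv)
  then obtain t where "gt_mult (gt_inv g) h = gt_exp_ih t" using gt_stabilizer by blast
  then have "gt_mult g (gt_exp_ih t) = h"
    by (metis gt_mult_assoc gt_mult_inv_right gt_mult_one(1))
  then show ?thesis using that by blast
qed

lemma gt_log_aut_exp_ih: "gt_log_aut (gt_exp_ih t) z = - \<i> * of_real t / 2"
proof -
  have "gt_c (gt_exp_ih t) = 0" by (simp add: gt_c_def)
  then show ?thesis by (simp add: gt_log_aut_def) (simp add: gt_exp_ih_def)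
qed

lemma smooth_on_gt_c:
  assumes "open S" "smooth_on S (\<lambda>x. fst (g x))"
  shows "smooth_on S (\<lambda>x. gt_c (g x))" "smooth_on S (\<lambda>x. gt_b (g x))"
  using assms by (simp_all add: gt_c_def gt_b_def smooth_on_cnj)

text \<open>Since \<open>|d|\<^sup>2 = 1 + |b|\<^sup>2\<close>, the logarithm of the modulus of \<open>d\<close> is half of \<open>Ln (1 + b cnj b)\<close>, a
  holomorphic function of a smooth one.\<close>

lemma smooth_on_gt_d:
  assumes S: "open S" and b: "smooth_on S (\<lambda>x. fst (g x))" and t: "smooth_on S (\<lambda>x. complex_of_real (snd (g x)))"
  shows "smooth_on S (\<lambda>x. complex_of_real (ln (cmod (gt_d (g x)))))" "smooth_on S (\<lambda>x. gt_d (g x))"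
proof -
  have e: "complex_of_real (ln (cmod (gt_d (g x)))) = Ln (1 + fst (g x) * cnj (fst (g x))) / 2" for x
  proof -
    have p: "0 < 1 + (cmod (fst (g x)))\<^sup>2" by (simp add: add_pos_nonneg)
    have "ln (cmod (gt_d (g x))) = ln (1 + (cmod (fst (g x)))\<^sup>2) / 2"
      using p by (simp add: norm_gt_d gt_b_def ln_sqrt)
    also have "complex_of_real \<dots> = Ln (of_real (1 + (cmod (fst (g x)))\<^sup>2)) / 2"
      using p by (simp add: Ln_of_real del: of_real_add)
    finally show ?thesis by (simp flip: complex_norm_square)
  qed
  have p: "0 < Re (1 + fst (g x) * cnj (fst (g x)))" for x
    by (simp add: add_pos_nonneg)
  show 1: "smooth_on S (\<lambda>x. complex_of_real (ln (cmod (gt_d (g x)))))"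
    unfolding e
    by (intro smooth_on_divide[OF S] smooth_on_Ln[OF S] smooth_on_add[OF S] smooth_on_const[OF S]
        smooth_on_mult[OF S] b smooth_on_cnj[OF S] p) simp
  have "smooth_on S (\<lambda>x. exp (complex_of_real (ln (cmod (gt_d (g x)))) + \<i> * complex_of_real (snd (g x))))"
    by (intro smooth_intros S 1 t)
  then show "smooth_on S (\<lambda>x. gt_d (g x))" by (simp only: exp_ln_gt_d)
qed

lemma smooth_on_gt_log_aut:
  assumes S: "open S" and b: "smooth_on S (\<lambda>x. fst (g x))" and t: "smooth_on S (\<lambda>x. complex_of_real (snd (g x)))"
    and z: "smooth_on S z" "\<And>x. x \<in> S \<Longrightarrow> z x \<in> disc"
  shows "smooth_on S (\<lambda>x. gt_log_aut (g x) (z x))"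
  unfolding gt_log_aut_def
  by (intro smooth_intros S smooth_on_gt_d[OF S b t] smooth_on_gt_c[OF S b] t z(1))
    (auto intro!: Re_one_plus_pos gt_aut_factor_norm z(2) simp del: plus_complex.sel)

lemma smooth_on_fst: "open S \<Longrightarrow> smooth_on S fst"
  by (rule smooth_on_bounded_linear) (auto intro: bounded_linear_fst)

lemma smooth_on_snd: "open S \<Longrightarrow> smooth_on S (\<lambda>x. complex_of_real (snd x))"
  by (rule smooth_on_bounded_linear)
    (auto intro!: bounded_linear_compose[OF bounded_linear_of_real bounded_linear_snd])

lemma smooth_gt_act_0: "open S \<Longrightarrow> smooth_on S (\<lambda>g. gt_act g 0)"
  unfolding gt_act_0
  by (intro smooth_intros smooth_on_gt_c(2) smooth_on_gt_d(2) smooth_on_fst smooth_on_snd) auto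

lemma continuous_gt_act_0: "continuous_on UNIV (\<lambda>g. gt_act g 0)"
  using smooth_gt_act_0[OF open_UNIV] by (metis Ck_on.simps(1) smooth_on_def)

lemma open_gt_act_0: "open U \<Longrightarrow> open {g. gt_act g 0 \<in> U}"
  using open_vimage[OF _ continuous_gt_act_0] by (simp add: vimage_def)

section \<open>Linear algebra\<close>

lemma mat_adjoint_carrier [simp]: "A \<in> carrier_mat n m \<Longrightarrow> mat_adjoint A \<in> carrier_mat m n"
  by (auto simp: mat_adjoint_def mat_of_rows_def)

lemma mat_adjoint_index:
  "i < dim_col A \<Longrightarrow> j < dim_row A \<Longrightarrow> mat_adjoint A $$ (i, j) = cnj (A $$ (j, i))" for A :: "complex mat"
  by (simp add: mat_adjoint_def mat_of_rows_def)

lemma mat_adjoint_adjoint: "mat_adjoint (mat_adjoint A) = A" for A :: "complex mat"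
proof -
  have d: "dim_row (mat_adjoint A) = dim_col A" "dim_col (mat_adjoint A) = dim_row A"
    using carrier_matD[OF mat_adjoint_carrier[OF carrier_matI[OF refl refl], of A]] .
  have d2: "dim_row (mat_adjoint (mat_adjoint A)) = dim_row A" "dim_col (mat_adjoint (mat_adjoint A)) = dim_col A"
    using carrier_matD[OF mat_adjoint_carrier[OF carrier_matI[OF refl refl], of "mat_adjoint A"]] by (simp_all add: d)
  show ?thesis by (rule eq_matI) (simp_all add: mat_adjoint_index d d2)
qed

lemma cscalar_prod_sum: "dim_vec v = n \<Longrightarrow> u \<bullet>c v = (\<Sum>i<n. u $ i * cnj (v $ i))" for v :: "complex vec"
  by (simp add: scalar_prod_def atLeast0LessThan)

lemma mult_mat_vec_sum:
  "A \<in> carrier_mat n m \<Longrightarrow> v \<in> carrier_vec m \<Longrightarrow> i < n \<Longrightarrow> (A *\<^sub>v v) $ i = (\<Sum>j<m. A $$ (i, j) * v $ j)"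
  by (auto simp: scalar_prod_def atLeast0LessThan intro!: sum.cong)

lemma mult_mat_sum:
  "A \<in> carrier_mat n m \<Longrightarrow> B \<in> carrier_mat m k \<Longrightarrow> i < n \<Longrightarrow> j < k \<Longrightarrow>
    (A * B) $$ (i, j) = (\<Sum>q<m. A $$ (i, q) * B $$ (q, j))"
  by (auto simp: scalar_prod_def atLeast0LessThan intro!: sum.cong)

lemma cscalar_prod_adjoint:
  fixes A :: "complex mat"
  assumes A: "A \<in> carrier_mat n m" and u: "u \<in> carrier_vec m" and v: "v \<in> carrier_vec n"
  shows "(A *\<^sub>v u) \<bullet>c v = u \<bullet>c (mat_adjoint A *\<^sub>v v)"
proof -
  have A': "mat_adjoint A \<in> carrier_mat m n" using A by simp
  have "(A *\<^sub>v u) \<bullet>c v = (\<Sum>i<n. \<Sum>j<m. A $$ (i, j) * u $ j * cnj (v $ i))"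
    using v by (subst cscalar_prod_sum[of _ n]) (auto simp: mult_mat_vec_sum[OF A u] sum_distrib_right)
  also have "\<dots> = (\<Sum>j<m. \<Sum>i<n. A $$ (i, j) * u $ j * cnj (v $ i))"
    by (rule sum.swap)
  also have "\<dots> = (\<Sum>j<m. u $ j * cnj (\<Sum>i<n. mat_adjoint A $$ (j, i) * v $ i))"
    using A by (auto intro!: sum.cong simp: sum_distrib_left mat_adjoint_index)
  also have "\<dots> = u \<bullet>c (mat_adjoint A *\<^sub>v v)"
    using A' v by (subst cscalar_prod_sum[of _ m]) (auto simp: mult_mat_vec_sum[OF A' v] simp del: index_mult_mat_vec)
  finally show ?thesis .
qed

lemma mult_mat_unit_vec:
  "A \<in> carrier_mat n m \<Longrightarrow> j < m \<Longrightarrow> A *\<^sub>v unit_vec m j = col A j" for A :: "'a::comm_semiring_1 mat"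
  by (rule eq_vecI) (auto simp: scalar_prod_right_unit)

lemma mat_eqI_mult_vec:
  fixes A :: "'a::comm_semiring_1 mat"
  assumes A: "A \<in> carrier_mat n m" "B \<in> carrier_mat n m"
    and e: "\<And>v. v \<in> carrier_vec m \<Longrightarrow> A *\<^sub>v v = B *\<^sub>v v"
  shows "A = B"
proof (rule eq_matI)
  fix i j assume "i < dim_row B" "j < dim_col B"
  then have ij: "i < n" "j < m" using A by auto
  have "(M *\<^sub>v unit_vec m j) $ i = M $$ (i, j)" if "M \<in> carrier_mat n m" for M :: "'a mat"
    using that ij by (auto simp: scalar_prod_right_unit)
  then show "A $$ (i, j) = B $$ (i, j)" using e[of "unit_vec m j"] A by (metis unit_vec_carrier)
qed (use A in auto)

lemma cscalar_prod_self_pos: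
  fixes v :: "complex vec"
  assumes "v \<in> carrier_vec n"
  shows "0 \<le> Re (v \<bullet>c v)" "v \<noteq> 0\<^sub>v n \<Longrightarrow> 0 < Re (v \<bullet>c v)"
proof -
  have e: "Re (v \<bullet>c v) = (\<Sum>i<n. (cmod (v $ i))\<^sup>2)"
    using assms by (subst cscalar_prod_sum[of _ n]) (auto simp: cmod_sq)
  show "0 \<le> Re (v \<bullet>c v)" unfolding e by (auto intro: sum_nonneg)
  assume "v \<noteq> 0\<^sub>v n"
  then obtain i where "i < n" "v $ i \<noteq> 0" using assms by (metis carrier_vecD eq_vecI index_zero_vec)
  then show "0 < Re (v \<bullet>c v)" unfolding e by (intro sum_pos2[of _ i]) auto
qed

text \<open>Charts express holomorphy only through frames. Expanding in unit vectors transfers it to other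
  sections and to bundle maps.\<close>

lemma linear_functional_sum:
  fixes f :: "complex vec \<Rightarrow> complex"
  assumes add: "\<And>u v. u \<in> carrier_vec n \<Longrightarrow> v \<in> carrier_vec n \<Longrightarrow> f (u + v) = f u + f v"
    and sc: "\<And>c u. u \<in> carrier_vec n \<Longrightarrow> f (c \<cdot>\<^sub>v u) = c * f u"
    and v: "v \<in> carrier_vec n"
  shows "f v = (\<Sum>j<n. v $ j * f (unit_vec n j))"
proof -
  have "\<forall>v\<in>carrier_vec n. (\<forall>i<n. k \<le> i \<longrightarrow> v $ i = 0) \<longrightarrow> f v = (\<Sum>j<k. v $ j * f (unit_vec n j))" if "k \<le> n" for k
    using that
  proof (induction k)
    case 0
    have "f v = 0" if "v \<in> carrier_vec n" "\<forall>i<n. v $ i = 0" for v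
    proof -
      have "v = 0 \<cdot>\<^sub>v v" using that by (intro eq_vecI) auto
      then show ?thesis using sc[OF that(1), of 0] by simp
    qed
    then show ?case by simp
  next
    case (Suc k)
    show ?case
    proof (intro ballI impI)
      fix v :: "complex vec" assume v: "v \<in> carrier_vec n" and z: "\<forall>i<n. Suc k \<le> i \<longrightarrow> v $ i = 0"
      define w :: "complex vec" where "w = vec n (\<lambda>i. if i = k then 0 else v $ i)"
      have w: "w \<in> carrier_vec n" by (simp add: w_def)
      have e: "v = w + v $ k \<cdot>\<^sub>v unit_vec n k"
        using v Suc.prems by (intro eq_vecI) (auto simp: w_def unit_vec_def)
      have "\<forall>i<n. k \<le> i \<longrightarrow> w $ i = 0" using z by (auto simp: w_def)
      then have "f w = (\<Sum>j<k. w $ j * f (unit_vec n j))" using Suc.IH[OF Suc_leD[OF Suc.prems]] w by blast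
      also have "\<dots> = (\<Sum>j<k. v $ j * f (unit_vec n j))" using Suc.prems by (auto simp: w_def intro!: sum.cong)
      finally have "f w = (\<Sum>j<k. v $ j * f (unit_vec n j))" .
      moreover have "f v = f w + f (v $ k \<cdot>\<^sub>v unit_vec n k)" using add[OF w, of "v $ k \<cdot>\<^sub>v unit_vec n k"] e by simp
      moreover have "f (v $ k \<cdot>\<^sub>v unit_vec n k) = v $ k * f (unit_vec n k)" by (rule sc) simp
      ultimately show "f v = (\<Sum>j<Suc k. v $ j * f (unit_vec n j))" by simp
    qed
  qed
  from this[OF order_refl] v show ?thesis by (metis not_le)
qed

lemma linear_map_matrix:
  fixes L :: "complex vec \<Rightarrow> complex vec"
  assumes L: "\<And>u. u \<in> carrier_vec n \<Longrightarrow> L u \<in> carrier_vec m"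
    and add: "\<And>u v. u \<in> carrier_vec n \<Longrightarrow> v \<in> carrier_vec n \<Longrightarrow> L (u + v) = L u + L v"
    and sc: "\<And>c u. u \<in> carrier_vec n \<Longrightarrow> L (c \<cdot>\<^sub>v u) = c \<cdot>\<^sub>v L u"
  obtains M where "M \<in> carrier_mat m n" "\<And>v. v \<in> carrier_vec n \<Longrightarrow> L v = M *\<^sub>v v"
proof
  let ?M = "mat m n (\<lambda>(i, j). L (unit_vec n j) $ i)"
  show M: "?M \<in> carrier_mat m n" by simp
  fix v :: "complex vec" assume v: "v \<in> carrier_vec n"
  show "L v = ?M *\<^sub>v v"
  proof (rule eq_vecI)
    fix i assume "i < dim_vec (?M *\<^sub>v v)"
    then have i: "i < m" by simp
    have "L v $ i = (\<Sum>j<n. v $ j * L (unit_vec n j) $ i)"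
    proof (rule linear_functional_sum[OF _ _ v])
      fix u w :: "complex vec" assume uw: "u \<in> carrier_vec n" "w \<in> carrier_vec n"
      show "L (u + w) $ i = L u $ i + L w $ i" using add[OF uw] L[OF uw(2)] i by simp
    next
      fix c and u :: "complex vec" assume u: "u \<in> carrier_vec n"
      show "L (c \<cdot>\<^sub>v u) $ i = c * L u $ i" using sc[OF u] L[OF u] i by simp
    qed
    then show "L v $ i = (?M *\<^sub>v v) $ i"
      using i by (simp add: mult_mat_vec_sum[OF M v i] mult.commute)
  qed (use L[OF v] in simp)
qed

text \<open>Hermitian inner products on the coordinate space, linear in the first argument.\<close>

definition inner_form :: "nat \<Rightarrow> (complex vec \<Rightarrow> complex vec \<Rightarrow> complex) \<Rightarrow> bool" where
  "inner_form n h \<longleftrightarrow> (\<forall>u\<in>carrier_vec n. \<forall>v\<in>carrier_vec n.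
       (\<forall>w\<in>carrier_vec n. h (u + v) w = h u w + h v w)
     \<and> (\<forall>c. h (c \<cdot>\<^sub>v u) v = c * h u v) \<and> h v u = cnj (h u v))
   \<and> (\<forall>u\<in>carrier_vec n. u \<noteq> 0\<^sub>v n \<longrightarrow> 0 < Re (h u u))"

lemma inner_formD:
  assumes "inner_form n h" "u \<in> carrier_vec n" "v \<in> carrier_vec n"
  shows "w \<in> carrier_vec n \<Longrightarrow> h (u + v) w = h u w + h v w" "h (c \<cdot>\<^sub>v u) v = c * h u v"
    "h v u = cnj (h u v)" "u \<noteq> 0\<^sub>v n \<Longrightarrow> 0 < Re (h u u)"
    "w \<in> carrier_vec n \<Longrightarrow> h w (u + v) = h w u + h w v" "h v (c \<cdot>\<^sub>v u) = cnj c * h v u"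
proof -
  note a = assms[unfolded inner_form_def]
  show 1: "h (u + v) w = h u w + h v w" if "w \<in> carrier_vec n" for w using a that by blast
  show 2: "h (c \<cdot>\<^sub>v u) v = c * h u v" for c using a by blast
  show 3: "h v u = cnj (h u v)" using a by blast
  show "u \<noteq> 0\<^sub>v n \<Longrightarrow> 0 < Re (h u u)" using a by blast
  have s: "h x y = cnj (h y x)" if "x \<in> carrier_vec n" "y \<in> carrier_vec n" for x y
    using a that by blast
  show "h w (u + v) = h w u + h w v" if "w \<in> carrier_vec n" for w
    using s[of w "u + v"] s[of w u] s[of w v] that assms 1[OF that] by simp
  show "h v (c \<cdot>\<^sub>v u) = cnj c * h v u" for c
    using s[of v "c \<cdot>\<^sub>v u"] s[of v u] assms 2 by simp
qed

lemma inner_form_cscalar: "inner_form n (\<lambda>u v. u \<bullet>c v)"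
  unfolding inner_form_def
proof (intro conjI ballI impI allI)
  fix u v :: "complex vec" assume u: "u \<in> carrier_vec n" and v: "v \<in> carrier_vec n"
  show "v \<bullet>c u = cnj (u \<bullet>c v)"
    using u v by (simp add: cscalar_prod_sum[of _ n] mult.commute)
  show "(c \<cdot>\<^sub>v u) \<bullet>c v = c * (u \<bullet>c v)" for c
    using u v by (simp add: cscalar_prod_sum[of _ n] sum_distrib_left mult.assoc)
  show "(u + v) \<bullet>c w = u \<bullet>c w + v \<bullet>c w" if "w \<in> carrier_vec n" for w
    using u v that by (simp add: cscalar_prod_sum[of _ n] sum.distrib distrib_right)
qed (rule cscalar_prod_self_pos)

lemma inner_form_zero:
  assumes "inner_form n h" "v \<in> carrier_vec n"
  shows "h (0\<^sub>v n) v = 0" "h v (0\<^sub>v n) = 0"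
proof -
  have "0 \<cdot>\<^sub>v 0\<^sub>v n = (0\<^sub>v n :: complex vec)" by (intro eq_vecI) auto
  then show "h (0\<^sub>v n) v = 0" "h v (0\<^sub>v n) = 0"
    using inner_formD(2,6)[OF assms(1) zero_carrier_vec assms(2), of 0] by simp_all
qed

lemma inner_form_self_Re:
  assumes "inner_form n h" "u \<in> carrier_vec n"
  shows "h u u = of_real (Re (h u u))"
  using inner_formD(3)[OF assms(1,2,2)] by (simp add: complex_eq_iff)

lemma inner_form_comp:
  assumes h: "inner_form n h" and P: "P \<in> carrier_mat n n" "P' \<in> carrier_mat n n" "P' * P = 1\<^sub>m n"
  shows "inner_form n (\<lambda>u v. h (P *\<^sub>v u) (P *\<^sub>v v))"
  unfolding inner_form_def
proof (intro conjI ballI impI allI)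
  fix u v :: "complex vec" assume u: "u \<in> carrier_vec n" and v: "v \<in> carrier_vec n"
  show "h (P *\<^sub>v (u + v)) (P *\<^sub>v w) = h (P *\<^sub>v u) (P *\<^sub>v w) + h (P *\<^sub>v v) (P *\<^sub>v w)"
    if "w \<in> carrier_vec n" for w
    using u v that P by (simp add: mult_add_distrib_mat_vec[of P n n] inner_formD(1)[OF h])
  show "h (P *\<^sub>v (c \<cdot>\<^sub>v u)) (P *\<^sub>v v) = c * h (P *\<^sub>v u) (P *\<^sub>v v)" for c
    using u v P by (simp add: mult_mat_vec[of P n n] inner_formD(2)[OF h])
  show "h (P *\<^sub>v v) (P *\<^sub>v u) = cnj (h (P *\<^sub>v u) (P *\<^sub>v v))"
    using u v P by (intro inner_formD(3)[OF h]) auto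
next
  fix u :: "complex vec" assume u: "u \<in> carrier_vec n" "u \<noteq> 0\<^sub>v n"
  have "P *\<^sub>v u \<noteq> 0\<^sub>v n"
  proof
    assume "P *\<^sub>v u = 0\<^sub>v n"
    then have "P' *\<^sub>v (P *\<^sub>v u) = 0\<^sub>v n" using P by (auto intro!: eq_vecI)
    then show False using P u by (simp flip: assoc_mult_mat_vec)
  qed
  then show "0 < Re (h (P *\<^sub>v u) (P *\<^sub>v u))" using P u by (intro inner_formD(4)[OF h]) auto
qed

definition initial_span :: "nat \<Rightarrow> nat \<Rightarrow> complex vec set" where
  "initial_span n k = {v \<in> carrier_vec n. \<forall>i<n. k \<le> i \<longrightarrow> v $ i = 0}"

text \<open>Vectors whose expansion is triangular with nonzero diagonal span the same flag as the unit
  vectors, so orthogonality to the former implies orthogonality to the latter.\<close>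

lemma orthogonal_to_initial_span:
  assumes h: "inner_form n h" and y: "y \<in> carrier_vec n"
  shows "k \<le> n \<Longrightarrow> (\<And>j. j < k \<Longrightarrow> w j \<in> initial_span n (Suc j) \<and> w j $ j \<noteq> 0 \<and> h (w j) y = 0) \<Longrightarrow>
    x \<in> initial_span n k \<Longrightarrow> h x y = 0"
proof (induction k arbitrary: x)
  case 0
  then have "x = 0\<^sub>v n" by (auto simp: initial_span_def)
  then show ?case using inner_form_zero[OF h y] by simp
next
  case (Suc k)
  have w: "w k \<in> carrier_vec n" "\<And>i. i < n \<Longrightarrow> k < i \<Longrightarrow> w k $ i = 0" "w k $ k \<noteq> 0" "h (w k) y = 0"
    using Suc.prems(2)[of k] by (auto simp: initial_span_def)
  have x: "x \<in> carrier_vec n" "\<And>i. i < n \<Longrightarrow> k < i \<Longrightarrow> x $ i = 0"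
    using Suc.prems(3) by (auto simp: initial_span_def)
  let ?c = "x $ k / w k $ k"
  let ?x = "x + (- ?c) \<cdot>\<^sub>v w k"
  have "?x \<in> initial_span n k"
    unfolding initial_span_def using w x Suc.prems(1) by (auto simp: le_less)
  then have "h ?x y = 0" using Suc by auto
  moreover have "h ?x y = h x y + (- ?c) * h (w k) y"
    using inner_formD(1)[OF h x(1) smult_carrier_vec[THEN iffD2, OF w(1)] y]
      inner_formD(2)[OF h w(1) y] by simp
  ultimately show ?case using w by simp
qed

text \<open>Gram-Schmidt, keeping track of the flag.\<close>

lemma triangular_orthonormal_basis:
  assumes h: "inner_form n h"
  shows "k \<le> n \<Longrightarrow> \<exists>w. (\<forall>j<k. w j \<in> initial_span n (Suc j) \<and> w j $ j \<noteq> 0)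
    \<and> (\<forall>i<k. \<forall>j<k. h (w i) (w j) = (if i = j then 1 else 0))
    \<and> (\<forall>j<k. \<forall>x\<in>initial_span n j. h x (w j) = 0)"
proof (induction k)
  case (Suc k)
  then obtain w where w: "\<And>j. j < k \<Longrightarrow> w j \<in> initial_span n (Suc j) \<and> w j $ j \<noteq> 0"
    and on: "\<And>i j. i < k \<Longrightarrow> j < k \<Longrightarrow> h (w i) (w j) = (if i = j then 1 else 0)"
    and fl: "\<And>j x. j < k \<Longrightarrow> x \<in> initial_span n j \<Longrightarrow> h x (w j) = 0"
    by (metis Suc_leD)
  have wc: "w j \<in> carrier_vec n" if "j < k" for j using w[OF that] by (simp add: initial_span_def)
  \<comment> \<open>The components along the earlier vectors are subtracted one at a time; the entry at \<open>k\<close> stays \<open>1\<close>.\<close>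
  have "\<exists>u\<in>initial_span n (Suc k). u $ k = 1 \<and> (\<forall>j<l. h u (w j) = 0)" if "l \<le> k" for l
    using that
  proof (induction l)
    case 0
    show ?case using Suc.prems by (intro bexI[of _ "unit_vec n k"]) (auto simp: initial_span_def unit_vec_def)
  next
    case (Suc l)
    then obtain u where u: "u \<in> initial_span n (Suc k)" "u $ k = 1" "\<And>j. j < l \<Longrightarrow> h u (w j) = 0"
      by auto
    have l: "l < k" using Suc.prems by simp
    have uc: "u \<in> carrier_vec n" using u(1) by (simp add: initial_span_def)
    let ?u = "u + (- h u (w l)) \<cdot>\<^sub>v w l"
    have hu: "h ?u (w j) = h u (w j) - h u (w l) * h (w l) (w j)" if "j < k" for j
      using inner_formD(1)[OF h uc smult_carrier_vec[THEN iffD2, OF wc[OF l]] wc[OF that]]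
        inner_formD(2)[OF h wc[OF l] wc[OF that]] by simp
    have "?u \<in> initial_span n (Suc k)" "?u $ k = 1"
      using u(1,2) w[OF l] l \<open>Suc k \<le> n\<close> uc wc[OF l] by (auto simp: initial_span_def)
    moreover have "h ?u (w j) = 0" if "j < Suc l" for j
      using hu[of j] that l u(3)[of j] on[of l j] by (cases "j = l") auto
    ultimately show ?case by blast
  qed
  from this[of k] obtain u where u: "u \<in> initial_span n (Suc k)" "u $ k = 1" "\<And>j. j < k \<Longrightarrow> h u (w j) = 0"
    by auto
  have uc: "u \<in> carrier_vec n" using u(1) by (simp add: initial_span_def)
  have "u \<noteq> 0\<^sub>v n" using u(2) Suc.prems by auto
  then have pos: "0 < Re (h u u)" by (rule inner_formD(4)[OF h uc uc])
  let ?c = "complex_of_real (1 / sqrt (Re (h u u)))"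
  let ?v = "?c \<cdot>\<^sub>v u"
  have vc: "?v \<in> carrier_vec n" using uc by simp
  have hv: "h x ?v = ?c * h x u" "h ?v x = ?c * h u x" if "x \<in> carrier_vec n" for x
    using inner_formD(6)[OF h uc that] inner_formD(2)[OF h uc that] by simp_all
  have "h ?v ?v = ?c * ?c * h u u" using hv(1)[OF vc] hv(2)[OF uc] by simp
  also have "\<dots> = of_real (1 / sqrt (Re (h u u)) * (1 / sqrt (Re (h u u))) * Re (h u u))"
    using inner_form_self_Re[OF h uc] by (metis of_real_mult)
  also have "\<dots> = 1" using pos by (simp add: field_simps)
  finally have vv: "h ?v ?v = 1" .
  have wu: "h (w j) u = 0" if "j < k" for j
    using u(3)[OF that] inner_formD(3)[OF h uc wc[OF that]] by simp
  have "h x u = 0" if "x \<in> initial_span n k" for x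
    by (rule orthogonal_to_initial_span[OF h uc _ _ that, of w]) (use w wu Suc.prems in auto)
  then have vf: "h x ?v = 0" if "x \<in> initial_span n k" for x
    using hv(1)[of x] that by (simp add: initial_span_def)
  have vt: "?v \<in> initial_span n (Suc k)" "?v $ k \<noteq> 0"
    using u uc Suc.prems pos by (auto simp: initial_span_def)
  show ?case
  proof (intro exI[of _ "w(k := ?v)"] conjI allI impI ballI)
    fix i j assume ij: "i < Suc k" "j < Suc k"
    consider "i < k" "j < k" | "i = k" "j < k" | "i < k" "j = k" | "i = k" "j = k" using ij by linarith
    then show "h ((w(k := ?v)) i) ((w(k := ?v)) j) = (if i = j then 1 else 0)"
      by cases (use on vv hv wu u(3) wc in auto)
  qed (use w vt fl vf in \<open>auto simp: less_Suc_eq\<close>)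
qed simp

lemma mat_inverse_of_mult:
  fixes A B :: "complex mat"
  assumes "A \<in> carrier_mat n n" "B \<in> carrier_mat n n" "A * B = 1\<^sub>m n"
  shows "the (mat_inverse A) = B"
proof (cases "mat_inverse A")
  case None
  have "B * A = 1\<^sub>m n" using mat_mult_left_right_inverse assms by blast
  then have "A \<in> Units (ring_mat TYPE(complex) n ())"
    using assms by (auto simp: Units_def ring_mat_def)
  then show ?thesis using mat_inverse(1)[OF assms(1) None, of "()"] by blast
next
  case (Some C)
  then have C: "A * C = 1\<^sub>m n" "C * A = 1\<^sub>m n" "C \<in> carrier_mat n n" using mat_inverse(2)[OF assms(1) Some] by auto
  have "C = C * (A * B)" using assms C by simp
  also have "\<dots> = B" using assms C by (subst assoc_mult_mat[symmetric, of _ n n _ n _ n]) auto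
  finally show ?thesis using Some by simp
qed

text \<open>Orthonormalizing a Schur basis with respect to the form does not change its flag; the matrix in
  the new basis is triangular and Hermitian, so it is diagonal, with the eigenvalues in the prescribed order.\<close>

lemma self_adjoint_diagonalization:
  assumes h: "inner_form n h" and A: "A \<in> carrier_mat n n"
    and sa: "\<And>u v. u \<in> carrier_vec n \<Longrightarrow> v \<in> carrier_vec n \<Longrightarrow> h (A *\<^sub>v u) v = h u (A *\<^sub>v v)"
    and cp: "char_poly A = (\<Prod>a\<leftarrow>es. [:- a, 1:])"
  obtains B Q where "B \<in> carrier_mat n n" "Q \<in> carrier_mat n n" "B * Q = 1\<^sub>m n" "Q * B = 1\<^sub>m n"
    "\<And>u v. u \<in> carrier_vec n \<Longrightarrow> v \<in> carrier_vec n \<Longrightarrow> h (Q *\<^sub>v u) (Q *\<^sub>v v) = u \<bullet>c v"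
    "B * A * Q = mat n n (\<lambda>(i, j). if i = j then es ! i else 0)"
proof -
  obtain U P P' where sd: "schur_decomposition A es = (U, P, P')" by (cases "schur_decomposition A es")
  from schur_decomposition[OF A cp sd]
  have sim: "similar_mat_wit A U P P'" and ut: "upper_triangular U" and dg: "diag_mat U = es" by auto
  have U: "U \<in> carrier_mat n n" and P: "P \<in> carrier_mat n n" and P': "P' \<in> carrier_mat n n"
    and PP: "P * P' = 1\<^sub>m n" "P' * P = 1\<^sub>m n" and AU: "A = P * U * P'"
    using similar_mat_witD2[OF A sim] by auto
  \<comment> \<open>In the Schur coordinates the matrix is \<open>U\<close> and the form is \<open>h'\<close>.\<close>
  define h' where "h' u v = h (P *\<^sub>v u) (P *\<^sub>v v)" for u v
  have h': "inner_form n h'" unfolding h'_def by (rule inner_form_comp[OF h P P' PP(2)])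
  obtain w where w: "\<And>j. j < n \<Longrightarrow> w j \<in> initial_span n (Suc j) \<and> w j $ j \<noteq> 0"
    and on: "\<And>i j. i < n \<Longrightarrow> j < n \<Longrightarrow> h' (w i) (w j) = (if i = j then 1 else 0)"
    and fl: "\<And>j x. j < n \<Longrightarrow> x \<in> initial_span n j \<Longrightarrow> h' x (w j) = 0"
    using triangular_orthonormal_basis[OF h' order_refl] by metis
  have wc: "w j \<in> carrier_vec n" if "j < n" for j using w[OF that] by (simp add: initial_span_def)
  define q where "q j = P *\<^sub>v w j" for j
  have qc: "q j \<in> carrier_vec n" if "j < n" for j using P wc[OF that] by (simp add: q_def)
  \<comment> \<open>\<open>B\<close> takes coefficients in the orthonormal basis \<open>q\<close>, so it inverts the matrix \<open>Q\<close> with the columns \<open>q j\<close>.\<close>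
  define Q where "Q = mat n n (\<lambda>(i, j). q j $ i)"
  define B where "B = mat n n (\<lambda>(i, j). h (unit_vec n j) (q i))"
  have Q: "Q \<in> carrier_mat n n" and B: "B \<in> carrier_mat n n" by (simp_all add: Q_def B_def)
  have Bv: "(B *\<^sub>v v) $ i = h v (q i)" if "v \<in> carrier_vec n" "i < n" for v i
  proof -
    have "h v (q i) = (\<Sum>j<n. v $ j * h (unit_vec n j) (q i))"
      by (rule linear_functional_sum[OF _ _ that(1)]) (use inner_formD(1,2)[OF h _ _ ] qc[OF that(2)] in auto)
    then show ?thesis using that(2) by (subst mult_mat_vec_sum[OF B that]) (simp add: B_def mult.commute)
  qed
  have Qe: "col Q j = q j" if "j < n" for j
    using that qc[OF that] by (intro eq_vecI) (auto simp: Q_def)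
  have qq: "h (q i) (q j) = (if i = j then 1 else 0)" if "i < n" "j < n" for i j
    using on[OF that] by (simp add: h'_def q_def)
  have BQ: "B * Q = 1\<^sub>m n"
  proof (rule eq_matI)
    fix i j assume "i < dim_row (1\<^sub>m n)" "j < dim_col (1\<^sub>m n)"
    then have ij: "i < n" "j < n" by auto
    have "(B * Q) $$ (i, j) = (B *\<^sub>v col Q j) $ i" using ij B Q by simp
    also have "\<dots> = h (q j) (q i)" using Bv[OF qc[OF ij(2)] ij(1)] Qe[OF ij(2)] by simp
    finally show "(B * Q) $$ (i, j) = 1\<^sub>m n $$ (i, j)" using qq ij by auto
  qed (use B Q in auto)
  have QB: "Q * B = 1\<^sub>m n" using mat_mult_left_right_inverse[OF B Q BQ] .
  have Aq: "A *\<^sub>v q j = P *\<^sub>v (U *\<^sub>v w j)" if "j < n" for j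
  proof -
    have "A *\<^sub>v q j = (A * P) *\<^sub>v w j" unfolding q_def using A P wc[OF that] by simp
    also have "A * P = P * U * (P' * P)" unfolding AU using P U P' by (simp add: assoc_mult_mat[of _ n n _ n _ n])
    also have "\<dots> *\<^sub>v w j = P *\<^sub>v (U *\<^sub>v w j)" using P U wc[OF that] PP by simp
    finally show ?thesis .
  qed
  \<comment> \<open>Modulo the previous step of the flag, \<open>U\<close> multiplies \<open>w j\<close> by its diagonal entry.\<close>
  have Uw: "U *\<^sub>v w j + (- (U $$ (j, j))) \<cdot>\<^sub>v w j \<in> initial_span n j" if j: "j < n" for j
  proof -
    have "(U *\<^sub>v w j) $ i = U $$ (i, j) * w j $ j" if "j \<le> i" "i < n" for i
    proof -
      have "(U *\<^sub>v w j) $ i = (\<Sum>k<n. U $$ (i, k) * w j $ k)" by (rule mult_mat_vec_sum[OF U wc[OF j] that(2)])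
      also have "\<dots> = (\<Sum>k<n. if k = j then U $$ (i, j) * w j $ j else 0)"
      proof (rule sum.cong)
        fix k assume "k \<in> {..<n}"
        moreover have "U $$ (i, k) = 0" if "k < j" using ut U \<open>j \<le> i\<close> \<open>i < n\<close> that by (auto simp: upper_triangular_def)
        moreover have "w j $ k = 0" if "j < k" "k < n" using w[OF j] that by (auto simp: initial_span_def)
        ultimately show "U $$ (i, k) * w j $ k = (if k = j then U $$ (i, j) * w j $ j else 0)"
          by (cases k j rule: linorder_cases) auto
      qed simp
      finally show ?thesis using j by simp
    qed
    moreover have "U $$ (i, j) = 0" "w j $ i = 0" if "j < i" "i < n" for i
      using ut U that w[OF j] by (auto simp: upper_triangular_def initial_span_def)
    ultimately show ?thesis using U wc[OF j] by (auto simp: initial_span_def le_less)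
  qed
  have D: "h (A *\<^sub>v q j) (q i) = h' (U *\<^sub>v w j) (w i)" if "i < n" "j < n" for i j
    using Aq[OF that(2)] by (simp add: h'_def q_def)
  have Dij: "h (A *\<^sub>v q j) (q i) = (if i = j then es ! i else 0)" if "j \<le> i" "i < n" for i j
  proof -
    have j: "j < n" using that by simp
    let ?x = "U *\<^sub>v w j + (- (U $$ (j, j))) \<cdot>\<^sub>v w j"
    have c: "U *\<^sub>v w j \<in> carrier_vec n" "(- (U $$ (j, j))) \<cdot>\<^sub>v w j \<in> carrier_vec n" using U wc[OF j] by auto
    have "?x \<in> initial_span n i" using Uw[OF j] that(1) by (auto simp: initial_span_def)
    then have "h' ?x (w i) = 0" by (rule fl[OF that(2)])
    moreover have "h' ?x (w i) = h' (U *\<^sub>v w j) (w i) - U $$ (j, j) * h' (w j) (w i)"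
      using inner_formD(1)[OF h' c wc[OF that(2)]] inner_formD(2)[OF h' wc[OF j] wc[OF that(2)]] by simp
    moreover have "U $$ (j, j) = es ! j" using dg U j by (auto simp: diag_mat_def)
    ultimately show ?thesis using D[OF that(2) j] on[OF j that(2)] by auto
  qed
  \<comment> \<open>The entries above the diagonal follow from those below it.\<close>
  have sym: "h (A *\<^sub>v q j) (q i) = cnj (h (A *\<^sub>v q i) (q j))" if "i < n" "j < n" for i j
    using sa[OF qc[OF that(2)] qc[OF that(1)]] inner_formD(3)[OF h, of "A *\<^sub>v q i" "q j"] A qc that by auto
  have BAQ: "(B * A * Q) $$ (i, j) = h (A *\<^sub>v q j) (q i)" if "i < n" "j < n" for i j
  proof -
    have "(B * A * Q) $$ (i, j) = (B * (A * Q)) $$ (i, j)" by (simp only: assoc_mult_mat[OF B A Q])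
    also have "\<dots> = row B i \<bullet> col (A * Q) j" using that A B Q by (intro index_mult_mat(1)) auto
    also have "\<dots> = (B *\<^sub>v (A *\<^sub>v col Q j)) $ i"
      using that B by (simp only: col_mult2[OF A Q that(2)]) simp
    finally have "(B * A * Q) $$ (i, j) = (B *\<^sub>v (A *\<^sub>v col Q j)) $ i" .
    then show ?thesis using Bv[of "A *\<^sub>v q j" i] Qe[OF that(2)] that A qc by auto
  qed
  have diag: "B * A * Q = mat n n (\<lambda>(i, j). if i = j then es ! i else 0)"
  proof (rule eq_matI)
    fix i j assume "i < dim_row (mat n n (\<lambda>(i, j). if i = j then es ! i else 0))"
      "j < dim_col (mat n n (\<lambda>(i, j). if i = j then es ! i else 0))"
    then have ij: "i < n" "j < n" by auto
    then show "(B * A * Q) $$ (i, j) = mat n n (\<lambda>(i, j). if i = j then es ! i else 0) $$ (i, j)"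
      using BAQ[OF ij] Dij[of j i] Dij[of i j] sym[OF ij] by (cases "j \<le> i") auto
  qed (use B Q A in auto)
  have iso: "h (Q *\<^sub>v u) (Q *\<^sub>v v) = u \<bullet>c v" if u: "u \<in> carrier_vec n" and v: "v \<in> carrier_vec n" for u v
  proof -
    have Qc: "Q *\<^sub>v u \<in> carrier_vec n" "Q *\<^sub>v v \<in> carrier_vec n" using Q u v by auto
    have Qu: "Q *\<^sub>v unit_vec n j = q j" if "j < n" for j
      using Qe[OF that] mult_mat_unit_vec[OF Q that] by simp
    have "h (Q *\<^sub>v u) y = (\<Sum>j<n. u $ j * h (q j) y)" if y: "y \<in> carrier_vec n" for y
    proof -
      have "h (Q *\<^sub>v u) y = (\<Sum>j<n. u $ j * h (Q *\<^sub>v unit_vec n j) y)"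
      proof (rule linear_functional_sum[of n "\<lambda>u. h (Q *\<^sub>v u) y", OF _ _ u])
        fix a b :: "complex vec" assume ab: "a \<in> carrier_vec n" "b \<in> carrier_vec n"
        then show "h (Q *\<^sub>v (a + b)) y = h (Q *\<^sub>v a) y + h (Q *\<^sub>v b) y"
          using Q y by (simp add: mult_add_distrib_mat_vec[of Q n n] inner_formD(1)[OF h])
        show "h (Q *\<^sub>v (c \<cdot>\<^sub>v a)) y = c * h (Q *\<^sub>v a) y" for c
          using Q y ab by (simp add: mult_mat_vec[of Q n n] inner_formD(2)[OF h])
      qed
      then show ?thesis using Qu by simp
    qed
    note ex = this
    have "h (q j) (Q *\<^sub>v v) = cnj (v $ j)" if j: "j < n" for j
    proof -
      have "(B *\<^sub>v (Q *\<^sub>v v)) $ j = v $ j"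
        using B Q v BQ by (simp flip: assoc_mult_mat_vec)
      then have "h (Q *\<^sub>v v) (q j) = v $ j" using Bv[OF Qc(2) j] by simp
      then show ?thesis using inner_formD(3)[OF h Qc(2) qc[OF j]] by simp
    qed
    then show ?thesis using ex[OF Qc(2)] v by (simp add: cscalar_prod_sum[of v n])
  qed
  show ?thesis by (rule that[OF B Q BQ QB iso diag])
qed

section \<open>Block matrices and the factors of automorphy\<close>

lemma blk_start_Suc: "p < length ds \<Longrightarrow> blk_start ds (Suc p) = blk_start ds p + ds ! p"
  by (simp add: blk_start_def take_Suc_conv_app_nth)

lemma blk_start_mono: "p \<le> q \<Longrightarrow> blk_start ds p \<le> blk_start ds q"
proof -
  assume "p \<le> q"
  then obtain k where "q = p + k" using le_iff_add by blast
  then show ?thesis by (simp add: blk_start_def take_add)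
qed

lemma blk_start_length: "length ds \<le> p \<Longrightarrow> blk_start ds p = sum_list ds"
  by (simp add: blk_start_def)

lemma blk_start_le: "blk_start ds p \<le> sum_list ds"
  using blk_start_mono[of p "p + length ds" ds] by (simp add: blk_start_length)

lemma blk_of_eq:
  assumes "blk_start ds p \<le> i" "i < blk_start ds (Suc p)"
  shows "blk_of ds i = p"
  unfolding blk_of_def
proof (rule Least_equality)
  fix y assume y: "i < blk_start ds (Suc y)"
  show "p \<le> y"
  proof (rule ccontr)
    assume "\<not> p \<le> y"
    then have "blk_start ds (Suc y) \<le> blk_start ds p" by (intro blk_start_mono) simp
    then show False using y assms by simp
  qed
qed (use assms in simp)

lemma blk_of_bounds:
  assumes "i < sum_list ds"
  shows "blk_start ds (blk_of ds i) \<le> i" "i < blk_start ds (Suc (blk_of ds i))" "blk_of ds i < length ds"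
proof -
  have ne: "ds \<noteq> []" using assms by auto
  have l: "i < blk_start ds (Suc (length ds - 1))" using assms ne by (simp add: blk_start_length)
  show 1: "i < blk_start ds (Suc (blk_of ds i))"
    unfolding blk_of_def by (rule LeastI[of "\<lambda>p. i < blk_start ds (Suc p)", OF l])
  have "blk_of ds i \<le> length ds - 1" unfolding blk_of_def by (rule Least_le[of "\<lambda>p. i < blk_start ds (Suc p)", OF l])
  then show "blk_of ds i < length ds" using ne by (cases ds) auto
  show "blk_start ds (blk_of ds i) \<le> i"
  proof (cases "blk_of ds i")
    case 0
    then show ?thesis by (simp add: blk_start_def)
  next
    case (Suc q)
    then have "\<not> i < blk_start ds (Suc q)" using not_less_Least[of q "\<lambda>p. i < blk_start ds (Suc p)"] by (simp add: blk_of_def)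
    then show ?thesis using Suc by simp
  qed
qed

lemma blk_decomp:
  assumes "i < sum_list ds"
  shows "i = blk_start ds (blk_of ds i) + blk_off ds i" "blk_off ds i < ds ! blk_of ds i"
  using blk_of_bounds[OF assms] by (simp_all add: blk_off_def blk_start_Suc)

lemma blk_index:
  assumes "p < length ds" "r < ds ! p"
  shows "blk_start ds p + r < sum_list ds" "blk_of ds (blk_start ds p + r) = p" "blk_off ds (blk_start ds p + r) = r"
proof -
  have s: "blk_start ds p + r < blk_start ds (Suc p)" using assms by (simp add: blk_start_Suc)
  then show "blk_start ds p + r < sum_list ds" using blk_start_le[of ds "Suc p"] by linarith
  show b: "blk_of ds (blk_start ds p + r) = p" using s by (intro blk_of_eq) auto
  show "blk_off ds (blk_start ds p + r) = r" by (simp add: blk_off_def b)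
qed

lemma bij_betw_block:
  "p < length ds \<Longrightarrow> bij_betw (\<lambda>r. blk_start ds p + r) {..<ds ! p} {i. i < sum_list ds \<and> blk_of ds i = p}"
  by (rule bij_betw_byWitness[where f' = "blk_off ds"]) (auto simp: blk_index blk_decomp(2) intro: blk_decomp(1)[symmetric])

lemma card_block: "p < length ds \<Longrightarrow> card {i. i < sum_list ds \<and> blk_of ds i = p} = ds ! p"
  using bij_betw_same_card[OF bij_betw_block] by force

lemma sum_block:
  fixes f :: "nat \<Rightarrow> 'a::comm_monoid_add"
  assumes "p < length ds" "\<And>i. i < sum_list ds \<Longrightarrow> blk_of ds i \<noteq> p \<Longrightarrow> f i = 0"
  shows "(\<Sum>i<sum_list ds. f i) = (\<Sum>r<ds ! p. f (blk_start ds p + r))"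
proof -
  have "(\<Sum>i<sum_list ds. f i) = (\<Sum>i\<in>{i. i < sum_list ds \<and> blk_of ds i = p}. f i)"
    using assms(2) by (intro sum.mono_neutral_right) auto
  then show ?thesis using sum.reindex_bij_betw[OF bij_betw_block[OF assms(1)], of f] by simp
qed

lemma block_index:
  "r < ds ! p \<Longrightarrow> s < ds ! l \<Longrightarrow> block ds M p l $$ (r, s) = M $$ (blk_start ds p + r, blk_start ds l + s)"
  by (simp add: block_def)

lemma block_eq_zero_iff:
  assumes "p < length ds" "l < length ds"
  shows "block ds M p l = 0\<^sub>m (ds ! p) (ds ! l) \<longleftrightarrow>
    (\<forall>i j. i < sum_list ds \<and> j < sum_list ds \<and> blk_of ds i = p \<and> blk_of ds j = l \<longrightarrow> M $$ (i, j) = 0)"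
    (is "?L = ?R")
proof
  assume L: ?L
  show ?R
  proof (intro allI impI, elim conjE)
    fix i j assume ij: "i < sum_list ds" "j < sum_list ds" "blk_of ds i = p" "blk_of ds j = l"
    then have "block ds M p l $$ (blk_off ds i, blk_off ds j) = M $$ (i, j)"
      using blk_decomp[of i ds] blk_decomp[of j ds] by (simp add: block_index)
    then show "M $$ (i, j) = 0" using L ij blk_decomp(2)[of i ds] blk_decomp(2)[of j ds] by simp
  qed
next
  assume ?R
  then show ?L using assms by (intro eq_matI) (auto simp: block_def blk_index)
qed

lemma block_subdiagonal_iff:
  "block_subdiagonal ds Y \<longleftrightarrow> Y \<in> carrier_mat (sum_list ds) (sum_list ds)
   \<and> (\<forall>i<sum_list ds. \<forall>j<sum_list ds. blk_of ds i \<noteq> Suc (blk_of ds j) \<longrightarrow> Y $$ (i, j) = 0)"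
  unfolding block_subdiagonal_def using blk_of_bounds(3)[of _ ds] by (auto simp: block_eq_zero_iff) blast

lemma block_diagonal_iff:
  "block_diagonal ds Y \<longleftrightarrow> Y \<in> carrier_mat (sum_list ds) (sum_list ds)
   \<and> (\<forall>i<sum_list ds. \<forall>j<sum_list ds. blk_of ds i \<noteq> blk_of ds j \<longrightarrow> Y $$ (i, j) = 0)"
  unfolding block_diagonal_def using blk_of_bounds(3)[of _ ds] by (auto simp: block_eq_zero_iff) blast

lemma pow_mat_add: "A \<in> carrier_mat n n \<Longrightarrow> A ^\<^sub>m (a + b) = A ^\<^sub>m a * A ^\<^sub>m b"
proof (induction b)
  case (Suc b)
  then show ?case by (simp add: assoc_mult_mat[of "A ^\<^sub>m a" n n "A ^\<^sub>m b" n A n])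
qed simp

lemma pow_mat_Suc_left: "A \<in> carrier_mat n n \<Longrightarrow> A ^\<^sub>m Suc k = A * A ^\<^sub>m k"
  using pow_mat_add[of A n 1 k] by simp

lemma subdiagonal_pow_zero:
  assumes Y: "block_subdiagonal ds Y"
  shows "i < sum_list ds \<Longrightarrow> j < sum_list ds \<Longrightarrow> blk_of ds i \<noteq> blk_of ds j + k \<Longrightarrow> (Y ^\<^sub>m k) $$ (i, j) = 0"
proof (induction k arbitrary: i j)
  case (Suc k)
  have c: "Y \<in> carrier_mat (sum_list ds) (sum_list ds)" using Y by (simp add: block_subdiagonal_iff)
  have "(Y ^\<^sub>m Suc k) $$ (i, j) = (\<Sum>q<sum_list ds. (Y ^\<^sub>m k) $$ (i, q) * Y $$ (q, j))"
    using Suc.prems c by (simp only: pow_mat.simps) (rule mult_mat_sum[of _ "sum_list ds" "sum_list ds" _ "sum_list ds"], auto)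
  also have "\<dots> = 0"
  proof (rule sum.neutral, rule ballI)
    fix q assume "q \<in> {..<sum_list ds}"
    then have q: "q < sum_list ds" by simp
    show "(Y ^\<^sub>m k) $$ (i, q) * Y $$ (q, j) = 0"
    proof (cases "blk_of ds q = Suc (blk_of ds j)")
      case True
      then show ?thesis using Suc.IH[OF Suc.prems(1) q] Suc.prems by simp
    next
      case False
      then show ?thesis using Y q Suc.prems by (auto simp: block_subdiagonal_iff)
    qed
  qed
  finally show ?case .
next
  case 0
  have c: "Y \<in> carrier_mat (sum_list ds) (sum_list ds)" using Y by (simp add: block_subdiagonal_iff)
  from 0 show ?case using c by auto
qed

text \<open>The only blocks of \<open>Y\<^sup>k\<close> that can be nonzero are the products of \<open>k\<close> consecutive blocks of \<open>Y\<close>. Powers of the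
  square matrix \<open>Y\<close> thus replace the products of rectangular blocks in the factor of automorphy.\<close>

lemma chain_index:
  assumes Y: "block_subdiagonal ds Y"
  shows "l + k < length ds \<Longrightarrow> chain ds Y l k \<in> carrier_mat (ds ! (l + k)) (ds ! l) \<and>
    (\<forall>r<ds ! (l + k). \<forall>s<ds ! l. chain ds Y l k $$ (r, s) = (Y ^\<^sub>m k) $$ (blk_start ds (l + k) + r, blk_start ds l + s))"
proof (induction k)
  case 0
  have c: "Y \<in> carrier_mat (sum_list ds) (sum_list ds)" using Y by (simp add: block_subdiagonal_iff)
  from 0 show ?case using c by (auto simp: blk_index)
next
  case (Suc k)
  let ?n = "sum_list ds" and ?p = "l + k"
  have c: "Y \<in> carrier_mat ?n ?n" using Y by (simp add: block_subdiagonal_iff)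
  have p: "?p < length ds" "Suc ?p < length ds" "l < length ds" using Suc.prems by auto
  have IH: "chain ds Y l k \<in> carrier_mat (ds ! ?p) (ds ! l)"
    "\<And>r s. r < ds ! ?p \<Longrightarrow> s < ds ! l \<Longrightarrow> chain ds Y l k $$ (r, s) = (Y ^\<^sub>m k) $$ (blk_start ds ?p + r, blk_start ds l + s)"
    using Suc p by auto
  have b: "block ds Y (Suc ?p) ?p \<in> carrier_mat (ds ! Suc ?p) (ds ! ?p)" by (simp add: block_def)
  show ?case
  proof (intro conjI allI impI)
    show "chain ds Y l (Suc k) \<in> carrier_mat (ds ! (l + Suc k)) (ds ! l)" using IH(1) b by simp
    fix r s assume "r < ds ! (l + Suc k)" and s: "s < ds ! l"
    then have r: "r < ds ! Suc ?p" by simp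
    let ?i = "blk_start ds (Suc ?p) + r" and ?j = "blk_start ds l + s"
    have ij: "?i < ?n" "?j < ?n" "blk_of ds ?i = Suc ?p" using r s p by (auto simp: blk_index)
    have "(Y ^\<^sub>m Suc k) $$ (?i, ?j) = (\<Sum>q<?n. Y $$ (?i, q) * (Y ^\<^sub>m k) $$ (q, ?j))"
      unfolding pow_mat_Suc_left[OF c] using ij c by (intro mult_mat_sum) auto
    also have "\<dots> = (\<Sum>t<ds ! ?p. Y $$ (?i, blk_start ds ?p + t) * (Y ^\<^sub>m k) $$ (blk_start ds ?p + t, ?j))"
      using Y ij p by (intro sum_block) (auto simp: block_subdiagonal_iff)
    also have "\<dots> = (\<Sum>t<ds ! ?p. block ds Y (Suc ?p) ?p $$ (r, t) * chain ds Y l k $$ (t, s))"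
      using r s IH(2) by (intro sum.cong) (auto simp: block_index)
    also have "\<dots> = chain ds Y l (Suc k) $$ (r, s)"
      using mult_mat_sum[OF b IH(1) r s] by simp
    finally show "chain ds Y l (Suc k) $$ (r, s) = (Y ^\<^sub>m Suc k) $$ (blk_start ds (l + Suc k) + r, ?j)" by simp
  qed
qed

text \<open>With \<open>c\<close> the lower left entry and \<open>L\<close> the logarithm of \<open>c z + d\<close> this is the factor of automorphy.
  As a function of independent variables \<open>c\<close> and \<open>L\<close> it is \<open>D exp(- c Y) D\<close> with \<open>D = exp(L \<rho>(h))\<close>. The truncated
  difference of the block indices makes the entries above the diagonal vanish: they are off-diagonal entries of
  \<open>Y\<close> to the power zero.\<close>

definition aut_mat :: "real \<Rightarrow> nat list \<Rightarrow> complex mat \<Rightarrow> complex \<Rightarrow> complex \<Rightarrow> complex mat" where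
  "aut_mat \<eta> ds Y c L = mat (sum_list ds) (sum_list ds) (\<lambda>(i, j).
     let p = blk_of ds i; l = blk_of ds j in
     (- c) ^ (p - l) / fact (p - l) * exp (- (2 * of_real \<eta> + of_nat p + of_nat l) * L) * (Y ^\<^sub>m (p - l)) $$ (i, j))"

lemma aut_mat_carrier [simp]: "aut_mat \<eta> ds Y c L \<in> carrier_mat (sum_list ds) (sum_list ds)"
  "dim_row (aut_mat \<eta> ds Y c L) = sum_list ds" "dim_col (aut_mat \<eta> ds Y c L) = sum_list ds"
  by (simp_all add: aut_mat_def)

lemma aut_mat_index:
  "i < sum_list ds \<Longrightarrow> j < sum_list ds \<Longrightarrow> aut_mat \<eta> ds Y c L $$ (i, j) =
    (- c) ^ (blk_of ds i - blk_of ds j) / fact (blk_of ds i - blk_of ds j) *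
    exp (- (2 * of_real \<eta> + of_nat (blk_of ds i) + of_nat (blk_of ds j)) * L) * (Y ^\<^sub>m (blk_of ds i - blk_of ds j)) $$ (i, j)"
  by (simp add: aut_mat_def Let_def)

lemma J_mat_aut:
  assumes Y: "block_subdiagonal ds Y"
  shows "J_mat \<eta> ds Y g z = aut_mat \<eta> ds Y (gt_c g) (gt_log_aut g z)"
proof (rule eq_matI)
  fix i j assume "i < dim_row (aut_mat \<eta> ds Y (gt_c g) (gt_log_aut g z))" "j < dim_col (aut_mat \<eta> ds Y (gt_c g) (gt_log_aut g z))"
  then have ij: "i < sum_list ds" "j < sum_list ds" by auto
  let ?p = "blk_of ds i" and ?l = "blk_of ds j"
  have p: "?p < length ds" "?l < length ds" using blk_of_bounds(3) ij by auto
  show "J_mat \<eta> ds Y g z $$ (i, j) = aut_mat \<eta> ds Y (gt_c g) (gt_log_aut g z) $$ (i, j)"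
  proof (cases "?l \<le> ?p")
    case True
    have ch: "chain ds Y ?l (?p - ?l) \<in> carrier_mat (ds ! ?p) (ds ! ?l)"
      "chain ds Y ?l (?p - ?l) $$ (blk_off ds i, blk_off ds j) = (Y ^\<^sub>m (?p - ?l)) $$ (i, j)"
      using chain_index[OF Y, of ?l "?p - ?l"] True p blk_decomp[OF ij(1)] blk_decomp[OF ij(2)] by auto
    have "of_real (\<eta> + (real ?p + real ?l) / 2) * gt_log_deriv g z
        = - (2 * of_real \<eta> + of_nat ?p + of_nat ?l) * gt_log_aut g z"
      by (simp add: gt_log_deriv_aut algebra_simps add_divide_distrib)
    then have "gt_deriv_pow (\<eta> + (real ?p + real ?l) / 2) g z
        = exp (- (2 * of_real \<eta> + of_nat ?p + of_nat ?l) * gt_log_aut g z)"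
      by (simp only: gt_deriv_pow_def)
    then show ?thesis
      unfolding J_mat_def of_blocks_def aut_mat_index[OF ij]
      using ij True ch blk_decomp(2)[OF ij(1)] blk_decomp(2)[OF ij(2)] by auto
  next
    case False
    then have "(Y ^\<^sub>m (?p - ?l)) $$ (i, j) = 0" by (intro subdiagonal_pow_zero[OF Y]) (use ij in auto)
    then show ?thesis
      unfolding J_mat_def of_blocks_def aut_mat_index[OF ij]
      using ij False blk_decomp(2)[OF ij(1)] blk_decomp(2)[OF ij(2)] by auto
  qed
qed (simp_all add: J_mat_def of_blocks_def)

text \<open>In an entry of the product, the intermediate block index \<open>r\<close> runs from the block of the column to the block
  of the row, since the other entries of the powers of \<open>Y\<close> vanish. The power of \<open>Y\<close> that results does not depend on
  \<open>r\<close>, and the scalar factors add up by the binomial theorem.\<close>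

lemma aut_mat_mult:
  assumes Y: "block_subdiagonal ds Y"
  shows "aut_mat \<eta> ds Y c1 L1 * aut_mat \<eta> ds Y c2 L2 = aut_mat \<eta> ds Y (c1 * exp L2 + c2 * exp (- L1)) (L1 + L2)"
    (is "?A1 * ?A2 = ?A")
proof (rule eq_matI)
  fix i j assume "i < dim_row ?A" "j < dim_col ?A"
  then have ij: "i < sum_list ds" "j < sum_list ds" by auto
  let ?n = "sum_list ds" and ?p = "blk_of ds i" and ?l = "blk_of ds j"
  have c: "Y \<in> carrier_mat ?n ?n" using Y by (simp add: block_subdiagonal_iff)
  define C where "C r = ((- c1) ^ (?p - r) / fact (?p - r) * exp (- (2 * of_real \<eta> + of_nat ?p + of_nat r) * L1))
      * ((- c2) ^ (r - ?l) / fact (r - ?l) * exp (- (2 * of_real \<eta> + of_nat r + of_nat ?l) * L2))" for r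
  have T: "?A1 $$ (i, q) * ?A2 $$ (q, j) = C (blk_of ds q) * ((Y ^\<^sub>m (?p - blk_of ds q)) $$ (i, q) * (Y ^\<^sub>m (blk_of ds q - ?l)) $$ (q, j))"
    if "q < ?n" for q
    unfolding aut_mat_index[OF ij(1) that] aut_mat_index[OF that ij(2)] C_def by (simp only: mult.assoc mult.left_commute)
  have "(?A1 * ?A2) $$ (i, j) = (\<Sum>q<?n. ?A1 $$ (i, q) * ?A2 $$ (q, j))"
    using ij by (intro mult_mat_sum) auto
  also have "\<dots> = (\<Sum>q<?n. \<Sum>r=?l..?p. C r * ((Y ^\<^sub>m (?p - r)) $$ (i, q) * (Y ^\<^sub>m (r - ?l)) $$ (q, j)))"
  proof (rule sum.cong)
    fix q assume "q \<in> {..<?n}"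
    then have q: "q < ?n" by simp
    let ?F = "\<lambda>r. C r * ((Y ^\<^sub>m (?p - r)) $$ (i, q) * (Y ^\<^sub>m (r - ?l)) $$ (q, j))"
    have z: "?F r = 0" if "r \<noteq> blk_of ds q" "r \<in> {?l..?p}" for r
    proof -
      have "(Y ^\<^sub>m (?p - r)) $$ (i, q) = 0" by (rule subdiagonal_pow_zero[OF Y ij(1) q]) (use that in auto)
      then show ?thesis by simp
    qed
    have "(\<Sum>r=?l..?p. ?F r) = (\<Sum>r=?l..?p. if r = blk_of ds q then ?F r else 0)"
      using z by (intro sum.cong) auto
    also have "\<dots> = (if blk_of ds q \<in> {?l..?p} then ?F (blk_of ds q) else 0)" by (simp add: sum.delta)
    also have "\<dots> = ?F (blk_of ds q)"
    proof (cases "blk_of ds q \<in> {?l..?p}")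
      case False
      then have "?p < blk_of ds q \<or> blk_of ds q < ?l" by auto
      then have "(Y ^\<^sub>m (?p - blk_of ds q)) $$ (i, q) = 0 \<or> (Y ^\<^sub>m (blk_of ds q - ?l)) $$ (q, j) = 0"
        using subdiagonal_pow_zero[OF Y ij(1) q, of "?p - blk_of ds q"] subdiagonal_pow_zero[OF Y q ij(2), of "blk_of ds q - ?l"] by auto
      then show ?thesis using False by auto
    qed simp
    finally show "?A1 $$ (i, q) * ?A2 $$ (q, j) = (\<Sum>r=?l..?p. ?F r)" using T[OF q] by simp
  qed simp
  also have "\<dots> = (\<Sum>r=?l..?p. C r * (\<Sum>q<?n. (Y ^\<^sub>m (?p - r)) $$ (i, q) * (Y ^\<^sub>m (r - ?l)) $$ (q, j)))"
    by (subst sum.swap) (simp add: sum_distrib_left)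
  also have "\<dots> = (\<Sum>r=?l..?p. C r * (Y ^\<^sub>m (?p - ?l)) $$ (i, j))"
  proof (rule sum.cong)
    fix r assume r: "r \<in> {?l..?p}"
    have "Y ^\<^sub>m (?p - ?l) = Y ^\<^sub>m (?p - r) * Y ^\<^sub>m (r - ?l)"
      using pow_mat_add[OF c, of "?p - r" "r - ?l"] r by simp
    then have "(Y ^\<^sub>m (?p - ?l)) $$ (i, j) = (\<Sum>q<?n. (Y ^\<^sub>m (?p - r)) $$ (i, q) * (Y ^\<^sub>m (r - ?l)) $$ (q, j))"
      using ij c by (simp only:) (intro mult_mat_sum, auto)
    then show "C r * (\<Sum>q<?n. (Y ^\<^sub>m (?p - r)) $$ (i, q) * (Y ^\<^sub>m (r - ?l)) $$ (q, j)) = C r * (Y ^\<^sub>m (?p - ?l)) $$ (i, j)"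
      by simp
  qed simp
  also have "\<dots> = (\<Sum>r=?l..?p. C r) * (Y ^\<^sub>m (?p - ?l)) $$ (i, j)" by (simp add: sum_distrib_right)
  also have "\<dots> = ?A $$ (i, j)"
  proof (cases "?l \<le> ?p")
    case False
    then have "(Y ^\<^sub>m (?p - ?l)) $$ (i, j) = 0" by (intro subdiagonal_pow_zero[OF Y]) (use ij in auto)
    then show ?thesis unfolding aut_mat_index[OF ij] by simp
  next
    case True
    then obtain k where k: "?p = ?l + k" using le_iff_add by blast
    let ?e = "exp (- (2 * of_real \<eta> + of_nat ?p + of_nat ?l) * (L1 + L2)) :: complex"
    let ?x = "- c1 * exp L2" and ?y = "- c2 * exp (- L1)"
    have factor: "a ^ r * b ^ s / F * (e * u ^ s * v ^ r) = e * (1 / F) * (b * u) ^ s * (a * v) ^ r"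
      for a b u v F e :: complex and r s by (simp add: power_mult_distrib)
    have C: "C (?l + t) = ?e / fact k * (of_nat (k choose t) * ?y ^ t * ?x ^ (k - t))" if "t \<le> k" for t
    proof -
      have "exp (- (2 * of_real \<eta> + of_nat ?p + of_nat (?l + t)) * L1) * exp (- (2 * of_real \<eta> + of_nat (?l + t) + of_nat ?l) * L2)
          = ?e * exp (of_nat t * - L1) * exp (of_nat (k - t) * L2)"
        unfolding exp_add[symmetric] using that k by (simp add: of_nat_diff algebra_simps)
      also have "\<dots> = ?e * exp (- L1) ^ t * exp L2 ^ (k - t)" by (simp only: exp_of_nat_mult)
      finally have ee: "exp (- (2 * of_real \<eta> + of_nat ?p + of_nat (?l + t)) * L1) * exp (- (2 * of_real \<eta> + of_nat (?l + t) + of_nat ?l) * L2)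
          = ?e * exp (- L1) ^ t * exp L2 ^ (k - t)" .
      have "C (?l + t) = (- c1) ^ (k - t) * (- c2) ^ t / (fact (k - t) * fact t)
          * (exp (- (2 * of_real \<eta> + of_nat ?p + of_nat (?l + t)) * L1) * exp (- (2 * of_real \<eta> + of_nat (?l + t) + of_nat ?l) * L2))"
        using k by (simp add: C_def)
      also have "\<dots> = (- c1) ^ (k - t) * (- c2) ^ t / (fact (k - t) * fact t) * (?e * exp (- L1) ^ t * exp L2 ^ (k - t))"
        by (simp only: ee)
      also have "\<dots> = ?e * (1 / (fact (k - t) * fact t)) * ?y ^ t * ?x ^ (k - t)"
        by (rule factor)
      also have "1 / (fact (k - t) * fact t) = of_nat (k choose t) / (fact k :: complex)"
        using that by (subst binomial_fact) (simp_all add: field_simps)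
      finally show ?thesis by simp
    qed
    have "(\<Sum>r=?l..?p. C r) = (\<Sum>t\<le>k. C (?l + t))"
      unfolding k using sum.shift_bounds_cl_nat_ivl[of C 0 ?l k] by (simp add: atLeast0AtMost add.commute)
    also have "\<dots> = ?e / fact k * (\<Sum>t\<le>k. of_nat (k choose t) * ?y ^ t * ?x ^ (k - t))"
      using C by (simp add: sum_distrib_left)
    also have "\<dots> = ?e / fact k * (?y + ?x) ^ k" by (simp only: binomial_ring)
    also have "?y + ?x = - (c1 * exp L2 + c2 * exp (- L1))" by simp
    finally show ?thesis unfolding aut_mat_index[OF ij] using k by simp
  qed
  finally show "(?A1 * ?A2) $$ (i, j) = ?A $$ (i, j)" .
qed simp_all

lemma aut_mat_one:
  assumes Y: "block_subdiagonal ds Y"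
  shows "aut_mat \<eta> ds Y 0 0 = 1\<^sub>m (sum_list ds)"
proof (rule eq_matI)
  fix i j assume "i < dim_row (1\<^sub>m (sum_list ds))" "j < dim_col (1\<^sub>m (sum_list ds))"
  then have ij: "i < sum_list ds" "j < sum_list ds" by auto
  have c: "Y \<in> carrier_mat (sum_list ds) (sum_list ds)" using Y by (simp add: block_subdiagonal_iff)
  show "aut_mat \<eta> ds Y 0 0 $$ (i, j) = 1\<^sub>m (sum_list ds) $$ (i, j)"
  proof (cases "blk_of ds i \<le> blk_of ds j")
    case True
    then show ?thesis unfolding aut_mat_index[OF ij] using ij c by simp
  next
    case False
    then show ?thesis unfolding aut_mat_index[OF ij] using ij by auto
  qed
qed simp_all

lemma aut_mat_inverse:
  assumes Y: "block_subdiagonal ds Y"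
  shows "aut_mat \<eta> ds Y c L * aut_mat \<eta> ds Y (- c) (- L) = 1\<^sub>m (sum_list ds)"
    "aut_mat \<eta> ds Y (- c) (- L) * aut_mat \<eta> ds Y c L = 1\<^sub>m (sum_list ds)"
  by (simp_all add: aut_mat_mult[OF Y] aut_mat_one[OF Y])

text \<open>The scalar factor of an entry depends only on its two blocks, so block diagonal matrices move past it.\<close>

lemma aut_mat_commute:
  assumes Y: "block_subdiagonal ds Y" and A: "block_diagonal ds A" and AY: "A * Y = Y * A"
  shows "A * aut_mat \<eta> ds Y c L = aut_mat \<eta> ds Y c L * A" (is "?l = ?r")
proof -
  let ?n = "sum_list ds"
  have c: "Y \<in> carrier_mat ?n ?n" "A \<in> carrier_mat ?n ?n"
    using Y A by (simp_all add: block_subdiagonal_iff block_diagonal_iff)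
  have AYk: "A * Y ^\<^sub>m k = Y ^\<^sub>m k * A" for k
  proof (induction k)
    case (Suc k)
    have "A * (Y ^\<^sub>m k * Y) = (A * Y ^\<^sub>m k) * Y" using c by (subst assoc_mult_mat[of _ ?n ?n _ ?n _ ?n]) auto
    also have "\<dots> = Y ^\<^sub>m k * (A * Y)" unfolding Suc using c by (subst assoc_mult_mat[of _ ?n ?n _ ?n _ ?n]) auto
    also have "\<dots> = (Y ^\<^sub>m k * Y) * A" unfolding AY using c by (subst assoc_mult_mat[of _ ?n ?n _ ?n _ ?n]) auto
    finally show ?case by simp
  qed (use c in simp)
  show ?thesis
  proof (rule eq_matI)
    fix i j assume "i < dim_row ?r" "j < dim_col ?r"
    then have ij: "i < ?n" "j < ?n" using c by auto
    let ?k = "blk_of ds i - blk_of ds j"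
    let ?C = "(- c) ^ ?k / fact ?k * exp (- (2 * of_real \<eta> + of_nat (blk_of ds i) + of_nat (blk_of ds j)) * L)"
    have "?l $$ (i, j) = (\<Sum>q<?n. A $$ (i, q) * aut_mat \<eta> ds Y c L $$ (q, j))"
      by (rule mult_mat_sum[OF c(2) aut_mat_carrier(1) ij])
    also have "\<dots> = (\<Sum>q<?n. ?C * (A $$ (i, q) * (Y ^\<^sub>m ?k) $$ (q, j)))"
    proof (rule sum.cong)
      fix q assume "q \<in> {..<?n}"
      then have q: "q < ?n" by simp
      show "A $$ (i, q) * aut_mat \<eta> ds Y c L $$ (q, j) = ?C * (A $$ (i, q) * (Y ^\<^sub>m ?k) $$ (q, j))"
      proof (cases "blk_of ds q = blk_of ds i")
        case True
        show ?thesis unfolding aut_mat_index[OF q ij(2)] True by (simp only: mult.assoc mult.left_commute)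
      next
        case False
        then have "A $$ (i, q) = 0" using A ij q by (auto simp: block_diagonal_iff)
        then show ?thesis by simp
      qed
    qed simp
    also have "\<dots> = ?C * (A * Y ^\<^sub>m ?k) $$ (i, j)"
      using c ij by (subst mult_mat_sum[of A ?n ?n _ ?n]) (auto simp: sum_distrib_left)
    also have "\<dots> = ?C * (Y ^\<^sub>m ?k * A) $$ (i, j)" by (simp only: AYk)
    also have "\<dots> = (\<Sum>q<?n. ?C * ((Y ^\<^sub>m ?k) $$ (i, q) * A $$ (q, j)))"
      using c ij by (subst mult_mat_sum[of _ ?n ?n _ ?n]) (auto simp: sum_distrib_left)
    also have "\<dots> = (\<Sum>q<?n. aut_mat \<eta> ds Y c L $$ (i, q) * A $$ (q, j))"
    proof (rule sum.cong)
      fix q assume "q \<in> {..<?n}"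
      then have q: "q < ?n" by simp
      show "?C * ((Y ^\<^sub>m ?k) $$ (i, q) * A $$ (q, j)) = aut_mat \<eta> ds Y c L $$ (i, q) * A $$ (q, j)"
      proof (cases "blk_of ds q = blk_of ds j")
        case True
        show ?thesis unfolding aut_mat_index[OF ij(1) q] True by (simp only: mult.assoc)
      next
        case False
        then have "A $$ (q, j) = 0" using A ij q by (auto simp: block_diagonal_iff)
        then show ?thesis by simp
      qed
    qed simp
    also have "\<dots> = ?r $$ (i, j)" by (rule mult_mat_sum[OF aut_mat_carrier(1) c(2) ij, symmetric])
    finally show "?l $$ (i, j) = ?r $$ (i, j)" .
  qed (use c in auto)
qed

section \<open>Derivatives along one-parameter subgroups\<close>

lemma smooth_on_sinh_cosh:
  "smooth_on UNIV (\<lambda>t::real. complex_of_real (sinh t))" "smooth_on UNIV (\<lambda>t::real. complex_of_real (cosh t))"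
proof -
  have e: "smooth_on UNIV complex_of_real"
    by (rule smooth_on_bounded_linear) (auto intro: bounded_linear_of_real)
  have "smooth_on UNIV (\<lambda>t. (\<lambda>z. (exp z - exp (- z)) / 2) (complex_of_real t))"
    by (rule smooth_on_holomorphic_comp[OF open_UNIV open_UNIV _ _ e]) (auto intro!: holomorphic_intros)
  moreover have "complex_of_real (sinh t) = (\<lambda>z. (exp z - exp (- z)) / 2) (complex_of_real t)" for t
    by (simp add: sinh_def scaleR_conv_of_real flip: exp_of_real)
  ultimately show "smooth_on UNIV (\<lambda>t::real. complex_of_real (sinh t))" by presburger
  have "smooth_on UNIV (\<lambda>t. (\<lambda>z. (exp z + exp (- z)) / 2) (complex_of_real t))"
    by (rule smooth_on_holomorphic_comp[OF open_UNIV open_UNIV _ _ e]) (auto intro!: holomorphic_intros)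
  moreover have "complex_of_real (cosh t) = (\<lambda>z. (exp z + exp (- z)) / 2) (complex_of_real t)" for t
    by (simp add: cosh_def scaleR_conv_of_real flip: exp_of_real)
  ultimately show "smooth_on UNIV (\<lambda>t::real. complex_of_real (cosh t))" by presburger
qed

definition gt_curve :: "(real \<Rightarrow> gtilde) \<Rightarrow> bool" where
  "gt_curve e \<longleftrightarrow> e 0 = gt_one \<and> (\<forall>g. (\<lambda>t. gt_mult g (e t)) differentiable (at 0))"

lemma gt_curveI:
  assumes e: "e 0 = gt_one" and b: "smooth_on UNIV (\<lambda>t. gt_b (e t))" and d: "smooth_on UNIV (\<lambda>t. gt_d (e t))"
    and s: "(\<lambda>t. snd (e t)) differentiable (at 0)"
  shows "gt_curve e"
  unfolding gt_curve_def
proof (intro conjI allI e)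
  fix g
  have 1: "smooth_on UNIV (\<lambda>t. gt_a g * gt_b (e t) + gt_b g * gt_d (e t))"
    by (intro smooth_intros b d) auto
  have w: "smooth_on UNIV (\<lambda>t. Ln (1 + gt_c g * gt_b (e t) / (gt_d g * gt_d (e t))))"
    by (intro smooth_intros b d) (auto intro!: Re_one_plus_pos gt_factor_norm simp del: plus_complex.sel)
  have A: "Arg (1 + gt_c g * gt_b (e t) / (gt_d g * gt_d (e t))) = Im (Ln (1 + gt_c g * gt_b (e t) / (gt_d g * gt_d (e t))))" for t
    using Re_one_plus_pos[OF gt_factor_norm[of g "e t"]] by (intro Arg_eq_Im_Ln) force
  have "smooth_on UNIV (\<lambda>t. Im (Ln (1 + gt_c g * gt_b (e t) / (gt_d g * gt_d (e t)))))"
    by (rule smooth_on_bounded_linear_comp[OF bounded_linear_Im _ w]) auto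
  then have 2: "(\<lambda>t. Arg (1 + gt_c g * gt_b (e t) / (gt_d g * gt_d (e t)))) differentiable (at 0)"
    unfolding A by (rule smooth_on_differentiable) simp
  show "(\<lambda>t. gt_mult g (e t)) differentiable (at 0)"
    unfolding gt_mult_def
    by (intro differentiable_Pair differentiable_add differentiable_const s 2 smooth_on_differentiable[OF 1]) auto
qed

lemma gt_curve_exp: "gt_curve gt_exp_ih" "gt_curve gt_exp_x1" "gt_curve gt_exp_x2"
proof -
  have c: "smooth_on UNIV (\<lambda>t::real. cis (- t / 2))"
  proof -
    have "smooth_on UNIV (\<lambda>t::real. complex_of_real t)"
      by (rule smooth_on_bounded_linear) (auto intro: bounded_linear_of_real)
    then have "smooth_on UNIV (\<lambda>t::real. exp ((- \<i> / 2) * complex_of_real t))"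
      by (intro smooth_intros) auto
    moreover have "cis (- t / 2) = exp ((- \<i> / 2) * complex_of_real t)" for t
      by (simp add: cis_conv_exp)
    ultimately show ?thesis by simp
  qed
  show "gt_curve gt_exp_ih"
    by (rule gt_curveI) (use c in \<open>auto simp: gt_exp_ih_def gt_one_def intro!: smooth_on_const\<close>,
      auto simp: gt_d_def gt_b_def intro!: smooth_on_const smooth_on_mult c)
  show "gt_curve gt_exp_x1"
    by (rule gt_curveI) (auto intro: smooth_on_sinh_cosh, auto simp: gt_exp_x1_def gt_one_def)
  show "gt_curve gt_exp_x2"
    by (rule gt_curveI) (auto intro!: smooth_on_sinh_cosh smooth_on_mult smooth_on_const, auto simp: gt_exp_x2_def gt_one_def)
qed

lemma has_vector_derivative_lie_deriv:
  assumes e: "gt_curve e" and f: "f differentiable (at g)"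
  shows "((\<lambda>t. f (gt_mult g (e t))) has_vector_derivative lie_deriv e f g) (at 0)"
proof -
  have "(\<lambda>t. gt_mult g (e t)) differentiable (at 0)" using e unfolding gt_curve_def by blast
  moreover have "gt_mult g (e 0) = g" using e by (simp add: gt_curve_def)
  ultimately have "(f \<circ> (\<lambda>t. gt_mult g (e t))) differentiable (at 0)"
    using f by (intro differentiable_chain_at) auto
  then show ?thesis by (simp add: lie_deriv_def o_def flip: vector_derivative_works)
qed

lemma lie_deriv_sum:
  assumes e: "gt_curve e" and f: "\<And>j. j \<in> J \<Longrightarrow> f j differentiable (at g)"
  shows "lie_deriv e (\<lambda>x. \<Sum>j\<in>J. a j * f j x) g = (\<Sum>j\<in>J. a j * lie_deriv e (f j) g)"
proof -
  have "((\<lambda>t. \<Sum>j\<in>J. a j * f j (gt_mult g (e t))) has_vector_derivative (\<Sum>j\<in>J. a j * lie_deriv e (f j) g)) (at 0)"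
    by (intro has_vector_derivative_sum has_vector_derivative_mult_right has_vector_derivative_lie_deriv e f)
  then show ?thesis unfolding lie_deriv_def by (rule vector_derivative_at)
qed

lemma lie_h_sum:
  "(\<And>j. j \<in> J \<Longrightarrow> f j differentiable (at g)) \<Longrightarrow> lie_h (\<lambda>x. \<Sum>j\<in>J. a j * f j x) g = (\<Sum>j\<in>J. a j * lie_h (f j) g)"
  by (simp add: lie_h_def lie_deriv_sum[OF gt_curve_exp(1)] sum_distrib_left algebra_simps)

lemma lie_y_sum:
  "(\<And>j. j \<in> J \<Longrightarrow> f j differentiable (at g)) \<Longrightarrow> lie_y (\<lambda>x. \<Sum>j\<in>J. a j * f j x) g = (\<Sum>j\<in>J. a j * lie_y (f j) g)"
  by (simp add: lie_y_def lie_deriv_sum[OF gt_curve_exp(2)] lie_deriv_sum[OF gt_curve_exp(3)]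
      sum_distrib_left sum_divide_distrib sum.distrib distrib_left add_divide_distrib mult.left_commute)

lemma lie_deriv_cong:
  assumes e: "gt_curve e" and W: "open W" "g \<in> W" "\<And>x. x \<in> W \<Longrightarrow> f x = f' x"
  shows "lie_deriv e f g = lie_deriv e f' g"
proof -
  have "(\<lambda>t. gt_mult g (e t)) differentiable (at 0)" using e unfolding gt_curve_def by blast
  then have "isCont (\<lambda>t. gt_mult g (e t)) 0" by (rule differentiable_imp_continuous_within)
  moreover have "gt_mult g (e 0) = g" using e by (simp add: gt_curve_def)
  ultimately have "\<forall>\<^sub>F t in nhds 0. gt_mult g (e t) \<in> W"
    using W(1,2) by (metis isCont_def tendsto_at_iff_tendsto_nhds topological_tendstoD)
  then have "\<forall>\<^sub>F t in nhds 0. f (gt_mult g (e t)) = f' (gt_mult g (e t))"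
    by (rule eventually_mono) (use W(3) in auto)
  then show ?thesis unfolding lie_deriv_def
    by (intro vector_derivative_cong_eq) auto
qed

lemma lie_cong:
  assumes "open W" "g \<in> W" "\<And>x. x \<in> W \<Longrightarrow> f x = f' x"
  shows "lie_h f g = lie_h f' g" "lie_y f g = lie_y f' g"
  using lie_deriv_cong[OF _ assms] gt_curve_exp by (simp_all add: lie_h_def lie_y_def)

lemma gt_act_mult_exp_ih: "gt_act (gt_mult g (gt_exp_ih t)) 0 = gt_act g 0"
  by (simp add: gt_act_mult)

text \<open>The conditions on a lift concern derivatives and right translates by the stabilizer, and the preimage of
  \<open>U\<close> is open and invariant under these translates.\<close>

lemma induced_lift_cong:
  assumes U: "open U" and eq: "\<And>g. gt_act g 0 \<in> U \<Longrightarrow> F g = F' g"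
  shows "induced_lift n \<rho>h \<rho>y {g. gt_act g 0 \<in> U} F = induced_lift n \<rho>h \<rho>y {g. gt_act g 0 \<in> U} F'"
proof -
  let ?W = "{g. gt_act g 0 \<in> U}"
  have W: "open ?W" by (rule open_gt_act_0[OF U])
  have s: "smooth_on ?W (\<lambda>g. F g $ i) = smooth_on ?W (\<lambda>g. F' g $ i)" for i
    by (rule smooth_on_cong[OF W]) (use eq in auto)
  have l: "lie_h (\<lambda>g. F g $ i) g = lie_h (\<lambda>g. F' g $ i) g" "lie_y (\<lambda>g. F g $ i) g = lie_y (\<lambda>g. F' g $ i) g"
    if "g \<in> ?W" for g i
    using lie_cong[OF W that, of "\<lambda>g. F g $ i" "\<lambda>g. F' g $ i"] eq by auto
  show ?thesis unfolding induced_lift_def using s l eq by (auto simp: gt_act_mult_exp_ih)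
qed

section \<open>Homogeneous bundles and their holomorphic sections\<close>

lemma fibre_coordsD:
  assumes "fibre_coords E n z \<phi>" "u \<in> fibre E z"
  shows "\<phi> u \<in> carrier_vec n" "the_inv_into (fibre E z) \<phi> (\<phi> u) = u"
    "v \<in> fibre E z \<Longrightarrow> vadd E u v \<in> fibre E z" "v \<in> fibre E z \<Longrightarrow> \<phi> (vadd E u v) = \<phi> u + \<phi> v"
    "vscale E c u \<in> fibre E z" "\<phi> (vscale E c u) = c \<cdot>\<^sub>v \<phi> u"
    "v \<in> fibre E z \<Longrightarrow> \<phi> u = \<phi> v \<Longrightarrow> u = v"
  using assms unfolding fibre_coords_def bij_betw_def by (auto simp: the_inv_into_f_f dest: inj_onD)

lemma fibre_coords_inv:
  assumes "fibre_coords E n z \<phi>" "v \<in> carrier_vec n"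
  shows "the_inv_into (fibre E z) \<phi> v \<in> fibre E z" "\<phi> (the_inv_into (fibre E z) \<phi> v) = v"
  using assms unfolding fibre_coords_def bij_betw_def
  by (metis the_inv_into_into subset_refl, metis f_the_inv_into_f)

lemma fibre_coords_inv_linear:
  assumes f: "fibre_coords E n z \<phi>" and u: "u \<in> carrier_vec n" and v: "v \<in> carrier_vec n"
  shows "the_inv_into (fibre E z) \<phi> (u + v) = vadd E (the_inv_into (fibre E z) \<phi> u) (the_inv_into (fibre E z) \<phi> v)"
    "the_inv_into (fibre E z) \<phi> (c \<cdot>\<^sub>v u) = vscale E c (the_inv_into (fibre E z) \<phi> u)"
proof -
  note iu = fibre_coords_inv[OF f u] and iv = fibre_coords_inv[OF f v]
  have "\<phi> (vadd E (the_inv_into (fibre E z) \<phi> u) (the_inv_into (fibre E z) \<phi> v)) = u + v"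
    using fibre_coordsD(4)[OF f iu(1) iv(1)] iu iv by simp
  then show "the_inv_into (fibre E z) \<phi> (u + v) = vadd E (the_inv_into (fibre E z) \<phi> u) (the_inv_into (fibre E z) \<phi> v)"
    using fibre_coordsD(2)[OF f fibre_coordsD(3)[OF f iu(1) iv(1)]] by simp
  have "\<phi> (vscale E c (the_inv_into (fibre E z) \<phi> u)) = c \<cdot>\<^sub>v u"
    using fibre_coordsD(6)[OF f iu(1)] iu by simp
  then show "the_inv_into (fibre E z) \<phi> (c \<cdot>\<^sub>v u) = vscale E c (the_inv_into (fibre E z) \<phi> u)"
    using fibre_coordsD(2)[OF f fibre_coordsD(5)[OF f iu(1)]] by metis
qed

definition hol_section :: "('e, 'm) vbundle_scheme \<Rightarrow> nat \<Rightarrow> complex set \<Rightarrow> (complex \<Rightarrow> 'e) \<Rightarrow> bool" where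
  "hol_section E n U s \<longleftrightarrow> (\<forall>(V, \<phi>)\<in>charts E. \<forall>i<n. (\<lambda>z. \<phi> (s z) $ i) holomorphic_on U \<inter> V)"

text \<open>Holomorphic induction with a given identification \<open>\<iota>\<close> of the fibre over \<open>0\<close> with the representation
  space: intertwiners and inner products have to be expressed in these coordinates.\<close>

definition induced_via :: "('e, 'm) hom_vbundle_scheme \<Rightarrow> nat \<Rightarrow> complex mat \<Rightarrow> complex mat \<Rightarrow>
    ('e \<Rightarrow> complex vec) \<Rightarrow> bool" where
  "induced_via E n \<rho>h \<rho>y \<iota> \<longleftrightarrow> fibre_coords E n 0 \<iota> \<and>
     (\<forall>U s. open U \<and> U \<subseteq> disc \<and> (\<forall>z\<in>U. s z \<in> fibre E z) \<longrightarrow>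
        (hol_section E n U s \<longleftrightarrow> induced_lift n \<rho>h \<rho>y {g. gt_act g 0 \<in> U} (section_lift E \<iota> s)))"

lemma induced_viaD:
  assumes "induced_via E n \<rho>h \<rho>y \<iota>" "open U" "U \<subseteq> disc" "\<forall>z\<in>U. s z \<in> fibre E z"
  shows "hol_section E n U s \<longleftrightarrow> induced_lift n \<rho>h \<rho>y {g. gt_act g 0 \<in> U} (section_lift E \<iota> s)"
  using assms unfolding induced_via_def by blast

lemma hol_induced_from_via:
  "hol_induced_from E n \<rho>h \<rho>y \<longleftrightarrow> b_rep n \<rho>h \<rho>y \<and> (\<exists>\<iota>. induced_via E n \<rho>h \<rho>y \<iota>)"
  by (simp add: hol_induced_from_def induced_via_def hol_section_def)

lemma vbundle_chart_at:
  assumes "hol_vbundle E n" "z \<in> disc"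
  obtains U \<phi> where "(U, \<phi>) \<in> charts E" "z \<in> U" "open U" "U \<subseteq> disc" "fibre_coords E n z \<phi>"
proof -
  have "z \<in> \<Union> (fst ` charts E)" using assms unfolding hol_vbundle_def by blast
  then obtain U \<phi> where c: "(U, \<phi>) \<in> charts E" "z \<in> U" by auto
  then have "local_triv E n (U, \<phi>)" using assms unfolding hol_vbundle_def by blast
  then show ?thesis using c by (intro that[of U \<phi>]) (auto simp: local_triv_def)
qed

lemma local_trivD: "local_triv E n (U, \<phi>) \<Longrightarrow> z \<in> U \<Longrightarrow> fibre_coords E n z \<phi>"
  by (simp add: local_triv_def)

lemma chart_fibre_coords: "hol_vbundle E n \<Longrightarrow> (U, \<phi>) \<in> charts E \<Longrightarrow> z \<in> U \<Longrightarrow> fibre_coords E n z \<phi>"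
  unfolding hol_vbundle_def using local_trivD by fast

text \<open>In another chart, the coordinates of a section with constant coordinates are linear combinations of the
  transition functions.\<close>

lemma hol_section_constant:
  assumes E: "hol_vbundle E n" and U: "local_triv E n (U, \<phi>)"
    and tr: "\<And>A. A \<in> charts E \<Longrightarrow> hol_transition E n (U, \<phi>) A" and v: "v \<in> carrier_vec n"
    and s: "\<And>z. z \<in> U \<Longrightarrow> s z = the_inv_into (fibre E z) \<phi> v"
  shows "hol_section E n U s"
  unfolding hol_section_def
proof clarify
  fix V \<psi> i assume c: "(V, \<psi>) \<in> charts E" and i: "i < n"
  have "\<psi> (s z) $ i = (\<Sum>j<n. v $ j * \<psi> (frame E n \<phi> z j) $ i)" if z: "z \<in> U \<inter> V" for z
  proof -
    have f: "fibre_coords E n z \<phi>" "fibre_coords E n z \<psi>"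
      using local_trivD[OF U] chart_fibre_coords[OF E c] z by auto
    have "\<psi> (the_inv_into (fibre E z) \<phi> v) $ i = (\<Sum>j<n. v $ j * \<psi> (the_inv_into (fibre E z) \<phi> (unit_vec n j)) $ i)"
    proof (rule linear_functional_sum[OF _ _ v])
      fix u w :: "complex vec" assume uw: "u \<in> carrier_vec n" "w \<in> carrier_vec n"
      show "\<psi> (the_inv_into (fibre E z) \<phi> (u + w)) $ i =
          \<psi> (the_inv_into (fibre E z) \<phi> u) $ i + \<psi> (the_inv_into (fibre E z) \<phi> w) $ i"
        using fibre_coords_inv_linear(1)[OF f(1) uw] fibre_coords_inv(1)[OF f(1) uw(1)] fibre_coords_inv(1)[OF f(1) uw(2)]
          fibre_coordsD(1,4)[OF f(2)] i by (simp add: carrier_vecD[of _ n])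
      show "\<psi> (the_inv_into (fibre E z) \<phi> (c \<cdot>\<^sub>v u)) $ i = c * \<psi> (the_inv_into (fibre E z) \<phi> u) $ i" for c
        using fibre_coords_inv_linear(2)[OF f(1) uw(1) uw(1)] fibre_coords_inv(1)[OF f(1) uw(1)]
          fibre_coordsD(1,6)[OF f(2)] i by (simp add: carrier_vecD[of _ n])
    qed
    then show ?thesis using s z by (simp add: frame_def)
  qed
  moreover have "(\<lambda>z. \<Sum>j<n. v $ j * \<psi> (frame E n \<phi> z j) $ i) holomorphic_on U \<inter> V"
    using tr[OF c] i unfolding hol_transition_def by (intro holomorphic_intros) auto
  ultimately show "(\<lambda>z. \<psi> (s z) $ i) holomorphic_on U \<inter> V"
    using holomorphic_transform by (metis (no_types, lifting))
qed

lemma fibre_nonempty: "hol_vbundle E n \<Longrightarrow> z \<in> disc \<Longrightarrow> \<exists>e. e \<in> fibre E z"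
  using vbundle_chart_at fibre_coords_inv(1)[OF _ zero_carrier_vec] by metis

lemma hol_section_through:
  assumes E: "hol_vbundle E n" and z: "z0 \<in> disc" and e: "e \<in> fibre E z0"
  obtains U s where "open U" "z0 \<in> U" "U \<subseteq> disc" "hol_section E n U s" "s z0 = e" "\<forall>z\<in>disc. s z \<in> fibre E z"
proof -
  obtain U \<phi> where c: "(U, \<phi>) \<in> charts E" "z0 \<in> U" "open U" "U \<subseteq> disc" "fibre_coords E n z0 \<phi>"
    using vbundle_chart_at[OF E z] .
  define s where "s z = (if z \<in> U then the_inv_into (fibre E z) \<phi> (\<phi> e) else (SOME e. e \<in> fibre E z))" for z
  have v: "\<phi> e \<in> carrier_vec n" using fibre_coordsD(1)[OF c(5) e] .
  have "hol_section E n U s"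
    by (rule hol_section_constant[OF E _ _ v]) (use E c(1) in \<open>auto simp: hol_vbundle_def s_def\<close>)
  moreover have "s z0 = e" using c fibre_coordsD(2)[OF c(5) e] by (simp add: s_def)
  moreover have "s z \<in> fibre E z" if "z \<in> disc" for z
    using fibre_coords_inv(1)[OF chart_fibre_coords[OF E c(1)] v] someI_ex[OF fibre_nonempty[OF E that]]
    by (auto simp: s_def)
  ultimately show ?thesis using that c by blast
qed

lemma hom_hol_vbundle_bundle: "hom_hol_vbundle E n \<Longrightarrow> hol_vbundle E n"
  by (simp add: hom_hol_vbundle_def)

lemma bact_fibre:
  assumes E: "hom_hol_vbundle E n" and z: "z \<in> disc" and u: "u \<in> fibre E z"
  shows "bact E g u \<in> fibre E (gt_act g z)"
    "v \<in> fibre E z \<Longrightarrow> bact E g (vadd E u v) = vadd E (bact E g u) (bact E g v)"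
    "bact E g (vscale E c u) = vscale E c (bact E g u)"
  using assms unfolding hom_hol_vbundle_def hol_bundle_map_def by blast+

lemma bact_mult:
  assumes E: "hom_hol_vbundle E n" and u: "u \<in> fibre E z"
  shows "bact E (gt_mult g h) u = bact E g (bact E h u)" "bact E gt_one u = u"
    "bact E (gt_inv g) (bact E g u) = u" "bact E g (bact E (gt_inv g) u) = u"
proof -
  have t: "u \<in> total E" using u by (simp add: fibre_def)
  show m: "bact E (gt_mult g h) u = bact E g (bact E h u)" for g h using E t unfolding hom_hol_vbundle_def by blast
  show o: "bact E gt_one u = u" using E t unfolding hom_hol_vbundle_def by blast
  show "bact E (gt_inv g) (bact E g u) = u" "bact E g (bact E (gt_inv g) u) = u"
    using m[of "gt_inv g" g] m[of g "gt_inv g"] o by (simp_all add: gt_mult_inv gt_mult_inv_right)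
qed

lemma gt_inv_one: "gt_inv gt_one = gt_one"
  by (simp add: gt_inv_def gt_one_def)

lemma gt_inv_exp_ih: "gt_inv (gt_exp_ih t) = gt_exp_ih (- t)"
  by (simp add: gt_inv_def gt_exp_ih_def)

lemma gt_inv_mult: "gt_inv (gt_mult g h) = gt_mult (gt_inv h) (gt_inv g)"
proof -
  have "gt_mult (gt_mult (gt_inv h) (gt_inv g)) (gt_mult g h) = gt_one"
    by (metis gt_mult_assoc gt_mult_inv gt_mult_one(1))
  then show ?thesis by (metis gt_mult_assoc gt_mult_inv_right gt_mult_one)
qed

lemma section_lift_fibre:
  assumes E: "hom_hol_vbundle E n" and i: "fibre_coords E n 0 \<iota>" and s: "s (gt_act g 0) \<in> fibre E (gt_act g 0)"
  shows "bact E (gt_inv g) (s (gt_act g 0)) \<in> fibre E 0" "section_lift E \<iota> s g \<in> carrier_vec n"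
proof -
  have "bact E (gt_inv g) (s (gt_act g 0)) \<in> fibre E (gt_act (gt_inv g) (gt_act g 0))"
    by (rule bact_fibre(1)[OF E gt_act_disc s]) simp
  then show 1: "bact E (gt_inv g) (s (gt_act g 0)) \<in> fibre E 0" by (simp add: gt_act_inv)
  show "section_lift E \<iota> s g \<in> carrier_vec n" unfolding section_lift_def by (rule fibre_coordsD(1)[OF i 1])
qed

text \<open>The lift of a holomorphic section through a given vector of the fibre over \<open>0\<close> recovers the
  representation from the bundle.\<close>

lemma induced_viaE:
  assumes E: "hom_hol_vbundle E n" and i: "induced_via E n \<rho>h \<rho>y \<iota>" and e: "e \<in> fibre E 0"
  obtains U s where "open U" "0 \<in> U" "U \<subseteq> disc" "hol_section E n U s" "s 0 = e" "\<forall>z\<in>disc. s z \<in> fibre E z"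
    "induced_lift n \<rho>h \<rho>y {g. gt_act g 0 \<in> U} (section_lift E \<iota> s)" "section_lift E \<iota> s gt_one = \<iota> e"
proof -
  have z: "0 \<in> disc" by simp
  obtain U s where s: "open U" "0 \<in> U" "U \<subseteq> disc" "hol_section E n U s" "s 0 = e" "\<forall>z\<in>disc. s z \<in> fibre E z"
    using hol_section_through[OF hom_hol_vbundle_bundle[OF E] z e] .
  have "\<forall>z\<in>U. s z \<in> fibre E z" using s by auto
  then have "induced_lift n \<rho>h \<rho>y {g. gt_act g 0 \<in> U} (section_lift E \<iota> s)"
    using i s unfolding induced_via_def by blast
  moreover have "section_lift E \<iota> s gt_one = \<iota> e"
    using s(5) bact_mult(2)[OF E e] by (simp add: section_lift_def gt_inv_one gt_act_one)
  ultimately show ?thesis using that s by blast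
qed

lemma induced_via_coords: "induced_via E n \<rho>h \<rho>y \<iota> \<Longrightarrow> fibre_coords E n 0 \<iota>"
  by (simp add: induced_via_def)

text \<open>The equivariance of a lift, read at the identity, describes the action of the stabilizer on the fibre.\<close>

lemma induced_via_stabilizer:
  assumes E: "hom_hol_vbundle E n" and i: "induced_via E n \<rho>h \<rho>y \<iota>" and e: "e \<in> fibre E 0"
  shows "\<iota> (bact E (gt_exp_ih t) e) = mat_exp ((\<i> * of_real t) \<cdot>\<^sub>m \<rho>h) *\<^sub>v \<iota> e"
proof -
  obtain U s where s: "0 \<in> U" "s 0 = e" "induced_lift n \<rho>h \<rho>y {g. gt_act g 0 \<in> U} (section_lift E \<iota> s)"
    "section_lift E \<iota> s gt_one = \<iota> e"
    using induced_viaE[OF E i e] by metis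
  have "section_lift E \<iota> s (gt_mult gt_one (gt_exp_ih (- t)))
      = mat_exp ((- \<i> * of_real (- t)) \<cdot>\<^sub>m \<rho>h) *\<^sub>v section_lift E \<iota> s gt_one"
    using s(1,3) gt_act_one[of 0] unfolding induced_lift_def by (metis (no_types, lifting) mem_Collect_eq)
  then show ?thesis using s(2,4) by (simp add: section_lift_def gt_inv_exp_ih)
qed

text \<open>If the linear combination vanishes on \<open>\<Omega>\<close>, then so do the left hand sides. A linear relation between the
  components of a lift \<open>F\<close> therefore also holds for \<open>\<rho>(h) F\<close> and \<open>\<rho>(y) F\<close>.\<close>

lemma lift_relation:
  assumes F: "induced_lift n \<rho>h \<rho>y \<Omega> F" and g: "g \<in> \<Omega>"
  shows "lie_h (\<lambda>g. \<Sum>j<n. a j * F g $ j) g = - (\<Sum>j<n. a j * (\<rho>h *\<^sub>v F g) $ j)"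
    "lie_y (\<lambda>g. \<Sum>j<n. a j * F g $ j) g = - (\<Sum>j<n. a j * (\<rho>y *\<^sub>v F g) $ j)"
proof -
  have d: "(\<lambda>g. F g $ j) differentiable (at g)" if "j \<in> {..<n}" for j
    using F g that smooth_on_differentiable unfolding induced_lift_def by blast
  have h: "lie_h (\<lambda>g. F g $ j) g = - (\<rho>h *\<^sub>v F g) $ j" if "j < n" for j
    using F g that unfolding induced_lift_def by blast
  have y: "lie_y (\<lambda>g. F g $ j) g = - (\<rho>y *\<^sub>v F g) $ j" if "j < n" for j
    using F g that unfolding induced_lift_def by blast
  show "lie_h (\<lambda>g. \<Sum>j<n. a j * F g $ j) g = - (\<Sum>j<n. a j * (\<rho>h *\<^sub>v F g) $ j)"
  proof -
    have "lie_h (\<lambda>g. \<Sum>j<n. a j * F g $ j) g = (\<Sum>j<n. a j * lie_h (\<lambda>g. F g $ j) g)"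
      by (rule lie_h_sum[of "{..<n}" "\<lambda>j g. F g $ j"]) (rule d)
    then show ?thesis using h by (simp add: sum_negf del: index_mult_mat_vec)
  qed
  show "lie_y (\<lambda>g. \<Sum>j<n. a j * F g $ j) g = - (\<Sum>j<n. a j * (\<rho>y *\<^sub>v F g) $ j)"
  proof -
    have "lie_y (\<lambda>g. \<Sum>j<n. a j * F g $ j) g = (\<Sum>j<n. a j * lie_y (\<lambda>g. F g $ j) g)"
      by (rule lie_y_sum[of "{..<n}" "\<lambda>j g. F g $ j"]) (rule d)
    then show ?thesis using y by (simp add: sum_negf del: index_mult_mat_vec)
  qed
qed

section \<open>Change of coordinates in the fibre over the origin\<close>

lemma induced_lift_intertwine:
  assumes W: "open \<Omega>" and F: "induced_lift n \<rho>h \<rho>y \<Omega> F"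
    and c: "\<rho>h \<in> carrier_mat n n" "\<rho>y \<in> carrier_mat n n" "\<rho>h' \<in> carrier_mat n n" "\<rho>y' \<in> carrier_mat n n" "B \<in> carrier_mat n n"
    and h: "\<rho>h' * B = B * \<rho>h" and y: "\<rho>y' * B = B * \<rho>y"
    and ex: "\<And>t. mat_exp ((- \<i> * of_real t) \<cdot>\<^sub>m \<rho>h') * B = B * mat_exp ((- \<i> * of_real t) \<cdot>\<^sub>m \<rho>h)"
  shows "induced_lift n \<rho>h' \<rho>y' \<Omega> (\<lambda>g. B *\<^sub>v F g)"
proof -
  have Fc: "F g \<in> carrier_vec n" if "g \<in> \<Omega>" for g using F that unfolding induced_lift_def by blast
  have Fi: "(B *\<^sub>v F g) $ i = (\<Sum>j<n. B $$ (i, j) * F g $ j)" if "g \<in> \<Omega>" "i < n" for g i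
    by (rule mult_mat_vec_sum[OF c(5) Fc[OF that(1)] that(2)])
  have me: "mat_exp (x \<cdot>\<^sub>m M) \<in> carrier_mat n n" if "M \<in> carrier_mat n n" for x M
    using that by (simp add: mat_exp_def)
  have eqv: "F (gt_mult g (gt_exp_ih t)) = mat_exp ((- \<i> * of_real t) \<cdot>\<^sub>m \<rho>h) *\<^sub>v F g" if "g \<in> \<Omega>" for g t
    using F that unfolding induced_lift_def by blast
  have sm: "smooth_on \<Omega> (\<lambda>g. F g $ j)" if "j < n" for j using F that unfolding induced_lift_def by blast
  show ?thesis
    unfolding induced_lift_def
  proof (intro conjI ballI allI impI)
    fix g assume g: "g \<in> \<Omega>"
    show "B *\<^sub>v F g \<in> carrier_vec n" using c Fc[OF g] by simp
    fix t
    show "B *\<^sub>v F (gt_mult g (gt_exp_ih t)) = mat_exp ((- \<i> * of_real t) \<cdot>\<^sub>m \<rho>h') *\<^sub>v (B *\<^sub>v F g)"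
      unfolding eqv[OF g] assoc_mult_mat_vec[OF me[OF c(3)] c(5) Fc[OF g], symmetric] ex
      by (rule assoc_mult_mat_vec[OF c(5) me[OF c(1)] Fc[OF g], symmetric])
  next
    fix i assume i: "i < n"
    have "smooth_on \<Omega> (\<lambda>g. \<Sum>j<n. B $$ (i, j) * F g $ j)"
      by (intro smooth_intros W sm) auto
    moreover have "smooth_on \<Omega> (\<lambda>g. (B *\<^sub>v F g) $ i) = smooth_on \<Omega> (\<lambda>g. \<Sum>j<n. B $$ (i, j) * F g $ j)"
      by (rule smooth_on_cong[OF W]) (rule Fi[OF _ i])
    ultimately show "smooth_on \<Omega> (\<lambda>g. (B *\<^sub>v F g) $ i)" by (simp only:)
  next
    fix g i assume g: "g \<in> \<Omega>" and i: "i < n"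
    have k: "(\<rho>' *\<^sub>v (B *\<^sub>v F g)) $ i = (\<Sum>j<n. B $$ (i, j) * (\<rho> *\<^sub>v F g) $ j)"
      if "\<rho> \<in> carrier_mat n n" "\<rho>' \<in> carrier_mat n n" "\<rho>' * B = B * \<rho>" for \<rho> \<rho>'
    proof -
      have "\<rho>' *\<^sub>v (B *\<^sub>v F g) = B *\<^sub>v (\<rho> *\<^sub>v F g)"
        using assoc_mult_mat_vec[OF that(2) c(5) Fc[OF g]] assoc_mult_mat_vec[OF c(5) that(1) Fc[OF g]] that(3) by simp
      then show ?thesis using mult_mat_vec_sum[OF c(5) _ i, of "\<rho> *\<^sub>v F g"] that Fc[OF g] by simp
    qed
    have "lie_h (\<lambda>g. (B *\<^sub>v F g) $ i) g = lie_h (\<lambda>g. \<Sum>j<n. B $$ (i, j) * F g $ j) g"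
      by (rule lie_cong(1)[OF W g]) (rule Fi[OF _ i])
    then show "lie_h (\<lambda>g. (B *\<^sub>v F g) $ i) g = - (\<rho>h' *\<^sub>v (B *\<^sub>v F g)) $ i"
      unfolding lift_relation(1)[OF F g] k[OF c(1,3) h] .
    have "lie_y (\<lambda>g. (B *\<^sub>v F g) $ i) g = lie_y (\<lambda>g. \<Sum>j<n. B $$ (i, j) * F g $ j) g"
      by (rule lie_cong(2)[OF W g]) (rule Fi[OF _ i])
    then show "lie_y (\<lambda>g. (B *\<^sub>v F g) $ i) g = - (\<rho>y' *\<^sub>v (B *\<^sub>v F g)) $ i"
      unfolding lift_relation(2)[OF F g] k[OF c(2,4) y] .
  qed
qed

lemma mat_intertwine_inverse:
  fixes B Q M M' :: "complex mat"
  assumes "B \<in> carrier_mat n n" "Q \<in> carrier_mat n n" "B * Q = 1\<^sub>m n" "Q * B = 1\<^sub>m n"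
    "M \<in> carrier_mat n n" "M' \<in> carrier_mat n n" "M' * B = B * M"
  shows "M * Q = Q * M'"
proof -
  have "M * Q = (Q * B) * (M * Q)" using assms by simp
  also have "\<dots> = Q * ((B * M) * Q)"
    using assms(1,2,5) by (simp add: assoc_mult_mat[of _ n n _ n _ n])
  also have "(B * M) * Q = M' * (B * Q)"
    unfolding assms(7)[symmetric] using assms(1,2,6) by (simp add: assoc_mult_mat[of _ n n _ n _ n])
  finally show ?thesis using assms by simp
qed

lemma fibre_coords_change:
  assumes ic: "fibre_coords E n z \<phi>" and B: "B \<in> carrier_mat n n" "Q \<in> carrier_mat n n" "B * Q = 1\<^sub>m n" "Q * B = 1\<^sub>m n"
  shows "fibre_coords E n z (\<lambda>e. B *\<^sub>v \<phi> e)"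
  unfolding fibre_coords_def
proof (intro conjI ballI allI)
  have QB: "Q *\<^sub>v (B *\<^sub>v v) = v" "B *\<^sub>v (Q *\<^sub>v v) = v" if "v \<in> carrier_vec n" for v
    using that B by (simp_all flip: assoc_mult_mat_vec)
  have bij: "bij_betw (\<lambda>v. B *\<^sub>v v) (carrier_vec n) (carrier_vec n)"
    by (rule bij_betw_byWitness[where f' = "\<lambda>v. Q *\<^sub>v v"]) (use QB B in auto)
  have "bij_betw \<phi> (fibre E z) (carrier_vec n)" using ic by (simp add: fibre_coords_def)
  from bij_betw_trans[OF this bij] show "bij_betw (\<lambda>e. B *\<^sub>v \<phi> e) (fibre E z) (carrier_vec n)" by (simp add: o_def)
  fix u assume u: "u \<in> fibre E z"
  show "B *\<^sub>v \<phi> (vscale E x u) = x \<cdot>\<^sub>v (B *\<^sub>v \<phi> u)" "vscale E x u \<in> fibre E z" for x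
    using fibre_coordsD(1,5,6)[OF ic u] by (simp_all add: mult_mat_vec[OF B(1)])
  fix v assume v: "v \<in> fibre E z"
  show "B *\<^sub>v \<phi> (vadd E u v) = B *\<^sub>v \<phi> u + B *\<^sub>v \<phi> v" "vadd E u v \<in> fibre E z"
    using fibre_coordsD(3,4)[OF ic u v] fibre_coordsD(1)[OF ic u] fibre_coordsD(1)[OF ic v]
    by (simp_all add: mult_add_distrib_mat_vec[OF B(1)])
qed

lemma induced_via_change:
  assumes E: "hom_hol_vbundle E n" and i: "induced_via E n \<rho>h \<rho>y \<iota>"
    and c: "\<rho>h \<in> carrier_mat n n" "\<rho>y \<in> carrier_mat n n" "\<rho>h' \<in> carrier_mat n n" "\<rho>y' \<in> carrier_mat n n"
    and B: "B \<in> carrier_mat n n" "Q \<in> carrier_mat n n" "B * Q = 1\<^sub>m n" "Q * B = 1\<^sub>m n"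
    and h: "\<rho>h' * B = B * \<rho>h" and y: "\<rho>y' * B = B * \<rho>y"
    and ex: "\<And>t. mat_exp ((- \<i> * of_real t) \<cdot>\<^sub>m \<rho>h') * B = B * mat_exp ((- \<i> * of_real t) \<cdot>\<^sub>m \<rho>h)"
  shows "induced_via E n \<rho>h' \<rho>y' (\<lambda>e. B *\<^sub>v \<iota> e)"
  unfolding induced_via_def
proof (intro conjI allI impI)
  note ic = induced_via_coords[OF i]
  have QB: "Q *\<^sub>v (B *\<^sub>v v) = v" "B *\<^sub>v (Q *\<^sub>v v) = v" if "v \<in> carrier_vec n" for v
    using that B by (simp_all flip: assoc_mult_mat_vec)
  show "fibre_coords E n 0 (\<lambda>e. B *\<^sub>v \<iota> e)" by (rule fibre_coords_change[OF ic B])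
  fix U s assume s: "open U \<and> U \<subseteq> disc \<and> (\<forall>z\<in>U. s z \<in> fibre E z)"
  let ?W = "{g. gt_act g 0 \<in> U}"
  have W: "open ?W" using open_gt_act_0 s by blast
  let ?F = "section_lift E \<iota> s"
  have sl: "section_lift E (\<lambda>e. B *\<^sub>v \<iota> e) s = (\<lambda>g. B *\<^sub>v ?F g)" by (simp add: section_lift_def fun_eq_iff)
  have me: "mat_exp (x \<cdot>\<^sub>m M) \<in> carrier_mat n n" if "M \<in> carrier_mat n n" for x M
    using that by (simp add: mat_exp_def)
  have "induced_lift n \<rho>h \<rho>y ?W ?F \<longleftrightarrow> induced_lift n \<rho>h' \<rho>y' ?W (\<lambda>g. B *\<^sub>v ?F g)"
  proof
    assume "induced_lift n \<rho>h \<rho>y ?W ?F"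
    then show "induced_lift n \<rho>h' \<rho>y' ?W (\<lambda>g. B *\<^sub>v ?F g)"
      by (rule induced_lift_intertwine[OF W _ c B(1) h y ex])
  next
    assume "induced_lift n \<rho>h' \<rho>y' ?W (\<lambda>g. B *\<^sub>v ?F g)"
    then have "induced_lift n \<rho>h \<rho>y ?W (\<lambda>g. Q *\<^sub>v (B *\<^sub>v ?F g))"
      by (rule induced_lift_intertwine[OF W _ c(3,4,1,2) B(2)])
        (intro mat_intertwine_inverse[OF B] c h y ex me)+
    moreover have "Q *\<^sub>v (B *\<^sub>v ?F g) = ?F g" if "gt_act g 0 \<in> U" for g
      using QB(1) section_lift_fibre(2)[OF E ic] s that by blast
    ultimately show "induced_lift n \<rho>h \<rho>y ?W ?F"
      using induced_lift_cong[of U "\<lambda>g. Q *\<^sub>v (B *\<^sub>v ?F g)" ?F] s by blast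
  qed
  then show "hol_section E n U s = induced_lift n \<rho>h' \<rho>y' ?W (section_lift E (\<lambda>e. B *\<^sub>v \<iota> e) s)"
    unfolding sl using i s unfolding induced_via_def by blast
qed

definition diagonal :: "nat \<Rightarrow> (nat \<Rightarrow> complex) \<Rightarrow> complex mat" where
  "diagonal n d = mat n n (\<lambda>(i, j). if i = j then d i else 0)"

lemma diagonal_carrier [simp]: "diagonal n d \<in> carrier_mat n n" "dim_row (diagonal n d) = n" "dim_col (diagonal n d) = n"
  by (simp_all add: diagonal_def)

lemma diagonal_mult_index:
  assumes "i < n" "j < n" "A \<in> carrier_mat n n"
  shows "(diagonal n d * A) $$ (i, j) = d i * A $$ (i, j)" "(A * diagonal n d) $$ (i, j) = A $$ (i, j) * d j"
proof -
  have "(diagonal n d * A) $$ (i, j) = (\<Sum>q<n. diagonal n d $$ (i, q) * A $$ (q, j))"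
    by (rule mult_mat_sum[OF diagonal_carrier(1) assms(3,1,2)])
  also have "\<dots> = (\<Sum>q<n. if q = i then d i * A $$ (i, j) else 0)"
    using assms by (intro sum.cong) (auto simp: diagonal_def)
  finally show "(diagonal n d * A) $$ (i, j) = d i * A $$ (i, j)" using assms by simp
  have "(A * diagonal n d) $$ (i, j) = (\<Sum>q<n. A $$ (i, q) * diagonal n d $$ (q, j))"
    by (rule mult_mat_sum[OF assms(3) diagonal_carrier(1) assms(1,2)])
  also have "\<dots> = (\<Sum>q<n. if q = j then A $$ (i, j) * d j else 0)"
    using assms by (intro sum.cong) (auto simp: diagonal_def)
  finally show "(A * diagonal n d) $$ (i, j) = A $$ (i, j) * d j" using assms by simp
qed

lemma diagonal_mult_vec:
  assumes "i < n" "v \<in> carrier_vec n"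
  shows "(diagonal n d *\<^sub>v v) $ i = d i * v $ i"
proof -
  have "(diagonal n d *\<^sub>v v) $ i = (\<Sum>q<n. if q = i then d i * v $ i else 0)"
    unfolding mult_mat_vec_sum[OF diagonal_carrier(1) assms(2,1)]
    using assms by (intro sum.cong) (auto simp: diagonal_def)
  then show ?thesis using assms by simp
qed

text \<open>Entrywise, the exponential series is a linear combination of the scalar series of the eigenvalues.\<close>

lemma mat_exp_diagonalizable:
  assumes Q: "Q \<in> carrier_mat n n" and B: "B \<in> carrier_mat n n" and BQ: "B * Q = 1\<^sub>m n" "Q * B = 1\<^sub>m n"
    and A: "A = Q * diagonal n d * B"
  shows "mat_exp (c \<cdot>\<^sub>m A) = Q * diagonal n (\<lambda>i. exp (c * d i)) * B"
proof -
  have Ac: "A \<in> carrier_mat n n" using A Q B by auto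
  have pw: "(c \<cdot>\<^sub>m A) ^\<^sub>m k = Q * diagonal n (\<lambda>i. (c * d i) ^ k) * B" for k
  proof (induction k)
    case 0
    have "diagonal n (\<lambda>i. 1) = 1\<^sub>m n" by (rule eq_matI) (auto simp: diagonal_def)
    then show ?case using Q B BQ Ac by simp
  next
    case (Suc k)
    let ?D = "diagonal n (\<lambda>i. (c * d i) ^ k)"
    have "c \<cdot>\<^sub>m A = Q * (diagonal n (\<lambda>i. c * d i)) * B"
    proof -
      have "c \<cdot>\<^sub>m diagonal n d = diagonal n (\<lambda>i. c * d i)" by (rule eq_matI) (auto simp: diagonal_def)
      then show ?thesis unfolding A using Q B
        by (metis diagonal_carrier(1) mult_carrier_mat mult_smult_assoc_mat mult_smult_distrib)
    qed
    then have "(c \<cdot>\<^sub>m A) ^\<^sub>m Suc k = (Q * ?D * B) * (Q * diagonal n (\<lambda>i. c * d i) * B)" using Suc by simp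
    also have "\<dots> = Q * (?D * ((B * Q) * diagonal n (\<lambda>i. c * d i))) * B"
      using Q B by (simp add: assoc_mult_mat[of _ n n _ n _ n] mult_carrier_mat[of _ n n _ n])
    also have "?D * ((B * Q) * diagonal n (\<lambda>i. c * d i)) = diagonal n (\<lambda>i. (c * d i) ^ Suc k)"
      using BQ by (intro eq_matI) (auto simp: diagonal_mult_index simp del: index_mult_mat(1), auto simp: diagonal_def)
    finally show ?case .
  qed
  have ent: "(Q * diagonal n e * B) $$ (i, j) = (\<Sum>a<n. Q $$ (i, a) * B $$ (a, j) * e a)" if "i < n" "j < n" for e i j
  proof -
    have "(Q * diagonal n e * B) $$ (i, j) = (\<Sum>a<n. (Q * diagonal n e) $$ (i, a) * B $$ (a, j))"
      using Q by (intro mult_mat_sum[OF _ B that]) auto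
    then show ?thesis using that Q by (simp add: diagonal_mult_index mult.commute mult.left_commute del: index_mult_mat(1))
  qed
  have exp_sums: "(\<lambda>k. x ^ k / fact k) sums exp x" for x :: complex
    using exp_converges[of x] by (simp add: scaleR_conv_of_real divide_inverse mult.commute)
  show ?thesis
  proof (rule eq_matI)
    fix i j assume "i < dim_row (Q * diagonal n (\<lambda>i. exp (c * d i)) * B)" "j < dim_col (Q * diagonal n (\<lambda>i. exp (c * d i)) * B)"
    then have ij: "i < n" "j < n" using Q B by auto
    have "(\<lambda>k. (\<Sum>a<n. Q $$ (i, a) * B $$ (a, j) * ((c * d a) ^ k / fact k))) sums
        (\<Sum>a<n. Q $$ (i, a) * B $$ (a, j) * exp (c * d a))"
      by (intro sums_sum sums_mult exp_sums)
    moreover have "(\<Sum>a<n. Q $$ (i, a) * B $$ (a, j) * ((c * d a) ^ k / fact k)) = ((c \<cdot>\<^sub>m A) ^\<^sub>m k) $$ (i, j) / fact k" for k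
      unfolding pw ent[OF ij] by (simp add: sum_divide_distrib)
    ultimately have "(\<lambda>k. ((c \<cdot>\<^sub>m A) ^\<^sub>m k) $$ (i, j) / fact k) sums (\<Sum>a<n. Q $$ (i, a) * B $$ (a, j) * exp (c * d a))"
      by simp
    then show "mat_exp (c \<cdot>\<^sub>m A) $$ (i, j) = (Q * diagonal n (\<lambda>i. exp (c * d i)) * B) $$ (i, j)"
      unfolding ent[OF ij] using ij Ac by (simp add: mat_exp_def sums_iff)
  qed (use Q B Ac in \<open>auto simp: mat_exp_def\<close>)
qed

lemma mat_exp_diagonal: "mat_exp (c \<cdot>\<^sub>m diagonal n d) = diagonal n (\<lambda>i. exp (c * d i))"
  using mat_exp_diagonalizable[of "1\<^sub>m n" n "1\<^sub>m n" "diagonal n d" d c] by simp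

section \<open>The inner product on the fibre over the origin\<close>

definition fibre_form :: "('e, 'm) hom_herm_vbundle_scheme \<Rightarrow> ('e \<Rightarrow> complex vec) \<Rightarrow> complex vec \<Rightarrow> complex vec \<Rightarrow> complex" where
  "fibre_form E \<iota> u v = herm E (the_inv_into (fibre E 0) \<iota> u) (the_inv_into (fibre E 0) \<iota> v)"

lemma herm_bundle_hom: "hom_hol_herm_vbundle E n \<Longrightarrow> hom_hol_vbundle E n"
  by (simp add: hom_hol_herm_vbundle_def)

lemma fibre_form_inner:
  assumes E: "hom_hol_herm_vbundle E n" and i: "fibre_coords E n 0 \<iota>"
  shows "inner_form n (fibre_form E \<iota>)"
  unfolding inner_form_def
proof (intro conjI ballI allI impI)
  have hs: "herm_structure E n" using E by (simp add: hom_hol_herm_vbundle_def)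
  have z: "0 \<in> disc" by simp
  let ?j = "the_inv_into (fibre E 0) \<iota>"
  note a = hs[unfolded herm_structure_def, THEN conjunct1, rule_format, OF z]
  fix u v :: "complex vec" assume u: "u \<in> carrier_vec n" and v: "v \<in> carrier_vec n"
  note ju = fibre_coords_inv[OF i u] and jv = fibre_coords_inv[OF i v]
  show "fibre_form E \<iota> v u = cnj (fibre_form E \<iota> u v)"
    using a[OF ju(1) jv(1)] unfolding fibre_form_def by blast
  show "fibre_form E \<iota> (c \<cdot>\<^sub>v u) v = c * fibre_form E \<iota> u v" for c
    using a[OF ju(1) jv(1)] fibre_coords_inv_linear(2)[OF i u u] unfolding fibre_form_def by metis
  show "fibre_form E \<iota> (u + v) w = fibre_form E \<iota> u w + fibre_form E \<iota> v w" if "w \<in> carrier_vec n" for w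
    using a[OF ju(1) jv(1)] fibre_coords_inv_linear(1)[OF i u v] fibre_coords_inv[OF i that] unfolding fibre_form_def by metis
next
  fix u :: "complex vec" assume u: "u \<in> carrier_vec n" and nz: "u \<noteq> 0\<^sub>v n"
  let ?e = "the_inv_into (fibre E 0) \<iota> u"
  have hs: "herm_structure E n" using E by (simp add: hom_hol_herm_vbundle_def)
  note iu = fibre_coords_inv[OF i u]
  have "?e \<noteq> vscale E 0 ?e"
  proof
    assume "?e = vscale E 0 ?e"
    then have "u = 0 \<cdot>\<^sub>v u" using fibre_coordsD(6)[OF i iu(1), of 0] iu(2) by simp
    then have "u = 0\<^sub>v n" using u by (metis eq_vecI[of "0 \<cdot>\<^sub>v u" "0\<^sub>v n"] carrier_vecD index_smult_vec index_zero_vec mult_zero_left)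
    then show False using nz by simp
  qed
  moreover have "?e \<in> total E" using iu(1) by (simp add: fibre_def)
  ultimately show "0 < Re (fibre_form E \<iota> u u)"
    using hs unfolding herm_structure_def fibre_form_def by blast
qed

lemma inner_form_expand:
  assumes h: "inner_form n h" and u: "u \<in> carrier_vec n" and v: "v \<in> carrier_vec n"
  shows "h u v = (\<Sum>i<n. \<Sum>j<n. u $ i * cnj (v $ j) * h (unit_vec n i) (unit_vec n j))"
proof -
  have 1: "h x y = (\<Sum>i<n. x $ i * h (unit_vec n i) y)" if "x \<in> carrier_vec n" "y \<in> carrier_vec n" for x y
    by (rule linear_functional_sum[OF _ _ that(1)]) (use inner_formD(1,2)[OF h] that in auto)
  have 2: "h (unit_vec n i) v = (\<Sum>j<n. cnj (v $ j) * h (unit_vec n i) (unit_vec n j))" if "i < n" for i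
  proof -
    have "h (unit_vec n i) v = cnj (h v (unit_vec n i))" by (rule inner_formD(3)[OF h v unit_vec_carrier])
    also have "\<dots> = (\<Sum>j<n. cnj (v $ j) * cnj (h (unit_vec n j) (unit_vec n i)))"
      by (subst 1[OF v unit_vec_carrier]) simp
    also have "\<dots> = (\<Sum>j<n. cnj (v $ j) * h (unit_vec n i) (unit_vec n j))"
      by (rule sum.cong[OF refl]) (simp add: inner_formD(3)[OF h unit_vec_carrier unit_vec_carrier, symmetric])
    finally show ?thesis .
  qed
  show ?thesis unfolding 1[OF u v] using 2 by (simp add: sum_distrib_left mult.assoc)
qed

text \<open>The vector field of \<open>\<i> h\<close> generates the right translations by the stabilizer, so this is the equation for \<open>h\<close>
  at the identity.\<close>

lemma stabilizer_derivative:
  assumes E: "hom_hol_vbundle E n" and i: "induced_via E n \<rho>h \<rho>y \<iota>" and e: "e \<in> fibre E 0" and j: "j < n"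
  shows "((\<lambda>t. \<iota> (bact E (gt_exp_ih (- t)) e) $ j) has_vector_derivative - \<i> * (\<rho>h *\<^sub>v \<iota> e) $ j) (at 0)"
proof -
  obtain U s where s: "0 \<in> U" "s 0 = e" "induced_lift n \<rho>h \<rho>y {g. gt_act g 0 \<in> U} (section_lift E \<iota> s)"
    "section_lift E \<iota> s gt_one = \<iota> e"
    using induced_viaE[OF E i e] by metis
  let ?F = "section_lift E \<iota> s" and ?W = "{g. gt_act g 0 \<in> U}"
  have o: "gt_one \<in> ?W" using s(1) by (simp add: gt_act_one)
  have "(\<lambda>g. ?F g $ j) differentiable (at gt_one)"
    using s(3) j o smooth_on_differentiable unfolding induced_lift_def by blast
  then have "((\<lambda>t. ?F (gt_mult gt_one (gt_exp_ih t)) $ j) has_vector_derivative lie_deriv gt_exp_ih (\<lambda>g. ?F g $ j) gt_one) (at 0)"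
    by (rule has_vector_derivative_lie_deriv[OF gt_curve_exp(1)])
  moreover have "?F (gt_mult gt_one (gt_exp_ih t)) = \<iota> (bact E (gt_exp_ih (- t)) e)" for t
    using s(2) by (simp add: section_lift_def gt_inv_exp_ih)
  moreover have "lie_h (\<lambda>g. ?F g $ j) gt_one = - (\<rho>h *\<^sub>v ?F gt_one) $ j"
    using s(3) j o unfolding induced_lift_def by blast
  then have "\<i> * lie_h (\<lambda>g. ?F g $ j) gt_one = \<i> * (- (\<rho>h *\<^sub>v \<iota> e) $ j)" by (simp only: s(4))
  then have "lie_deriv gt_exp_ih (\<lambda>g. ?F g $ j) gt_one = - \<i> * (\<rho>h *\<^sub>v \<iota> e) $ j"
    unfolding lie_h_def by simp
  ultimately show ?thesis by simp
qed

text \<open>The stabilizer of the origin acts by isometries, so its generator \<open>\<i> \<rho>(h)\<close> is skew-adjoint: the inner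
  product of two vectors that move under the stabilizer is constant, and its derivative at the identity is the
  difference of the two sides, up to a factor \<open>\<i>\<close>.\<close>

lemma induced_h_self_adjoint:
  assumes E: "hom_hol_herm_vbundle E n" and i: "induced_via E n \<rho>h \<rho>y \<iota>" and c: "\<rho>h \<in> carrier_mat n n"
    and u: "u \<in> carrier_vec n" and v: "v \<in> carrier_vec n"
  shows "fibre_form E \<iota> (\<rho>h *\<^sub>v u) v = fibre_form E \<iota> u (\<rho>h *\<^sub>v v)"
proof -
  note E' = herm_bundle_hom[OF E] and ic = induced_via_coords[OF i]
  let ?h = "fibre_form E \<iota>" and ?e = "the_inv_into (fibre E 0) \<iota> u" and ?f = "the_inv_into (fibre E 0) \<iota> v"
  note h = fibre_form_inner[OF E ic]
  note eu = fibre_coords_inv[OF ic u] and fv = fibre_coords_inv[OF ic v]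
  have z: "0 \<in> disc" by simp
  define x where "x t = \<iota> (bact E (gt_exp_ih (- t)) ?e)" for t
  define y where "y t = \<iota> (bact E (gt_exp_ih (- t)) ?f)" for t
  have b: "bact E (gt_exp_ih (- t)) w \<in> fibre E 0" if "w \<in> fibre E 0" for w t
    using bact_fibre(1)[OF E' z that, of "gt_exp_ih (- t)"] by simp
  have xy: "x t \<in> carrier_vec n" "y t \<in> carrier_vec n" for t
    unfolding x_def y_def using fibre_coordsD(1)[OF ic b] eu fv by auto
  have g1: "gt_exp_ih (- 0) = gt_one" by (simp add: gt_exp_ih_def gt_one_def)
  have x0: "x 0 = u" and y0: "y 0 = v"
    unfolding x_def y_def g1 bact_mult(2)[OF E' eu(1)] bact_mult(2)[OF E' fv(1)] by (rule eu(2), rule fv(2))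
  have dx: "((\<lambda>t. x t $ j) has_vector_derivative - \<i> * (\<rho>h *\<^sub>v u) $ j) (at 0)" if "j < n" for j
    using stabilizer_derivative[OF E' i eu(1) that] unfolding eu(2) x_def .
  have dy: "((\<lambda>t. y t $ j) has_vector_derivative - \<i> * (\<rho>h *\<^sub>v v) $ j) (at 0)" if "j < n" for j
    using stabilizer_derivative[OF E' i fv(1) that] unfolding fv(2) y_def .
  let ?G = "\<lambda>i j. ?h (unit_vec n i) (unit_vec n j)"
  have "?h (x t) (y t) = herm E (bact E (gt_exp_ih (- t)) ?e) (bact E (gt_exp_ih (- t)) ?f)" for t
    unfolding fibre_form_def x_def y_def
    using fibre_coordsD(2)[OF ic b[OF eu(1)]] fibre_coordsD(2)[OF ic b[OF fv(1)]] by simp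
  moreover have "herm E (bact E g ?e) (bact E g ?f) = herm E ?e ?f" for g
    using E eu(1) fv(1) z unfolding hom_hol_herm_vbundle_def by blast
  ultimately have const: "(\<Sum>i<n. \<Sum>j<n. x t $ i * cnj (y t $ j) * ?G i j) = ?h u v" for t
    unfolding inner_form_expand[OF h xy, symmetric] by (simp add: fibre_form_def)
  have "((\<lambda>t. \<Sum>i<n. \<Sum>j<n. x t $ i * cnj (y t $ j) * ?G i j) has_vector_derivative
      (\<Sum>i<n. \<Sum>j<n. (x 0 $ i * cnj (- \<i> * (\<rho>h *\<^sub>v v) $ j) + (- \<i> * (\<rho>h *\<^sub>v u) $ i) * cnj (y 0 $ j)) * ?G i j)) (at 0)"
    by (intro has_vector_derivative_sum has_vector_derivative_mult_left has_vector_derivative_mult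
        has_vector_derivative_cnj dx dy) auto
  then have "((\<lambda>t::real. ?h u v) has_vector_derivative
      (\<Sum>i<n. \<Sum>j<n. (u $ i * cnj (- \<i> * (\<rho>h *\<^sub>v v) $ j) + (- \<i> * (\<rho>h *\<^sub>v u) $ i) * cnj (v $ j)) * ?G i j)) (at 0)"
    unfolding const x0 y0 .
  then have "(\<Sum>i<n. \<Sum>j<n. (u $ i * cnj (- \<i> * (\<rho>h *\<^sub>v v) $ j) + (- \<i> * (\<rho>h *\<^sub>v u) $ i) * cnj (v $ j)) * ?G i j) = 0"
    by (rule vector_derivative_unique_at[OF _ has_vector_derivative_const])
  moreover have "(\<Sum>i<n. \<Sum>j<n. (u $ i * cnj (- \<i> * (\<rho>h *\<^sub>v v) $ j) + (- \<i> * (\<rho>h *\<^sub>v u) $ i) * cnj (v $ j)) * ?G i j)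
      = (\<Sum>i<n. \<Sum>j<n. \<i> * (u $ i * cnj ((\<rho>h *\<^sub>v v) $ j) * ?G i j) - \<i> * ((\<rho>h *\<^sub>v u) $ i * cnj (v $ j) * ?G i j))"
    by (intro sum.cong refl) (simp add: algebra_simps del: index_mult_mat_vec)
  moreover have "\<dots> = \<i> * ?h u (\<rho>h *\<^sub>v v) - \<i> * ?h (\<rho>h *\<^sub>v u) v"
    unfolding inner_form_expand[OF h u mult_mat_vec_carrier[OF c v]] inner_form_expand[OF h mult_mat_vec_carrier[OF c u] v]
    by (simp only: sum_subtractf sum_distrib_left)
  ultimately show ?thesis by simp
qed

section \<open>Bundles induced from the same representation are isomorphic\<close>

definition fibre_map :: "('e, 'm) hom_vbundle_scheme \<Rightarrow> ('f, 'k) hom_vbundle_scheme \<Rightarrow>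
    ('e \<Rightarrow> complex vec) \<Rightarrow> ('f \<Rightarrow> complex vec) \<Rightarrow> 'e \<Rightarrow> 'f" where
  "fibre_map E E' \<iota> \<iota>' e = the_inv_into (fibre E' 0) \<iota>' (\<iota> e)"

text \<open>The map of the fibres over \<open>0\<close> is transported to the fibre over \<open>z\<close> by the actions of an element that carries
  \<open>0\<close> to \<open>z\<close>.\<close>

definition induced_map :: "('e, 'm) hom_vbundle_scheme \<Rightarrow> ('f, 'k) hom_vbundle_scheme \<Rightarrow>
    ('e \<Rightarrow> complex vec) \<Rightarrow> ('f \<Rightarrow> complex vec) \<Rightarrow> 'e \<Rightarrow> 'f" where
  "induced_map E E' \<iota> \<iota>' e = (let t = gt_transvection (bproj E e) in
     bact E' t (fibre_map E E' \<iota> \<iota>' (bact E (gt_inv t) e)))"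

context
  fixes E :: "('e, 'm) hom_vbundle_scheme" and E' :: "('f, 'k) hom_vbundle_scheme"
    and n \<rho>h \<rho>y \<iota> \<iota>'
  assumes E: "hom_hol_vbundle E n" and E': "hom_hol_vbundle E' n"
    and i: "induced_via E n \<rho>h \<rho>y \<iota>" and i': "induced_via E' n \<rho>h \<rho>y \<iota>'"
begin

lemma fibre_map:
  assumes "e \<in> fibre E 0"
  shows "fibre_map E E' \<iota> \<iota>' e \<in> fibre E' 0" "\<iota>' (fibre_map E E' \<iota> \<iota>' e) = \<iota> e"
  using fibre_coords_inv[OF induced_via_coords[OF i'] fibre_coordsD(1)[OF induced_via_coords[OF i] assms]]
  by (simp_all add: fibre_map_def)

lemma fibre_map_linear:
  assumes u: "u \<in> fibre E 0" and v: "v \<in> fibre E 0"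
  shows "fibre_map E E' \<iota> \<iota>' (vadd E u v) = vadd E' (fibre_map E E' \<iota> \<iota>' u) (fibre_map E E' \<iota> \<iota>' v)"
    "fibre_map E E' \<iota> \<iota>' (vscale E c u) = vscale E' c (fibre_map E E' \<iota> \<iota>' u)"
  using fibre_coords_inv_linear[OF induced_via_coords[OF i'] fibre_coordsD(1)[OF induced_via_coords[OF i] u]
      fibre_coordsD(1)[OF induced_via_coords[OF i] v]]
    fibre_coordsD(4)[OF induced_via_coords[OF i] u v] fibre_coordsD(6)[OF induced_via_coords[OF i] u]
  by (simp_all add: fibre_map_def)

lemma fibre_map_stabilizer:
  assumes e: "e \<in> fibre E 0"
  shows "fibre_map E E' \<iota> \<iota>' (bact E (gt_exp_ih t) e) = bact E' (gt_exp_ih t) (fibre_map E E' \<iota> \<iota>' e)"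
proof -
  have z: "0 \<in> disc" by simp
  have k: "bact E (gt_exp_ih t) e \<in> fibre E 0" using bact_fibre(1)[OF E z e, of "gt_exp_ih t"] by simp
  have k': "bact E' (gt_exp_ih t) (fibre_map E E' \<iota> \<iota>' e) \<in> fibre E' 0"
    using bact_fibre(1)[OF E' z fibre_map(1)[OF e], of "gt_exp_ih t"] by simp
  have "\<iota>' (fibre_map E E' \<iota> \<iota>' (bact E (gt_exp_ih t) e)) = \<iota>' (bact E' (gt_exp_ih t) (fibre_map E E' \<iota> \<iota>' e))"
    using induced_via_stabilizer[OF E i e] induced_via_stabilizer[OF E' i' fibre_map(1)[OF e]] fibre_map(2)[OF k]
      fibre_map(2)[OF e] by simp
  then show ?thesis using fibre_coordsD(7)[OF induced_via_coords[OF i'] fibre_map(1)[OF k] k'] by blast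
qed

text \<open>The map of the fibres over \<open>0\<close> commutes with the stabilizer, so the transport does not depend on the element
  that is chosen.\<close>

lemma induced_map_eq:
  assumes e: "e \<in> fibre E (gt_act g 0)"
  shows "induced_map E E' \<iota> \<iota>' e = bact E' g (fibre_map E E' \<iota> \<iota>' (bact E (gt_inv g) e))"
    "bact E (gt_inv g) e \<in> fibre E 0"
proof -
  have d: "gt_act g 0 \<in> disc" by (rule gt_act_disc) simp
  show g: "bact E (gt_inv g) e \<in> fibre E 0"
    using bact_fibre(1)[OF E d e, of "gt_inv g"] by (simp add: gt_act_inv)
  define t where "t = gt_transvection (gt_act g 0)"
  have "gt_act t 0 = gt_act g 0" using gt_act_transvection[OF d] by (simp add: t_def)
  then obtain x where "g = gt_mult t (gt_exp_ih x)" by (rule gt_orbit_eq)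
  then have "t = gt_mult g (gt_inv (gt_exp_ih x))"
    by (simp add: gt_mult_assoc gt_mult_inv_right)
  then have t: "t = gt_mult g (gt_exp_ih (- x))" by (simp add: gt_inv_exp_ih)
  have e0: "bproj E e = gt_act g 0" using e by (simp add: fibre_def)
  have "bact E (gt_inv t) e = bact E (gt_exp_ih x) (bact E (gt_inv g) e)"
    unfolding t gt_inv_mult bact_mult(1)[OF E e] by (simp add: gt_inv_exp_ih)
  then have "induced_map E E' \<iota> \<iota>' e = bact E' t (bact E' (gt_exp_ih x) (fibre_map E E' \<iota> \<iota>' (bact E (gt_inv g) e)))"
    unfolding induced_map_def e0 t_def[symmetric] Let_def using fibre_map_stabilizer[OF g] by simp
  also have "\<dots> = bact E' (gt_mult t (gt_exp_ih x)) (fibre_map E E' \<iota> \<iota>' (bact E (gt_inv g) e))"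
    by (rule bact_mult(1)[OF E' fibre_map(1)[OF g], symmetric])
  finally show "induced_map E E' \<iota> \<iota>' e = bact E' g (fibre_map E E' \<iota> \<iota>' (bact E (gt_inv g) e))"
    using \<open>g = gt_mult t (gt_exp_ih x)\<close> by simp
qed

lemma induced_map_fibre:
  assumes z: "z \<in> disc" and e: "e \<in> fibre E z"
  shows "induced_map E E' \<iota> \<iota>' e \<in> fibre E' z"
    "u \<in> fibre E z \<Longrightarrow> induced_map E E' \<iota> \<iota>' (vadd E e u) = vadd E' (induced_map E E' \<iota> \<iota>' e) (induced_map E E' \<iota> \<iota>' u)"
    "induced_map E E' \<iota> \<iota>' (vscale E c e) = vscale E' c (induced_map E E' \<iota> \<iota>' e)"
proof -
  let ?g = "gt_transvection z"
  have o: "0 \<in> disc" by simp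
  have gz: "gt_act ?g 0 = z" by (rule gt_act_transvection[OF z])
  have m: "induced_map E E' \<iota> \<iota>' x = bact E' ?g (fibre_map E E' \<iota> \<iota>' (bact E (gt_inv ?g) x))"
    "bact E (gt_inv ?g) x \<in> fibre E 0" if "x \<in> fibre E z" for x
    using induced_map_eq[of x ?g] that gz by simp_all
  note fm = fibre_map(1)[OF m(2)]
  show "induced_map E E' \<iota> \<iota>' e \<in> fibre E' z"
    unfolding m(1)[OF e] using bact_fibre(1)[OF E' o fm[OF e], of ?g] gz by simp
  obtain \<phi> where f: "fibre_coords E n z \<phi>" using vbundle_chart_at[OF hom_hol_vbundle_bundle[OF E] z] by metis
  show "induced_map E E' \<iota> \<iota>' (vadd E e u) = vadd E' (induced_map E E' \<iota> \<iota>' e) (induced_map E E' \<iota> \<iota>' u)"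
    if u: "u \<in> fibre E z"
    unfolding m(1)[OF e] m(1)[OF u] m(1)[OF fibre_coordsD(3)[OF f e u]] bact_fibre(2)[OF E z e u]
      fibre_map_linear(1)[OF m(2)[OF e] m(2)[OF u]]
    by (rule bact_fibre(2)[OF E' o fm[OF e] fm[OF u]])
  show "induced_map E E' \<iota> \<iota>' (vscale E c e) = vscale E' c (induced_map E E' \<iota> \<iota>' e)"
    unfolding m(1)[OF e] m(1)[OF fibre_coordsD(5)[OF f e]] bact_fibre(3)[OF E z e]
      fibre_map_linear(2)[OF m(2)[OF e] m(2)[OF e]]
    by (rule bact_fibre(3)[OF E' o fm[OF e]])
qed

lemma induced_map_equivariant:
  assumes z: "z \<in> disc" and e: "e \<in> fibre E z"
  shows "induced_map E E' \<iota> \<iota>' (bact E h e) = bact E' h (induced_map E E' \<iota> \<iota>' e)"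
proof -
  let ?g = "gt_transvection z"
  have gz: "gt_act ?g 0 = z" by (rule gt_act_transvection[OF z])
  have e': "e \<in> fibre E (gt_act ?g 0)" using e gz by simp
  have he: "bact E h e \<in> fibre E (gt_act (gt_mult h ?g) 0)"
    using bact_fibre(1)[OF E z e, of h] gt_act_mult[of 0 h ?g] gz by simp
  have "bact E (gt_inv (gt_mult h ?g)) (bact E h e) = bact E (gt_inv ?g) e"
    unfolding gt_inv_mult bact_mult(1)[OF E bact_fibre(1)[OF E z e]] bact_mult(3)[OF E e] ..
  then show ?thesis
    unfolding induced_map_eq(1)[OF he] induced_map_eq(1)[OF e']
    using bact_mult(1)[OF E' fibre_map(1)[OF induced_map_eq(2)[OF e']]] by simp
qed

lemma section_lift_induced_map:
  assumes "\<And>z. z \<in> disc \<Longrightarrow> s z \<in> fibre E z"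
  shows "section_lift E' \<iota>' (\<lambda>z. induced_map E E' \<iota> \<iota>' (s z)) = section_lift E \<iota> s"
proof
  fix g
  have "gt_act g 0 \<in> disc" by (rule gt_act_disc) simp
  then have s: "s (gt_act g 0) \<in> fibre E (gt_act g 0)" by (rule assms)
  show "section_lift E' \<iota>' (\<lambda>z. induced_map E E' \<iota> \<iota>' (s z)) g = section_lift E \<iota> s g"
    unfolding section_lift_def induced_map_eq(1)[OF s] bact_mult(3)[OF E' fibre_map(1)[OF induced_map_eq(2)[OF s]]]
    by (rule fibre_map(2)[OF induced_map_eq(2)[OF s]])
qed

text \<open>A section and its image have the same lift, and the lift decides in both bundles whether the section is
  holomorphic.\<close>

lemma induced_map_hol_section:
  assumes U: "open U" "U \<subseteq> disc" and s: "\<And>z. z \<in> disc \<Longrightarrow> s z \<in> fibre E z" and h: "hol_section E n U s"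
  shows "hol_section E' n U (\<lambda>z. induced_map E E' \<iota> \<iota>' (s z))"
proof -
  have "\<forall>z\<in>U. s z \<in> fibre E z" using s U by auto
  then have "induced_lift n \<rho>h \<rho>y {g. gt_act g 0 \<in> U} (section_lift E \<iota> s)"
    using induced_viaD[OF i U] h by blast
  then have lift: "induced_lift n \<rho>h \<rho>y {g. gt_act g 0 \<in> U} (section_lift E' \<iota>' (\<lambda>z. induced_map E E' \<iota> \<iota>' (s z)))"
    by (simp only: section_lift_induced_map[OF s])
  have "\<forall>z\<in>U. induced_map E E' \<iota> \<iota>' (s z) \<in> fibre E' z" using s U induced_map_fibre(1) by blast
  from induced_viaD[OF i' U this] show ?thesis using lift by (rule iffD2)
qed

text \<open>The function \<open>\<Psi>\<close> is arbitrary outside of the total space, as the inverse of an isomorphism is.\<close>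

lemma induced_map_bundle_map:
  assumes \<Psi>: "\<And>z e. z \<in> disc \<Longrightarrow> e \<in> fibre E z \<Longrightarrow> \<Psi> e = induced_map E E' \<iota> \<iota>' e"
  shows "hol_bundle_map E n E' n id \<Psi>"
  unfolding hol_bundle_map_def
proof (rule conjI)
  show "\<forall>z\<in>disc. \<forall>u\<in>fibre E z. \<Psi> u \<in> fibre E' (id z)
        \<and> (\<forall>v\<in>fibre E z. \<Psi> (vadd E u v) = vadd E' (\<Psi> u) (\<Psi> v))
        \<and> (\<forall>c. \<Psi> (vscale E c u) = vscale E' c (\<Psi> u))"
  proof (intro ballI conjI allI)
    fix z u assume z: "z \<in> disc" and u: "u \<in> fibre E z"
    obtain \<phi> where f: "fibre_coords E n z \<phi>" using vbundle_chart_at[OF hom_hol_vbundle_bundle[OF E] z] by metis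
    show "\<Psi> u \<in> fibre E' (id z)" using induced_map_fibre(1)[OF z u] \<Psi>[OF z u] by simp
    show "\<Psi> (vadd E u v) = vadd E' (\<Psi> u) (\<Psi> v)" if v: "v \<in> fibre E z" for v
      using induced_map_fibre(2)[OF z u v] \<Psi>[OF z u] \<Psi>[OF z v] \<Psi>[OF z fibre_coordsD(3)[OF f u v]] by simp
    show "\<Psi> (vscale E c u) = vscale E' c (\<Psi> u)" for c
      using induced_map_fibre(3)[OF z u] \<Psi>[OF z u] \<Psi>[OF z fibre_coordsD(5)[OF f u]] by simp
  qed
  show "\<forall>(U, \<phi>)\<in>charts E. \<forall>(V, \<psi>)\<in>charts E'. \<forall>i<n. \<forall>j<n.
        (\<lambda>z. \<psi> (\<Psi> (frame E n \<phi> z j)) $ i) holomorphic_on {z\<in>U. id z \<in> V}"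
  proof clarify
    fix U \<phi> V \<psi> p j assume c: "(U, \<phi>) \<in> charts E" and c': "(V, \<psi>) \<in> charts E'" and pj: "p < n" "j < n"
    note B = hom_hol_vbundle_bundle[OF E]
    have lt: "local_triv E n (U, \<phi>)" using B c unfolding hol_vbundle_def by blast
    then have U: "open U" "U \<subseteq> disc" by (simp_all add: local_triv_def)
    \<comment> \<open>The frame is continued arbitrarily to a section over the disc.\<close>
    define s where "s z = (if z \<in> U then frame E n \<phi> z j else (SOME e. e \<in> fibre E z))" for z
    have st: "s z \<in> fibre E z" if "z \<in> disc" for z
      using fibre_coords_inv(1)[OF local_trivD[OF lt] unit_vec_carrier, of z j]
        someI_ex[OF fibre_nonempty[OF B that]] by (auto simp: s_def frame_def)
    have hs: "hol_section E n U s"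
      by (rule hol_section_constant[OF B lt _ unit_vec_carrier[of n j]])
        (use B c in \<open>auto simp: hol_vbundle_def s_def frame_def\<close>)
    have "hol_section E' n U (\<lambda>z. induced_map E E' \<iota> \<iota>' (s z))"
      by (rule induced_map_hol_section[OF U _ hs]) (rule st)
    then have "(\<lambda>z. \<psi> (induced_map E E' \<iota> \<iota>' (s z)) $ p) holomorphic_on U \<inter> V"
      using c' pj unfolding hol_section_def by blast
    moreover have "\<psi> (induced_map E E' \<iota> \<iota>' (s z)) $ p = \<psi> (\<Psi> (frame E n \<phi> z j)) $ p" if "z \<in> U \<inter> V" for z
      using that \<Psi>[of z "s z"] st[of z] U by (auto simp: s_def)
    ultimately have "(\<lambda>z. \<psi> (\<Psi> (frame E n \<phi> z j)) $ p) holomorphic_on U \<inter> V"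
      by (rule holomorphic_transform)
    moreover have "{z\<in>U. id z \<in> V} = U \<inter> V" by auto
    ultimately show "(\<lambda>z. \<psi> (\<Psi> (frame E n \<phi> z j)) $ p) holomorphic_on {z\<in>U. id z \<in> V}" by simp
  qed
qed

lemma induced_map_inverse:
  assumes z: "z \<in> disc" and e: "e \<in> fibre E z"
  shows "bact E (gt_transvection z) (fibre_map E' E \<iota>' \<iota> (bact E' (gt_inv (gt_transvection z)) (induced_map E E' \<iota> \<iota>' e))) = e"
proof -
  let ?g = "gt_transvection z"
  have gz: "gt_act ?g 0 = z" by (rule gt_act_transvection[OF z])
  have e': "e \<in> fibre E (gt_act ?g 0)" using e gz by simp
  note m = induced_map_eq[OF e']
  have "bact E' (gt_inv ?g) (induced_map E E' \<iota> \<iota>' e) = fibre_map E E' \<iota> \<iota>' (bact E (gt_inv ?g) e)"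
    unfolding m(1) by (rule bact_mult(3)[OF E' fibre_map(1)[OF m(2)]])
  moreover have "fibre_map E' E \<iota>' \<iota> (fibre_map E E' \<iota> \<iota>' (bact E (gt_inv ?g) e)) = bact E (gt_inv ?g) e"
    unfolding fibre_map_def[of E' E] fibre_map(2)[OF m(2)] by (rule fibre_coordsD(2)[OF induced_via_coords[OF i] m(2)])
  ultimately show ?thesis using bact_mult(4)[OF E e] by simp
qed

end

lemma induced_map_cancel:
  assumes E: "hom_hol_vbundle E n" and E': "hom_hol_vbundle E' n"
    and i: "induced_via E n \<rho>h \<rho>y \<iota>" and i': "induced_via E' n \<rho>h \<rho>y \<iota>'"
    and z: "z \<in> disc" and e: "e \<in> fibre E z"
  shows "induced_map E' E \<iota>' \<iota> (induced_map E E' \<iota> \<iota>' e) = e"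
proof -
  have "bproj E' (induced_map E E' \<iota> \<iota>' e) = z"
    using induced_map_fibre(1)[OF E E' i i' z e] by (simp add: fibre_def)
  then show ?thesis
    unfolding induced_map_def[of E' E] Let_def using induced_map_inverse[OF E E' i i' z e] by simp
qed

text \<open>By invariance and transitivity, it suffices to compare the inner products over the origin.\<close>

theorem isomorphic_if_same_representation:
  assumes E: "hom_hol_herm_vbundle E n" and E': "hom_hol_herm_vbundle E' n"
    and i: "induced_via E n \<rho>h \<rho>y \<iota>" and i': "induced_via E' n \<rho>h \<rho>y \<iota>'"
    and h: "\<And>u v. u \<in> carrier_vec n \<Longrightarrow> v \<in> carrier_vec n \<Longrightarrow> fibre_form E \<iota> u v = fibre_form E' \<iota>' u v"
  shows "hom_herm_isomorphic E E'"
proof -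
  note H = herm_bundle_hom[OF E] and H' = herm_bundle_hom[OF E']
  let ?\<Phi> = "induced_map E E' \<iota> \<iota>'" and ?\<Psi> = "induced_map E' E \<iota>' \<iota>"
  have tot: "bproj E e \<in> disc" "e \<in> fibre E (bproj E e)" if "e \<in> total E" for e
    using hom_hol_vbundle_bundle[OF H] that unfolding hol_vbundle_def fibre_def by auto
  have tot': "bproj E' e \<in> disc" "e \<in> fibre E' (bproj E' e)" if "e \<in> total E'" for e
    using hom_hol_vbundle_bundle[OF H'] that unfolding hol_vbundle_def fibre_def by auto
  have into: "?\<Phi> e \<in> total E'" if "e \<in> total E" for e
    using induced_map_fibre(1)[OF H H' i i' tot[OF that]] by (simp add: fibre_def)
  have into': "?\<Psi> e \<in> total E" if "e \<in> total E'" for e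
    using induced_map_fibre(1)[OF H' H i' i tot'[OF that]] by (simp add: fibre_def)
  have c: "?\<Psi> (?\<Phi> e) = e" if "e \<in> total E" for e by (rule induced_map_cancel[OF H H' i i' tot[OF that]])
  have c': "?\<Phi> (?\<Psi> e) = e" if "e \<in> total E'" for e by (rule induced_map_cancel[OF H' H i' i tot'[OF that]])
  have bij: "bij_betw ?\<Phi> (total E) (total E')"
    by (rule bij_betw_byWitness[where f' = ?\<Psi>]) (use c c' into into' in auto)
  have inv: "the_inv_into (total E) ?\<Phi> e = ?\<Psi> e" if "e \<in> fibre E' z" for e z
  proof -
    have t: "e \<in> total E'" using that by (simp add: fibre_def)
    show ?thesis by (rule the_inv_into_f_eq) (use bij into' c' t in \<open>auto simp: bij_betw_def\<close>)
  qed
  have iso: "herm E' (?\<Phi> u) (?\<Phi> v) = herm E u v" if z: "z \<in> disc" and u: "u \<in> fibre E z" and v: "v \<in> fibre E z" for z u v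
  proof -
    let ?g = "gt_transvection z"
    have gz: "gt_act ?g 0 = z" by (rule gt_act_transvection[OF z])
    have uv: "u \<in> fibre E (gt_act ?g 0)" "v \<in> fibre E (gt_act ?g 0)" using u v gz by simp_all
    note mu = induced_map_eq[OF H H' i i' uv(1)] and mv = induced_map_eq[OF H H' i i' uv(2)]
    let ?u = "bact E (gt_inv ?g) u" and ?v = "bact E (gt_inv ?g) v"
    have o: "0 \<in> disc" by simp
    have "herm E' (?\<Phi> u) (?\<Phi> v) = herm E' (fibre_map E E' \<iota> \<iota>' ?u) (fibre_map E E' \<iota> \<iota>' ?v)"
      unfolding mu(1) mv(1) using E' o fibre_map(1)[OF H H' i i' mu(2)] fibre_map(1)[OF H H' i i' mv(2)]
      unfolding hom_hol_herm_vbundle_def by blast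
    also have "\<dots> = fibre_form E' \<iota>' (\<iota> ?u) (\<iota> ?v)" by (simp add: fibre_form_def fibre_map_def)
    also have "\<dots> = fibre_form E \<iota> (\<iota> ?u) (\<iota> ?v)"
      using h fibre_coordsD(1)[OF induced_via_coords[OF i]] mu(2) mv(2) by simp
    also have "\<dots> = herm E ?u ?v"
      unfolding fibre_form_def using fibre_coordsD(2)[OF induced_via_coords[OF i]] mu(2) mv(2) by simp
    also have "\<dots> = herm E u v" using E z u v unfolding hom_hol_herm_vbundle_def by blast
    finally show ?thesis .
  qed
  show ?thesis
    unfolding hom_herm_isomorphic_def
  proof (intro exI[of _ n] exI[of _ ?\<Phi>] conjI E E' bij)
    show "hol_bundle_map E n E' n id ?\<Phi>" by (rule induced_map_bundle_map[OF H H' i i']) simp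
    show "hol_bundle_map E' n E n id (the_inv_into (total E) ?\<Phi>)"
      by (rule induced_map_bundle_map[OF H' H i' i]) (use inv in simp)
    show "\<forall>g. \<forall>e\<in>total E. ?\<Phi> (bact E g e) = bact E' g (?\<Phi> e)"
      using induced_map_equivariant[OF H H' i i' tot] by blast
    show "\<forall>z\<in>disc. \<forall>u\<in>fibre E z. \<forall>v\<in>fibre E z. herm E' (?\<Phi> u) (?\<Phi> v) = herm E u v"
      using iso by blast
  qed
qed

lemma holomorphic_on_local:
  assumes "\<And>x. x \<in> S \<Longrightarrow> \<exists>N. open N \<and> x \<in> N \<and> f holomorphic_on N"
  shows "f holomorphic_on S"
  unfolding holomorphic_on_def
proof
  fix x assume "x \<in> S"
  then obtain N where "open N" "x \<in> N" "f holomorphic_on N" using assms by blast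
  then show "f field_differentiable at x within S"
    using holomorphic_on_imp_differentiable_at field_differentiable_at_within by blast
qed

text \<open>Locally a holomorphic section is a combination of a frame with holomorphic coefficients, and bundle maps are
  holomorphic on frames.\<close>

lemma hol_bundle_map_section:
  assumes E: "hol_vbundle E n" and E': "hol_vbundle E' n'" and \<Phi>: "hol_bundle_map E n E' n' id \<Phi>"
    and U: "open U" "U \<subseteq> disc" and s: "\<And>z. z \<in> U \<Longrightarrow> s z \<in> fibre E z" and h: "hol_section E n U s"
  shows "hol_section E' n' U (\<lambda>z. \<Phi> (s z))"
  unfolding hol_section_def
proof clarify
  fix V \<psi> p assume c': "(V, \<psi>) \<in> charts E'" and p: "p < n'"
  have V: "open V" using E' c' unfolding hol_vbundle_def local_triv_def by blast
  have lin: "\<forall>z\<in>disc. \<forall>u\<in>fibre E z. \<Phi> u \<in> fibre E' (id z)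
        \<and> (\<forall>v\<in>fibre E z. \<Phi> (vadd E u v) = vadd E' (\<Phi> u) (\<Phi> v))
        \<and> (\<forall>c. \<Phi> (vscale E c u) = vscale E' c (\<Phi> u))"
    using \<Phi> unfolding hol_bundle_map_def by blast
  show "(\<lambda>z. \<psi> (\<Phi> (s z)) $ p) holomorphic_on U \<inter> V"
  proof (rule holomorphic_on_local)
    fix z0 assume z0: "z0 \<in> U \<inter> V"
    then have "z0 \<in> disc" using U by auto
    then obtain W \<phi> where c: "(W, \<phi>) \<in> charts E" and W: "z0 \<in> W" "open W" "W \<subseteq> disc"
      using vbundle_chart_at[OF E] by metis
    let ?N = "U \<inter> V \<inter> W"
    have "\<psi> (\<Phi> (s z)) $ p = (\<Sum>j<n. \<phi> (s z) $ j * \<psi> (\<Phi> (frame E n \<phi> z j)) $ p)" if z: "z \<in> ?N" for z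
    proof -
      have zd: "z \<in> disc" using z U by auto
      have f: "fibre_coords E n z \<phi>" "fibre_coords E' n' z \<psi>"
        using chart_fibre_coords[OF E c] chart_fibre_coords[OF E' c'] z by auto
      have sz: "s z \<in> fibre E z" using s z by auto
      let ?j = "the_inv_into (fibre E z) \<phi>"
      note iv = fibre_coords_inv(1)[OF f(1)]
      have \<Phi>f: "\<Phi> u \<in> fibre E' z" if "u \<in> fibre E z" for u using lin zd that by auto
      have "\<psi> (\<Phi> (?j (\<phi> (s z)))) $ p = (\<Sum>j<n. \<phi> (s z) $ j * \<psi> (\<Phi> (?j (unit_vec n j))) $ p)"
      proof (rule linear_functional_sum[OF _ _ fibre_coordsD(1)[OF f(1) sz]])
        fix a b :: "complex vec" assume ab: "a \<in> carrier_vec n" "b \<in> carrier_vec n"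
        have "\<Phi> (?j (a + b)) = vadd E' (\<Phi> (?j a)) (\<Phi> (?j b))"
          unfolding fibre_coords_inv_linear(1)[OF f(1) ab] using lin zd iv ab by blast
        then show "\<psi> (\<Phi> (?j (a + b))) $ p = \<psi> (\<Phi> (?j a)) $ p + \<psi> (\<Phi> (?j b)) $ p"
          using fibre_coordsD(4)[OF f(2) \<Phi>f[OF iv[OF ab(1)]] \<Phi>f[OF iv[OF ab(2)]]]
            fibre_coordsD(1)[OF f(2) \<Phi>f[OF iv[OF ab(2)]]] p by (simp add: carrier_vecD[of _ n'])
        have "\<Phi> (?j (x \<cdot>\<^sub>v a)) = vscale E' x (\<Phi> (?j a))" for x
          unfolding fibre_coords_inv_linear(2)[OF f(1) ab(1) ab(1)] using lin zd iv ab by blast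
        then show "\<psi> (\<Phi> (?j (x \<cdot>\<^sub>v a))) $ p = x * \<psi> (\<Phi> (?j a)) $ p" for x
          using fibre_coordsD(6)[OF f(2) \<Phi>f[OF iv[OF ab(1)]]]
            fibre_coordsD(1)[OF f(2) \<Phi>f[OF iv[OF ab(1)]]] p by (simp add: carrier_vecD[of _ n'])
      qed
      then show ?thesis using fibre_coordsD(2)[OF f(1) sz] by (simp add: frame_def)
    qed
    note eq = this
    have "(\<lambda>z. \<Sum>j<n. \<phi> (s z) $ j * \<psi> (\<Phi> (frame E n \<phi> z j)) $ p) holomorphic_on ?N"
    proof (intro holomorphic_intros)
      fix j assume "j \<in> {..<n}"
      then have j: "j < n" by simp
      have "(\<lambda>z. \<phi> (s z) $ j) holomorphic_on U \<inter> W" using h c j unfolding hol_section_def by blast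
      then show "(\<lambda>z. \<phi> (s z) $ j) holomorphic_on ?N" by (rule holomorphic_on_subset) auto
      have "(\<lambda>z. \<psi> (\<Phi> (frame E n \<phi> z j)) $ p) holomorphic_on {z\<in>W. id z \<in> V}"
        using \<Phi> c c' j p unfolding hol_bundle_map_def by blast
      then show "(\<lambda>z. \<psi> (\<Phi> (frame E n \<phi> z j)) $ p) holomorphic_on ?N" by (rule holomorphic_on_subset) auto
    qed
    then have "(\<lambda>z. \<psi> (\<Phi> (s z)) $ p) holomorphic_on ?N"
      by (rule holomorphic_transform) (simp add: eq)
    then show "\<exists>N. open N \<and> z0 \<in> N \<and> (\<lambda>z. \<psi> (\<Phi> (s z)) $ p) holomorphic_on N"
      using z0 W U V by (intro exI[of _ ?N]) auto
  qed
qed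

text \<open>An equivariant bundle map takes lifts to lifts, and the representation is read off from the derivatives of the
  lifts at the identity.\<close>

lemma bundle_map_intertwines:
  assumes E: "hom_hol_vbundle E n" and E': "hom_hol_vbundle E' n'"
    and i: "induced_via E n \<rho>h \<rho>y \<iota>" and i': "induced_via E' n' \<rho>h' \<rho>y' \<iota>'"
    and c: "\<rho>h \<in> carrier_mat n n" "\<rho>y \<in> carrier_mat n n" "\<rho>h' \<in> carrier_mat n' n'" "\<rho>y' \<in> carrier_mat n' n'"
    and \<Phi>: "hol_bundle_map E n E' n' id \<Phi>" and eqv: "\<forall>g. \<forall>e\<in>total E. \<Phi> (bact E g e) = bact E' g (\<Phi> e)"
  obtains A where "A \<in> carrier_mat n' n" "\<forall>e\<in>fibre E 0. \<iota>' (\<Phi> e) = A *\<^sub>v \<iota> e"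
    "A * \<rho>h = \<rho>h' * A" "A * \<rho>y = \<rho>y' * A"
proof -
  note ic = induced_via_coords[OF i] and ic' = induced_via_coords[OF i']
  have lin: "\<forall>z\<in>disc. \<forall>u\<in>fibre E z. \<Phi> u \<in> fibre E' (id z)
        \<and> (\<forall>v\<in>fibre E z. \<Phi> (vadd E u v) = vadd E' (\<Phi> u) (\<Phi> v))
        \<and> (\<forall>c. \<Phi> (vscale E c u) = vscale E' c (\<Phi> u))"
    using \<Phi> unfolding hol_bundle_map_def by blast
  let ?j = "the_inv_into (fibre E 0) \<iota>"
  note iv = fibre_coords_inv[OF ic]
  have o: "0 \<in> disc" by simp
  have \<Phi>f: "\<Phi> u \<in> fibre E' 0" if "u \<in> fibre E 0" for u using lin o that by auto
  obtain A where A: "A \<in> carrier_mat n' n" and L: "\<And>v. v \<in> carrier_vec n \<Longrightarrow> \<iota>' (\<Phi> (?j v)) = A *\<^sub>v v"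
  proof (rule linear_map_matrix[of n "\<lambda>v. \<iota>' (\<Phi> (?j v))" n'])
    fix u v :: "complex vec" assume u: "u \<in> carrier_vec n" and v: "v \<in> carrier_vec n"
    have "\<Phi> (?j (u + v)) = vadd E' (\<Phi> (?j u)) (\<Phi> (?j v))"
      unfolding fibre_coords_inv_linear(1)[OF ic u v] using lin o iv(1)[OF u] iv(1)[OF v] by blast
    then show "\<iota>' (\<Phi> (?j (u + v))) = \<iota>' (\<Phi> (?j u)) + \<iota>' (\<Phi> (?j v))"
      using fibre_coordsD(4)[OF ic' \<Phi>f[OF iv(1)[OF u]] \<Phi>f[OF iv(1)[OF v]]] by simp
  next
    fix x and u :: "complex vec" assume u: "u \<in> carrier_vec n"
    have "\<Phi> (?j (x \<cdot>\<^sub>v u)) = vscale E' x (\<Phi> (?j u))"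
      unfolding fibre_coords_inv_linear(2)[OF ic u u] using lin o iv(1)[OF u] by blast
    then show "\<iota>' (\<Phi> (?j (x \<cdot>\<^sub>v u))) = x \<cdot>\<^sub>v \<iota>' (\<Phi> (?j u))"
      using fibre_coordsD(6)[OF ic' \<Phi>f[OF iv(1)[OF u]]] by simp
  qed (use fibre_coordsD(1)[OF ic' \<Phi>f] iv(1) in blast)+
  have Ae: "\<iota>' (\<Phi> e) = A *\<^sub>v \<iota> e" if "e \<in> fibre E 0" for e
    using L[OF fibre_coordsD(1)[OF ic that]] fibre_coordsD(2)[OF ic that] by simp
  have key: "A *\<^sub>v (\<rho>h *\<^sub>v v) = \<rho>h' *\<^sub>v (A *\<^sub>v v) \<and> A *\<^sub>v (\<rho>y *\<^sub>v v) = \<rho>y' *\<^sub>v (A *\<^sub>v v)"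
    if v: "v \<in> carrier_vec n" for v
  proof -
    obtain U s where U: "open U" "0 \<in> U" "U \<subseteq> disc" and hs: "hol_section E n U s"
      and s0: "s 0 = ?j v" and st': "\<forall>z\<in>disc. s z \<in> fibre E z"
      and F: "induced_lift n \<rho>h \<rho>y {g. gt_act g 0 \<in> U} (section_lift E \<iota> s)"
      and F1: "section_lift E \<iota> s gt_one = \<iota> (?j v)"
      using induced_viaE[OF E i iv(1)[OF v]] .
    have st: "s z \<in> fibre E z" if "z \<in> disc" for z using st' that by blast
    let ?F = "section_lift E \<iota> s" and ?F' = "section_lift E' \<iota>' (\<lambda>z. \<Phi> (s z))" and ?W = "{g. gt_act g 0 \<in> U}"
    have on: "gt_one \<in> ?W" using U by (simp add: gt_act_one)
    have "hol_section E' n' U (\<lambda>z. \<Phi> (s z))"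
      by (rule hol_bundle_map_section[OF hom_hol_vbundle_bundle[OF E] hom_hol_vbundle_bundle[OF E'] \<Phi> U(1,3) _ hs])
        (use st U in auto)
    moreover have \<Phi>s: "\<forall>z\<in>U. \<Phi> (s z) \<in> fibre E' z" using lin st U by auto
    ultimately have F': "induced_lift n' \<rho>h' \<rho>y' ?W ?F'" using induced_viaD[OF i' U(1,3) \<Phi>s] by (simp only:)
    have eq: "?F' g = A *\<^sub>v ?F g" "?F g \<in> carrier_vec n" for g
    proof -
      have d: "gt_act g 0 \<in> disc" by (rule gt_act_disc) simp
      have sg: "s (gt_act g 0) \<in> fibre E (gt_act g 0)" by (rule st[OF d])
      show "?F g \<in> carrier_vec n" by (rule section_lift_fibre(2)[where s = s, OF E ic sg])
      have "bact E' (gt_inv g) (\<Phi> (s (gt_act g 0))) = \<Phi> (bact E (gt_inv g) (s (gt_act g 0)))"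
        by (rule eqv[rule_format, symmetric]) (use sg in \<open>simp add: fibre_def\<close>)
      then show "?F' g = A *\<^sub>v ?F g"
        using Ae[OF section_lift_fibre(1)[where s = s, OF E ic sg]] by (simp add: section_lift_def)
    qed
    have comp: "(\<lambda>g. ?F' g $ p) = (\<lambda>g. \<Sum>j<n. A $$ (p, j) * ?F g $ j)" if "p < n'" for p
      unfolding eq(1) using mult_mat_vec_sum[OF A eq(2) that] by blast
    have Fv: "?F gt_one = v" using F1 iv(2)[OF v] by simp
    show ?thesis
    proof (intro conjI eq_vecI)
      fix p assume "p < dim_vec (\<rho>h' *\<^sub>v (A *\<^sub>v v))"
      then have p: "p < n'" using c by simp
      have "lie_h (\<lambda>g. ?F' g $ p) gt_one = - (\<rho>h' *\<^sub>v ?F' gt_one) $ p"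
        using F' on p unfolding induced_lift_def by blast
      then have "(\<Sum>j<n. A $$ (p, j) * (\<rho>h *\<^sub>v v) $ j) = (\<rho>h' *\<^sub>v (A *\<^sub>v v)) $ p"
        unfolding comp[OF p] lift_relation(1)[OF F on] unfolding eq(1) Fv by (simp only: neg_equal_iff_equal)
      then show "(A *\<^sub>v (\<rho>h *\<^sub>v v)) $ p = (\<rho>h' *\<^sub>v (A *\<^sub>v v)) $ p"
        using mult_mat_vec_sum[OF A mult_mat_vec_carrier[OF c(1) v] p] by simp
    next
      fix p assume "p < dim_vec (\<rho>y' *\<^sub>v (A *\<^sub>v v))"
      then have p: "p < n'" using c by simp
      have "lie_y (\<lambda>g. ?F' g $ p) gt_one = - (\<rho>y' *\<^sub>v ?F' gt_one) $ p"
        using F' on p unfolding induced_lift_def by blast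
      then have "(\<Sum>j<n. A $$ (p, j) * (\<rho>y *\<^sub>v v) $ j) = (\<rho>y' *\<^sub>v (A *\<^sub>v v)) $ p"
        unfolding comp[OF p] lift_relation(2)[OF F on] unfolding eq(1) Fv by (simp only: neg_equal_iff_equal)
      then show "(A *\<^sub>v (\<rho>y *\<^sub>v v)) $ p = (\<rho>y' *\<^sub>v (A *\<^sub>v v)) $ p"
        using mult_mat_vec_sum[OF A mult_mat_vec_carrier[OF c(2) v] p] by simp
    qed (use A c in auto)
  qed
  have "A * \<rho>h = \<rho>h' * A"
    by (rule mat_eqI_mult_vec[of _ n' n]) (use key A c in \<open>auto simp: assoc_mult_mat_vec[of _ n' n] assoc_mult_mat_vec[of _ n' n' _ n]\<close>)
  moreover have "A * \<rho>y = \<rho>y' * A"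
    by (rule mat_eqI_mult_vec[of _ n' n]) (use key A c in \<open>auto simp: assoc_mult_mat_vec[of _ n' n] assoc_mult_mat_vec[of _ n' n' _ n]\<close>)
  ultimately show ?thesis using that A Ae by blast
qed

section \<open>The bundles in their canonical trivialization\<close>

definition h_mat :: "real \<Rightarrow> nat list \<Rightarrow> complex mat" where
  "h_mat \<eta> ds = diagonal (sum_list ds) (\<lambda>i. - of_real (\<eta> + real (blk_of ds i)))"

lemma h_mat_carrier [simp]: "h_mat \<eta> ds \<in> carrier_mat (sum_list ds) (sum_list ds)"
  by (simp add: h_mat_def)

lemma aut_mat_diagonal:
  assumes Y: "block_subdiagonal ds Y"
  shows "aut_mat \<eta> ds Y 0 L = diagonal (sum_list ds) (\<lambda>i. exp (- (2 * of_real (\<eta> + real (blk_of ds i))) * L))"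
    (is "?l = ?r")
proof (rule eq_matI)
  have c: "Y \<in> carrier_mat (sum_list ds) (sum_list ds)" using Y by (simp add: block_subdiagonal_iff)
  fix i j assume "i < dim_row ?r" "j < dim_col ?r"
  then have ij: "i < sum_list ds" "j < sum_list ds" by auto
  show "?l $$ (i, j) = ?r $$ (i, j)"
  proof (cases "blk_of ds i \<le> blk_of ds j")
    case True
    then show ?thesis unfolding aut_mat_index[OF ij] using ij c
      by (cases "i = j") (auto simp: diagonal_def algebra_simps)
  next
    case False
    then show ?thesis unfolding aut_mat_index[OF ij] using ij by (auto simp: diagonal_def)
  qed
qed simp_all

lemma aut_mat_exp_ih:
  assumes Y: "block_subdiagonal ds Y"
  shows "aut_mat \<eta> ds Y (gt_c (gt_exp_ih t)) (gt_log_aut (gt_exp_ih t) z) = mat_exp ((- \<i> * of_real t) \<cdot>\<^sub>m h_mat \<eta> ds)"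
proof -
  have "gt_c (gt_exp_ih t) = 0" by (simp add: gt_c_def)
  then show ?thesis
    unfolding h_mat_def mat_exp_diagonal gt_log_aut_exp_ih by (simp add: aut_mat_diagonal[OF Y] algebra_simps)
qed

lemma aut_mat_cocycle:
  assumes Y: "block_subdiagonal ds Y" and z: "z \<in> disc"
  shows "aut_mat \<eta> ds Y (gt_c (gt_mult g h)) (gt_log_aut (gt_mult g h) z) =
    aut_mat \<eta> ds Y (gt_c h) (gt_log_aut h z) * aut_mat \<eta> ds Y (gt_c g) (gt_log_aut g (gt_act h z))"
  unfolding aut_mat_mult[OF Y] gt_log_aut_mult[OF z] gt_c_mult_aut[OF z] by (simp add: add.commute)

lemma gt_c_inv: "gt_c (gt_inv g) = - gt_c g"
  by (simp add: gt_c_def)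

lemma gt_log_aut_inv: "z \<in> disc \<Longrightarrow> gt_log_aut (gt_inv g) (gt_act g z) = - gt_log_aut g z"
  using gt_log_aut_mult[of z "gt_inv g" g] by (simp add: gt_mult_inv gt_log_aut_one eq_neg_iff_add_eq_0)

lemma the_inverse_J_mat:
  assumes Y: "block_subdiagonal ds Y"
  shows "the (mat_inverse (J_mat \<eta> ds Y g z)) = aut_mat \<eta> ds Y (- gt_c g) (- gt_log_aut g z)"
  unfolding J_mat_aut[OF Y] by (rule mat_inverse_of_mult[OF _ _ aut_mat_inverse(1)[OF Y]]) simp_all

lemma holomorphic_gt_log_aut: "gt_log_aut g holomorphic_on disc"
proof -
  have "0 < Re (1 + gt_c g * z / gt_d g)" if "z \<in> disc" for z
    by (rule Re_one_plus_pos[OF gt_aut_factor_norm[OF that]])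
  then have "1 + gt_c g * z / gt_d g \<notin> \<real>\<^sub>\<le>\<^sub>0" if "z \<in> disc" for z
    using that by (meson complex_nonpos_Reals_iff not_le)
  then have "(\<lambda>z. gt_log_aut g z) holomorphic_on disc"
    unfolding gt_log_aut_def by (intro holomorphic_intros) auto
  then show ?thesis by simp
qed

lemma holomorphic_gt_act: "gt_act g holomorphic_on disc"
  unfolding holomorphic_on_def field_differentiable_def
  using gt_log_deriv[of _ g] has_field_derivative_at_within by blast

lemma holomorphic_aut_mat:
  assumes "i < sum_list ds" "j < sum_list ds" "f holomorphic_on S"
  shows "(\<lambda>z. aut_mat \<eta> ds Y c (f z) $$ (i, j)) holomorphic_on S"
  unfolding aut_mat_index[OF assms(1,2)] by (intro holomorphic_intros assms(3))

lemma smooth_on_aut_mat: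
  assumes "i < sum_list ds" "j < sum_list ds" "open S" "smooth_on S c" "smooth_on S L"
  shows "smooth_on S (\<lambda>x. aut_mat \<eta> ds Y (c x) (L x) $$ (i, j))"
  unfolding aut_mat_index[OF assms(1,2)] by (intro smooth_intros assms) auto

text \<open>The factor \<open>1 / sqrt (1 - |z|\<^sup>2)\<close> is \<open>exp (- Ln (1 - z cnj z) / 2)\<close>, which is built from smooth functions.\<close>

lemma smooth_transvection:
  "smooth_on disc (\<lambda>z. fst (gt_transvection z))"
  "smooth_on disc (\<lambda>z. complex_of_real (snd (gt_transvection z)))"
  "smooth_on disc (\<lambda>z. gt_log_aut (gt_transvection z) 0)"
proof -
  have p: "0 < 1 - (cmod z)\<^sup>2" if "z \<in> disc" for z using that by (simp add: abs_square_less_1)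
  have z: "smooth_on disc (\<lambda>z. z)" by (rule smooth_on_ident) simp
  have "smooth_on disc (\<lambda>z. z / exp (Ln (1 + - (z * cnj z)) / 2))"
  proof (intro smooth_intros z)
    fix z assume "z \<in> disc"
    moreover have "Re (1 + - (z * cnj z)) = 1 - (cmod z)\<^sup>2" by (simp add: cmod_sq)
    ultimately show "0 < Re (1 + - (z * cnj z))" using p by (simp only:)
  qed auto
  moreover have "z / exp (Ln (1 + - (z * cnj z)) / 2) = fst (gt_transvection z)" if "z \<in> disc" for z
  proof -
    have "1 + - (z * cnj z) = of_real (1 - (cmod z)\<^sup>2)" by (simp flip: complex_norm_square)
    then have "Ln (1 + - (z * cnj z)) / 2 = of_real (ln (sqrt (1 - (cmod z)\<^sup>2)))"
      using p[OF that] by (simp only: Ln_of_real ln_sqrt) simp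
    then have "exp (Ln (1 + - (z * cnj z)) / 2) = of_real (sqrt (1 - (cmod z)\<^sup>2))"
      using p[OF that] by (simp only: exp_of_real) simp
    then show ?thesis by (simp add: gt_transvection_def)
  qed
  ultimately show b: "smooth_on disc (\<lambda>z. fst (gt_transvection z))"
    using smooth_on_cong[OF open_ball] by (metis (no_types, lifting))
  show t: "smooth_on disc (\<lambda>z. complex_of_real (snd (gt_transvection z)))"
    by (simp add: gt_transvection_def smooth_on_const)
  show "smooth_on disc (\<lambda>z. gt_log_aut (gt_transvection z) 0)"
    by (rule smooth_on_gt_log_aut[OF open_ball b t]) (auto intro: smooth_on_const)
qed

subsection \<open>The structure of a homogeneous holomorphic Hermitian bundle\<close>

text \<open>Transport by the transvection from \<open>0\<close> to \<open>z\<close> makes \<open>J\<^sup>* J\<close>, with \<open>J\<close> this matrix, the metric over \<open>z\<close>.\<close>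

definition J_origin :: "real \<Rightarrow> nat list \<Rightarrow> complex mat \<Rightarrow> complex \<Rightarrow> complex mat" where
  "J_origin \<eta> ds Y z = aut_mat \<eta> ds Y (gt_c (gt_transvection z)) (gt_log_aut (gt_transvection z) 0)"

context
  fixes \<eta> :: real and ds :: "nat list" and Y :: "complex mat" and n :: nat
    and E :: "(complex \<times> complex vec) hom_herm_vbundle"
  assumes Y: "block_subdiagonal ds Y"
  defines "n \<equiv> sum_list ds" and "E \<equiv> E_bundle \<eta> ds Y (1\<^sub>m (sum_list ds))"
begin

lemma E_simps: "total E = disc \<times> carrier_vec n" "bproj E = fst" "vadd E (z, u) (w, v) = (z, u + v)"
  "vscale E c (z, u) = (z, c \<cdot>\<^sub>v u)" "charts E = {(disc, snd)}"
  "bact E g (z, u) = (gt_act g z, aut_mat \<eta> ds Y (- gt_c g) (- gt_log_aut g z) *\<^sub>v u)"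
  by (simp_all add: E_def E_bundle_def n_def the_inverse_J_mat[OF Y])

lemma E_fibre: "z \<in> disc \<Longrightarrow> fibre E z = {z} \<times> carrier_vec n"
  by (auto simp: fibre_def E_simps)

lemma E_coords: "z \<in> disc \<Longrightarrow> fibre_coords E n z snd"
  unfolding fibre_coords_def E_fibre by (auto simp: bij_betw_def inj_on_def E_simps)

lemma E_inv: "z \<in> disc \<Longrightarrow> v \<in> carrier_vec n \<Longrightarrow> the_inv_into (fibre E z) snd v = (z, v)"
  using fibre_coordsD(2)[OF E_coords, of z "(z, v)"] by (simp add: E_fibre del: mem_ball)

lemma E_frame: "z \<in> disc \<Longrightarrow> frame E n snd z j = (z, unit_vec n j)"
  unfolding frame_def by (rule E_inv) simp_all

lemma A_carrier: "aut_mat \<eta> ds Y c L \<in> carrier_mat n n"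
  by (simp add: n_def)

lemma A_mult: "aut_mat \<eta> ds Y c1 L1 * aut_mat \<eta> ds Y c2 L2 = aut_mat \<eta> ds Y (c1 * exp L2 + c2 * exp (- L1)) (L1 + L2)"
  by (rule aut_mat_mult[OF Y])

lemma A_unit_vec: "i < n \<Longrightarrow> j < n \<Longrightarrow> (aut_mat \<eta> ds Y c L *\<^sub>v unit_vec n j) $ i = aut_mat \<eta> ds Y c L $$ (i, j)"
  by (subst mult_mat_unit_vec[OF A_carrier]) (simp_all add: n_def)

lemma E_vbundle: "hol_vbundle E n"
proof -
  have "hol_transition E n (disc, snd) (disc, snd)"
    unfolding hol_transition_def split_conv
  proof (intro allI impI)
    fix i j assume "i < n" "j < n"
    have "(\<lambda>z::complex. (unit_vec n j :: complex vec) $ i) holomorphic_on disc \<inter> disc" by (rule holomorphic_on_const)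
    then show "(\<lambda>z. snd (frame E n snd z j) $ i) holomorphic_on disc \<inter> disc"
      by (rule holomorphic_transform) (simp add: E_frame del: mem_ball)
  qed
  then show ?thesis
    unfolding hol_vbundle_def E_simps local_triv_def using E_coords by (auto simp del: mem_ball)
qed

lemma E_hom: "hom_hol_vbundle E n"
  unfolding hom_hol_vbundle_def
proof (intro conjI allI ballI E_vbundle)
  fix e assume "e \<in> total E"
  then obtain z u where e: "e = (z, u)" "z \<in> disc" "u \<in> carrier_vec n" by (auto simp: E_simps)
  show "bact E gt_one e = e"
    using e aut_mat_one[OF Y] by (simp add: E_simps gt_act_one gt_log_aut_one n_def)
  fix g h
  have "aut_mat \<eta> ds Y (- gt_c (gt_mult g h)) (- gt_log_aut (gt_mult g h) z) =
      aut_mat \<eta> ds Y (- gt_c g) (- gt_log_aut g (gt_act h z)) * aut_mat \<eta> ds Y (- gt_c h) (- gt_log_aut h z)"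
    unfolding A_mult gt_log_aut_mult[OF e(2)] gt_c_mult_aut[OF e(2)] by (simp add: algebra_simps)
  then show "bact E (gt_mult g h) e = bact E g (bact E h e)"
    unfolding e(1) E_simps gt_act_mult[OF e(2)] using assoc_mult_mat_vec[OF A_carrier A_carrier e(3)] by simp
next
  fix g
  show "hol_bundle_map E n E n (gt_act g) (bact E g)"
    unfolding hol_bundle_map_def
  proof (intro conjI)
    show "\<forall>z\<in>disc. \<forall>u\<in>fibre E z. bact E g u \<in> fibre E (gt_act g z)
        \<and> (\<forall>v\<in>fibre E z. bact E g (vadd E u v) = vadd E (bact E g u) (bact E g v))
        \<and> (\<forall>c. bact E g (vscale E c u) = vscale E c (bact E g u))"
    proof (intro ballI conjI allI)
      fix z e assume z: "z \<in> disc" and "e \<in> fibre E z"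
      then obtain u where e: "e = (z, u)" "u \<in> carrier_vec n" by (auto simp: E_fibre)
      show "bact E g e \<in> fibre E (gt_act g z)"
        unfolding E_fibre[OF gt_act_disc[OF z]] e(1) E_simps using mult_mat_vec_carrier[OF A_carrier e(2)] by simp
      show "bact E g (vscale E c e) = vscale E c (bact E g e)" for c
        unfolding e E_simps by (simp add: mult_mat_vec[OF A_carrier e(2)])
      fix f assume "f \<in> fibre E z"
      then obtain v where f: "f = (z, v)" "v \<in> carrier_vec n" using z by (auto simp: E_fibre)
      show "bact E g (vadd E e f) = vadd E (bact E g e) (bact E g f)"
        unfolding e f E_simps by (simp add: mult_add_distrib_mat_vec[OF A_carrier e(2) f(2)])
    qed
    have *: "(\<lambda>z. snd (bact E g (frame E n snd z j)) $ i) holomorphic_on {z\<in>disc. gt_act g z \<in> disc}"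
      if ij: "i < n" "j < n" for i j
    proof -
      have "(\<lambda>z. aut_mat \<eta> ds Y (- gt_c g) (- gt_log_aut g z) $$ (i, j)) holomorphic_on disc"
        by (rule holomorphic_aut_mat) (use ij in \<open>auto simp: n_def intro!: holomorphic_intros holomorphic_gt_log_aut\<close>)
      then have "(\<lambda>z. aut_mat \<eta> ds Y (- gt_c g) (- gt_log_aut g z) $$ (i, j)) holomorphic_on {z\<in>disc. gt_act g z \<in> disc}"
        by (rule holomorphic_on_subset) auto
      then show ?thesis
        by (rule holomorphic_transform) (use ij in \<open>auto simp: E_frame E_simps A_unit_vec simp del: mem_ball index_mult_mat_vec\<close>)
    qed
    show "\<forall>(U, \<phi>)\<in>charts E. \<forall>(V, \<psi>)\<in>charts E. \<forall>i<n. \<forall>j<n.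
        (\<lambda>z. \<psi> (bact E g (frame E n \<phi> z j)) $ i) holomorphic_on {z\<in>U. gt_act g z \<in> V}"
      unfolding E_simps(5) using * by blast
  qed
next
  have S: "{(g, z). z \<in> disc \<and> gt_act g z \<in> disc} = UNIV \<times> disc" using gt_act_disc by blast
  have oS: "open ((UNIV :: gtilde set) \<times> disc)" by (intro open_Times) auto
  have *: "smooth_on (UNIV \<times> disc) (\<lambda>(g, z). snd (bact E g (frame E n snd z j)) $ i)" if ij: "i < n" "j < n" for i j
  proof -
    have b: "smooth_on (UNIV \<times> disc) (\<lambda>x::gtilde \<times> complex. fst (fst x))"
      by (rule smooth_on_bounded_linear[OF _ oS]) (auto intro: bounded_linear_compose[OF bounded_linear_fst bounded_linear_fst])
    have t: "smooth_on (UNIV \<times> disc) (\<lambda>x::gtilde \<times> complex. complex_of_real (snd (fst x)))"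
      by (rule smooth_on_bounded_linear[OF _ oS])
        (auto intro: bounded_linear_compose[OF bounded_linear_of_real bounded_linear_compose[OF bounded_linear_snd bounded_linear_fst]])
    have z: "smooth_on (UNIV \<times> disc) (\<lambda>x::gtilde \<times> complex. snd x)"
      by (rule smooth_on_bounded_linear[OF bounded_linear_snd oS])
    have L: "smooth_on (UNIV \<times> disc) (\<lambda>x::gtilde \<times> complex. gt_log_aut (fst x) (snd x))"
      by (rule smooth_on_gt_log_aut[OF oS b t z]) auto
    have "smooth_on (UNIV \<times> disc) (\<lambda>x::gtilde \<times> complex. aut_mat \<eta> ds Y (- gt_c (fst x)) (- gt_log_aut (fst x) (snd x)) $$ (i, j))"
      by (rule smooth_on_aut_mat) (use ij in \<open>auto simp: n_def intro!: smooth_on_uminus oS smooth_on_gt_c(1) b L\<close>)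
    moreover have "(\<lambda>(g, z). snd (bact E g (frame E n snd z j)) $ i) x
        = aut_mat \<eta> ds Y (- gt_c (fst x)) (- gt_log_aut (fst x) (snd x)) $$ (i, j)" if "x \<in> UNIV \<times> disc" for x
      using that ij by (cases x) (auto simp: E_frame E_simps A_unit_vec simp del: mem_ball index_mult_mat_vec)
    ultimately show ?thesis using smooth_on_cong[OF oS] by (metis (no_types, lifting))
  qed
  show "case x of (U, \<phi>) \<Rightarrow> \<forall>(V, \<psi>)\<in>charts E. \<forall>i<n. \<forall>j<n.
        smooth_on {(g, z). z \<in> U \<and> gt_act g z \<in> V} (\<lambda>(g, z). \<psi> (bact E g (frame E n \<phi> z j)) $ i)"
    if "x \<in> charts E" for x
    using that * unfolding E_simps(5) S[symmetric] by blast
qed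

lemma J_carrier: "J_origin \<eta> ds Y z \<in> carrier_mat n n"
  by (simp add: J_origin_def n_def)

lemma E_herm:
  assumes "u \<in> carrier_vec n" "v \<in> carrier_vec n"
  shows "herm E (z, u) (w, v) = (J_origin \<eta> ds Y z *\<^sub>v u) \<bullet>c (J_origin \<eta> ds Y z *\<^sub>v v)"
proof -
  let ?J = "J_origin \<eta> ds Y z"
  have a: "mat_adjoint ?J \<in> carrier_mat n n" using J_carrier by simp
  have "H_mat \<eta> ds Y (1\<^sub>m n) z = mat_adjoint ?J * 1\<^sub>m n * ?J"
    by (simp add: H_mat_def J_mat_aut[OF Y] J_origin_def Let_def)
  then have "H_mat \<eta> ds Y (1\<^sub>m n) z = mat_adjoint ?J * ?J" by (simp only: right_mult_one_mat[OF a])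
  then have "herm E (z, u) (w, v) = (mat_adjoint ?J *\<^sub>v (?J *\<^sub>v u)) \<bullet>c v"
    using assoc_mult_mat_vec[OF a J_carrier assms(1)] by (simp add: E_def E_bundle_def n_def)
  also have "\<dots> = (?J *\<^sub>v u) \<bullet>c (?J *\<^sub>v v)"
    using cscalar_prod_adjoint[OF a mult_mat_vec_carrier[OF J_carrier assms(1)] assms(2)] by (simp add: mat_adjoint_adjoint)
  finally show ?thesis .
qed

lemma J_origin_0: "J_origin \<eta> ds Y 0 = 1\<^sub>m n"
  by (simp add: J_origin_def gt_transvection_0 gt_log_aut_one aut_mat_one[OF Y] n_def)

lemma J_inner: "inner_form n (\<lambda>u v. (J_origin \<eta> ds Y z *\<^sub>v u) \<bullet>c (J_origin \<eta> ds Y z *\<^sub>v v))"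
  unfolding J_origin_def
  by (rule inner_form_comp[OF inner_form_cscalar A_carrier A_carrier]) (use aut_mat_inverse(2)[OF Y] in \<open>simp add: n_def\<close>)

lemma smooth_J_origin:
  assumes ij: "i < n" "j < n"
  shows "smooth_on disc (\<lambda>z. J_origin \<eta> ds Y z $$ (i, j))"
proof -
  show ?thesis unfolding J_origin_def
    by (rule smooth_on_aut_mat[OF _ _ open_ball smooth_on_gt_c(1)[OF open_ball smooth_transvection(1)] smooth_transvection(3)])
      (use ij in \<open>auto simp: n_def\<close>)
qed

lemma E_herm_structure: "herm_structure E n"
  unfolding herm_structure_def
proof (intro conjI ballI allI impI)
  fix z e f assume z: "z \<in> disc" and "e \<in> fibre E z" "f \<in> fibre E z"
  then obtain u v where e: "e = (z, u)" "u \<in> carrier_vec n" and f: "f = (z, v)" "v \<in> carrier_vec n" by (auto simp: E_fibre)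
  note i = J_inner[of z]
  show "herm E f e = cnj (herm E e f)"
    unfolding e f E_herm[OF e(2) f(2)] E_herm[OF f(2) e(2)] by (rule inner_formD(3)[OF i e(2) f(2)])
  show "herm E (vscale E c e) f = c * herm E e f" for c
    unfolding e f E_simps E_herm[OF e(2) f(2)] E_herm[OF smult_carrier_vec[THEN iffD2, OF e(2)] f(2)]
    by (rule inner_formD(2)[OF i e(2) f(2)])
  fix k assume "k \<in> fibre E z"
  then obtain w where k: "k = (z, w)" "w \<in> carrier_vec n" using z by (auto simp: E_fibre)
  show "herm E (vadd E e f) k = herm E e k + herm E f k"
    unfolding e f k E_simps E_herm[OF e(2) k(2)] E_herm[OF f(2) k(2)] E_herm[OF add_carrier_vec[OF e(2) f(2)] k(2)]
    by (rule inner_formD(1)[OF i e(2) f(2) k(2)])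
next
  fix e assume "e \<in> total E" and nz: "e \<noteq> vscale E 0 e"
  then obtain z u where e: "e = (z, u)" "u \<in> carrier_vec n" by (auto simp: E_simps)
  have "0 \<cdot>\<^sub>v 0\<^sub>v n = (0\<^sub>v n :: complex vec)" by (intro eq_vecI) auto
  then have "u \<noteq> 0\<^sub>v n" using nz by (auto simp: e E_simps)
  then show "0 < Re (herm E e e)" unfolding e E_herm[OF e(2) e(2)] by (rule inner_formD(4)[OF J_inner e(2) e(2)])
next
  have *: "smooth_on disc (\<lambda>z. herm E (frame E n snd z i) (frame E n snd z j))" if ij: "i < n" "j < n" for i j
  proof -
    have "smooth_on disc (\<lambda>z. \<Sum>k<n. J_origin \<eta> ds Y z $$ (k, i) * cnj (J_origin \<eta> ds Y z $$ (k, j)))"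
      by (intro smooth_intros smooth_J_origin) (use ij in auto)
    moreover have "herm E (frame E n snd z i) (frame E n snd z j)
        = (\<Sum>k<n. J_origin \<eta> ds Y z $$ (k, i) * cnj (J_origin \<eta> ds Y z $$ (k, j)))" if "z \<in> disc" for z
    proof -
      have "(J_origin \<eta> ds Y z *\<^sub>v unit_vec n l) $ k = J_origin \<eta> ds Y z $$ (k, l)" if "l < n" "k < n" for k l
        using that J_carrier[of z] by (subst mult_mat_unit_vec[OF J_carrier]) auto
      then show ?thesis
        unfolding E_frame[OF that] E_herm[OF unit_vec_carrier unit_vec_carrier]
        using ij J_carrier[of z] by (subst cscalar_prod_sum[of _ n]) (auto simp del: index_mult_mat_vec)
    qed
    ultimately show ?thesis using smooth_on_cong[OF open_ball] by (metis (no_types, lifting))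
  qed
  show "case x of (U, \<phi>) \<Rightarrow> \<forall>i<n. \<forall>j<n. smooth_on U (\<lambda>z. herm E (frame E n \<phi> z i) (frame E n \<phi> z j))"
    if "x \<in> charts E" for x using that * unfolding E_simps(5) by blast
qed

text \<open>The transvection to \<open>g z\<close> differs from \<open>g\<close> times the transvection to \<open>z\<close> by an element of the
  stabilizer, which acts by a diagonal unitary matrix.\<close>

lemma E_invariant:
  assumes z: "z \<in> disc" and u: "u \<in> carrier_vec n" and v: "v \<in> carrier_vec n"
  shows "herm E (bact E g (z, u)) (bact E g (z, v)) = herm E (z, u) (z, v)"
proof -
  let ?A = "\<lambda>g z. aut_mat \<eta> ds Y (gt_c g) (gt_log_aut g z)"
  let ?M = "aut_mat \<eta> ds Y (- gt_c g) (- gt_log_aut g z)"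
  let ?t = "gt_transvection z" and ?t' = "gt_transvection (gt_act g z)"
  have o: "0 \<in> disc" by simp
  have gz: "gt_act g z \<in> disc" by (rule gt_act_disc[OF z])
  have "gt_act ?t' 0 = gt_act (gt_mult g ?t) 0"
    by (simp only: gt_act_mult[OF o] gt_act_transvection[OF z] gt_act_transvection[OF gz])
  \<comment> \<open>The element \<open>gt_exp_ih x\<close> of the stabilizer contributes the diagonal unitary matrix \<open>?K\<close>.\<close>
  then obtain x where gt: "gt_mult g ?t = gt_mult ?t' (gt_exp_ih x)" by (rule gt_orbit_eq)
  let ?K = "diagonal n (\<lambda>i. exp (\<i> * of_real (x * (\<eta> + real (blk_of ds i)))))"
  have K: "?A (gt_exp_ih x) 0 = ?K"
    unfolding aut_mat_exp_ih[OF Y] h_mat_def mat_exp_diagonal n_def by (simp add: algebra_simps)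
  have "J_origin \<eta> ds Y z * ?A g z = ?A (gt_mult g ?t) 0"
    unfolding aut_mat_cocycle[OF Y o] gt_act_transvection[OF z] J_origin_def ..
  also have "\<dots> = ?K * J_origin \<eta> ds Y (gt_act g z)"
    unfolding gt aut_mat_cocycle[OF Y o] K by (simp add: J_origin_def)
  finally have JA: "J_origin \<eta> ds Y z * ?A g z = ?K * J_origin \<eta> ds Y (gt_act g z)" .
  have "?K * (J_origin \<eta> ds Y (gt_act g z) * ?M) = (J_origin \<eta> ds Y z * ?A g z) * ?M"
    unfolding JA by (rule assoc_mult_mat[OF diagonal_carrier(1) J_carrier A_carrier, symmetric])
  also have "\<dots> = J_origin \<eta> ds Y z"
    unfolding assoc_mult_mat[OF J_carrier A_carrier A_carrier] aut_mat_inverse(1)[OF Y]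
    by (rule right_mult_one_mat[OF J_carrier, unfolded n_def])
  finally have KJ: "?K * (J_origin \<eta> ds Y (gt_act g z) * ?M) = J_origin \<eta> ds Y z" .
  have Kiso: "(?K *\<^sub>v a) \<bullet>c (?K *\<^sub>v b) = a \<bullet>c b" if "a \<in> carrier_vec n" "b \<in> carrier_vec n" for a b
  proof -
    have "exp (\<i> * of_real y) * a' * cnj (exp (\<i> * of_real y) * b') = a' * cnj b'" for y :: real and a' b' :: complex
    proof -
      have "exp (\<i> * of_real y) * cnj (exp (\<i> * of_real y)) = 1"
        by (simp flip: cis_conv_exp add: cis_cnj cis_mult)
      then show ?thesis by (simp add: mult.assoc mult.left_commute)
    qed
    note unit = this
    have "(?K *\<^sub>v a) \<bullet>c (?K *\<^sub>v b) = (\<Sum>i<n. (?K *\<^sub>v a) $ i * cnj ((?K *\<^sub>v b) $ i))"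
      by (rule cscalar_prod_sum) simp
    also have "\<dots> = (\<Sum>i<n. a $ i * cnj (b $ i))"
      by (intro sum.cong refl) (simp only: diagonal_mult_vec that lessThan_iff unit)
    also have "\<dots> = a \<bullet>c b" using that by (simp add: cscalar_prod_sum[of _ n])
    finally show ?thesis .
  qed
  have Mu: "?M *\<^sub>v u \<in> carrier_vec n" "?M *\<^sub>v v \<in> carrier_vec n"
    by (rule mult_mat_vec_carrier[OF A_carrier u], rule mult_mat_vec_carrier[OF A_carrier v])
  have KJv: "?K *\<^sub>v (J_origin \<eta> ds Y (gt_act g z) *\<^sub>v (?M *\<^sub>v w)) = J_origin \<eta> ds Y z *\<^sub>v w" if "w \<in> carrier_vec n" for w
    unfolding KJ[symmetric] assoc_mult_mat_vec[OF diagonal_carrier(1) mult_carrier_mat[OF J_carrier A_carrier] that]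
      assoc_mult_mat_vec[OF J_carrier A_carrier that] ..
  show ?thesis
    unfolding E_simps E_herm[OF Mu] E_herm[OF u v] KJv[OF u, symmetric] KJv[OF v, symmetric]
    by (rule Kiso[symmetric]) (intro mult_mat_vec_carrier[OF J_carrier] Mu)+
qed

lemma E_hom_herm: "hom_hol_herm_vbundle E n"
  unfolding hom_hol_herm_vbundle_def
proof (intro conjI E_hom E_herm_structure allI ballI)
  fix g z e f assume z: "z \<in> disc" "e \<in> fibre E z" "f \<in> fibre E z"
  then obtain u v where "e = (z, u)" "u \<in> carrier_vec n" "f = (z, v)" "v \<in> carrier_vec n" by (auto simp: E_fibre)
  then show "herm E (bact E g e) (bact E g f) = herm E e f" using E_invariant[OF z(1)] by simp
qed

lemma E_fibre_form: "u \<in> carrier_vec n \<Longrightarrow> v \<in> carrier_vec n \<Longrightarrow> fibre_form E snd u v = u \<bullet>c v"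
  unfolding fibre_form_def by (simp add: E_inv E_herm J_origin_0)

end

subsection \<open>Lifts of holomorphic sections\<close>

lemma gt_act_exp_0: "gt_act (gt_exp_x1 t) 0 = of_real (tanh t)" "gt_act (gt_exp_x2 t) 0 = \<i> * of_real (tanh t)"
  by (simp_all add: gt_act_0 tanh_def)

lemma gt_aut_exp: "gt_c (gt_exp_x1 t) = of_real (sinh t)" "gt_c (gt_exp_x2 t) = - \<i> * of_real (sinh t)"
  "gt_log_aut (gt_exp_x1 t) 0 = of_real (ln (cosh t))" "gt_log_aut (gt_exp_x2 t) 0 = of_real (ln (cosh t))"
proof -
  have "cmod (gt_d (gt_exp_x1 t)) = cosh t" "cmod (gt_d (gt_exp_x2 t)) = cosh t"
    by (simp_all add: cosh_real_nonneg)
  then show "gt_log_aut (gt_exp_x1 t) 0 = of_real (ln (cosh t))" "gt_log_aut (gt_exp_x2 t) 0 = of_real (ln (cosh t))"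
    unfolding gt_log_aut_def by (simp_all add: gt_exp_x1_def gt_exp_x2_def)
qed (simp_all add: gt_c_def)

text \<open>On the one-parameter subgroups below, the lower left entry is a multiple of \<open>sinh t\<close> and the logarithm is
  \<open>ln (cosh t)\<close>, which vanishes to second order. Hence only the entries one block below the diagonal have a term of
  first order.\<close>

lemma aut_mat_curve_derivative:
  assumes Y: "block_subdiagonal ds Y" and ij: "i < sum_list ds" "j < sum_list ds"
  shows "((\<lambda>t. aut_mat \<eta> ds Y (\<kappa> * of_real (sinh t)) (of_real (ln (cosh t))) $$ (i, j)) has_vector_derivative
    - \<kappa> * Y $$ (i, j)) (at 0)"
proof -
  let ?k = "blk_of ds i - blk_of ds j" and ?m = "2 * of_real \<eta> + of_nat (blk_of ds i) + of_nat (blk_of ds j) :: complex"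
  \<comment> \<open>The entry extends to a holomorphic function of \<open>t\<close> near \<open>0\<close>, for which the rules of complex differentiation apply.\<close>
  define D where "D z = (- (\<kappa> * ((exp z - exp (- z)) / 2))) ^ ?k / fact ?k * exp (- ?m * Ln ((exp z + exp (- z)) / 2)) * (Y ^\<^sub>m ?k) $$ (i, j)" for z
  define d where "d = (if ?k = 1 then - \<kappa> * Y $$ (i, j) else 0)"
  have c: "Y \<in> carrier_mat (sum_list ds) (sum_list ds)" using Y by (simp add: block_subdiagonal_iff)
  have "(D has_field_derivative d) (at (of_real 0))"
    unfolding D_def d_def
    by (rule derivative_eq_intros refl | simp add: complex_nonpos_Reals_iff)+ (use c in \<open>auto simp: power_0_left split: if_splits\<close>)
  then have "((\<lambda>t. D (of_real t)) has_vector_derivative d) (at 0)"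
    by (rule has_vector_derivative_real_field)
  moreover have "D (of_real t) = aut_mat \<eta> ds Y (\<kappa> * of_real (sinh t)) (of_real (ln (cosh t))) $$ (i, j)" for t
  proof -
    have s: "(exp (of_real t) - exp (- of_real t)) / 2 = complex_of_real (sinh t)"
      and k: "(exp (of_real t) + exp (- of_real t)) / 2 = complex_of_real (cosh t)"
      by (simp_all add: sinh_def cosh_def scaleR_conv_of_real flip: exp_of_real)
    have "Ln (complex_of_real (cosh t)) = of_real (ln (cosh t))" by (simp add: Ln_of_real cosh_real_pos)
    then show ?thesis unfolding D_def aut_mat_index[OF ij] s k by simp
  qed
  moreover have "d = - \<kappa> * Y $$ (i, j)"
  proof (cases "?k = 1")
    case False
    then have "Y $$ (i, j) = 0" using Y ij by (auto simp: block_subdiagonal_iff)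
    then show ?thesis using False by (simp add: d_def)
  qed (simp add: d_def)
  ultimately show ?thesis by simp
qed

lemma tanh_curve_derivative: "((\<lambda>t. \<kappa> * complex_of_real (tanh t)) has_vector_derivative \<kappa>) (at 0)"
proof -
  have "(tanh has_real_derivative 1) (at 0)"
    by (rule derivative_eq_intros refl | simp)+
  then have "(tanh has_vector_derivative 1) (at 0)" by (simp add: has_real_derivative_iff_has_vector_derivative)
  then have "((\<lambda>t. complex_of_real (tanh t)) has_vector_derivative of_real 1) (at 0)"
    by (rule bounded_linear.has_vector_derivative[OF bounded_linear_of_real])
  from has_vector_derivative_mult_right[OF this, of \<kappa>] show ?thesis by simp
qed

text \<open>Writing \<open>F(g e) = J\<^sub>e(0) P(e 0)\<close> for the elements \<open>e\<close> of the two one-parameter subgroups, the derivative of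
  \<open>J\<^sub>e\<close> contributes \<open>- Y P(0)\<close>, and that of \<open>P\<close> the Cauchy-Riemann operator.\<close>

lemma lie_y_cauchy_riemann:
  assumes Y: "block_subdiagonal ds Y" and n: "n = sum_list ds" and i: "i < n"
    and F: "\<And>e. F (gt_mult g e) = (\<Sum>j<n. aut_mat \<eta> ds Y (gt_c e) (gt_log_aut e 0) $$ (i, j) * P j (gt_act e 0))"
    and P: "\<And>j. j < n \<Longrightarrow> (P j has_derivative P' j) (at 0)"
  shows "lie_y F g = - (\<Sum>j<n. Y $$ (i, j) * P j 0) + (P' i 1 + \<i> * P' i \<i>) / 2"
proof -
  have main: "lie_deriv e F g = - \<kappa> * (\<Sum>j<n. Y $$ (i, j) * P j 0) + P' i \<kappa>'"
    if e: "\<And>t. gt_c (e t) = \<kappa> * of_real (sinh t)" "\<And>t. gt_log_aut (e t) 0 = of_real (ln (cosh t))"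
      "\<And>t. gt_act (e t) 0 = \<kappa>' * of_real (tanh t)" for e \<kappa> \<kappa>'
  proof -
    note tc = tanh_curve_derivative[of \<kappa>']
    have Pd: "((\<lambda>t. P j (\<kappa>' * of_real (tanh t))) has_vector_derivative P' j \<kappa>') (at 0)" if j: "j < n" for j
    proof -
      have "((\<lambda>t. P j (\<kappa>' * of_real (tanh t))) has_derivative (\<lambda>s. P' j (s *\<^sub>R \<kappa>'))) (at 0)"
        using has_derivative_compose[OF tc[unfolded has_vector_derivative_def], of "P j" "P' j"] P[OF j] by simp
      then show ?thesis unfolding has_vector_derivative_def
        using linear_scale[OF has_derivative_linear[OF P[OF j]]] by simp
    qed
    have "((\<lambda>t. \<Sum>j<n. aut_mat \<eta> ds Y (\<kappa> * of_real (sinh t)) (of_real (ln (cosh t))) $$ (i, j) * P j (\<kappa>' * of_real (tanh t)))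
        has_vector_derivative (\<Sum>j<n. aut_mat \<eta> ds Y (\<kappa> * of_real (sinh 0)) (of_real (ln (cosh 0))) $$ (i, j) * P' j \<kappa>'
          + - \<kappa> * Y $$ (i, j) * P j (\<kappa>' * of_real (tanh 0)))) (at 0)"
      by (intro has_vector_derivative_sum has_vector_derivative_mult aut_mat_curve_derivative[OF Y] Pd) (use i n in auto)
    also have "(\<Sum>j<n. aut_mat \<eta> ds Y (\<kappa> * of_real (sinh 0)) (of_real (ln (cosh 0))) $$ (i, j) * P' j \<kappa>'
          + - \<kappa> * Y $$ (i, j) * P j (\<kappa>' * of_real (tanh 0)))
        = (\<Sum>j<n. (if j = i then P' i \<kappa>' else 0)) + - \<kappa> * (\<Sum>j<n. Y $$ (i, j) * P j 0)"
      unfolding sum.distrib sum_distrib_left using aut_mat_one[OF Y] i n by (auto intro!: arg_cong2[where f = "(+)"] sum.cong simp: if_distrib[of "\<lambda>x. x * _"] cong: if_cong)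
    finally have "((\<lambda>t. \<Sum>j<n. aut_mat \<eta> ds Y (\<kappa> * of_real (sinh t)) (of_real (ln (cosh t))) $$ (i, j) * P j (\<kappa>' * of_real (tanh t)))
        has_vector_derivative - \<kappa> * (\<Sum>j<n. Y $$ (i, j) * P j 0) + P' i \<kappa>') (at 0)" (is "(?f has_vector_derivative ?d) _")
      using i by (simp add: add.commute)
    then have d: "vector_derivative ?f (at 0) = ?d" by (rule vector_derivative_at)
    have "(\<lambda>t. F (gt_mult g (e t))) = ?f" by (simp add: F e fun_eq_iff)
    then show ?thesis unfolding lie_deriv_def using d by simp
  qed
  have "lie_deriv gt_exp_x1 F g = - 1 * (\<Sum>j<n. Y $$ (i, j) * P j 0) + P' i 1"
    by (rule main) (simp_all add: gt_aut_exp gt_act_exp_0)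
  moreover have "lie_deriv gt_exp_x2 F g = - (- \<i>) * (\<Sum>j<n. Y $$ (i, j) * P j 0) + P' i \<i>"
    by (rule main) (simp_all add: gt_aut_exp gt_act_exp_0)
  moreover have "(- 1 * s + p + \<i> * (- (- \<i>) * s + q)) / 2 = - s + (p + \<i> * q) / 2" for s p q
    by (simp add: field_simps)
  ultimately show ?thesis unfolding lie_y_def by (simp only:)
qed

lemma complex_differentiable_iff_cauchy_riemann:
  assumes "(f has_derivative f') (at z)"
  shows "f field_differentiable (at z) \<longleftrightarrow> f' 1 + \<i> * f' \<i> = 0"
proof
  assume "f field_differentiable (at z)"
  then obtain D where "(f has_derivative (*) D) (at z)"
    by (auto simp: field_differentiable_def has_field_derivative_def)
  then have "f' = (*) D" using assms has_derivative_unique by blast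
  then show "f' 1 + \<i> * f' \<i> = 0" by (simp add: mult.commute[of D] flip: mult.assoc)
next
  assume e: "f' 1 + \<i> * f' \<i> = 0"
  have lin: "linear f'" by (rule has_derivative_linear[OF assms])
  have "\<i> * (f' 1 + \<i> * f' \<i>) = 0" using e by simp
  then have fi: "f' \<i> = \<i> * f' 1" by (simp add: algebra_simps)
  have "f' w = f' 1 * w" for w
  proof -
    have "w = Re w *\<^sub>R 1 + Im w *\<^sub>R \<i>" by (simp add: complex_eq_iff)
    from arg_cong[OF this, of f'] have "f' w = f' (Re w *\<^sub>R 1 + Im w *\<^sub>R \<i>)" .
    also have "\<dots> = Re w *\<^sub>R f' 1 + Im w *\<^sub>R f' \<i>" using lin by (simp add: linear_add linear_scale)
    also have "\<dots> = f' 1 * (of_real (Re w) + \<i> * of_real (Im w))" by (simp add: fi scaleR_conv_of_real algebra_simps)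
    also have "of_real (Re w) + \<i> * of_real (Im w) = w" by (simp add: complex_eq_iff)
    finally show ?thesis .
  qed
  then have "f' = (*) (f' 1)" by (rule ext)
  then have "(f has_field_derivative f' 1) (at z)" using assms by (simp add: has_field_derivative_def)
  then show "f field_differentiable (at z)" by (auto simp: field_differentiable_def)
qed

lemma field_differentiable_imp_differentiable:
  "f field_differentiable (at z) \<Longrightarrow> f differentiable (at z)"
  by (auto simp: field_differentiable_def has_field_derivative_def differentiable_def)

lemma differentiable_cong_open:
  assumes "f differentiable (at z)" "open S" "z \<in> S" "\<And>x. x \<in> S \<Longrightarrow> f x = g x"
  shows "g differentiable (at z)"
  using assms(1) has_derivative_transform_within_open[OF _ assms(2,3), of f _ UNIV g] assms(4)
  unfolding differentiable_def by blast

lemma field_differentiable_cong_open: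
  assumes "f field_differentiable (at z)" "open S" "z \<in> S" "\<And>x. x \<in> S \<Longrightarrow> f x = g x"
  shows "g field_differentiable (at z)"
  using assms has_field_derivative_transform_within_open unfolding field_differentiable_def by metis

lemma transvection_differentiable: "z \<in> disc \<Longrightarrow> gt_transvection differentiable (at z)"
proof -
  assume z: "z \<in> disc"
  have "gt_transvection = (\<lambda>z. (fst (gt_transvection z), 0))" by (auto simp: gt_transvection_def)
  moreover have "(\<lambda>z. (fst (gt_transvection z), 0 :: real)) differentiable (at z)"
    by (intro differentiable_Pair smooth_on_differentiable[OF smooth_transvection(1) z] differentiable_const)
  ultimately show ?thesis by simp
qed

text \<open>By the cocycle identity, right translates of \<open>F\<close> at \<open>g\<close> have the form treated above, where \<open>P\<close> is
  \<open>w \<mapsto> J\<^sub>g(w) f(g w)\<close>. The equation for \<open>y\<close> at \<open>g\<close> thus says that \<open>P\<close> is complex differentiable at \<open>0\<close>,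
  equivalently that \<open>f\<close> is complex differentiable at \<open>g 0\<close>. Equivariance and the equation for \<open>h\<close> hold for every
  \<open>f\<close>. In the converse direction, real differentiability of \<open>f\<close> comes first: \<open>f(z)\<close> is recovered from the smooth function \<open>F\<close>
  at the transvection to \<open>z\<close>.\<close>

theorem induced_lift_canonical:
  assumes Y: "block_subdiagonal ds Y" and n: "n = sum_list ds" and U: "open U" "U \<subseteq> disc"
    and f: "\<And>z. f z \<in> carrier_vec n"
  shows "(\<forall>i<n. (\<lambda>z. f z $ i) holomorphic_on U) \<longleftrightarrow>
    induced_lift n (h_mat \<eta> ds) Y {g. gt_act g 0 \<in> U}
      (\<lambda>g. aut_mat \<eta> ds Y (gt_c g) (gt_log_aut g 0) *\<^sub>v f (gt_act g 0))"
proof -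
  let ?W = "{g. gt_act g 0 \<in> U}"
  let ?A = "\<lambda>g z. aut_mat \<eta> ds Y (gt_c g) (gt_log_aut g z)"
  let ?B = "\<lambda>g z. aut_mat \<eta> ds Y (- gt_c g) (- gt_log_aut g z)"
  define F where "F g = ?A g 0 *\<^sub>v f (gt_act g 0)" for g
  define P where "P g j w = (\<Sum>k<n. ?A g w $$ (j, k) * f (gt_act g w) $ k)" for g j w
  have W: "open ?W" by (rule open_gt_act_0[OF U(1)])
  have o: "0 \<in> disc" by simp
  have Ac: "aut_mat \<eta> ds Y c L \<in> carrier_mat n n" for c L by (simp add: n)
  have Yc: "Y \<in> carrier_mat n n" using Y by (simp add: n block_subdiagonal_iff)
  have Fc: "F g \<in> carrier_vec n" for g unfolding F_def by (rule mult_mat_vec_carrier[OF Ac f])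
  have Pv: "P g j w = (?A g w *\<^sub>v f (gt_act g w)) $ j" if "j < n" for g j w
    unfolding P_def by (rule mult_mat_vec_sum[OF Ac f that, symmetric])
  have BA: "?B g w *\<^sub>v (?A g w *\<^sub>v f z) = f z" for g w z
  proof -
    have "?B g w *\<^sub>v (?A g w *\<^sub>v f z) = (?B g w * ?A g w) *\<^sub>v f z"
      by (rule assoc_mult_mat_vec[OF Ac Ac f, symmetric])
    also have "\<dots> = f z" unfolding aut_mat_inverse(2)[OF Y] n[symmetric] by (rule one_mult_mat_vec[OF f])
    finally show ?thesis .
  qed
  have P0: "P g j 0 = F g $ j" if "j < n" for g j unfolding Pv[OF that] F_def ..
  have FP: "F (gt_mult g e) $ i = (\<Sum>j<n. ?A e 0 $$ (i, j) * P g j (gt_act e 0))" if i: "i < n" for g e i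
  proof -
    have "F (gt_mult g e) = ?A e 0 *\<^sub>v (?A g (gt_act e 0) *\<^sub>v f (gt_act g (gt_act e 0)))"
      unfolding F_def aut_mat_cocycle[OF Y o] gt_act_mult[OF o] by (rule assoc_mult_mat_vec[OF Ac Ac f])
    then have "F (gt_mult g e) $ i = (?A e 0 *\<^sub>v (?A g (gt_act e 0) *\<^sub>v f (gt_act g (gt_act e 0)))) $ i" by simp
    also have "\<dots> = (\<Sum>j<n. ?A e 0 $$ (i, j) * (?A g (gt_act e 0) *\<^sub>v f (gt_act g (gt_act e 0))) $ j)"
      by (rule mult_mat_vec_sum[OF Ac mult_mat_vec_carrier[OF Ac f] i])
    also have "\<dots> = (\<Sum>j<n. ?A e 0 $$ (i, j) * P g j (gt_act e 0))"
      by (rule sum.cong[OF refl]) (simp only: Pv lessThan_iff)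
    finally show ?thesis .
  qed
  have eqv: "F (gt_mult g (gt_exp_ih t)) = mat_exp ((- \<i> * of_real t) \<cdot>\<^sub>m h_mat \<eta> ds) *\<^sub>v F g" for g t
    unfolding F_def aut_mat_cocycle[OF Y o] gt_act_mult[OF o] aut_mat_exp_ih[OF Y] gt_act_exp_ih
    by (rule assoc_mult_mat_vec[of _ n n, OF _ Ac f]) (simp add: n h_mat_def mat_exp_diagonal)
  have lh: "lie_h (\<lambda>g. F g $ i) g = - (h_mat \<eta> ds *\<^sub>v F g) $ i" if i: "i < n" for g i
  proof -
    let ?c = "\<i> * of_real (\<eta> + real (blk_of ds i))"
    have Fi: "F (gt_mult g (gt_exp_ih t)) $ i = exp (?c * of_real t) * F g $ i" for t
      unfolding eqv h_mat_def mat_exp_diagonal n[symmetric] diagonal_mult_vec[OF i Fc] by (simp add: algebra_simps)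
    have "((\<lambda>z. exp (?c * z) * F g $ i) has_field_derivative ?c * F g $ i) (at (of_real 0))"
      by (rule derivative_eq_intros refl | simp)+
    then have "((\<lambda>t. exp (?c * of_real t) * F g $ i) has_vector_derivative ?c * F g $ i) (at 0)"
      by (rule has_vector_derivative_real_field)
    then have "lie_deriv gt_exp_ih (\<lambda>g. F g $ i) g = ?c * F g $ i"
      unfolding lie_deriv_def Fi by (rule vector_derivative_at)
    then have "lie_h (\<lambda>g. F g $ i) g = of_real (\<eta> + real (blk_of ds i)) * F g $ i"
      by (simp add: lie_h_def flip: mult.assoc)
    then show ?thesis unfolding h_mat_def n[symmetric] diagonal_mult_vec[OF i Fc] by (simp add: algebra_simps)
  qed
  have hol_entry: "(\<lambda>w. ?A g w $$ (j, k)) holomorphic_on disc" "(\<lambda>w. ?B g w $$ (j, k)) holomorphic_on disc"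
    if "j < n" "k < n" for g j k
    using that by (auto intro!: holomorphic_aut_mat holomorphic_intros holomorphic_gt_log_aut simp: n)
  have fd_entry: "(\<lambda>w. ?A g w $$ (j, k)) field_differentiable (at w)" "(\<lambda>w. ?B g w $$ (j, k)) field_differentiable (at w)"
    if "j < n" "k < n" "w \<in> disc" for g j k w
    using hol_entry[OF that(1,2), of g] that(3) holomorphic_on_imp_differentiable_at[OF _ open_ball] by blast+
  have fd_act: "gt_act g field_differentiable (at w)" if "w \<in> disc" for g w
    using holomorphic_on_imp_differentiable_at[OF holomorphic_gt_act open_ball that] .
  have ly: "lie_y (\<lambda>g. F g $ i) g = - (Y *\<^sub>v F g) $ i \<longleftrightarrow> P g i field_differentiable (at 0)"
    if i: "i < n" and d: "\<And>k. k < n \<Longrightarrow> (\<lambda>z. f z $ k) differentiable (at (gt_act g 0))" for g i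
  proof -
    have "P g j differentiable (at 0)" if j: "j < n" for j
      unfolding P_def
    proof (intro differentiable_sum differentiable_mult ballI)
      fix k assume "k \<in> {..<n}"
      then have k: "k < n" by simp
      show "(\<lambda>w. ?A g w $$ (j, k)) differentiable (at 0)"
        by (rule field_differentiable_imp_differentiable[OF fd_entry(1)[OF j k o]])
      show "(\<lambda>w. f (gt_act g w) $ k) differentiable (at 0)"
        using differentiable_chain_at[OF field_differentiable_imp_differentiable[OF fd_act[OF o]] d[OF k]] by (simp add: o_def)
    qed simp
    then obtain P' where P': "\<And>j. j < n \<Longrightarrow> (P g j has_derivative P' j) (at 0)"
      unfolding differentiable_def by metis
    have "lie_y (\<lambda>g. F g $ i) g = - (\<Sum>j<n. Y $$ (i, j) * P g j 0) + (P' i 1 + \<i> * P' i \<i>) / 2"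
      by (rule lie_y_cauchy_riemann[where F = "\<lambda>g. F g $ i" and P = "P g", OF Y n i FP[OF i] P'])
    moreover have "(\<Sum>j<n. Y $$ (i, j) * P g j 0) = (Y *\<^sub>v F g) $ i"
      unfolding mult_mat_vec_sum[OF Yc Fc i] using P0 by simp
    ultimately show ?thesis unfolding complex_differentiable_iff_cauchy_riemann[OF P'[OF i]] by auto
  qed
  show ?thesis
  proof
    assume "\<forall>i<n. (\<lambda>z. f z $ i) holomorphic_on U"
    then have hol: "(\<lambda>z. f z $ i) holomorphic_on U" if "i < n" for i using that by blast
    have fd: "(\<lambda>z. f z $ i) field_differentiable (at z)" if "i < n" "z \<in> U" for i z
      using holomorphic_on_imp_differentiable_at[OF hol[OF that(1)] U(1) that(2)] .
    have sF: "smooth_on ?W (\<lambda>g. F g $ i)" if i: "i < n" for i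
    proof -
      have "smooth_on ?W (\<lambda>g. \<Sum>k<n. ?A g 0 $$ (i, k) * f (gt_act g 0) $ k)"
      proof (intro smooth_intros W)
        fix k assume "k \<in> {..<n}"
        then have k: "k < n" by simp
        show "smooth_on ?W (\<lambda>g. ?A g 0 $$ (i, k))"
          by (rule smooth_on_aut_mat) (use i k in \<open>auto simp: n intro!: W smooth_on_gt_c(1) smooth_on_gt_log_aut smooth_on_fst smooth_on_snd smooth_on_const\<close>)
        show "smooth_on ?W (\<lambda>g. f (gt_act g 0) $ k)"
          by (rule smooth_on_holomorphic_comp[OF W U(1) _ hol[OF k] smooth_gt_act_0[OF W]]) auto
      qed
      then show ?thesis unfolding F_def mult_mat_vec_sum[OF Ac f i] .
    qed
    have lF: "lie_y (\<lambda>g. F g $ i) g = - (Y *\<^sub>v F g) $ i" if i: "i < n" and g: "g \<in> ?W" for i g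
    proof -
      have z: "gt_act g 0 \<in> U" using g by simp
      have "P g i field_differentiable (at 0)"
        unfolding P_def
      proof (intro field_differentiable_sum field_differentiable_mult)
        fix k assume "k \<in> {..<n}"
        then have k: "k < n" by simp
        show "(\<lambda>w. ?A g w $$ (i, k)) field_differentiable (at 0)" by (rule fd_entry(1)[OF i k o])
        show "(\<lambda>w. f (gt_act g w) $ k) field_differentiable (at 0)"
          using field_differentiable_compose[OF fd_act[OF o] fd[OF k z]] by (simp add: o_def)
      qed
      moreover have "(\<lambda>z. f z $ k) differentiable (at (gt_act g 0))" if "k < n" for k
        by (rule field_differentiable_imp_differentiable[OF fd[OF that z]])
      ultimately show ?thesis using ly[OF i, of g] by blast
    qed
    have "induced_lift n (h_mat \<eta> ds) Y ?W F"
      unfolding induced_lift_def by (intro conjI ballI allI impI Fc eqv lh sF lF)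
    then show "induced_lift n (h_mat \<eta> ds) Y ?W (\<lambda>g. ?A g 0 *\<^sub>v f (gt_act g 0))" unfolding F_def .
  next
    assume "induced_lift n (h_mat \<eta> ds) Y ?W (\<lambda>g. ?A g 0 *\<^sub>v f (gt_act g 0))"
    then have lift: "induced_lift n (h_mat \<eta> ds) Y ?W F" unfolding F_def[symmetric] .
    have Fd: "(\<lambda>g. F g $ j) differentiable (at g)" if "g \<in> ?W" "j < n" for g j
      using lift that smooth_on_differentiable unfolding induced_lift_def by blast
    have fd: "(\<lambda>z. f z $ k) differentiable (at z)" if k: "k < n" and z: "z \<in> U" for k z
    proof -
      have zd: "z \<in> disc" using z U by auto
      let ?t = gt_transvection
      have tz: "?t z \<in> ?W" using gt_act_transvection[OF zd] z by simp
      have "(\<lambda>z. ?B (?t z) 0 $$ (k, j)) differentiable (at z)" if "j < n" for j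
      proof (rule smooth_on_differentiable[OF _ zd])
        show "smooth_on disc (\<lambda>z. ?B (?t z) 0 $$ (k, j))"
          by (rule smooth_on_aut_mat) (use k that in \<open>auto simp: n intro!: smooth_on_uminus smooth_on_gt_c(1) smooth_transvection\<close>)
      qed
      moreover have "(\<lambda>z. F (?t z) $ j) differentiable (at z)" if "j < n" for j
        using differentiable_chain_at[OF transvection_differentiable[OF zd] Fd[OF tz that]] by (simp add: o_def)
      ultimately have "(\<lambda>z. \<Sum>j<n. ?B (?t z) 0 $$ (k, j) * F (?t z) $ j) differentiable (at z)"
        by (intro differentiable_sum differentiable_mult ballI) auto
      moreover have "(\<Sum>j<n. ?B (?t w) 0 $$ (k, j) * F (?t w) $ j) = f w $ k" if w: "w \<in> disc" for w
      proof -
        have "(\<Sum>j<n. ?B (?t w) 0 $$ (k, j) * F (?t w) $ j) = (?B (?t w) 0 *\<^sub>v F (?t w)) $ k"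
          by (rule mult_mat_vec_sum[OF Ac Fc k, symmetric])
        then show ?thesis by (simp only: F_def gt_act_transvection[OF w] BA)
      qed
      ultimately show ?thesis
        by (rule differentiable_cong_open[OF _ open_ball zd])
    qed
    show "\<forall>i<n. (\<lambda>z. f z $ i) holomorphic_on U"
    proof (intro allI impI)
      fix i assume i: "i < n"
      have "(\<lambda>z. f z $ i) field_differentiable (at z)" if z: "z \<in> U" for z
      proof -
        have zd: "z \<in> disc" using z U by auto
        define g where "g = gt_transvection z"
        have gz: "gt_act g 0 = z" unfolding g_def by (rule gt_act_transvection[OF zd])
        have gi: "gt_act (gt_inv g) z = 0" using gt_act_inv(1)[OF o, of g] gz by simp
        have gW: "g \<in> ?W" using gz z by simp
        have Pd: "P g j field_differentiable (at 0)" if j: "j < n" for j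
        proof -
          have "lie_y (\<lambda>g. F g $ j) g = - (Y *\<^sub>v F g) $ j" using lift gW j unfolding induced_lift_def by blast
          moreover have "(\<lambda>z. f z $ k) differentiable (at (gt_act g 0))" if "k < n" for k
            unfolding gz by (rule fd[OF that z])
          ultimately show ?thesis using ly[OF j, of g] by blast
        qed
        have "(\<lambda>w. \<Sum>j<n. ?B g w $$ (i, j) * P g j w) field_differentiable (at (gt_act (gt_inv g) z))"
          unfolding gi by (intro field_differentiable_sum field_differentiable_mult fd_entry(2) i o Pd) auto
        from field_differentiable_compose[OF fd_act[OF zd] this]
        have "(\<lambda>x. \<Sum>j<n. ?B g (gt_act (gt_inv g) x) $$ (i, j) * P g j (gt_act (gt_inv g) x)) field_differentiable (at z)"
          by (simp add: o_def)
        moreover have "(\<Sum>j<n. ?B g (gt_act (gt_inv g) x) $$ (i, j) * P g j (gt_act (gt_inv g) x)) = f x $ i" if x: "x \<in> disc" for x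
        proof -
          let ?w = "gt_act (gt_inv g) x"
          have "(\<Sum>j<n. ?B g ?w $$ (i, j) * P g j ?w) = (\<Sum>j<n. ?B g ?w $$ (i, j) * (?A g ?w *\<^sub>v f (gt_act g ?w)) $ j)"
            by (rule sum.cong[OF refl]) (simp only: Pv lessThan_iff)
          also have "\<dots> = (?B g ?w *\<^sub>v (?A g ?w *\<^sub>v f (gt_act g ?w))) $ i"
            by (rule mult_mat_vec_sum[OF Ac mult_mat_vec_carrier[OF Ac f] i, symmetric])
          finally show ?thesis by (simp only: BA gt_act_inv(2)[OF x])
        qed
        ultimately show ?thesis
          by (rule field_differentiable_cong_open[OF _ open_ball zd])
      qed
      then show "(\<lambda>z. f z $ i) holomorphic_on U"
        by (auto simp: holomorphic_on_def intro: field_differentiable_at_within)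
    qed
  qed
qed

lemma E_bundle_induced:
  assumes Y: "block_subdiagonal ds Y"
  shows "induced_via (E_bundle \<eta> ds Y (1\<^sub>m (sum_list ds))) (sum_list ds) (h_mat \<eta> ds) Y snd"
  unfolding induced_via_def
proof (intro conjI allI impI)
  let ?E = "E_bundle \<eta> ds Y (1\<^sub>m (sum_list ds))" and ?n = "sum_list ds"
  show "fibre_coords ?E ?n 0 snd" by (rule E_coords[OF Y]) simp
  fix U and s :: "complex \<Rightarrow> complex \<times> complex vec"
  assume "open U \<and> U \<subseteq> disc \<and> (\<forall>z\<in>U. s z \<in> fibre ?E z)"
  then have U: "open U" "U \<subseteq> disc" and s: "\<And>z. z \<in> U \<Longrightarrow> s z \<in> fibre ?E z" by auto
  define f where "f z = (if z \<in> U then snd (s z) else 0\<^sub>v ?n)" for z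
  have sf: "s z = (z, f z)" "f z \<in> carrier_vec ?n" if "z \<in> U" for z
    using s[OF that] that U E_fibre[OF Y subsetD[OF U(2) that]] by (auto simp: f_def)
  have f: "f z \<in> carrier_vec ?n" for z using sf(2) by (cases "z \<in> U") (auto simp: f_def)
  have "hol_section ?E ?n U s \<longleftrightarrow> (\<forall>i<?n. (\<lambda>z. snd (s z) $ i) holomorphic_on U \<inter> disc)"
    by (simp add: hol_section_def E_simps[OF Y])
  also have "\<dots> \<longleftrightarrow> (\<forall>i<?n. (\<lambda>z. f z $ i) holomorphic_on U)"
    using U by (simp add: Int_absorb2 f_def cong: holomorphic_cong)
  also have "\<dots> \<longleftrightarrow> induced_lift ?n (h_mat \<eta> ds) Y {g. gt_act g 0 \<in> U}
      (\<lambda>g. aut_mat \<eta> ds Y (gt_c g) (gt_log_aut g 0) *\<^sub>v f (gt_act g 0))"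
    by (rule induced_lift_canonical[OF Y refl U f])
  also have "\<dots> \<longleftrightarrow> induced_lift ?n (h_mat \<eta> ds) Y {g. gt_act g 0 \<in> U} (section_lift ?E snd s)"
  proof (rule induced_lift_cong[OF U(1)])
    fix g assume "gt_act g 0 \<in> U"
    then show "aut_mat \<eta> ds Y (gt_c g) (gt_log_aut g 0) *\<^sub>v f (gt_act g 0) = section_lift ?E snd s g"
      using gt_log_aut_inv[of 0 g] by (simp add: section_lift_def sf(1) E_simps[OF Y] gt_c_inv)
  qed
  finally show "hol_section ?E ?n U s = induced_lift ?n (h_mat \<eta> ds) Y {g. gt_act g 0 \<in> U} (section_lift ?E snd s)" .
qed

section \<open>Classification by unitary classes\<close>

lemma char_poly_diagonal: "char_poly (diagonal n d) = (\<Prod>a\<leftarrow>map d [0..<n]. [:- a, 1:])"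
proof -
  have "diag_mat (diagonal n d) = map d [0..<n]" by (simp add: diag_mat_def diagonal_def)
  moreover have "upper_triangular (diagonal n d)" by (auto simp: upper_triangular_def diagonal_def)
  ultimately show ?thesis using char_poly_upper_triangular[OF diagonal_carrier(1)] by metis
qed

lemma roots_prod_linear: "{x. poly (\<Prod>a\<leftarrow>as. [:- a, 1:]) x = 0} = set as" for as :: "complex list"
  by (induction as) auto

lemma proots_prod_linear: "proots (\<Prod>a\<leftarrow>as. [:- a, 1:]) = mset as" for as :: "complex list"
proof (induction as)
  case (Cons a as)
  have nz: "(\<Prod>a\<leftarrow>as. [:- a, 1:]) \<noteq> (0 :: complex poly)" by (auto simp: prod_list_zero_iff)
  have "proots ([:- a, 1:] * (\<Prod>a\<leftarrow>as. [:- a, 1:])) = proots [:- a, 1:] + proots (\<Prod>a\<leftarrow>as. [:- a, 1:])"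
    by (rule proots_mult) (use nz in auto)
  moreover have "proots [:- a, 1:] = {#a#}" using proots_linear_factor[of "- a"] by simp
  ultimately show ?case using Cons by simp
qed simp

lemma blk_of_surj:
  assumes "block_sizes ds"
  shows "blk_of ds ` {..<sum_list ds} = {..<length ds}"
proof
  show "blk_of ds ` {..<sum_list ds} \<subseteq> {..<length ds}" using blk_of_bounds(3) by auto
  show "{..<length ds} \<subseteq> blk_of ds ` {..<sum_list ds}"
  proof
    fix p assume "p \<in> {..<length ds}"
    then have p: "p < length ds" "0 < ds ! p" using assms by (auto simp: block_sizes_def Suc_le_eq[symmetric])
    then show "p \<in> blk_of ds ` {..<sum_list ds}" using blk_index[OF p] by (metis image_eqI lessThan_iff)
  qed
qed

lemma spectrum_h_mat:
  assumes "block_sizes ds"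
  shows "spectrum (h_mat \<eta> ds) = (\<lambda>j. - of_real (\<eta> + real j)) ` {0..length ds - 1}"
proof -
  have "spectrum (h_mat \<eta> ds) = set (map (\<lambda>i. - of_real (\<eta> + real (blk_of ds i))) [0..<sum_list ds])"
    unfolding spectrum_root_char_poly[OF h_mat_carrier] unfolding h_mat_def char_poly_diagonal by (rule roots_prod_linear)
  also have "\<dots> = (\<lambda>j. - of_real (\<eta> + real j)) ` blk_of ds ` {..<sum_list ds}"
    by (auto simp: image_image atLeast0LessThan)
  also have "blk_of ds ` {..<sum_list ds} = {0..length ds - 1}"
    unfolding blk_of_surj[OF assms] using assms by (cases ds) (auto simp: block_sizes_def)
  finally show ?thesis .
qed

text \<open>The relation \<open>[\<rho>(h), \<rho>(y)] = - \<rho>(y)\<close> says that \<open>\<rho>(y)\<close> lowers the eigenvalues of \<open>\<rho>(h)\<close> by one.\<close>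

lemma commutator_subdiagonal:
  assumes Y: "Y \<in> carrier_mat (sum_list ds) (sum_list ds)"
  shows "h_mat \<eta> ds * Y - Y * h_mat \<eta> ds = - Y \<longleftrightarrow> block_subdiagonal ds Y"
proof -
  let ?n = "sum_list ds" and ?L = "h_mat \<eta> ds * Y - Y * h_mat \<eta> ds"
  have e: "?L $$ (i, j) = (- Y) $$ (i, j) \<longleftrightarrow> blk_of ds i = Suc (blk_of ds j) \<or> Y $$ (i, j) = 0" if "i < ?n" "j < ?n" for i j
  proof -
    have "?L $$ (i, j) = (h_mat \<eta> ds * Y) $$ (i, j) - (Y * h_mat \<eta> ds) $$ (i, j)" using that Y by (intro index_minus_mat) (auto simp: h_mat_def)
    also have "\<dots> = (of_nat (blk_of ds j) - of_nat (blk_of ds i)) * Y $$ (i, j)"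
      unfolding h_mat_def diagonal_mult_index[OF that Y] by (simp add: algebra_simps)
    finally have L: "?L $$ (i, j) = (of_nat (blk_of ds j) - of_nat (blk_of ds i)) * Y $$ (i, j)" .
    have M: "(- Y) $$ (i, j) = - Y $$ (i, j)" using that Y by simp
    have "?L $$ (i, j) = (- Y) $$ (i, j) \<longleftrightarrow> (of_nat (blk_of ds j) - of_nat (blk_of ds i) + 1) * Y $$ (i, j) = 0"
      unfolding L M by (simp add: distrib_right eq_neg_iff_add_eq_0)
    also have "of_nat (blk_of ds j) - of_nat (blk_of ds i) + 1 = (of_nat (Suc (blk_of ds j)) - of_nat (blk_of ds i) :: complex)" by simp
    finally show ?thesis by (metis mult_eq_0_iff of_nat_eq_iff right_minus_eq)
  qed
  have "?L = - Y \<longleftrightarrow> (\<forall>i<?n. \<forall>j<?n. ?L $$ (i, j) = (- Y) $$ (i, j))"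
  proof
    assume "\<forall>i<?n. \<forall>j<?n. ?L $$ (i, j) = (- Y) $$ (i, j)"
    then show "?L = - Y" using Y by (intro eq_matI) (auto simp: h_mat_def)
  qed simp
  then show ?thesis using e Y by (auto simp: block_subdiagonal_iff)
qed

lemma b_rep_h_mat: "block_subdiagonal ds Y \<Longrightarrow> b_rep (sum_list ds) (h_mat \<eta> ds) Y"
  unfolding b_rep_def using commutator_subdiagonal[of Y ds \<eta>] by (simp add: block_subdiagonal_iff)

theorem E_bundle_elementary:
  assumes "block_sizes ds" and Y: "block_subdiagonal ds Y"
  shows "elementary (E_bundle \<eta> ds Y (1\<^sub>m (sum_list ds)))"
  unfolding elementary_def hol_induced_from_via
  using E_hom_herm[OF Y] b_rep_h_mat[OF Y] E_bundle_induced[OF Y] spectrum_h_mat[OF assms(1)] by blast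

lemma fibre_form_change:
  assumes i: "fibre_coords E n 0 \<iota>" and B: "B \<in> carrier_mat n n" "Q \<in> carrier_mat n n" "B * Q = 1\<^sub>m n" "Q * B = 1\<^sub>m n"
    and u: "u \<in> carrier_vec n" and v: "v \<in> carrier_vec n"
  shows "fibre_form E (\<lambda>e. B *\<^sub>v \<iota> e) u v = fibre_form E \<iota> (Q *\<^sub>v u) (Q *\<^sub>v v)"
proof -
  have "the_inv_into (fibre E 0) (\<lambda>e. B *\<^sub>v \<iota> e) w = the_inv_into (fibre E 0) \<iota> (Q *\<^sub>v w)" if w: "w \<in> carrier_vec n" for w
  proof (rule the_inv_into_f_eq)
    have Qw: "Q *\<^sub>v w \<in> carrier_vec n" using B w by simp
    show "B *\<^sub>v \<iota> (the_inv_into (fibre E 0) \<iota> (Q *\<^sub>v w)) = w"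
      unfolding fibre_coords_inv(2)[OF i Qw] using B w by (simp flip: assoc_mult_mat_vec)
    show "the_inv_into (fibre E 0) \<iota> (Q *\<^sub>v w) \<in> fibre E 0" by (rule fibre_coords_inv(1)[OF i Qw])
    show "inj_on (\<lambda>e. B *\<^sub>v \<iota> e) (fibre E 0)"
    proof (rule inj_onI)
      fix x y assume xy: "x \<in> fibre E 0" "y \<in> fibre E 0" "B *\<^sub>v \<iota> x = B *\<^sub>v \<iota> y"
      have "Q *\<^sub>v (B *\<^sub>v \<iota> z) = \<iota> z" if "z \<in> fibre E 0" for z
        using B fibre_coordsD(1)[OF i that] by (simp flip: assoc_mult_mat_vec)
      then have "\<iota> x = \<iota> y" using xy by metis
      then show "x = y" using fibre_coordsD(7)[OF i xy(1,2)] by simp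
    qed
  qed
  then show ?thesis using u v by (simp add: fibre_form_def)
qed

text \<open>Multiplicities of the eigenvalues become block sizes.\<close>

lemma ordered_eigenvalues:
  fixes as :: "complex list"
  assumes "set as = (\<lambda>j. - of_real (\<eta> + real j)) ` {0..m}"
  obtains ds where "block_sizes ds" "sum_list ds = length as"
    "mset as = mset (map (\<lambda>i. - of_real (\<eta> + real (blk_of ds i))) [0..<sum_list ds])"
proof -
  let ?e = "\<lambda>j. - complex_of_real (\<eta> + real j)"
  have inj: "inj ?e" by (auto simp: inj_def)
  define ds where "ds = map (\<lambda>j. count (mset as) (?e j)) [0..<Suc m]"
  have len: "length ds = Suc m" by (simp add: ds_def)
  have nth: "ds ! j = count (mset as) (?e j)" if "j \<le> m" for j using that by (simp add: ds_def del: upt_Suc)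
  have "1 \<le> count (mset as) (?e j)" if "j \<le> m" for j
  proof -
    have "?e j \<in> set as" unfolding assms using that by (intro imageI) simp
    then show ?thesis by (simp add: Suc_le_eq)
  qed
  then have bs: "block_sizes ds" by (auto simp: block_sizes_def ds_def simp del: upt_Suc)
  have "sum_list ds = (\<Sum>j\<in>{0..m}. count (mset as) (?e j))"
    unfolding ds_def by (simp add: interv_sum_list_conv_sum_set_nat atLeastLessThanSuc_atLeastAtMost del: upt_Suc)
  also have "\<dots> = (\<Sum>x\<in>?e ` {0..m}. count (mset as) x)"
    by (rule sum.reindex[symmetric, unfolded o_def]) (rule inj_on_subset[OF inj subset_UNIV])
  also have "\<dots> = size (mset as)" unfolding assms[symmetric] by (simp add: size_multiset_overloaded_eq)
  finally have sl: "sum_list ds = length as" by simp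
  have "count (mset as) x = count (mset (map (\<lambda>i. ?e (blk_of ds i)) [0..<sum_list ds])) x" for x
  proof -
    have c: "count (mset (map (\<lambda>i. ?e (blk_of ds i)) [0..<sum_list ds])) x = card {i. i < sum_list ds \<and> ?e (blk_of ds i) = x}"
      by (auto simp: count_image_mset' intro!: arg_cong[where f = card])
    show ?thesis
    proof (cases "\<exists>j\<le>m. x = ?e j")
      case True
      then obtain j where j: "j \<le> m" "x = ?e j" by blast
      then have "{i. i < sum_list ds \<and> ?e (blk_of ds i) = x} = {i. i < sum_list ds \<and> blk_of ds i = j}" by auto
      then show ?thesis using c card_block[of j ds] j nth len by simp
    next
      case False
      then have "x \<notin> set as" unfolding assms by auto
      then have Z: "count (mset as) x = 0" by simp
      have N: "{i. i < sum_list ds \<and> ?e (blk_of ds i) = x} = {}"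
      proof (rule ccontr)
        assume "{i. i < sum_list ds \<and> ?e (blk_of ds i) = x} \<noteq> {}"
        then obtain i where i: "i < sum_list ds" "?e (blk_of ds i) = x" by blast
        then have "blk_of ds i \<le> m" using blk_of_bounds(3)[OF i(1)] len by simp
        then show False using False i(2) by blast
      qed
      show ?thesis unfolding c N Z by simp
    qed
  qed
  then have "mset as = mset (map (\<lambda>i. ?e (blk_of ds i)) [0..<sum_list ds])" by (rule multiset_eqI)
  then show ?thesis using that bs sl by blast
qed

text \<open>In an orthonormal basis of eigenvectors of \<open>\<rho>(h)\<close>, ordered by the string, the bundle is induced from \<open>\<rho>(h)\<close> in
  standard form and a block subdiagonal \<open>Y\<close>, with the standard inner product over the origin.\<close>

theorem elementary_isomorphic_E_bundle:
  assumes "elementary E"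
  shows "\<exists>\<eta> ds Y. block_sizes ds \<and> block_subdiagonal ds Y \<and> hom_herm_isomorphic E (E_bundle \<eta> ds Y (1\<^sub>m (sum_list ds)))"
proof -
  obtain n \<rho>h \<rho>y \<eta> m where E: "hom_hol_herm_vbundle E n" and ind: "hol_induced_from E n \<rho>h \<rho>y"
    and sp: "spectrum \<rho>h = (\<lambda>j. - of_real (\<eta> + real j)) ` {0..m}"
    using assms unfolding elementary_def by blast
  obtain \<iota> where rep: "b_rep n \<rho>h \<rho>y" and i: "induced_via E n \<rho>h \<rho>y \<iota>"
    using ind unfolding hol_induced_from_via by blast
  have c: "\<rho>h \<in> carrier_mat n n" "\<rho>y \<in> carrier_mat n n" and comm: "\<rho>h * \<rho>y - \<rho>y * \<rho>h = - \<rho>y"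
    using rep by (auto simp: b_rep_def)
  obtain as where as: "char_poly \<rho>h = (\<Prod>a\<leftarrow>as. [:- a, 1:])" "length as = n"
    using char_poly_factorized[OF c(1)] by blast
  have "set as = (\<lambda>j. - of_real (\<eta> + real j)) ` {0..m}"
    using sp unfolding spectrum_root_char_poly[OF c(1)] as(1) roots_prod_linear .
  then obtain ds where bs: "block_sizes ds" and sl: "sum_list ds = length as"
    and ms: "mset as = mset (map (\<lambda>i. - of_real (\<eta> + real (blk_of ds i))) [0..<sum_list ds])"
    by (rule ordered_eigenvalues)
  have n: "n = sum_list ds" using sl as by simp
  define es where "es = map (\<lambda>i. - complex_of_real (\<eta> + real (blk_of ds i))) [0..<n]"
  have cp: "char_poly \<rho>h = (\<Prod>a\<leftarrow>es. [:- a, 1:])"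
    unfolding as(1) prod_mset_prod_list[symmetric] mset_map[of "\<lambda>a. [:- a, 1:]"] ms es_def n ..
  have "\<exists>B Q. (B \<in> carrier_mat n n \<and> Q \<in> carrier_mat n n \<and> B * Q = 1\<^sub>m n \<and> Q * B = 1\<^sub>m n)
      \<and> (\<forall>u\<in>carrier_vec n. \<forall>v\<in>carrier_vec n. fibre_form E \<iota> (Q *\<^sub>v u) (Q *\<^sub>v v) = u \<bullet>c v)
      \<and> B * \<rho>h * Q = mat n n (\<lambda>(i, j). if i = j then es ! i else 0)"
  proof (rule self_adjoint_diagonalization[OF fibre_form_inner[OF E induced_via_coords[OF i]] c(1) _ cp])
    fix u v :: "complex vec" assume "u \<in> carrier_vec n" "v \<in> carrier_vec n"
    then show "fibre_form E \<iota> (\<rho>h *\<^sub>v u) v = fibre_form E \<iota> u (\<rho>h *\<^sub>v v)"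
      by (rule induced_h_self_adjoint[OF E i c(1)])
  next
    fix B Q :: "complex mat"
    assume B: "B \<in> carrier_mat n n" "Q \<in> carrier_mat n n" "B * Q = 1\<^sub>m n" "Q * B = 1\<^sub>m n"
      and iso: "\<And>u v. u \<in> carrier_vec n \<Longrightarrow> v \<in> carrier_vec n \<Longrightarrow> fibre_form E \<iota> (Q *\<^sub>v u) (Q *\<^sub>v v) = u \<bullet>c v"
      and D: "B * \<rho>h * Q = mat n n (\<lambda>(i, j). if i = j then es ! i else 0)"
    show ?thesis by (rule exI[of _ B], rule exI[of _ Q]) (intro conjI ballI B iso D)
  qed
  then obtain B Q where B: "B \<in> carrier_mat n n" "Q \<in> carrier_mat n n" "B * Q = 1\<^sub>m n" "Q * B = 1\<^sub>m n"
    and iso': "\<forall>u\<in>carrier_vec n. \<forall>v\<in>carrier_vec n. fibre_form E \<iota> (Q *\<^sub>v u) (Q *\<^sub>v v) = u \<bullet>c v"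
    and D: "B * \<rho>h * Q = mat n n (\<lambda>(i, j). if i = j then es ! i else 0)"
    by (elim exE conjE)
  have iso: "fibre_form E \<iota> (Q *\<^sub>v u) (Q *\<^sub>v v) = u \<bullet>c v" if "u \<in> carrier_vec n" "v \<in> carrier_vec n" for u v
    using iso' that by blast
  have Dh: "B * \<rho>h * Q = h_mat \<eta> ds"
    unfolding D h_mat_def diagonal_def n[symmetric] by (rule eq_matI) (auto simp: es_def)
  define Y where "Y = B * \<rho>y * Q"
  have Yc: "Y \<in> carrier_mat n n" using B c by (simp add: Y_def)
  note assoc = assoc_mult_mat[of _ n n _ n _ n] and car = mult_carrier_mat[of _ n n _ n]
  \<comment> \<open>Conjugation carries the commutation relation over to the standard form of \<open>\<rho>(h)\<close> and to \<open>Y\<close>.\<close>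
  have conj_mult: "(B * M * Q) * (B * N * Q) = B * (M * N) * Q" if "M \<in> carrier_mat n n" "N \<in> carrier_mat n n" for M N
  proof -
    have "(B * M * Q) * (B * N * Q) = B * (M * ((Q * B) * N)) * Q" using that B(1,2) by (simp add: assoc car)
    then show ?thesis using B(4) that by simp
  qed
  have "h_mat \<eta> ds * Y - Y * h_mat \<eta> ds = B * (\<rho>h * \<rho>y) * Q - B * (\<rho>y * \<rho>h) * Q"
    unfolding Dh[symmetric] Y_def conj_mult[OF c] conj_mult[OF c(2,1)] ..
  also have "\<dots> = B * (\<rho>h * \<rho>y - \<rho>y * \<rho>h) * Q"
    using B c by (simp add: mult_minus_distrib_mat[of _ n n _ n] minus_mult_distrib_mat[of _ n n _ _ n] car)
  also have "\<dots> = - Y" unfolding comm Y_def using B c by (simp add: car)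
  finally have Y: "block_subdiagonal ds Y" using commutator_subdiagonal[of Y ds \<eta>] Yc n by simp
  have ret: "(B * M * Q) * B = B * M" if "M \<in> carrier_mat n n" for M
  proof -
    have "(B * M * Q) * B = B * M * (Q * B)" using that B(1,2) by (simp add: assoc car)
    then show ?thesis using B that by simp
  qed
  have hc: "h_mat \<eta> ds \<in> carrier_mat n n" by (simp add: n)
  have \<rho>hD: "\<rho>h = Q * h_mat \<eta> ds * B"
  proof -
    have "Q * h_mat \<eta> ds * B = (Q * B) * \<rho>h * (Q * B)" unfolding Dh[symmetric] using B(1,2) c by (simp add: assoc car)
    then show ?thesis using B(4) c by simp
  qed
  have ex: "mat_exp (x \<cdot>\<^sub>m h_mat \<eta> ds) * B = B * mat_exp (x \<cdot>\<^sub>m \<rho>h)" for x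
  proof -
    let ?d = "\<lambda>i. - complex_of_real (\<eta> + real (blk_of ds i))"
    have "\<rho>h = Q * diagonal n ?d * B" using \<rho>hD by (simp add: h_mat_def n)
    then have "mat_exp (x \<cdot>\<^sub>m \<rho>h) = Q * diagonal n (\<lambda>i. exp (x * ?d i)) * B"
      by (rule mat_exp_diagonalizable[OF B(2,1,3,4)])
    then have "B * mat_exp (x \<cdot>\<^sub>m \<rho>h) = (B * Q) * diagonal n (\<lambda>i. exp (x * ?d i)) * B" using B(1,2) by (simp add: assoc car)
    then show ?thesis using B(3) by (simp add: h_mat_def n mat_exp_diagonal)
  qed
  have ind: "induced_via E n (h_mat \<eta> ds) Y (\<lambda>e. B *\<^sub>v \<iota> e)"
    by (rule induced_via_change[OF herm_bundle_hom[OF E] i c hc Yc B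
          ret[OF c(1), unfolded Dh] ret[OF c(2), folded Y_def] ex])
  have form: "fibre_form E (\<lambda>e. B *\<^sub>v \<iota> e) u v = fibre_form (E_bundle \<eta> ds Y (1\<^sub>m (sum_list ds))) snd u v"
    if "u \<in> carrier_vec n" "v \<in> carrier_vec n" for u v
    using fibre_form_change[OF induced_via_coords[OF i] B that] iso[OF that] E_fibre_form[OF Y, of u v] that n by simp
  have "hom_herm_isomorphic E (E_bundle \<eta> ds Y (1\<^sub>m (sum_list ds)))"
    by (rule isomorphic_if_same_representation[OF E[unfolded n] E_hom_herm[OF Y] ind[unfolded n] E_bundle_induced[OF Y]])
      (rule form[unfolded n])
  then show ?thesis using bs Y by blast
qed

subsection \<open>Isomorphic bundles\<close>

lemma mat_adjoint_mult:
  fixes A B :: "complex mat"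
  assumes A: "A \<in> carrier_mat n m" and B: "B \<in> carrier_mat m k"
  shows "mat_adjoint (A * B) = mat_adjoint B * mat_adjoint A"
proof (rule eq_matI)
  fix i j assume "i < dim_row (mat_adjoint B * mat_adjoint A)" "j < dim_col (mat_adjoint B * mat_adjoint A)"
  then have ij: "i < k" "j < n"
    using carrier_matD[OF mat_adjoint_carrier[OF A]] carrier_matD[OF mat_adjoint_carrier[OF B]] by auto
  have "mat_adjoint (A * B) $$ (i, j) = cnj ((A * B) $$ (j, i))" using ij A B by (intro mat_adjoint_index) auto
  also have "\<dots> = (\<Sum>q<m. cnj (A $$ (j, q)) * cnj (B $$ (q, i)))" using ij by (simp add: mult_mat_sum[OF A B] del: index_mult_mat)
  also have "\<dots> = (\<Sum>q<m. mat_adjoint B $$ (i, q) * mat_adjoint A $$ (q, j))"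
    using ij A B by (intro sum.cong refl) (auto simp: mat_adjoint_index mult.commute)
  also have "\<dots> = (mat_adjoint B * mat_adjoint A) $$ (i, j)"
    by (rule mult_mat_sum[OF mat_adjoint_carrier[OF B] mat_adjoint_carrier[OF A] ij, symmetric])
  finally show "mat_adjoint (A * B) $$ (i, j) = (mat_adjoint B * mat_adjoint A) $$ (i, j)" .
qed (use A B carrier_matD[OF mat_adjoint_carrier[OF A]] carrier_matD[OF mat_adjoint_carrier[OF B]]
    carrier_matD[OF mat_adjoint_carrier[OF mult_carrier_mat[OF A B]]] in auto)

lemma block_diagonal_commute:
  assumes A: "block_diagonal ds A"
  shows "diagonal (sum_list ds) (\<lambda>i. f (blk_of ds i)) * A = A * diagonal (sum_list ds) (\<lambda>i. f (blk_of ds i))"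
    (is "?l = ?r")
proof -
  have c: "A \<in> carrier_mat (sum_list ds) (sum_list ds)" using A by (simp add: block_diagonal_iff)
  show ?thesis
  proof (rule eq_matI)
    fix i j assume "i < dim_row ?r" "j < dim_col ?r"
    then have ij: "i < sum_list ds" "j < sum_list ds" using c by auto
    show "?l $$ (i, j) = ?r $$ (i, j)"
      unfolding diagonal_mult_index[OF ij c] using A ij by (cases "blk_of ds i = blk_of ds j") (auto simp: block_diagonal_iff)
  qed (use c in auto)
qed

lemma block_diagonal_mult:
  assumes A: "block_diagonal ds A" and B: "block_diagonal ds B"
  shows "block_diagonal ds (A * B)"
proof -
  let ?n = "sum_list ds"
  have c: "A \<in> carrier_mat ?n ?n" "B \<in> carrier_mat ?n ?n" using A B by (simp_all add: block_diagonal_iff)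
  have "(A * B) $$ (i, j) = 0" if ij: "i < ?n" "j < ?n" "blk_of ds i \<noteq> blk_of ds j" for i j
    unfolding mult_mat_sum[OF c ij(1,2)]
    by (rule sum.neutral) (use A B ij in \<open>auto simp: block_diagonal_iff\<close>, metis)
  then show ?thesis using c by (auto simp: block_diagonal_iff simp del: index_mult_mat(1))
qed

lemma block_diagonal_adjoint: "block_diagonal ds A \<Longrightarrow> block_diagonal ds (mat_adjoint A)"
  by (auto simp: block_diagonal_iff mat_adjoint_index)

lemma unitary_mat_mult:
  assumes A: "unitary_mat n A" and B: "unitary_mat n B"
  shows "unitary_mat n (A * B)"
proof -
  have c: "A \<in> carrier_mat n n" "B \<in> carrier_mat n n" "mat_adjoint A \<in> carrier_mat n n" "mat_adjoint B \<in> carrier_mat n n"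
    using A B by (auto simp: unitary_mat_def)
  note assoc = assoc_mult_mat[of _ n n _ n _ n] and car = mult_carrier_mat[of _ n n _ n]
  have "(A * B) * (mat_adjoint B * mat_adjoint A) = A * ((B * mat_adjoint B) * mat_adjoint A)" using c by (simp add: assoc car)
  also have "\<dots> = 1\<^sub>m n"
    unfolding B[unfolded unitary_mat_def, THEN conjunct2, THEN conjunct1] left_mult_one_mat[OF c(3)]
    using A by (simp add: unitary_mat_def)
  finally have 1: "(A * B) * (mat_adjoint B * mat_adjoint A) = 1\<^sub>m n" .
  have "(mat_adjoint B * mat_adjoint A) * (A * B) = mat_adjoint B * ((mat_adjoint A * A) * B)" using c by (simp add: assoc car)
  also have "\<dots> = 1\<^sub>m n"
    unfolding A[unfolded unitary_mat_def, THEN conjunct2, THEN conjunct2] left_mult_one_mat[OF c(2)]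
    using B by (simp add: unitary_mat_def)
  finally have 2: "(mat_adjoint B * mat_adjoint A) * (A * B) = 1\<^sub>m n" .
  show ?thesis unfolding unitary_mat_def mat_adjoint_mult[OF c(1,2)] using 1 2 car[OF c(1,2)] by blast
qed

lemma unitary_mat_adjoint: "unitary_mat n A \<Longrightarrow> unitary_mat n (mat_adjoint A)"
  by (auto simp: unitary_mat_def mat_adjoint_adjoint)

lemma unitary_class_eq:
  assumes A: "block_diagonal ds A" "unitary_mat (sum_list ds) A" and Y: "Y \<in> carrier_mat (sum_list ds) (sum_list ds)"
  shows "unitary_class ds (A * Y * mat_adjoint A) = unitary_class ds Y"
proof -
  let ?n = "sum_list ds"
  note assoc = assoc_mult_mat[of _ ?n ?n _ ?n _ ?n] and car = mult_carrier_mat[of _ ?n ?n _ ?n]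
  have sub: "unitary_class ds (A * Y * mat_adjoint A) \<subseteq> unitary_class ds Y"
    if A: "block_diagonal ds A" "unitary_mat ?n A" and Y: "Y \<in> carrier_mat ?n ?n" for A Y
  proof
    fix X assume "X \<in> unitary_class ds (A * Y * mat_adjoint A)"
    then obtain C where C: "block_diagonal ds C" "unitary_mat ?n C" and X: "X = C * (A * Y * mat_adjoint A) * mat_adjoint C"
      by (auto simp: unitary_class_def)
    have c: "A \<in> carrier_mat ?n ?n" "C \<in> carrier_mat ?n ?n" "mat_adjoint A \<in> carrier_mat ?n ?n" "mat_adjoint C \<in> carrier_mat ?n ?n"
      using A C by (auto simp: unitary_mat_def)
    have "X = (C * A) * Y * mat_adjoint (C * A)"
      unfolding X mat_adjoint_mult[OF c(2,1)] using c Y by (simp add: assoc car)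
    then show "X \<in> unitary_class ds Y"
      using block_diagonal_mult[OF C(1) A(1)] unitary_mat_mult[OF C(2) A(2)] by (auto simp: unitary_class_def)
  qed
  have c: "A \<in> carrier_mat ?n ?n" "mat_adjoint A \<in> carrier_mat ?n ?n" and u: "mat_adjoint A * A = 1\<^sub>m ?n"
    using A by (auto simp: unitary_mat_def)
  have "mat_adjoint A * (A * Y * mat_adjoint A) * mat_adjoint (mat_adjoint A) = (mat_adjoint A * A) * Y * (mat_adjoint A * A)"
    unfolding mat_adjoint_adjoint using c Y by (simp add: assoc car)
  also have "\<dots> = Y" unfolding u using Y by simp
  finally have conj_inv: "mat_adjoint A * (A * Y * mat_adjoint A) * mat_adjoint (mat_adjoint A) = Y" .
  have "unitary_class ds (mat_adjoint A * (A * Y * mat_adjoint A) * mat_adjoint (mat_adjoint A))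
      \<subseteq> unitary_class ds (A * Y * mat_adjoint A)"
    by (rule sub[OF block_diagonal_adjoint[OF A(1)] unitary_mat_adjoint[OF A(2)]]) (intro car c Y)
  then have "unitary_class ds Y \<subseteq> unitary_class ds (A * Y * mat_adjoint A)" unfolding conj_inv .
  then show ?thesis using sub[OF A Y] by blast
qed

lemma unitary_class_self:
  assumes Y: "Y \<in> carrier_mat (sum_list ds) (sum_list ds)"
  shows "Y \<in> unitary_class ds Y"
proof -
  let ?n = "sum_list ds"
  have a: "mat_adjoint (1\<^sub>m ?n :: complex mat) = 1\<^sub>m ?n"
    using carrier_matD[OF mat_adjoint_carrier[of "1\<^sub>m ?n :: complex mat" "?n" "?n"]]
    by (intro eq_matI) (auto simp: mat_adjoint_index)
  have "block_diagonal ds (1\<^sub>m ?n)" by (auto simp: block_diagonal_iff)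
  moreover have "unitary_mat ?n (1\<^sub>m ?n)" by (simp add: unitary_mat_def a)
  ultimately show ?thesis using Y a unfolding unitary_class_def mem_Collect_eq
    by (intro exI[of _ "1\<^sub>m ?n"]) simp
qed

text \<open>A block diagonal unitary commutes with \<open>\<rho>(h)\<close> and preserves the inner product, so it only changes the
  coordinates of the fibre over the origin.\<close>

lemma unitary_class_imp_isomorphic:
  assumes Y: "block_subdiagonal ds Y" and Y': "block_subdiagonal ds Y'" and eq: "unitary_class ds Y = unitary_class ds Y'"
  shows "hom_herm_isomorphic (E_bundle \<eta> ds Y (1\<^sub>m (sum_list ds))) (E_bundle \<eta> ds Y' (1\<^sub>m (sum_list ds)))"
proof -
  let ?n = "sum_list ds" and ?E = "E_bundle \<eta> ds Y (1\<^sub>m (sum_list ds))" and ?E' = "E_bundle \<eta> ds Y' (1\<^sub>m (sum_list ds))"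
  have Yc: "Y \<in> carrier_mat ?n ?n" "Y' \<in> carrier_mat ?n ?n" using Y Y' by (simp_all add: block_subdiagonal_iff)
  have "Y' \<in> unitary_class ds Y" using unitary_class_self[OF Yc(2)] eq by simp
  then obtain A where A: "block_diagonal ds A" "unitary_mat ?n A" and Y'A: "Y' = A * Y * mat_adjoint A"
    by (auto simp: unitary_class_def)
  have B: "A \<in> carrier_mat ?n ?n" "mat_adjoint A \<in> carrier_mat ?n ?n" "A * mat_adjoint A = 1\<^sub>m ?n" "mat_adjoint A * A = 1\<^sub>m ?n"
    using A by (auto simp: unitary_mat_def)
  have "Y' * A = A * Y * (mat_adjoint A * A)"
    unfolding Y'A using B(1,2) Yc by (simp add: assoc_mult_mat[of _ ?n ?n _ ?n _ ?n] mult_carrier_mat[of _ ?n ?n _ ?n])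
  then have y: "Y' * A = A * Y" using B Yc by simp
  have h: "h_mat \<eta> ds * A = A * h_mat \<eta> ds"
    unfolding h_mat_def by (rule block_diagonal_commute[OF A(1)])
  have ex: "mat_exp (x \<cdot>\<^sub>m h_mat \<eta> ds) * A = A * mat_exp (x \<cdot>\<^sub>m h_mat \<eta> ds)" for x
    unfolding h_mat_def mat_exp_diagonal by (rule block_diagonal_commute[OF A(1)])
  have "induced_via ?E ?n (h_mat \<eta> ds) Y' (\<lambda>e. A *\<^sub>v snd e)"
    by (rule induced_via_change[OF E_hom[OF Y] E_bundle_induced[OF Y] h_mat_carrier Yc(1) h_mat_carrier Yc(2) B h y ex])
  moreover have "fibre_form ?E (\<lambda>e. A *\<^sub>v snd e) u v = fibre_form ?E' snd u v"
    if uv: "u \<in> carrier_vec ?n" "v \<in> carrier_vec ?n" for u v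
  proof -
    have "fibre_form ?E (\<lambda>e. A *\<^sub>v snd e) u v = (mat_adjoint A *\<^sub>v u) \<bullet>c (mat_adjoint A *\<^sub>v v)"
      unfolding fibre_form_change[OF induced_via_coords[OF E_bundle_induced[OF Y]] B uv] using B(2) uv
      by (intro E_fibre_form[OF Y]) auto
    also have "\<dots> = u \<bullet>c (A *\<^sub>v (mat_adjoint A *\<^sub>v v))"
      using cscalar_prod_adjoint[OF B(2) uv(1), of "mat_adjoint A *\<^sub>v v"] B(2) uv by (simp add: mat_adjoint_adjoint)
    also have "A *\<^sub>v (mat_adjoint A *\<^sub>v v) = v"
      unfolding assoc_mult_mat_vec[OF B(1,2) uv(2), symmetric] B(3) by (rule one_mult_mat_vec[OF uv(2)])
    finally show ?thesis using E_fibre_form[OF Y' uv] by simp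
  qed
  ultimately show ?thesis
    by (rule isomorphic_if_same_representation[OF E_hom_herm[OF Y] E_hom_herm[OF Y'] _ E_bundle_induced[OF Y']])
qed

text \<open>Isomorphism of bundles leaves the rank unspecified; the chart determines it.\<close>

lemma E_bundle_rank:
  assumes Y: "block_subdiagonal ds Y" and E: "hol_vbundle (E_bundle \<eta> ds Y (1\<^sub>m (sum_list ds))) n"
  shows "n = sum_list ds"
proof -
  let ?E = "E_bundle \<eta> ds Y (1\<^sub>m (sum_list ds))"
  have o: "0 \<in> disc" by simp
  have "fibre_coords ?E n 0 snd" by (rule chart_fibre_coords[OF E _ o]) (simp add: E_simps[OF Y])
  moreover have "(0, 0\<^sub>v (sum_list ds)) \<in> fibre ?E 0" by (simp add: E_fibre[OF Y o])
  ultimately have "snd (0 :: complex, 0\<^sub>v (sum_list ds) :: complex vec) \<in> carrier_vec n" by (rule fibre_coordsD(1))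
  then show ?thesis by (metis carrier_vecD index_zero_vec(2) snd_conv)
qed

text \<open>The largest eigenvalue is \<open>- \<eta>\<close>, the number of distinct eigenvalues is the number of blocks, and their
  multiplicities are the block sizes.\<close>

lemma eigenvalues_determine_blocks:
  assumes bs: "block_sizes ds" "block_sizes ds'"
    and ms: "mset (map (\<lambda>i. - complex_of_real (\<eta> + real (blk_of ds i))) [0..<sum_list ds]) =
      mset (map (\<lambda>i. - complex_of_real (\<eta>' + real (blk_of ds' i))) [0..<sum_list ds'])"
  shows "\<eta> = \<eta>' \<and> ds = ds'"
proof -
  have st: "set (map (\<lambda>i. - complex_of_real (\<eta> + real (blk_of ds i))) [0..<sum_list ds])
      = (\<lambda>j. - complex_of_real (\<eta> + real j)) ` {..<length ds}" if "block_sizes ds" for \<eta> ds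
    unfolding blk_of_surj[OF that, symmetric] by (auto simp: image_image atLeast0LessThan)
  have S: "(\<lambda>j. - complex_of_real (\<eta> + real j)) ` {..<length ds} = (\<lambda>j. - complex_of_real (\<eta>' + real j)) ` {..<length ds'}"
    using mset_eq_setD[OF ms] unfolding st[OF bs(1)] st[OF bs(2)] .
  have pos: "0 < length ds" "0 < length ds'" using bs by (auto simp: block_sizes_def)
  have ge: "b \<le> a" if "(\<lambda>j. - complex_of_real (a + real j)) ` {..<k} = (\<lambda>j. - complex_of_real (b + real j)) ` {..<l}" "0 < k" for a b k l
  proof -
    have "- complex_of_real (a + real 0) \<in> (\<lambda>j. - complex_of_real (b + real j)) ` {..<l}"
      unfolding that(1)[symmetric] using that(2) by blast
    then obtain j where "- complex_of_real (a + real 0) = - complex_of_real (b + real j)" by blast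
    then have "a + real 0 = b + real j" by (simp only: neg_equal_iff_equal of_real_eq_iff)
    then show ?thesis by simp
  qed
  have \<eta>: "\<eta> = \<eta>'" using ge[OF S pos(1)] ge[OF S[symmetric] pos(2)] by simp
  have "inj (\<lambda>j. - complex_of_real (\<eta> + real j))" by (auto simp: inj_def)
  then have "{..<length ds} = {..<length ds'}" using S unfolding \<eta> by (rule inj_image_eq_iff[THEN iffD1])
  then have len: "length ds = length ds'" by simp
  have cnt: "count (mset (map (\<lambda>i. - complex_of_real (\<eta> + real (blk_of ds i))) [0..<sum_list ds])) (- complex_of_real (\<eta> + real j)) = ds ! j"
    if "j < length ds" for \<eta> ds j
  proof -
    have "count (mset (map (\<lambda>i. - complex_of_real (\<eta> + real (blk_of ds i))) [0..<sum_list ds])) (- complex_of_real (\<eta> + real j))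
        = card {i. i < sum_list ds \<and> blk_of ds i = j}"
      by (auto simp: count_image_mset' intro!: arg_cong[where f = card])
    then show ?thesis using card_block[OF that] by simp
  qed
  have "ds ! j = ds' ! j" if "j < length ds" for j
    using cnt[OF that, of \<eta>] cnt[of j ds' \<eta>] that len ms \<eta> by simp
  then show ?thesis using \<eta> len by (simp add: list_eq_iff_nth_eq)
qed

text \<open>Over the origin an isomorphism is an isometric and surjective intertwiner \<open>A\<close>, hence unitary. It makes the two
  matrices \<open>\<rho>(h)\<close> similar, which gives equal parameters; then it commutes with \<open>\<rho>(h)\<close> and is block diagonal.\<close>

lemma isomorphic_imp_unitary_class:
  assumes bs: "block_sizes ds" "block_sizes ds'" and Y: "block_subdiagonal ds Y" and Y': "block_subdiagonal ds' Y'"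
    and iso: "hom_herm_isomorphic (E_bundle \<eta> ds Y (1\<^sub>m (sum_list ds))) (E_bundle \<eta>' ds' Y' (1\<^sub>m (sum_list ds')))"
  shows "\<eta> = \<eta>' \<and> ds = ds' \<and> unitary_class ds Y = unitary_class ds' Y'"
proof -
  let ?E = "E_bundle \<eta> ds Y (1\<^sub>m (sum_list ds))" and ?E' = "E_bundle \<eta>' ds' Y' (1\<^sub>m (sum_list ds'))"
  let ?n = "sum_list ds" and ?n' = "sum_list ds'"
  have o: "0 \<in> disc" by simp
  obtain n n' \<Phi> where E: "hom_hol_herm_vbundle ?E n" and E': "hom_hol_herm_vbundle ?E' n'"
    and bij: "bij_betw \<Phi> (total ?E) (total ?E')" and hm: "hol_bundle_map ?E n ?E' n' id \<Phi>"
    and eqv: "\<forall>g. \<forall>e\<in>total ?E. \<Phi> (bact ?E g e) = bact ?E' g (\<Phi> e)"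
    and isom: "\<forall>z\<in>disc. \<forall>u\<in>fibre ?E z. \<forall>v\<in>fibre ?E z. herm ?E' (\<Phi> u) (\<Phi> v) = herm ?E u v"
    using iso unfolding hom_herm_isomorphic_def by blast
  have n: "n = ?n" by (rule E_bundle_rank[OF Y hom_hol_vbundle_bundle[OF herm_bundle_hom[OF E]]])
  have n': "n' = ?n'" by (rule E_bundle_rank[OF Y' hom_hol_vbundle_bundle[OF herm_bundle_hom[OF E']]])
  have Yc: "Y \<in> carrier_mat ?n ?n" "Y' \<in> carrier_mat ?n' ?n'" using Y Y' by (simp_all add: block_subdiagonal_iff)
  obtain A where A: "A \<in> carrier_mat ?n' ?n" and Ae': "\<forall>e\<in>fibre ?E 0. snd (\<Phi> e) = A *\<^sub>v snd e"
    and Ah: "A * h_mat \<eta> ds = h_mat \<eta>' ds' * A" and AY: "A * Y = Y' * A"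
    using bundle_map_intertwines[OF E_hom[OF Y] E_hom[OF Y'] E_bundle_induced[OF Y] E_bundle_induced[OF Y']
        h_mat_carrier Yc(1) h_mat_carrier Yc(2) hm[unfolded n n'] eqv] .
  have Ae: "snd (\<Phi> e) = A *\<^sub>v snd e" if "e \<in> fibre ?E 0" for e using Ae' that by blast
  have \<Phi>f: "\<Phi> e \<in> fibre ?E' z" if "z \<in> disc" "e \<in> fibre ?E z" for e z
    using hm that unfolding hol_bundle_map_def by auto
  have Aadj: "mat_adjoint A \<in> carrier_mat ?n ?n'" using A by simp
  have isoA: "(A *\<^sub>v u) \<bullet>c (A *\<^sub>v v) = u \<bullet>c v" if u: "u \<in> carrier_vec ?n" and v: "v \<in> carrier_vec ?n" for u v
  proof -
    have f: "(0, u) \<in> fibre ?E 0" "(0, v) \<in> fibre ?E 0" using u v by (simp_all add: E_fibre[OF Y o])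
    have e: "\<Phi> (0, w) = (0, A *\<^sub>v w)" if "(0, w) \<in> fibre ?E 0" for w
      using \<Phi>f[OF o that] Ae[OF that] by (cases "\<Phi> (0, w)") (auto simp: E_fibre[OF Y' o])
    have Au: "A *\<^sub>v u \<in> carrier_vec ?n'" "A *\<^sub>v v \<in> carrier_vec ?n'" using A u v by auto
    have "herm ?E' (\<Phi> (0, u)) (\<Phi> (0, v)) = herm ?E (0, u) (0, v)" using isom o f by blast
    then show ?thesis unfolding e[OF f(1)] e[OF f(2)] E_herm[OF Y u v] E_herm[OF Y' Au] J_origin_0[OF Y] J_origin_0[OF Y']
      using u v Au by simp
  qed
  have AA: "mat_adjoint A * A = 1\<^sub>m ?n"
  proof (rule mat_eqI_mult_vec[of _ ?n ?n])
    fix v :: "complex vec" assume v: "v \<in> carrier_vec ?n"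
    let ?w = "(mat_adjoint A * A) *\<^sub>v v + (- 1) \<cdot>\<^sub>v v"
    have wc: "(mat_adjoint A * A) *\<^sub>v v \<in> carrier_vec ?n" by (rule mult_mat_vec_carrier[OF mult_carrier_mat[OF Aadj A] v])
    then have w: "?w \<in> carrier_vec ?n" using v by simp
    have "u \<bullet>c ((mat_adjoint A * A) *\<^sub>v v) = u \<bullet>c v" if u: "u \<in> carrier_vec ?n" for u
      unfolding assoc_mult_mat_vec[OF Aadj A v] cscalar_prod_adjoint[OF A u mult_mat_vec_carrier[OF A v], symmetric]
      by (rule isoA[OF u v])
    then have "?w \<bullet>c ?w = 0"
      using inner_formD(5)[OF inner_form_cscalar wc smult_carrier_vec[THEN iffD2, OF v] w]
        inner_formD(6)[OF inner_form_cscalar v w, of "-1"] w by simp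
    then have "?w = 0\<^sub>v ?n" using cscalar_prod_self_pos(2)[OF w] by (metis less_irrefl zero_complex.sel(1))
    show "(mat_adjoint A * A) *\<^sub>v v = 1\<^sub>m ?n *\<^sub>v v"
    proof (rule eq_vecI)
      fix i assume "i < dim_vec (1\<^sub>m ?n *\<^sub>v v)"
      then have i: "i < ?n" by simp
      have "?w $ i = 0" using \<open>?w = 0\<^sub>v ?n\<close> i by simp
      then show "((mat_adjoint A * A) *\<^sub>v v) $ i = (1\<^sub>m ?n *\<^sub>v v) $ i" using i wc v by (simp del: index_mult_mat_vec)
    qed (use A carrier_matD[OF Aadj] v in auto)
  qed (use mult_carrier_mat[OF Aadj A] in auto)
  have surj: "\<exists>u\<in>carrier_vec ?n. A *\<^sub>v u = v" if v: "v \<in> carrier_vec ?n'" for v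
  proof -
    have "(0, v) \<in> total ?E'" using v by (simp add: E_simps[OF Y'])
    then obtain e where e: "e \<in> total ?E" "\<Phi> e = (0, v)" using bij unfolding bij_betw_def by (metis imageE)
    obtain z u where zu: "e = (z, u)" "z \<in> disc" "u \<in> carrier_vec ?n" using e(1) by (auto simp: E_simps[OF Y])
    have "e \<in> fibre ?E z" using zu by (simp add: E_fibre[OF Y zu(2)])
    then have f0: "e \<in> fibre ?E 0" using \<Phi>f[OF zu(2), of e] e(2) E_fibre[OF Y' zu(2)] by auto
    then show ?thesis using Ae[OF f0] e(2) zu by auto
  qed
  have AA': "A * mat_adjoint A = 1\<^sub>m ?n'"
  proof (rule mat_eqI_mult_vec[of _ ?n' ?n'])
    fix v :: "complex vec" assume "v \<in> carrier_vec ?n'"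
    then obtain u where u: "u \<in> carrier_vec ?n" "A *\<^sub>v u = v" using surj by blast
    have "(A * mat_adjoint A) *\<^sub>v (A *\<^sub>v u) = A *\<^sub>v ((mat_adjoint A * A) *\<^sub>v u)"
      using assoc_mult_mat_vec[OF A Aadj, of "A *\<^sub>v u"] assoc_mult_mat_vec[OF Aadj A u(1)] A u(1) by simp
    then show "(A * mat_adjoint A) *\<^sub>v v = 1\<^sub>m ?n' *\<^sub>v v" unfolding AA u(2)[symmetric] using A u(1) by simp
  qed (use A in auto)
  \<comment> \<open>Both products have trace equal to the sum of the squared moduli of the entries.\<close>
  have "(of_nat ?n :: complex) = (\<Sum>i<?n. (mat_adjoint A * A) $$ (i, i))" unfolding AA by simp
  also have "\<dots> = (\<Sum>i<?n. \<Sum>j<?n'. mat_adjoint A $$ (i, j) * A $$ (j, i))"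
    by (rule sum.cong[OF refl], rule mult_mat_sum[OF Aadj A]) auto
  also have "\<dots> = (\<Sum>j<?n'. \<Sum>i<?n. A $$ (j, i) * mat_adjoint A $$ (i, j))"
    by (subst sum.swap) (simp add: mult.commute)
  also have "\<dots> = (\<Sum>j<?n'. (A * mat_adjoint A) $$ (j, j))"
    by (rule sum.cong[OF refl], rule mult_mat_sum[OF A Aadj, symmetric]) auto
  also have "\<dots> = of_nat ?n'" unfolding AA' by simp
  finally have nn: "?n = ?n'" by (simp only: of_nat_eq_iff)
  note A2 = A[unfolded nn[symmetric]] and Aadj2 = Aadj[unfolded nn[symmetric]] and AA'2 = AA'[unfolded nn[symmetric]]
  have hc: "h_mat \<eta>' ds' \<in> carrier_mat ?n ?n" unfolding nn by simp
  have hA: "h_mat \<eta>' ds' = A * h_mat \<eta> ds * mat_adjoint A"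
    unfolding Ah assoc_mult_mat[OF hc A2 Aadj2] AA'2 using hc by simp
  have "similar_mat (h_mat \<eta>' ds') (h_mat \<eta> ds)"
    unfolding similar_mat_def similar_mat_wit_def Let_def carrier_matD(1)[OF hc]
    by (rule exI[of _ A], rule exI[of _ "mat_adjoint A"]) (use hA hc A2 AA'2 AA in auto)
  from char_poly_similar[OF this]
  have "proots (char_poly (h_mat \<eta> ds)) = proots (char_poly (h_mat \<eta>' ds'))" by simp
  then have "\<eta> = \<eta>' \<and> ds = ds'"
    unfolding h_mat_def char_poly_diagonal proots_prod_linear by (rule eigenvalues_determine_blocks[OF bs])
  then have eq: "\<eta>' = \<eta>" "ds' = ds" by auto
  have "A $$ (i, j) = 0" if ij: "i < ?n" "j < ?n" "blk_of ds i \<noteq> blk_of ds j" for i j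
  proof -
    have "(A * h_mat \<eta> ds) $$ (i, j) = (h_mat \<eta> ds * A) $$ (i, j)" using Ah unfolding eq by simp
    then show ?thesis using ij(3) unfolding h_mat_def diagonal_mult_index[OF ij(1,2) A2] by auto
  qed
  then have bd: "block_diagonal ds A" using A2 by (simp add: block_diagonal_iff)
  have un: "unitary_mat ?n A" using A2 AA AA'2 by (simp add: unitary_mat_def)
  have Y'c: "Y' \<in> carrier_mat ?n ?n" using Yc(2) nn by simp
  have "A * Y * mat_adjoint A = Y' * (A * mat_adjoint A)"
    unfolding AY by (rule assoc_mult_mat[OF Y'c A2 Aadj2])
  then have "Y' = A * Y * mat_adjoint A" using AA'2 Y'c by simp
  then have "unitary_class ds Y' = unitary_class ds Y" using unitary_class_eq[OF bd un Yc(1)] by simp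
  then show ?thesis using eq by simp
qed

section \<open>Irreducibility\<close>

subsection \<open>Orthogonal decompositions of coordinate spaces\<close>

definition orthogonal_pair :: "nat \<Rightarrow> complex vec set \<Rightarrow> complex vec set \<Rightarrow> bool" where
  "orthogonal_pair n V W \<longleftrightarrow> vec_subspace n V \<and> vec_subspace n W \<and> (\<forall>u\<in>V. \<forall>v\<in>W. u \<bullet>c v = 0)
   \<and> (\<forall>x\<in>carrier_vec n. \<exists>u\<in>V. \<exists>v\<in>W. x = u + v)"

lemma orthogonal_pairD:
  assumes "orthogonal_pair n V W"
  shows "V \<subseteq> carrier_vec n" "W \<subseteq> carrier_vec n" "0\<^sub>v n \<in> V" "0\<^sub>v n \<in> W"
    "u \<in> V \<Longrightarrow> v \<in> V \<Longrightarrow> u + v \<in> V" "u \<in> W \<Longrightarrow> v \<in> W \<Longrightarrow> u + v \<in> W"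
    "u \<in> V \<Longrightarrow> c \<cdot>\<^sub>v u \<in> V" "u \<in> W \<Longrightarrow> c \<cdot>\<^sub>v u \<in> W" "u \<in> V \<Longrightarrow> v \<in> W \<Longrightarrow> u \<bullet>c v = 0"
    "x \<in> carrier_vec n \<Longrightarrow> \<exists>u\<in>V. \<exists>v\<in>W. x = u + v"
  using assms unfolding orthogonal_pair_def vec_subspace_def by blast+

lemma orthogonal_pair_sym:
  assumes p: "orthogonal_pair n V W" shows "orthogonal_pair n W V"
  unfolding orthogonal_pair_def
proof (intro conjI ballI)
  show "vec_subspace n W" "vec_subspace n V" using p by (simp_all add: orthogonal_pair_def)
  fix u v assume uv: "u \<in> W" "v \<in> V"
  then show "u \<bullet>c v = 0"
    using inner_formD(3)[OF inner_form_cscalar, of v n u] orthogonal_pairD(1,2,9)[OF p] by auto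
next
  fix x :: "complex vec" assume "x \<in> carrier_vec n"
  then obtain u v where "u \<in> V" "v \<in> W" "x = u + v" using orthogonal_pairD(10)[OF p] by blast
  then show "\<exists>u\<in>W. \<exists>v\<in>V. x = u + v"
    using orthogonal_pairD(1,2)[OF p] comm_add_vec[of u n v] by blast
qed

text \<open>\<open>V\<close> is all of the orthogonal complement of \<open>W\<close>.\<close>

lemma orthogonal_pair_mem:
  assumes p: "orthogonal_pair n V W" and x: "x \<in> carrier_vec n" and o: "\<And>w. w \<in> W \<Longrightarrow> x \<bullet>c w = 0"
  shows "x \<in> V"
proof -
  obtain u v where uv: "u \<in> V" "v \<in> W" "x = u + v" using orthogonal_pairD(10)[OF p x] by blast
  have c: "u \<in> carrier_vec n" "v \<in> carrier_vec n" using uv orthogonal_pairD(1,2)[OF p] by auto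
  have "v \<bullet>c v = 0"
    using o[OF uv(2)] inner_formD(1)[OF inner_form_cscalar c(1,2,2)] orthogonal_pairD(9)[OF p uv(1,2)] uv(3) by simp
  then have "v = 0\<^sub>v n" using cscalar_prod_self_pos(2)[OF c(2)] by (metis less_irrefl zero_complex.sel(1))
  then show ?thesis using uv c by simp
qed

lemma orthogonal_projection:
  assumes p: "orthogonal_pair n V W"
  obtains P where "P \<in> carrier_mat n n" "\<forall>v\<in>V. P *\<^sub>v v = v" "\<forall>w\<in>W. P *\<^sub>v w = 0\<^sub>v n"
    "\<forall>x\<in>carrier_vec n. P *\<^sub>v x \<in> V"
proof -
  note D = orthogonal_pairD[OF p]
  define L where "L x = (SOME u. u \<in> V \<and> (\<exists>v\<in>W. x = u + v))" for x
  have L: "L x \<in> V \<and> (\<exists>v\<in>W. x = L x + v)" if x: "x \<in> carrier_vec n" for x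
    unfolding L_def using someI_ex[of "\<lambda>u. u \<in> V \<and> (\<exists>v\<in>W. x = u + v)"] D(10)[OF x] by blast
  have uniq: "L (u + v) = u" if uv: "u \<in> V" "v \<in> W" for u v
  proof -
    have c: "u \<in> carrier_vec n" "v \<in> carrier_vec n" using uv D(1,2) by auto
    obtain v' where v': "L (u + v) \<in> V" "v' \<in> W" "u + v = L (u + v) + v'" using L[of "u + v"] c by auto
    let ?u = "L (u + v)"
    have c': "?u \<in> carrier_vec n" "v' \<in> carrier_vec n" using v' D(1,2) by auto
    have "?u + (-1) \<cdot>\<^sub>v u = v + (-1) \<cdot>\<^sub>v v'"
    proof (rule eq_vecI)
      fix i assume "i < dim_vec (v + (-1) \<cdot>\<^sub>v v')"
      then have i: "i < n" using c' by simp
      have "(u + v) $ i = (?u + v') $ i" using v'(3) by simp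
      then show "(?u + (-1) \<cdot>\<^sub>v u) $ i = (v + (-1) \<cdot>\<^sub>v v') $ i" using c c' i by (simp add: algebra_simps)
    qed (use c c' in simp)
    moreover have "?u + (-1) \<cdot>\<^sub>v u \<in> V" "v + (-1) \<cdot>\<^sub>v v' \<in> W" using D(5-8) uv v' by blast+
    ultimately have "(?u + (-1) \<cdot>\<^sub>v u) \<bullet>c (?u + (-1) \<cdot>\<^sub>v u) = 0" using D(9) by metis
    then have z: "?u + (-1) \<cdot>\<^sub>v u = 0\<^sub>v n"
      using cscalar_prod_self_pos(2)[of "?u + (-1) \<cdot>\<^sub>v u" n] c c' by (metis add_carrier_vec less_irrefl smult_carrier_vec zero_complex.sel(1))
    show ?thesis
    proof (rule eq_vecI)
      fix i assume "i < dim_vec u"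
      then have i: "i < n" using c by simp
      have "(?u + (-1) \<cdot>\<^sub>v u) $ i = 0" unfolding z using i by simp
      then show "?u $ i = u $ i" using c c' i by simp
    qed (use c c' in simp)
  qed
  obtain P where P: "P \<in> carrier_mat n n" "\<And>x. x \<in> carrier_vec n \<Longrightarrow> L x = P *\<^sub>v x"
  proof (rule linear_map_matrix[of n L n])
    fix x y :: "complex vec" assume x: "x \<in> carrier_vec n" and y: "y \<in> carrier_vec n"
    obtain v w where v: "v \<in> W" "x = L x + v" and w: "w \<in> W" "y = L y + w" using L[OF x] L[OF y] by blast
    have c: "L x \<in> carrier_vec n" "L y \<in> carrier_vec n" "v \<in> carrier_vec n" "w \<in> carrier_vec n"
      using L[OF x] L[OF y] v w D(1,2) by auto
    have "x + y = (L x + L y) + (v + w)"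
      by (subst v(2), subst w(2)) (use c in \<open>auto intro!: eq_vecI\<close>)
    then show "L (x + y) = L x + L y" using uniq[of "L x + L y" "v + w"] D(5,6) L[OF x] L[OF y] v w by metis
  next
    fix a and x :: "complex vec" assume x: "x \<in> carrier_vec n"
    obtain v where v: "v \<in> W" "x = L x + v" using L[OF x] by blast
    have c: "L x \<in> carrier_vec n" "v \<in> carrier_vec n" using L[OF x] v D(1,2) by auto
    have "a \<cdot>\<^sub>v x = a \<cdot>\<^sub>v L x + a \<cdot>\<^sub>v v"
      by (subst v(2)) (use c in \<open>auto intro!: eq_vecI simp: algebra_simps\<close>)
    then show "L (a \<cdot>\<^sub>v x) = a \<cdot>\<^sub>v L x" using uniq[of "a \<cdot>\<^sub>v L x" "a \<cdot>\<^sub>v v"] D(7,8) L[OF x] v by metis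
  qed (use L D(1) in blast)+
  have "P *\<^sub>v v = v" if "v \<in> V" for v
  proof -
    have c: "v \<in> carrier_vec n" using that D(1) by auto
    show ?thesis using uniq[OF that D(4)] P(2)[OF c] c by simp
  qed
  moreover have "P *\<^sub>v w = 0\<^sub>v n" if "w \<in> W" for w
  proof -
    have c: "w \<in> carrier_vec n" using that D(2) by auto
    show ?thesis using uniq[OF D(3) that] P(2)[OF c] c by simp
  qed
  moreover have "P *\<^sub>v x \<in> V" if "x \<in> carrier_vec n" for x using L[OF that] P(2)[OF that] by simp
  ultimately show ?thesis using that P(1) by blast
qed

context
  fixes n V W and P :: "complex mat"
  assumes p: "orthogonal_pair n V W" and P: "P \<in> carrier_mat n n"
    and PV: "\<forall>v\<in>V. P *\<^sub>v v = v" and PW: "\<forall>w\<in>W. P *\<^sub>v w = 0\<^sub>v n" and Pr: "\<forall>x\<in>carrier_vec n. P *\<^sub>v x \<in> V"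
begin

lemma projection_mem: "v \<in> carrier_vec n \<Longrightarrow> v \<in> V \<longleftrightarrow> P *\<^sub>v v = v"
  using PV Pr by metis

lemma projection_decomp:
  assumes x: "x \<in> carrier_vec n" obtains w where "w \<in> W" "x = P *\<^sub>v x + w"
proof -
  obtain u v where uv: "u \<in> V" "v \<in> W" "x = u + v" using orthogonal_pairD(10)[OF p x] by blast
  have c: "u \<in> carrier_vec n" "v \<in> carrier_vec n" using uv orthogonal_pairD(1,2)[OF p] by auto
  have "P *\<^sub>v x = u" unfolding uv(3) mult_add_distrib_mat_vec[OF P c] using PV PW uv c by simp
  then show ?thesis using that uv by metis
qed

lemma projection_commute:
  assumes M: "M \<in> carrier_mat n n" and MV: "\<And>v. v \<in> V \<Longrightarrow> M *\<^sub>v v \<in> V" and MW: "\<And>w. w \<in> W \<Longrightarrow> M *\<^sub>v w \<in> W"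
  shows "P * M = M * P"
proof (rule mat_eqI_mult_vec[of _ n n])
  fix x :: "complex vec" assume x: "x \<in> carrier_vec n"
  obtain w where w: "w \<in> W" "x = P *\<^sub>v x + w" using projection_decomp[OF x] .
  have Px: "P *\<^sub>v x \<in> V" using Pr x by blast
  have c: "P *\<^sub>v x \<in> carrier_vec n" "w \<in> carrier_vec n" using w Px orthogonal_pairD(1,2)[OF p] by auto
  have Mc: "M *\<^sub>v (P *\<^sub>v x) \<in> carrier_vec n" "M *\<^sub>v w \<in> carrier_vec n" using M c by auto
  have "M *\<^sub>v x = M *\<^sub>v (P *\<^sub>v x) + M *\<^sub>v w"
    using mult_add_distrib_mat_vec[OF M c] w(2) by metis
  then have "P *\<^sub>v (M *\<^sub>v x) = P *\<^sub>v (M *\<^sub>v (P *\<^sub>v x)) + P *\<^sub>v (M *\<^sub>v w)"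
    using mult_add_distrib_mat_vec[OF P Mc] by simp
  also have "\<dots> = M *\<^sub>v (P *\<^sub>v x)"
    using PV PW MV[OF Px] MW[OF w(1)] Mc by simp
  finally show "(P * M) *\<^sub>v x = (M * P) *\<^sub>v x"
    unfolding assoc_mult_mat_vec[OF P M x] assoc_mult_mat_vec[OF M P x] .
qed (use P M in auto)

lemma projection_self_adjoint:
  assumes u: "u \<in> carrier_vec n" and v: "v \<in> carrier_vec n"
  shows "(P *\<^sub>v u) \<bullet>c v = u \<bullet>c (P *\<^sub>v v)"
proof -
  obtain w where w: "w \<in> W" "u = P *\<^sub>v u + w" using projection_decomp[OF u] .
  obtain w' where w': "w' \<in> W" "v = P *\<^sub>v v + w'" using projection_decomp[OF v] .
  have Pu: "P *\<^sub>v u \<in> V" "P *\<^sub>v v \<in> V" using Pr u v by auto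
  have c: "P *\<^sub>v u \<in> carrier_vec n" "P *\<^sub>v v \<in> carrier_vec n" "w \<in> carrier_vec n" "w' \<in> carrier_vec n"
    using Pu w w' orthogonal_pairD(1,2)[OF p] by auto
  have "(P *\<^sub>v u) \<bullet>c (P *\<^sub>v v + w') = (P *\<^sub>v u) \<bullet>c (P *\<^sub>v v)"
    using inner_formD(5)[OF inner_form_cscalar c(2,4,1)] orthogonal_pairD(9)[OF p Pu(1) w'(1)] by simp
  moreover have "(P *\<^sub>v u + w) \<bullet>c (P *\<^sub>v v) = (P *\<^sub>v u) \<bullet>c (P *\<^sub>v v)"
    using inner_formD(1)[OF inner_form_cscalar c(1,3,2)] orthogonal_pairD(9)[OF orthogonal_pair_sym[OF p] w(1) Pu(2)] by simp
  ultimately show ?thesis using w(2) w'(2) by metis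
qed

text \<open>Diagonalizing the projection, with the eigenvalue \<open>1\<close> first, straightens the subspace.\<close>

lemma projection_straighten:
  obtains B Q k where "B \<in> carrier_mat n n" "Q \<in> carrier_mat n n" "B * Q = 1\<^sub>m n" "Q * B = 1\<^sub>m n" "k \<le> n"
    "(\<lambda>v. B *\<^sub>v v) ` V = initial_span n k"
proof -
  obtain as where as: "char_poly P = (\<Prod>a\<leftarrow>as. [:- a, 1:])" "length as = n"
    using char_poly_factorized[OF P] by blast
  have ev: "a = 1 \<or> a = 0" if "a \<in> set as" for a
  proof -
    have "a \<in> spectrum P" using that unfolding spectrum_root_char_poly[OF P] as(1) roots_prod_linear .
    then obtain v where "eigenvector P v a" by (auto simp: spectrum_def eigenvalue_def)
    then have v: "v \<in> carrier_vec n" "v \<noteq> 0\<^sub>v n" "P *\<^sub>v v = a \<cdot>\<^sub>v v" using P by (auto simp: eigenvector_def)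
    have "P *\<^sub>v (P *\<^sub>v v) = P *\<^sub>v v" using PV Pr v(1) by blast
    then have e: "a \<cdot>\<^sub>v (a \<cdot>\<^sub>v v) = a \<cdot>\<^sub>v v" using v P by (simp add: mult_mat_vec[OF P])
    obtain i where i: "i < n" "v $ i \<noteq> 0" using v(1,2) by (metis carrier_vecD eq_vecI index_zero_vec)
    have "(a \<cdot>\<^sub>v (a \<cdot>\<^sub>v v)) $ i = (a \<cdot>\<^sub>v v) $ i" by (simp only: e)
    then show ?thesis using i v(1) by auto
  qed
  define k where "k = count (mset as) 1"
  have kn: "k \<le> n" using as(2) count_le_size[of "mset as" 1] by (simp add: k_def)
  define es where "es = replicate k 1 @ replicate (n - k) (0 :: complex)"
  have "mset as = mset es"
  proof -
    have "mset as = filter_mset (\<lambda>x. x = 1) (mset as) + filter_mset (\<lambda>x. x \<noteq> 1) (mset as)"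
      by (rule multiset_partition)
    also have "filter_mset (\<lambda>x. x = 1) (mset as) = replicate_mset k 1" by (simp add: k_def filter_eq_replicate_mset)
    also have "filter_mset (\<lambda>x. x \<noteq> 1) (mset as) = filter_mset (\<lambda>x. x = 0) (mset as)"
      by (rule filter_mset_cong) (use ev in auto)
    also have "\<dots> = replicate_mset (count (mset as) 0) 0" by (simp add: filter_eq_replicate_mset)
    finally have m: "mset as = replicate_mset k 1 + replicate_mset (count (mset as) 0) 0" .
    have "size (mset as) = k + count (mset as) 0" by (subst m) simp
    then have "count (mset as) 0 = n - k" using as(2) by simp
    then show ?thesis using m by (simp add: es_def)
  qed
  then have cp: "char_poly P = (\<Prod>a\<leftarrow>es. [:- a, 1:])"
    unfolding as(1) prod_mset_prod_list[symmetric] mset_map[of "\<lambda>a. [:- a, 1:]"] by simp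
  have "\<exists>B Q. (B \<in> carrier_mat n n \<and> Q \<in> carrier_mat n n \<and> B * Q = 1\<^sub>m n \<and> Q * B = 1\<^sub>m n)
      \<and> B * P * Q = mat n n (\<lambda>(i, j). if i = j then es ! i else 0)"
  proof (rule self_adjoint_diagonalization[OF inner_form_cscalar P _ cp])
    fix u v :: "complex vec" assume "u \<in> carrier_vec n" "v \<in> carrier_vec n"
    then show "(P *\<^sub>v u) \<bullet>c v = u \<bullet>c (P *\<^sub>v v)" by (rule projection_self_adjoint)
  qed blast
  then obtain B Q where B: "B \<in> carrier_mat n n" "Q \<in> carrier_mat n n" "B * Q = 1\<^sub>m n" "Q * B = 1\<^sub>m n"
    and D: "B * P * Q = diagonal n (\<lambda>i. es ! i)" unfolding diagonal_def by blast
  have BQ: "B *\<^sub>v (Q *\<^sub>v w) = w" "Q *\<^sub>v (B *\<^sub>v w) = w" if "w \<in> carrier_vec n" for w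
    using B that by (simp_all flip: assoc_mult_mat_vec)
  have es: "es ! i = (if i < k then 1 else 0)" if "i < n" for i using that kn by (auto simp: es_def nth_append)
  have "v \<in> V \<longleftrightarrow> B *\<^sub>v v \<in> initial_span n k" if v: "v \<in> carrier_vec n" for v
  proof -
    have Bv: "B *\<^sub>v v \<in> carrier_vec n" using B v by simp
    have Pv: "P *\<^sub>v v \<in> carrier_vec n" using P v by simp
    have "(B * P * Q) *\<^sub>v (B *\<^sub>v v) = B *\<^sub>v (P *\<^sub>v (Q *\<^sub>v (B *\<^sub>v v)))"
      using B P Bv by (simp add: assoc_mult_mat_vec[of _ n n _ n] mult_carrier_mat[of _ n n _ n])
    then have DB: "diagonal n (\<lambda>i. es ! i) *\<^sub>v (B *\<^sub>v v) = B *\<^sub>v (P *\<^sub>v v)" unfolding D BQ(2)[OF v] .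
    have "v \<in> V \<longleftrightarrow> B *\<^sub>v (P *\<^sub>v v) = B *\<^sub>v v"
      using projection_mem[OF v] BQ(2)[OF v] BQ(2)[OF Pv] by metis
    also have "\<dots> \<longleftrightarrow> (\<forall>i<n. es ! i * (B *\<^sub>v v) $ i = (B *\<^sub>v v) $ i)"
    proof -
      have "diagonal n (\<lambda>i. es ! i) *\<^sub>v (B *\<^sub>v v) = B *\<^sub>v v
          \<longleftrightarrow> (\<forall>i<n. (diagonal n (\<lambda>i. es ! i) *\<^sub>v (B *\<^sub>v v)) $ i = (B *\<^sub>v v) $ i)"
        using Bv carrier_matD[OF B(1)] by (auto intro!: eq_vecI simp: diagonal_def simp del: index_mult_mat_vec(1))
      then show ?thesis unfolding DB[symmetric] using diagonal_mult_vec[OF _ Bv] by auto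
    qed
    also have "\<dots> \<longleftrightarrow> B *\<^sub>v v \<in> initial_span n k"
      using es Bv by (auto simp: initial_span_def not_less simp del: index_mult_mat_vec)
    finally show ?thesis .
  qed
  note mem = this
  have "(\<lambda>v. B *\<^sub>v v) ` V = initial_span n k"
  proof
    show "(\<lambda>v. B *\<^sub>v v) ` V \<subseteq> initial_span n k" using mem orthogonal_pairD(1)[OF p] by blast
    show "initial_span n k \<subseteq> (\<lambda>v. B *\<^sub>v v) ` V"
    proof
      fix w assume w: "w \<in> initial_span n k"
      then have wc: "w \<in> carrier_vec n" by (simp add: initial_span_def)
      have Qw: "Q *\<^sub>v w \<in> carrier_vec n" using B wc by simp
      have "Q *\<^sub>v w \<in> V" using mem[OF Qw] BQ(1)[OF wc] w by simp
      then show "w \<in> (\<lambda>v. B *\<^sub>v v) ` V" using BQ(1)[OF wc] by (metis image_eqI)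
    qed
  qed
  then show ?thesis using that B kn by blast
qed

end

subsection \<open>Invariant subspaces and sub-bundles\<close>

text \<open>The orthogonal projection to \<open>V\<close> commutes with \<open>\<rho>(h)\<close>, hence is block diagonal, and with \<open>Y\<close>. It then commutes with
  the factors of automorphy.\<close>

lemma invariant_under_aut_mat:
  assumes Y: "block_subdiagonal ds Y" and p: "orthogonal_pair (sum_list ds) V W"
    and inv: "\<And>v. v \<in> V \<Longrightarrow> h_mat \<eta> ds *\<^sub>v v \<in> V \<and> Y *\<^sub>v v \<in> V" "\<And>w. w \<in> W \<Longrightarrow> h_mat \<eta> ds *\<^sub>v w \<in> W \<and> Y *\<^sub>v w \<in> W"
    and v: "v \<in> V"
  shows "aut_mat \<eta> ds Y c L *\<^sub>v v \<in> V"
proof -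
  let ?n = "sum_list ds"
  obtain P where P: "P \<in> carrier_mat ?n ?n" "\<forall>v\<in>V. P *\<^sub>v v = v" "\<forall>w\<in>W. P *\<^sub>v w = 0\<^sub>v ?n" "\<forall>x\<in>carrier_vec ?n. P *\<^sub>v x \<in> V"
    using orthogonal_projection[OF p] .
  have Yc: "Y \<in> carrier_mat ?n ?n" using Y by (simp add: block_subdiagonal_iff)
  have PY: "P * Y = Y * P" by (rule projection_commute[OF p P Yc]) (use inv in auto)
  have Ph: "P * h_mat \<eta> ds = h_mat \<eta> ds * P" by (rule projection_commute[OF p P h_mat_carrier]) (use inv in auto)
  have "P $$ (i, j) = 0" if ij: "i < ?n" "j < ?n" "blk_of ds i \<noteq> blk_of ds j" for i j
  proof -
    have "(P * h_mat \<eta> ds) $$ (i, j) = (h_mat \<eta> ds * P) $$ (i, j)" by (simp only: Ph)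
    then show ?thesis using ij(3) unfolding h_mat_def diagonal_mult_index[OF ij(1,2) P(1)] by auto
  qed
  then have "block_diagonal ds P" using P(1) by (simp add: block_diagonal_iff)
  then have comm: "P * aut_mat \<eta> ds Y c L = aut_mat \<eta> ds Y c L * P" by (rule aut_mat_commute[OF Y _ PY])
  have vc: "v \<in> carrier_vec ?n" using v orthogonal_pairD(1)[OF p] by auto
  have "P *\<^sub>v (aut_mat \<eta> ds Y c L *\<^sub>v v) = aut_mat \<eta> ds Y c L *\<^sub>v (P *\<^sub>v v)"
    using assoc_mult_mat_vec[OF P(1) aut_mat_carrier(1) vc] assoc_mult_mat_vec[OF aut_mat_carrier(1) P(1) vc] comm by metis
  then have "P *\<^sub>v (aut_mat \<eta> ds Y c L *\<^sub>v v) = aut_mat \<eta> ds Y c L *\<^sub>v v" using P(2) v by simp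
  then show ?thesis using projection_mem[OF p P mult_mat_vec_carrier[OF aut_mat_carrier(1) vc]] by simp
qed

text \<open>The constant matrix that straightens \<open>V\<close> turns the canonical trivialization into one that is adapted to
  \<open>disc \<times> V\<close>, with constant transition functions.\<close>

lemma invariant_subspace_subbundle:
  assumes Y: "block_subdiagonal ds Y" and p: "orthogonal_pair (sum_list ds) V W" and nz: "V \<noteq> {0\<^sub>v (sum_list ds)}"
    and inv: "\<And>v. v \<in> V \<Longrightarrow> h_mat \<eta> ds *\<^sub>v v \<in> V \<and> Y *\<^sub>v v \<in> V" "\<And>w. w \<in> W \<Longrightarrow> h_mat \<eta> ds *\<^sub>v w \<in> W \<and> Y *\<^sub>v w \<in> W"
  shows "\<exists>k>0. hom_subbundle (E_bundle \<eta> ds Y (1\<^sub>m (sum_list ds))) (sum_list ds) k (disc \<times> V)"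
proof -
  let ?n = "sum_list ds" and ?E = "E_bundle \<eta> ds Y (1\<^sub>m (sum_list ds))"
  obtain P where P: "P \<in> carrier_mat ?n ?n" "\<forall>v\<in>V. P *\<^sub>v v = v" "\<forall>w\<in>W. P *\<^sub>v w = 0\<^sub>v ?n" "\<forall>x\<in>carrier_vec ?n. P *\<^sub>v x \<in> V"
    using orthogonal_projection[OF p] .
  obtain B Q k where B: "B \<in> carrier_mat ?n ?n" "Q \<in> carrier_mat ?n ?n" "B * Q = 1\<^sub>m ?n" "Q * B = 1\<^sub>m ?n" and k: "k \<le> ?n"
    and BV: "(\<lambda>v. B *\<^sub>v v) ` V = initial_span ?n k"
    using projection_straighten[OF p P] .
  have Vc: "V \<subseteq> carrier_vec ?n" by (rule orthogonal_pairD(1)[OF p])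
  have QB: "Q *\<^sub>v (B *\<^sub>v v) = v" if "v \<in> carrier_vec ?n" for v using B that by (simp flip: assoc_mult_mat_vec)
  have "k \<noteq> 0"
  proof
    assume "k = 0"
    have "v = 0\<^sub>v ?n" if v: "v \<in> V" for v
    proof -
      have "B *\<^sub>v v \<in> initial_span ?n k" using BV v by blast
      moreover have "w = 0\<^sub>v ?n" if "w \<in> initial_span ?n 0" for w
        using that by (auto simp: initial_span_def intro!: eq_vecI)
      ultimately have "B *\<^sub>v v = 0\<^sub>v ?n" using \<open>k = 0\<close> by simp
      then have "v = Q *\<^sub>v 0\<^sub>v ?n" using QB[of v] v Vc by auto
      then show ?thesis using B by (auto intro!: eq_vecI)
    qed
    then show False using nz orthogonal_pairD(3)[OF p] by blast
  qed
  let ?\<phi> = "\<lambda>e. B *\<^sub>v snd e"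
  have coords: "fibre_coords ?E ?n z ?\<phi>" if "z \<in> disc" for z
    by (rule fibre_coords_change[OF E_coords[OF Y that] B])
  have inv_\<phi>: "the_inv_into (fibre ?E z) ?\<phi> w = (z, Q *\<^sub>v w)" if z: "z \<in> disc" and w: "w \<in> carrier_vec ?n" for z w
  proof -
    have "(z, Q *\<^sub>v w) \<in> fibre ?E z" using B w by (simp add: E_fibre[OF Y z])
    moreover have "?\<phi> (z, Q *\<^sub>v w) = w" using B w by (simp flip: assoc_mult_mat_vec)
    ultimately show ?thesis using fibre_coordsD(2)[OF coords[OF z]] by metis
  qed
  have lt: "local_triv ?E ?n (disc, ?\<phi>)" using coords by (simp add: local_triv_def)
  have const: "(\<lambda>z. f z $ i) holomorphic_on disc \<inter> disc" if "\<And>z. z \<in> disc \<Longrightarrow> f z = w" for f :: "complex \<Rightarrow> complex vec" and w i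
    by (rule holomorphic_transform[of "\<lambda>z. w $ i"]) (use that in auto)
  have tr: "hol_transition ?E ?n A (disc, ?\<phi>) \<and> hol_transition ?E ?n (disc, ?\<phi>) A" if "A \<in> charts ?E" for A
  proof -
    have A: "A = (disc, snd)" using that by (simp add: E_simps[OF Y])
    show ?thesis unfolding A hol_transition_def split_conv
    proof (intro conjI allI impI)
      fix i j
      show "(\<lambda>z. ?\<phi> (frame ?E ?n snd z j) $ i) holomorphic_on disc \<inter> disc"
        by (rule const) (simp add: E_frame[OF Y] del: mem_ball)
      show "(\<lambda>z. snd (frame ?E ?n ?\<phi> z j) $ i) holomorphic_on disc \<inter> disc"
        by (rule const) (simp add: frame_def inv_\<phi> del: mem_ball)
    qed
  qed
  have img: "?\<phi> ` ((disc \<times> V) \<inter> fibre ?E z) = {v \<in> carrier_vec ?n. \<forall>i<?n. k \<le> i \<longrightarrow> v $ i = 0}" if z: "z \<in> disc" for z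
  proof -
    have "(disc \<times> V) \<inter> fibre ?E z = {z} \<times> V" using z Vc by (auto simp: E_fibre[OF Y z])
    then have "?\<phi> ` ((disc \<times> V) \<inter> fibre ?E z) = (\<lambda>v. B *\<^sub>v v) ` V" by force
    then show ?thesis unfolding BV initial_span_def .
  qed
  have "hol_subbundle ?E ?n k (disc \<times> V)"
    unfolding hol_subbundle_def
  proof (intro conjI ballI)
    show "disc \<times> V \<subseteq> total ?E" using Vc by (auto simp: E_simps[OF Y])
    show "k \<le> ?n" by (rule k)
    fix z0 assume z0: "z0 \<in> disc"
    show "\<exists>U \<phi>. z0 \<in> U \<and> local_triv ?E ?n (U, \<phi>)
        \<and> (\<forall>A\<in>charts ?E. hol_transition ?E ?n A (U, \<phi>) \<and> hol_transition ?E ?n (U, \<phi>) A)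
        \<and> (\<forall>z\<in>U. \<phi> ` ((disc \<times> V) \<inter> fibre ?E z) = {v \<in> carrier_vec ?n. \<forall>i<?n. k \<le> i \<longrightarrow> v $ i = 0})"
      by (rule exI[of _ disc], rule exI[of _ ?\<phi>]) (intro conjI ballI z0 lt tr[THEN conjunct1] tr[THEN conjunct2] img)
  qed
  moreover have "bact ?E g ` (disc \<times> V) \<subseteq> disc \<times> V" for g
  proof (rule image_subsetI)
    fix e assume "e \<in> disc \<times> V"
    then obtain z v where e: "e = (z, v)" and zv: "z \<in> disc" "v \<in> V" by blast
    have "aut_mat \<eta> ds Y (- gt_c g) (- gt_log_aut g z) *\<^sub>v v \<in> V"
      by (rule invariant_under_aut_mat[OF Y p inv zv(2)])
    then show "bact ?E g e \<in> disc \<times> V" unfolding e E_simps[OF Y] using gt_act_disc[OF zv(1)] by blast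
  qed
  ultimately show ?thesis using \<open>k \<noteq> 0\<close> unfolding hom_subbundle_def by blast
qed

text \<open>Sections of an invariant sub-bundle lift to functions with values in its fibre over the origin. A linear
  functional that vanishes on this fibre therefore vanishes on the derivatives of the lifts, that is, on the images of
  the fibre under \<open>\<rho>(h)\<close> and \<open>\<rho>(y)\<close>.\<close>

lemma subbundle_fibre_invariant:
  assumes E: "hom_hol_vbundle E n" and i: "induced_via E n \<rho>h \<rho>y \<iota>" and S: "hom_subbundle E n k S"
    and e: "e \<in> S \<inter> fibre E 0" and a: "\<forall>e\<in>S \<inter> fibre E 0. (\<Sum>j<n. a j * \<iota> e $ j) = 0"
  shows "(\<Sum>j<n. a j * (\<rho>h *\<^sub>v \<iota> e) $ j) = 0" "(\<Sum>j<n. a j * (\<rho>y *\<^sub>v \<iota> e) $ j) = 0"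
proof -
  note ic = induced_via_coords[OF i] and V = hom_hol_vbundle_bundle[OF E]
  have o: "0 \<in> disc" by simp
  obtain U \<phi> where U: "0 \<in> U" and lt: "local_triv E n (U, \<phi>)"
    and tr: "\<forall>A\<in>charts E. hol_transition E n A (U, \<phi>) \<and> hol_transition E n (U, \<phi>) A"
    and img: "\<forall>z\<in>U. \<phi> ` (S \<inter> fibre E z) = {v \<in> carrier_vec n. \<forall>i<n. k \<le> i \<longrightarrow> v $ i = 0}"
    using S o unfolding hom_subbundle_def hol_subbundle_def by blast
  have Uo: "open U" "U \<subseteq> disc" using lt by (simp_all add: local_triv_def)
  note fc = local_trivD[OF lt]
  have ef: "e \<in> fibre E 0" "e \<in> S" using e by auto
  have v: "\<phi> e \<in> carrier_vec n" using fibre_coordsD(1)[OF fc[OF U] ef(1)] .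
  define s where "s z = the_inv_into (fibre E z) \<phi> (\<phi> e)" for z
  have sf: "\<forall>z\<in>U. s z \<in> fibre E z" using fibre_coords_inv(1)[OF fc v] by (simp add: s_def)
  have sS: "s z \<in> S" if z: "z \<in> U" for z
  proof -
    have "\<phi> e \<in> \<phi> ` (S \<inter> fibre E z)" using img U z e by blast
    then obtain x where x: "x \<in> S" "x \<in> fibre E z" "\<phi> x = \<phi> e" by auto
    have "s z = x" using fibre_coordsD(2)[OF fc[OF z] x(2)] x(3) by (simp add: s_def)
    then show ?thesis using x by simp
  qed
  have "hol_section E n U s"
    by (rule hol_section_constant[OF V lt _ v]) (use tr in \<open>auto simp: s_def\<close>)
  then have F: "induced_lift n \<rho>h \<rho>y {g. gt_act g 0 \<in> U} (section_lift E \<iota> s)"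
    using induced_viaD[OF i Uo sf] by blast
  let ?F = "section_lift E \<iota> s" and ?W = "{g. gt_act g 0 \<in> U}"
  have W: "open ?W" by (rule open_gt_act_0[OF Uo(1)])
  have on: "gt_one \<in> ?W" using U by (simp add: gt_act_one)
  have "s 0 = e" using fibre_coordsD(2)[OF fc[OF U] ef(1)] by (simp add: s_def)
  then have F1: "?F gt_one = \<iota> e" using bact_mult(2)[OF E ef(1)] by (simp add: section_lift_def gt_inv_one gt_act_one)
  have z: "(\<Sum>j<n. a j * ?F g $ j) = 0" if g: "g \<in> ?W" for g
  proof -
    have gU: "gt_act g 0 \<in> U" using g by simp
    have sg: "s (gt_act g 0) \<in> fibre E (gt_act g 0)" using sf gU by blast
    have "bact E (gt_inv g) (s (gt_act g 0)) \<in> S" using S sS[OF gU] unfolding hom_subbundle_def by blast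
    then have "bact E (gt_inv g) (s (gt_act g 0)) \<in> S \<inter> fibre E 0"
      using section_lift_fibre(1)[where s = s, OF E ic sg] by blast
    then show ?thesis using a by (simp add: section_lift_def)
  qed
  have "lie_h (\<lambda>g. \<Sum>j<n. a j * ?F g $ j) gt_one = lie_h (\<lambda>g. 0) gt_one"
    "lie_y (\<lambda>g. \<Sum>j<n. a j * ?F g $ j) gt_one = lie_y (\<lambda>g. 0) gt_one"
    using lie_cong[OF W on, of "\<lambda>g. \<Sum>j<n. a j * ?F g $ j" "\<lambda>g. 0"] z by auto
  then show "(\<Sum>j<n. a j * (\<rho>h *\<^sub>v \<iota> e) $ j) = 0" "(\<Sum>j<n. a j * (\<rho>y *\<^sub>v \<iota> e) $ j) = 0"
    unfolding lift_relation[OF F on] F1 by (simp_all add: lie_h_def lie_y_def lie_deriv_def del: index_mult_mat_vec)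
qed

lemma subbundle_fibre_subspace:
  assumes E: "hol_vbundle E n" and S: "hol_subbundle E n k S" and i: "fibre_coords E n 0 \<iota>"
  shows "vec_subspace n (\<iota> ` (S \<inter> fibre E 0))" "0 < k \<Longrightarrow> \<iota> ` (S \<inter> fibre E 0) \<noteq> {0\<^sub>v n}"
proof -
  have o: "0 \<in> disc" by simp
  obtain U \<phi> where U: "0 \<in> U" and lt: "local_triv E n (U, \<phi>)"
    and im': "\<forall>z\<in>U. \<phi> ` (S \<inter> fibre E z) = {v \<in> carrier_vec n. \<forall>i<n. k \<le> i \<longrightarrow> v $ i = 0}"
    using S o unfolding hol_subbundle_def by blast
  have img: "\<phi> ` (S \<inter> fibre E 0) = initial_span n k" using im' U by (simp add: initial_span_def)
  note fc = local_trivD[OF lt U]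
  have mem: "x \<in> S" if x: "x \<in> fibre E 0" and sp: "\<phi> x \<in> initial_span n k" for x
  proof -
    have "\<phi> x \<in> \<phi> ` (S \<inter> fibre E 0)" using sp img by simp
    then obtain y where y: "\<phi> x = \<phi> y" "y \<in> S \<inter> fibre E 0" by (rule imageE)
    then have "x = y" using fibre_coordsD(7)[OF fc x, of y] by auto
    then show ?thesis using y by simp
  qed
  have span: "\<phi> x \<in> initial_span n k" if "x \<in> S \<inter> fibre E 0" for x using that img by blast
  have add: "vadd E x y \<in> S \<inter> fibre E 0" if x: "x \<in> S \<inter> fibre E 0" and y: "y \<in> S \<inter> fibre E 0" for x y
  proof -
    have f: "x \<in> fibre E 0" "y \<in> fibre E 0" using x y by auto
    have "\<phi> (vadd E x y) \<in> initial_span n k" unfolding fibre_coordsD(4)[OF fc f] using span[OF x] span[OF y]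
      by (auto simp: initial_span_def)
    then show ?thesis using mem fibre_coordsD(3)[OF fc f] by blast
  qed
  have sc: "vscale E c x \<in> S \<inter> fibre E 0" if x: "x \<in> S \<inter> fibre E 0" for c x
  proof -
    have f: "x \<in> fibre E 0" using x by auto
    have "\<phi> (vscale E c x) \<in> initial_span n k" unfolding fibre_coordsD(6)[OF fc f] using span[OF x]
      by (auto simp: initial_span_def)
    then show ?thesis using mem fibre_coordsD(5)[OF fc f] by blast
  qed
  let ?V = "\<iota> ` (S \<inter> fibre E 0)"
  have "0\<^sub>v n \<in> initial_span n k" by (simp add: initial_span_def)
  then obtain x0 where x0: "x0 \<in> S \<inter> fibre E 0" unfolding img[symmetric] by blast
  show "vec_subspace n ?V"
    unfolding vec_subspace_def
  proof (intro conjI ballI allI)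
    show "?V \<subseteq> carrier_vec n" using fibre_coordsD(1)[OF i] by blast
    fix u assume "u \<in> ?V"
    then obtain x where x: "x \<in> S \<inter> fibre E 0" "u = \<iota> x" by blast
    have xf: "x \<in> fibre E 0" using x by simp
    show "c \<cdot>\<^sub>v u \<in> ?V" for c
      using sc[OF x(1), of c] fibre_coordsD(6)[OF i xf, of c] x(2) by (metis image_eqI)
    fix v assume "v \<in> ?V"
    then obtain y where y: "y \<in> S \<inter> fibre E 0" "v = \<iota> y" by blast
    have yf: "y \<in> fibre E 0" using y by simp
    show "u + v \<in> ?V" using add[OF x(1) y(1)] fibre_coordsD(4)[OF i xf yf] x(2) y(2) by (metis image_eqI)
  next
    have x0f: "x0 \<in> fibre E 0" using x0 by simp
    have "\<iota> (vscale E 0 x0) = 0\<^sub>v n"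
      unfolding fibre_coordsD(6)[OF i x0f] using fibre_coordsD(1)[OF i x0f] by (intro eq_vecI) auto
    then show "0\<^sub>v n \<in> ?V" using sc[OF x0, of 0] by (metis image_eqI)
  qed
  assume k: "0 < k"
  have kn: "k \<le> n" using S by (simp add: hol_subbundle_def)
  have "unit_vec n 0 \<in> initial_span n k" using k kn by (auto simp: initial_span_def unit_vec_def)
  then obtain x where x: "x \<in> S \<inter> fibre E 0" "\<phi> x = unit_vec n 0" unfolding img[symmetric] by auto
  show "?V \<noteq> {0\<^sub>v n}"
  proof
    assume "?V = {0\<^sub>v n}"
    then have ix: "\<iota> x = 0\<^sub>v n" using x(1) by blast
    have xf: "x \<in> fibre E 0" using x by simp
    have "\<iota> (vscale E 0 x) = \<iota> x"
      unfolding fibre_coordsD(6)[OF i xf] ix by (intro eq_vecI) auto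
    then have "vscale E 0 x = x" using fibre_coordsD(7)[OF i fibre_coordsD(5)[OF i xf] xf] by blast
    then have "\<phi> x = 0 \<cdot>\<^sub>v \<phi> x" using fibre_coordsD(6)[OF fc xf, of 0] by simp
    then have "unit_vec n 0 $ 0 = (0 \<cdot>\<^sub>v unit_vec n 0 :: complex vec) $ 0" using x(2) by simp
    then show False using k kn by simp
  qed
qed

subsection \<open>Splittings\<close>

lemma vec_block_index: "r < ds ! j \<Longrightarrow> vec_block ds v j $ r = v $ (blk_start ds j + r)"
  by (simp add: vec_block_def)

lemma vec_block_carrier [simp]: "vec_block ds v j \<in> carrier_vec (ds ! j)" "dim_vec (vec_block ds v j) = ds ! j"
  by (simp_all add: vec_block_def)

lemma vec_block_linear:
  assumes "j < length ds" "u \<in> carrier_vec (sum_list ds)" "v \<in> carrier_vec (sum_list ds)"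
  shows "vec_block ds (u + v) j = vec_block ds u j + vec_block ds v j" "vec_block ds (c \<cdot>\<^sub>v u) j = c \<cdot>\<^sub>v vec_block ds u j"
  using assms blk_index(1)[OF assms(1)] by (auto intro!: eq_vecI simp: vec_block_index)

lemma cscalar_prod_blocks:
  assumes u: "u \<in> carrier_vec (sum_list ds)" and v: "v \<in> carrier_vec (sum_list ds)"
  shows "u \<bullet>c v = (\<Sum>j<length ds. vec_block ds u j \<bullet>c vec_block ds v j)"
proof -
  let ?f = "\<lambda>i. u $ i * cnj (v $ i)"
  have "u \<bullet>c v = (\<Sum>i<sum_list ds. ?f i)" using v by (simp add: cscalar_prod_sum[of v "sum_list ds"])
  also have "\<dots> = (\<Sum>i<sum_list ds. \<Sum>j<length ds. if blk_of ds i = j then ?f i else 0)"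
    using blk_of_bounds(3)[of _ ds] by (intro sum.cong) (auto simp: sum.delta')
  also have "\<dots> = (\<Sum>j<length ds. \<Sum>i<sum_list ds. if blk_of ds i = j then ?f i else 0)" by (rule sum.swap)
  also have "\<dots> = (\<Sum>j<length ds. vec_block ds u j \<bullet>c vec_block ds v j)"
  proof (rule sum.cong[OF refl])
    fix j assume "j \<in> {..<length ds}"
    then have j: "j < length ds" by simp
    have "(\<Sum>i<sum_list ds. if blk_of ds i = j then ?f i else 0)
        = (\<Sum>r<ds ! j. if blk_of ds (blk_start ds j + r) = j then ?f (blk_start ds j + r) else 0)"
      by (rule sum_block[OF j]) simp
    also have "\<dots> = (\<Sum>r<ds ! j. vec_block ds u j $ r * cnj (vec_block ds v j $ r))"
      by (rule sum.cong[OF refl]) (simp add: blk_index[OF j] vec_block_index)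
    also have "\<dots> = vec_block ds u j \<bullet>c vec_block ds v j" by (rule cscalar_prod_sum[symmetric]) simp
    finally show "(\<Sum>i<sum_list ds. if blk_of ds i = j then ?f i else 0) = vec_block ds u j \<bullet>c vec_block ds v j" .
  qed
  finally show ?thesis .
qed

definition vec_of_blocks :: "nat list \<Rightarrow> (nat \<Rightarrow> complex vec) \<Rightarrow> complex vec" where
  "vec_of_blocks ds x = vec (sum_list ds) (\<lambda>i. x (blk_of ds i) $ blk_off ds i)"

lemma vec_of_blocks_carrier [simp]: "vec_of_blocks ds x \<in> carrier_vec (sum_list ds)"
  by (simp add: vec_of_blocks_def)

lemma vec_block_of_blocks:
  assumes "j < length ds" "x j \<in> carrier_vec (ds ! j)"
  shows "vec_block ds (vec_of_blocks ds x) j = x j"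
  using assms by (intro eq_vecI) (auto simp: vec_block_index vec_of_blocks_def blk_index)

lemma vec_blocks_eqI:
  assumes "u \<in> carrier_vec (sum_list ds)" "v \<in> carrier_vec (sum_list ds)" "\<And>j. j < length ds \<Longrightarrow> vec_block ds u j = vec_block ds v j"
  shows "u = v"
proof (rule eq_vecI)
  fix i assume "i < dim_vec v"
  then have i: "i < sum_list ds" using assms by simp
  have "vec_block ds u (blk_of ds i) $ blk_off ds i = vec_block ds v (blk_of ds i) $ blk_off ds i"
    using assms(3)[OF blk_of_bounds(3)[OF i]] by simp
  then show "u $ i = v $ i" using blk_decomp[OF i] by (simp add: vec_block_index)
qed (use assms in auto)

lemma splitting_orthogonal_pair:
  assumes W: "\<forall>j<length ds. orthogonal_pair (ds ! j) (W' j) (W'' j)"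
  shows "orthogonal_pair (sum_list ds) (block_direct_sum ds W') (block_direct_sum ds W'')"
proof -
  have sub: "vec_subspace (sum_list ds) (block_direct_sum ds X)" if X: "\<forall>j<length ds. vec_subspace (ds ! j) (X j)" for X
  proof -
    have z: "vec_block ds (0\<^sub>v (sum_list ds)) j = 0\<^sub>v (ds ! j)" if "j < length ds" for j
      using blk_index(1)[OF that] by (intro eq_vecI) (auto simp: vec_block_index)
    show ?thesis unfolding vec_subspace_def
    proof (intro conjI ballI allI)
      show "block_direct_sum ds X \<subseteq> carrier_vec (sum_list ds)" by (auto simp: block_direct_sum_def)
      show "0\<^sub>v (sum_list ds) \<in> block_direct_sum ds X"
        using X z unfolding block_direct_sum_def vec_subspace_def by simp
      fix u assume u: "u \<in> block_direct_sum ds X"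
      then have uc: "u \<in> carrier_vec (sum_list ds)" by (simp add: block_direct_sum_def)
      show "c \<cdot>\<^sub>v u \<in> block_direct_sum ds X" for c
        using u X unfolding block_direct_sum_def vec_subspace_def by (auto simp: vec_block_linear(2)[OF _ uc uc])
      fix v assume v: "v \<in> block_direct_sum ds X"
      then have vc: "v \<in> carrier_vec (sum_list ds)" by (simp add: block_direct_sum_def)
      show "u + v \<in> block_direct_sum ds X"
        using u v X unfolding block_direct_sum_def vec_subspace_def by (auto simp: vec_block_linear(1)[OF _ uc vc])
    qed
  qed
  show ?thesis unfolding orthogonal_pair_def
  proof (intro conjI ballI)
    show "vec_subspace (sum_list ds) (block_direct_sum ds W')" "vec_subspace (sum_list ds) (block_direct_sum ds W'')"
      using W by (auto intro!: sub simp: orthogonal_pair_def)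
    fix u v assume u: "u \<in> block_direct_sum ds W'" and v: "v \<in> block_direct_sum ds W''"
    have c: "u \<in> carrier_vec (sum_list ds)" "v \<in> carrier_vec (sum_list ds)" using u v by (auto simp: block_direct_sum_def)
    show "u \<bullet>c v = 0" unfolding cscalar_prod_blocks[OF c]
      by (rule sum.neutral) (use u v W in \<open>auto simp: block_direct_sum_def intro: orthogonal_pairD(9)\<close>)
  next
    fix x :: "complex vec" assume x: "x \<in> carrier_vec (sum_list ds)"
    have "\<forall>j. \<exists>u v. j < length ds \<longrightarrow> u \<in> W' j \<and> v \<in> W'' j \<and> vec_block ds x j = u + v"
      using W orthogonal_pairD(10)[OF _ vec_block_carrier(1)] by blast
    then obtain u v where uv: "\<And>j. j < length ds \<Longrightarrow> u j \<in> W' j \<and> v j \<in> W'' j \<and> vec_block ds x j = u j + v j" by metis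
    have c: "u j \<in> carrier_vec (ds ! j)" "v j \<in> carrier_vec (ds ! j)" if "j < length ds" for j
      using uv[OF that] W that orthogonal_pairD(1,2) by blast+
    have "vec_of_blocks ds u \<in> block_direct_sum ds W'" "vec_of_blocks ds v \<in> block_direct_sum ds W''"
      using uv c by (auto simp: block_direct_sum_def vec_block_of_blocks)
    moreover have "x = vec_of_blocks ds u + vec_of_blocks ds v"
      by (rule vec_blocks_eqI[OF x]) (use uv c in \<open>auto simp: vec_block_linear vec_block_of_blocks\<close>)
    ultimately show "\<exists>u\<in>block_direct_sum ds W'. \<exists>v\<in>block_direct_sum ds W''. x = u + v" by blast
  qed
qed

lemma h_mat_block: "j < length ds \<Longrightarrow> v \<in> carrier_vec (sum_list ds) \<Longrightarrow>
    vec_block ds (h_mat \<eta> ds *\<^sub>v v) j = (- of_real (\<eta> + real j)) \<cdot>\<^sub>v vec_block ds v j"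
  by (rule eq_vecI) (auto simp: vec_block_index h_mat_def diagonal_mult_vec blk_index simp del: index_mult_mat_vec)

text \<open>The two direct sums are invariant under \<open>\<rho>(h)\<close>, which is scalar on each block, and under \<open>Y\<close>. The constant
  sub-bundles are orthogonal over every point because the matrix whose Gram matrix is the metric preserves both
  summands.\<close>

lemma splits_imp_reducible:
  assumes Y: "block_subdiagonal ds Y" and s: "splits ds Y"
  shows "\<not> irreducible_bundle (E_bundle \<eta> ds Y (1\<^sub>m (sum_list ds))) (sum_list ds)"
proof -
  let ?n = "sum_list ds" and ?E = "E_bundle \<eta> ds Y (1\<^sub>m (sum_list ds))"
  obtain W' W'' where W: "\<forall>j<length ds. orthogonal_pair (ds ! j) (W' j) (W'' j)"
    and nz: "block_direct_sum ds W' \<noteq> {0\<^sub>v ?n}" "block_direct_sum ds W'' \<noteq> {0\<^sub>v ?n}"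
    and YW: "\<forall>v\<in>block_direct_sum ds W'. Y *\<^sub>v v \<in> block_direct_sum ds W'"
      "\<forall>v\<in>block_direct_sum ds W''. Y *\<^sub>v v \<in> block_direct_sum ds W''"
    using s unfolding splits_def orthogonal_pair_def by blast
  let ?V = "block_direct_sum ds W'" and ?W = "block_direct_sum ds W''"
  have p: "orthogonal_pair ?n ?V ?W" by (rule splitting_orthogonal_pair[OF W])
  note p' = orthogonal_pair_sym[OF p]
  have h: "h_mat \<eta> ds *\<^sub>v v \<in> block_direct_sum ds X"
    if "\<forall>j<length ds. vec_subspace (ds ! j) (X j)" "v \<in> block_direct_sum ds X" for X v
    using that mult_mat_vec_carrier[OF h_mat_carrier, of v ds \<eta>]
    by (auto simp: block_direct_sum_def h_mat_block vec_subspace_def)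
  have inv: "h_mat \<eta> ds *\<^sub>v v \<in> ?V \<and> Y *\<^sub>v v \<in> ?V" if "v \<in> ?V" for v
    using h[of W' v] YW(1) W that by (auto simp: orthogonal_pair_def)
  have inv': "h_mat \<eta> ds *\<^sub>v v \<in> ?W \<and> Y *\<^sub>v v \<in> ?W" if "v \<in> ?W" for v
    using h[of W'' v] YW(2) W that by (auto simp: orthogonal_pair_def)
  obtain k' where k': "0 < k'" "hom_subbundle ?E ?n k' (disc \<times> ?V)"
    using invariant_subspace_subbundle[OF Y p nz(1) inv inv'] by blast
  obtain k'' where k'': "0 < k''" "hom_subbundle ?E ?n k'' (disc \<times> ?W)"
    using invariant_subspace_subbundle[OF Y p' nz(2) inv' inv] by blast
  have Vc: "?V \<subseteq> carrier_vec ?n" "?W \<subseteq> carrier_vec ?n" using orthogonal_pairD(1,2)[OF p] .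
  have "(\<forall>u\<in>(disc \<times> ?V) \<inter> fibre ?E z. \<forall>v\<in>(disc \<times> ?W) \<inter> fibre ?E z. herm ?E u v = 0)
      \<and> (\<forall>e\<in>fibre ?E z. \<exists>u\<in>(disc \<times> ?V) \<inter> fibre ?E z. \<exists>v\<in>(disc \<times> ?W) \<inter> fibre ?E z. e = vadd ?E u v)"
    if z: "z \<in> disc" for z
  proof -
    have fV: "(disc \<times> ?V) \<inter> fibre ?E z = {z} \<times> ?V" "(disc \<times> ?W) \<inter> fibre ?E z = {z} \<times> ?W"
      using z Vc by (auto simp: E_fibre[OF Y z])
    show ?thesis unfolding fV
    proof (intro conjI ballI)
      fix e f assume "e \<in> {z} \<times> ?V" "f \<in> {z} \<times> ?W"
      then obtain u v where e: "e = (z, u)" "u \<in> ?V" and f: "f = (z, v)" "v \<in> ?W" by blast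
      have c: "u \<in> carrier_vec ?n" "v \<in> carrier_vec ?n" using e f Vc by auto
      show "herm ?E e f = 0"
        unfolding e(1) f(1) E_herm[OF Y c] J_origin_def
        by (rule orthogonal_pairD(9)[OF p invariant_under_aut_mat[OF Y p inv inv' e(2)]
              invariant_under_aut_mat[OF Y p' inv' inv f(2)]])
    next
      fix e assume "e \<in> fibre ?E z"
      then obtain x where x: "e = (z, x)" "x \<in> carrier_vec ?n" by (auto simp: E_fibre[OF Y z])
      then obtain u v where "u \<in> ?V" "v \<in> ?W" "x = u + v" using orthogonal_pairD(10)[OF p] by blast
      then show "\<exists>u\<in>{z} \<times> ?V. \<exists>v\<in>{z} \<times> ?W. e = vadd ?E u v"
        using x by (intro bexI[of _ "(z, u)"] bexI[of _ "(z, v)"]) (auto simp: E_simps[OF Y])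
    qed
  qed
  then show ?thesis using k' k'' unfolding irreducible_bundle_def by blast
qed

text \<open>A product of shifts of \<open>\<rho>(h)\<close> is a nonzero multiple of the projection to a given block, because distinct
  blocks belong to distinct eigenvalues.\<close>

lemma block_component_closed:
  assumes V: "vec_subspace (sum_list ds) V" and h: "\<forall>v\<in>V. h_mat \<eta> ds *\<^sub>v v \<in> V" and v: "v \<in> V" and p: "p < length ds"
  shows "vec (sum_list ds) (\<lambda>i. if blk_of ds i = p then v $ i else 0) \<in> V"
proof -
  let ?n = "sum_list ds"
  have Vc: "V \<subseteq> carrier_vec ?n" and add: "\<And>u v. u \<in> V \<Longrightarrow> v \<in> V \<Longrightarrow> u + v \<in> V"
    and sc: "\<And>c u. u \<in> V \<Longrightarrow> c \<cdot>\<^sub>v u \<in> V" using V by (auto simp: vec_subspace_def)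
  have vc: "v \<in> carrier_vec ?n" using v Vc by auto
  have "vec ?n (\<lambda>i. (\<Prod>q\<in>Q. of_nat q - of_nat (blk_of ds i)) * v $ i) \<in> V" if "finite Q" for Q
    using that
  proof (induction Q)
    case empty
    have "vec ?n (\<lambda>i. v $ i) = v" using vc by (intro eq_vecI) auto
    then show ?case using v by simp
  next
    case (insert q Q)
    let ?w = "vec ?n (\<lambda>i. (\<Prod>q\<in>Q. of_nat q - of_nat (blk_of ds i)) * v $ i)"
    have w: "?w \<in> V" by (rule insert.IH)
    have "h_mat \<eta> ds *\<^sub>v ?w + of_real (\<eta> + real q) \<cdot>\<^sub>v ?w \<in> V" using add sc h w by blast
    moreover have "h_mat \<eta> ds *\<^sub>v ?w + of_real (\<eta> + real q) \<cdot>\<^sub>v ?w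
        = vec ?n (\<lambda>i. (\<Prod>q\<in>insert q Q. of_nat q - of_nat (blk_of ds i)) * v $ i)"
      using insert.hyps by (intro eq_vecI) (auto simp: h_mat_def diagonal_mult_vec algebra_simps simp del: index_mult_mat_vec(1))
    ultimately show ?case by simp
  qed
  from this[of "{..<length ds} - {p}"]
  have m: "vec ?n (\<lambda>i. (\<Prod>q\<in>{..<length ds} - {p}. of_nat q - of_nat (blk_of ds i)) * v $ i) \<in> V" by simp
  let ?c = "\<Prod>q\<in>{..<length ds} - {p}. of_nat q - (of_nat p :: complex)"
  have c: "?c \<noteq> 0" by (simp add: prod_zero_iff)
  have "vec ?n (\<lambda>i. (\<Prod>q\<in>{..<length ds} - {p}. of_nat q - of_nat (blk_of ds i)) * v $ i)
      = vec ?n (\<lambda>i. ?c * (if blk_of ds i = p then v $ i else 0))"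
  proof (rule eq_vecI)
    fix i assume "i < dim_vec (vec ?n (\<lambda>i. ?c * (if blk_of ds i = p then v $ i else 0)))"
    then have i: "i < ?n" by simp
    have "(\<Prod>q\<in>{..<length ds} - {p}. of_nat q - (of_nat (blk_of ds i) :: complex)) = 0" if "blk_of ds i \<noteq> p"
      using that blk_of_bounds(3)[OF i] by (auto simp: prod_zero_iff)
    then show "vec ?n (\<lambda>i. (\<Prod>q\<in>{..<length ds} - {p}. of_nat q - of_nat (blk_of ds i)) * v $ i) $ i
        = vec ?n (\<lambda>i. ?c * (if blk_of ds i = p then v $ i else 0)) $ i" using i by auto
  qed simp
  then have "inverse ?c \<cdot>\<^sub>v vec ?n (\<lambda>i. ?c * (if blk_of ds i = p then v $ i else 0)) \<in> V" using sc[OF m] by simp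
  moreover have "inverse ?c \<cdot>\<^sub>v vec ?n (\<lambda>i. ?c * (if blk_of ds i = p then v $ i else 0))
      = vec ?n (\<lambda>i. if blk_of ds i = p then v $ i else 0)"
    using c by (intro eq_vecI) (auto simp flip: mult.assoc)
  ultimately show ?thesis by simp
qed

lemma block_direct_sum_components:
  assumes V: "vec_subspace (sum_list ds) V" and h: "\<forall>v\<in>V. h_mat \<eta> ds *\<^sub>v v \<in> V"
  shows "block_direct_sum ds (\<lambda>j. (\<lambda>v. vec_block ds v j) ` V) = V"
proof
  let ?n = "sum_list ds"
  have Vc: "V \<subseteq> carrier_vec ?n" and add: "\<And>u v. u \<in> V \<Longrightarrow> v \<in> V \<Longrightarrow> u + v \<in> V" and z: "0\<^sub>v ?n \<in> V"
    using V by (auto simp: vec_subspace_def)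
  show "V \<subseteq> block_direct_sum ds (\<lambda>j. (\<lambda>v. vec_block ds v j) ` V)" using Vc by (auto simp: block_direct_sum_def)
  show "block_direct_sum ds (\<lambda>j. (\<lambda>v. vec_block ds v j) ` V) \<subseteq> V"
  proof
    fix v assume "v \<in> block_direct_sum ds (\<lambda>j. (\<lambda>v. vec_block ds v j) ` V)"
    then have v: "v \<in> carrier_vec ?n" and b: "\<And>j. j < length ds \<Longrightarrow> \<exists>w\<in>V. vec_block ds v j = vec_block ds w j"
      by (auto simp: block_direct_sum_def)
    let ?comp = "\<lambda>w p. vec ?n (\<lambda>i. if blk_of ds i = p then w $ i else 0)"
    have comp: "?comp v p \<in> V" if p: "p < length ds" for p
    proof -
      obtain w where w: "w \<in> V" "vec_block ds v p = vec_block ds w p" using b[OF p] by blast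
      have "?comp v p = ?comp w p"
      proof (rule eq_vecI)
        fix i assume "i < dim_vec (?comp w p)"
        then have i: "i < ?n" by simp
        have "v $ i = w $ i" if "blk_of ds i = p"
          using blk_decomp[OF i] w(2) vec_block_index[of "blk_off ds i" ds p] that by metis
        then show "?comp v p $ i = ?comp w p $ i" using i by simp
      qed simp
      then show ?thesis using block_component_closed[OF V h w(1) p] by simp
    qed
    have "vec ?n (\<lambda>i. if blk_of ds i < k then v $ i else 0) \<in> V" if "k \<le> length ds" for k
      using that
    proof (induction k)
      case 0
      have "vec ?n (\<lambda>i. 0) = (0\<^sub>v ?n :: complex vec)" by (intro eq_vecI) auto
      then show ?case using z by simp
    next
      case (Suc k)
      have "vec ?n (\<lambda>i. if blk_of ds i < k then v $ i else 0) + ?comp v k \<in> V"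
        using Suc.IH Suc.prems comp[of k] by (intro add) auto
      moreover have "vec ?n (\<lambda>i. if blk_of ds i < k then v $ i else 0) + ?comp v k
          = vec ?n (\<lambda>i. if blk_of ds i < Suc k then v $ i else 0)"
        by (intro eq_vecI) (auto simp: less_Suc_eq)
      ultimately show ?case by simp
    qed
    from this[of "length ds"] have "vec ?n (\<lambda>i. if blk_of ds i < length ds then v $ i else 0) \<in> V" by simp
    moreover have "vec ?n (\<lambda>i. if blk_of ds i < length ds then v $ i else 0) = v"
      using v blk_of_bounds(3)[of _ ds] by (intro eq_vecI) auto
    ultimately show "v \<in> V" by simp
  qed
qed

text \<open>The summands of the splitting are the block components of the two subspaces, which recover the subspaces as
  their direct sums.\<close>

lemma invariant_pair_splits:
  assumes p: "orthogonal_pair (sum_list ds) V W" and nz: "V \<noteq> {0\<^sub>v (sum_list ds)}" "W \<noteq> {0\<^sub>v (sum_list ds)}"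
    and V: "\<forall>v\<in>V. h_mat \<eta> ds *\<^sub>v v \<in> V" "\<forall>v\<in>V. Y *\<^sub>v v \<in> V"
    and W: "\<forall>v\<in>W. h_mat \<eta> ds *\<^sub>v v \<in> W" "\<forall>v\<in>W. Y *\<^sub>v v \<in> W"
  shows "splits ds Y"
proof -
  let ?n = "sum_list ds"
  let ?B = "\<lambda>V j. (\<lambda>v. vec_block ds v j) ` V"
  note D = orthogonal_pairD[OF p]
  have sV: "vec_subspace ?n V" "vec_subspace ?n W" using p by (simp_all add: orthogonal_pair_def)
  have eq: "block_direct_sum ds (?B V) = V" "block_direct_sum ds (?B W) = W"
    using block_direct_sum_components[OF sV(1) V(1)] block_direct_sum_components[OF sV(2) W(1)] .
  have sub: "vec_subspace (ds ! j) (?B X j)" if j: "j < length ds" and X: "vec_subspace ?n X" for j X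
    unfolding vec_subspace_def
  proof (intro conjI ballI allI)
    have c: "X \<subseteq> carrier_vec ?n" using X by (simp add: vec_subspace_def)
    show "?B X j \<subseteq> carrier_vec (ds ! j)" by auto
    have "vec_block ds (0\<^sub>v ?n) j = 0\<^sub>v (ds ! j)" using blk_index(1)[OF j] by (intro eq_vecI) (auto simp: vec_block_index)
    then show "0\<^sub>v (ds ! j) \<in> ?B X j" using X by (metis image_eqI vec_subspace_def)
    fix u assume "u \<in> ?B X j"
    then obtain x where x: "x \<in> X" "u = vec_block ds x j" by blast
    have xc: "x \<in> carrier_vec ?n" using x c by auto
    have "a \<cdot>\<^sub>v x \<in> X" for a using X x by (simp add: vec_subspace_def)
    then show "a \<cdot>\<^sub>v u \<in> ?B X j" for a unfolding x(2) vec_block_linear(2)[OF j xc xc, symmetric] by blast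
    fix v assume "v \<in> ?B X j"
    then obtain y where y: "y \<in> X" "v = vec_block ds y j" by blast
    have yc: "y \<in> carrier_vec ?n" using y c by auto
    have "x + y \<in> X" using X x y by (simp add: vec_subspace_def)
    then show "u + v \<in> ?B X j" unfolding x(2) y(2) vec_block_linear(1)[OF j xc yc, symmetric] by blast
  qed
  have "vec_subspace (ds ! j) (?B V j) \<and> vec_subspace (ds ! j) (?B W j)
      \<and> (\<forall>u\<in>?B V j. \<forall>v\<in>?B W j. u \<bullet>c v = 0)
      \<and> (\<forall>x\<in>carrier_vec (ds ! j). \<exists>u\<in>?B V j. \<exists>v\<in>?B W j. x = u + v)" if j: "j < length ds" for j
  proof (intro conjI ballI sub[OF j] sV)
    fix u v assume "u \<in> ?B V j" "v \<in> ?B W j"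
    then obtain x y where x: "x \<in> V" "u = vec_block ds x j" and y: "y \<in> W" "v = vec_block ds y j" by blast
    let ?x = "vec ?n (\<lambda>i. if blk_of ds i = j then x $ i else 0)"
    have xV: "?x \<in> V" by (rule block_component_closed[OF sV(1) V(1) x(1) j])
    have yc: "y \<in> carrier_vec ?n" using y D(2) by auto
    have bl: "vec_block ds ?x k = (if k = j then u else 0\<^sub>v (ds ! k))" if "k < length ds" for k
      using that x(2) by (auto intro!: eq_vecI simp: vec_block_index blk_index)
    have "?x \<bullet>c y = (\<Sum>k<length ds. vec_block ds ?x k \<bullet>c vec_block ds y k)"
      by (rule cscalar_prod_blocks[OF _ yc]) simp
    also have "\<dots> = (\<Sum>k<length ds. if k = j then u \<bullet>c v else 0)"
      by (rule sum.cong[OF refl]) (use y(2) in \<open>auto simp: bl\<close>)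
    also have "\<dots> = u \<bullet>c v" using j by simp
    finally show "u \<bullet>c v = 0" using D(9)[OF xV y(1)] by simp
  next
    fix x :: "complex vec" assume x: "x \<in> carrier_vec (ds ! j)"
    let ?x = "vec_of_blocks ds (\<lambda>k. if k = j then x else 0\<^sub>v (ds ! k))"
    obtain u v where uv: "u \<in> V" "v \<in> W" "?x = u + v" using D(10)[OF vec_of_blocks_carrier] by metis
    have c: "u \<in> carrier_vec ?n" "v \<in> carrier_vec ?n" using uv D(1,2) by auto
    have "x = vec_block ds ?x j" using vec_block_of_blocks[OF j, of "\<lambda>k. if k = j then x else 0\<^sub>v (ds ! k)"] x by simp
    also have "\<dots> = vec_block ds u j + vec_block ds v j" unfolding uv(3) by (rule vec_block_linear(1)[OF j c])
    finally show "\<exists>u\<in>?B V j. \<exists>v\<in>?B W j. x = u + v" using uv by blast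
  qed
  then show ?thesis
    unfolding splits_def using nz V(2) W(2) eq by (intro exI[of _ "?B V"] exI[of _ "?B W"]) simp
qed

text \<open>The fibres over the origin of the two sub-bundles are orthogonal complements of each other, so the functionals
  that vanish on one of them are the inner products with vectors of the other.\<close>

lemma reducible_imp_splits:
  assumes Y: "block_subdiagonal ds Y"
    and r: "\<not> irreducible_bundle (E_bundle \<eta> ds Y (1\<^sub>m (sum_list ds))) (sum_list ds)"
  shows "splits ds Y"
proof -
  let ?n = "sum_list ds" and ?E = "E_bundle \<eta> ds Y (1\<^sub>m (sum_list ds))"
  have o: "0 \<in> disc" by simp
  define dec where "dec S S' \<longleftrightarrow> (\<forall>z\<in>disc. (\<forall>u\<in>S \<inter> fibre ?E z. \<forall>v\<in>S' \<inter> fibre ?E z. herm ?E u v = 0)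
             \<and> (\<forall>e\<in>fibre ?E z. \<exists>u\<in>S \<inter> fibre ?E z. \<exists>v\<in>S' \<inter> fibre ?E z. e = vadd ?E u v))" for S S'
  have "\<exists>S S' k k'. 0 < k \<and> 0 < k' \<and> hom_subbundle ?E ?n k S \<and> hom_subbundle ?E ?n k' S' \<and> dec S S'"
    using r[unfolded irreducible_bundle_def] E_hom_herm[OF Y, of \<eta>] unfolding dec_def by (simp only: simp_thms)
  then obtain S S' k k' where k: "0 < k" "0 < k'" and S: "hom_subbundle ?E ?n k S" and S': "hom_subbundle ?E ?n k' S'"
    and dec': "dec S S'" by (elim exE conjE)
  note dec = dec'[unfolded dec_def]
  define V where "V = snd ` (S \<inter> fibre ?E 0)"
  define W where "W = snd ` (S' \<inter> fibre ?E 0)"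
  have ss: "hol_subbundle ?E ?n k S" "hol_subbundle ?E ?n k' S'" using S S' by (simp_all add: hom_subbundle_def)
  note c0 = E_coords[OF Y o]
  have sV: "vec_subspace ?n V" "V \<noteq> {0\<^sub>v ?n}" "vec_subspace ?n W" "W \<noteq> {0\<^sub>v ?n}"
    unfolding V_def W_def using subbundle_fibre_subspace[OF E_vbundle[OF Y] ss(1) c0] subbundle_fibre_subspace[OF E_vbundle[OF Y] ss(2) c0] k
    by blast+
  have Vc: "V \<subseteq> carrier_vec ?n" "W \<subseteq> carrier_vec ?n" using sV by (simp_all add: vec_subspace_def)
  have mem: "(0, v) \<in> X \<inter> fibre ?E 0" if "v \<in> snd ` (X \<inter> fibre ?E 0)" for v X
    using that by (auto simp: E_fibre[OF Y o])
  have p: "orthogonal_pair ?n V W"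
    unfolding orthogonal_pair_def
  proof (intro conjI ballI sV(1,3))
    fix u v assume uv: "u \<in> V" "v \<in> W"
    have c: "u \<in> carrier_vec ?n" "v \<in> carrier_vec ?n" using uv Vc by auto
    have "herm ?E (0, u) (0, v) = 0" using dec o mem uv unfolding V_def W_def by blast
    then show "u \<bullet>c v = 0" unfolding E_herm[OF Y c] J_origin_0[OF Y] using c by simp
  next
    fix x :: "complex vec" assume x: "x \<in> carrier_vec ?n"
    then have "(0, x) \<in> fibre ?E 0" by (simp add: E_fibre[OF Y o])
    then obtain e f where ef: "e \<in> S \<inter> fibre ?E 0" "f \<in> S' \<inter> fibre ?E 0" "(0, x) = vadd ?E e f" using dec o by blast
    obtain u v where uv: "e = (0, u)" "f = (0, v)" using ef by (auto simp: E_fibre[OF Y o])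
    have "x = u + v" using ef(3) unfolding uv E_simps[OF Y] by simp
    moreover have "u \<in> V" "v \<in> W" using ef uv unfolding V_def W_def by force+
    ultimately show "\<exists>u\<in>V. \<exists>v\<in>W. x = u + v" by blast
  qed
  have inv: "\<rho> *\<^sub>v v \<in> V"
    if S: "hom_subbundle ?E ?n k S" and p: "orthogonal_pair ?n V W" and V: "V = snd ` (S \<inter> fibre ?E 0)"
      and v: "v \<in> V" and \<rho>: "\<rho> = h_mat \<eta> ds \<or> \<rho> = Y" for S V W v k \<rho>
  proof (rule orthogonal_pair_mem[OF p])
    have Yc: "Y \<in> carrier_mat ?n ?n" using Y by (simp add: block_subdiagonal_iff)
    have vc: "v \<in> carrier_vec ?n" using v orthogonal_pairD(1)[OF p] by auto
    have \<rho>c: "\<rho> \<in> carrier_mat ?n ?n" using \<rho> Yc by auto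
    show "\<rho> *\<^sub>v v \<in> carrier_vec ?n" by (rule mult_mat_vec_carrier[OF \<rho>c vc])
    fix w assume w: "w \<in> W"
    have wc: "w \<in> carrier_vec ?n" using w orthogonal_pairD(2)[OF p] by auto
    have dot: "(\<Sum>j<?n. cnj (w $ j) * x $ j) = x \<bullet>c w" for x :: "complex vec"
      using wc by (simp add: cscalar_prod_sum[of w ?n] mult.commute)
    have "\<forall>e\<in>S \<inter> fibre ?E 0. (\<Sum>j<?n. cnj (w $ j) * snd e $ j) = 0"
      unfolding dot using orthogonal_pairD(9)[OF p _ w] V by blast
    from subbundle_fibre_invariant[OF E_hom[OF Y] E_bundle_induced[OF Y] S mem[OF v[unfolded V]] this]
    show "(\<rho> *\<^sub>v v) \<bullet>c w = 0" using \<rho> unfolding dot by auto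
  qed
  have invV: "\<forall>v\<in>V. h_mat \<eta> ds *\<^sub>v v \<in> V" "\<forall>v\<in>V. Y *\<^sub>v v \<in> V"
    using inv[OF S p V_def] by simp_all
  have invW: "\<forall>v\<in>W. h_mat \<eta> ds *\<^sub>v v \<in> W" "\<forall>v\<in>W. Y *\<^sub>v v \<in> W"
    using inv[OF S' orthogonal_pair_sym[OF p] W_def] by simp_all
  show ?thesis by (rule invariant_pair_splits[OF p sV(2,4) invV invW])
qed

theorem proposition2p3:
  shows
    "(\<forall>\<eta> ds Y. block_sizes ds \<and> block_subdiagonal ds Y \<longrightarrow>
        elementary (E_bundle \<eta> ds Y (1\<^sub>m (sum_list ds))))
   \<and> (\<forall>E :: 'e hom_herm_vbundle. elementary E \<longrightarrow>
        (\<exists>\<eta> ds Y. block_sizes ds \<and> block_subdiagonal ds Y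
           \<and> hom_herm_isomorphic E (E_bundle \<eta> ds Y (1\<^sub>m (sum_list ds)))))
   \<and> (\<forall>\<eta> ds Y \<eta>' ds' Y'.
        block_sizes ds \<and> block_subdiagonal ds Y \<and> block_sizes ds' \<and> block_subdiagonal ds' Y' \<longrightarrow>
        (hom_herm_isomorphic (E_bundle \<eta> ds Y (1\<^sub>m (sum_list ds)))
                             (E_bundle \<eta>' ds' Y' (1\<^sub>m (sum_list ds')))
         \<longleftrightarrow> \<eta> = \<eta>' \<and> ds = ds' \<and> unitary_class ds Y = unitary_class ds' Y'))
   \<and> (\<forall>\<eta> ds Y. block_sizes ds \<and> block_subdiagonal ds Y \<longrightarrow>
        (irreducible_bundle (E_bundle \<eta> ds Y (1\<^sub>m (sum_list ds))) (sum_list ds) \<longleftrightarrow> \<not> splits ds Y))"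
proof (intro conjI allI impI)
  fix \<eta> ds Y assume "block_sizes ds \<and> block_subdiagonal ds Y"
  then show "elementary (E_bundle \<eta> ds Y (1\<^sub>m (sum_list ds)))"
    using E_bundle_elementary by blast
next
  fix E :: "'e hom_herm_vbundle" assume "elementary E"
  then show "\<exists>\<eta> ds Y. block_sizes ds \<and> block_subdiagonal ds Y \<and> hom_herm_isomorphic E (E_bundle \<eta> ds Y (1\<^sub>m (sum_list ds)))"
    by (rule elementary_isomorphic_E_bundle)
next
  fix \<eta> ds Y \<eta>' ds' Y'
  assume a: "block_sizes ds \<and> block_subdiagonal ds Y \<and> block_sizes ds' \<and> block_subdiagonal ds' Y'"
  show "hom_herm_isomorphic (E_bundle \<eta> ds Y (1\<^sub>m (sum_list ds))) (E_bundle \<eta>' ds' Y' (1\<^sub>m (sum_list ds')))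
    \<longleftrightarrow> \<eta> = \<eta>' \<and> ds = ds' \<and> unitary_class ds Y = unitary_class ds' Y'"
    using a isomorphic_imp_unitary_class[of ds ds' Y Y' \<eta> \<eta>'] unitary_class_imp_isomorphic[of ds Y Y' \<eta>] by blast
next
  fix \<eta> ds Y assume "block_sizes ds \<and> block_subdiagonal ds Y"
  then show "irreducible_bundle (E_bundle \<eta> ds Y (1\<^sub>m (sum_list ds))) (sum_list ds) \<longleftrightarrow> \<not> splits ds Y"
    using splits_imp_reducible reducible_imp_splits by blast
qed

end
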